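(* Let $d<p\le\infty$, $p\ge2$, $1/p+1/q=1$, $N\in\mathbb{Z}_+$, let $M$ be a $d\times d$ isotropic dilation matrix and $\lambda$ an eigenvalue of $M$. Let $h$ be a positive function on $(0,\infty)$ and $w$ a probability density on $(0,\infty)$ such that $$\int_0^\infty w(u)\left(1+h^{N+1}(u)\right)du<\infty.$$ Let $L$ be the differential operator $$Lf=\sum_{[\beta]<N+1}a_\beta D^\beta f,\qquad a_\beta=\int_0^\infty\frac{w(u)}{\beta!\,V_{h(u)}}\left(\int_{B_{h(u)}}t^\beta\,dt\right)du,$$ and let $\widetilde\varphi$ be the distribution associated with $L$. Suppose that (b) $\varphi\in\mathcal{L}_p$ and there exists $B_\varphi>0$ such that $\sum_{k\in\mathbb{Z}^d}|\widehat\varphi(\xi+k)|^q<B_\varphi$ for all $\xi\in\mathbb{R}^d$; (c) there exist $n\in\mathbb{N}$ and $\delta\in(0,1/2)$ such that $\widehat\varphi\,\widehat{\widetilde\varphi}$ is boundedly differentiable up to order $n$ on $\{|\xi|<\delta\}$; $\widehat\varphi$ is boundedly differentiable up to order $n$ on $\{|\xi+l|<\delta\}$ for all $l\in\mathbb{Z}^d\setminus\{\mathbf 0\}$; the function $\sum_{l\in\mathbb{Z}^d,\,l\ne\mathbf 0}|D^\beta\widehat\varphi(\xi+l)|$ is bounded on $\{|\xi|<\delta\}$ for $[\beta]=n$; $D^\beta(1-\widehat\varphi\,\widehat{\widetilde\varphi})(\mathbf 0)=0$ for $[\beta]<n$; and the Strang-Fix condition of order $n$ holds for $\varphi$; (d)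 $f\in L_p$, $\widehat f\in L_q$, and $\widehat f(\xi)=O\left(|\xi|^{-N-1-\frac dq-\varepsilon}\right)$ as $|\xi|\to\infty$, where $\varepsilon>0$. Then for all $j\in\mathbb{Z}_+$ $$\left\|f-m^{-j/2}\sum_{k\in\mathbb{Z}^d}E(f,-M^{-j}k)\,\varphi_{jk}\right\|_p\le\begin{cases}C|\lambda|^{-j(N+1)}&\text{if }n>N+1,\\ C|\lambda|^{-jn}&\text{if }n\le N+1,\end{cases}$$ where $C$ does not depend on $j$.
   Context: A dilation matrix is a real $d\times d$ matrix all of whose eigenvalues are bigger than $1$ in modulus; $m=|\det M|$. $M$ is isotropic if it is similar to a diagonal matrix with diagonal entries $\lambda_1,\dots,\lambda_d$ (possibly complex) satisfying $|\lambda_1|=\dots=|\lambda_d|$. $L_p=L_p(\mathbb{R}^d)$, $\mathbb{T}^d=[-\frac12,\frac12]^d$, $[\beta]=\beta_1+\dots+\beta_d$ for $\beta\in\mathbb{Z}_+^d$, $\widehat f(\xi)=\int_{\mathbb{R}^d}f(x)e^{-2\pi i(x,\xi)}\,dx$, $\varphi_{jk}(x)=m^{j/2}\varphi(M^jx+k)$. $B_r=\{x\in\mathbb{R}^d:|x|\le r\}$ and $V_r$ is the volume of $B_r$. For $y\in\mathbb{R}^d$ of the form $M^{-j}k$, $k\in\mathbb{Z}^d$, $$E(f,y)=\int_0^\infty w(u)\,\frac{m^j}{V_{h(u)}}\left(\int_{M^{-j}B_{h(u)}}f(y+t)\,dt\right)du$$ (this quantity depends on the level $j$ through the averaging set $M^{-j}B_{h(u)}$).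 $\mathcal{L}_p$ is the set of $\varphi\in L_p$ with $\|\varphi\|_{\mathcal{L}_p}:=\left\|\sum_{k\in\mathbb{Z}^d}|\varphi(\cdot+k)|\right\|_{L_p(\mathbb{T}^d)}<\infty$. A function $\varphi\in L_1$ satisfies the Strang-Fix condition of order $n$ if $D^\beta\widehat\varphi(k)=0$ whenever $k\in\mathbb{Z}^d\setminus\{\mathbf 0\}$ and $[\beta]<n$. "Boundedly differentiable up to order $n$" means having bounded derivatives up to order $n$. The distribution associated with $L=\sum_{[\beta]\le N}a_\beta D^\beta$ is $\widetilde\varphi=\sum_{[\beta]\le N}\overline{a_\beta}(-1)^{[\beta]}D^\beta\delta$ ($\delta$ the Dirac delta); thus $\widehat{\widetilde\varphi}(\xi)=\sum_{[\beta]\le N}\overline{a_\beta}(-2\pi i\xi)^\beta$. *)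

theory Defs
  imports "HOL-Probability.Essential_Supremum" "HOL-Library.Multiset"
begin

section \<open>Dilation matrices\<close>

text \<open>On \<^typ>\<open>real ^ 'd ^ 'd\<close> the operation \<open>^\<close> is the entrywise power, hence \<open>mat_pow\<close>.\<close>

primrec mat_pow :: "real ^ 'd ^ 'd \<Rightarrow> nat \<Rightarrow> real ^ 'd ^ 'd" where
  "mat_pow A 0 = mat 1"
| "mat_pow A (Suc j) = A ** mat_pow A j"

definition complex_mat :: "real ^ 'd ^ 'd \<Rightarrow> complex ^ 'd ^ 'd" where
  "complex_mat A = map_matrix complex_of_real A"

definition eigenvalue :: "real ^ 'd ^ 'd \<Rightarrow> complex \<Rightarrow> bool" where
  "eigenvalue A \<mu> \<longleftrightarrow> (\<exists>v. v \<noteq> 0 \<and> complex_mat A *v v = \<mu> *s v)"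

definition dilation_matrix :: "real ^ 'd ^ 'd \<Rightarrow> bool" where
  "dilation_matrix A \<longleftrightarrow> (\<forall>\<mu>. eigenvalue A \<mu> \<longrightarrow> 1 < norm \<mu>)"

definition isotropic :: "real ^ 'd ^ 'd \<Rightarrow> bool" where
  "isotropic A \<longleftrightarrow>
     (\<exists>(P :: complex ^ 'd ^ 'd) (\<Lambda> :: 'd \<Rightarrow> complex).
        invertible P \<and>
        complex_mat A = P ** (\<chi> i j. if i = j then \<Lambda> i else 0) ** matrix_inv P \<and>
        (\<forall>i j. norm (\<Lambda> i) = norm (\<Lambda> j)))"

definition int_lattice :: "(real ^ 'd) set" where
  "int_lattice = {k. \<forall>i. k $ i \<in> \<int>}"

definition dilate :: "real ^ 'd ^ 'd \<Rightarrow> (real ^ 'd \<Rightarrow> complex) \<Rightarrow> nat \<Rightarrow> real ^ 'd \<Rightarrow> real ^ 'd \<Rightarrow> complex" where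
  "dilate M \<phi> j k x =
     complex_of_real (\<bar>det M\<bar> powr (real j / 2)) * \<phi> (mat_pow M j *v x + k)"

section \<open>Lebesgue spaces\<close>

definition epowr :: "ennreal \<Rightarrow> real \<Rightarrow> ennreal" where
  "epowr x r = (if x = \<infinity> then \<infinity> else ennreal (enn2real x powr r))"

text \<open>The norm is \<open>\<infinity>\<close> for non-measurable functions, as \<^const>\<open>esssup\<close> is.\<close>

definition eLp_norm :: "ennreal \<Rightarrow> 'a measure \<Rightarrow> ('a \<Rightarrow> ennreal) \<Rightarrow> ennreal" where
  "eLp_norm p A g =
     (if g \<notin> borel_measurable A then \<infinity>
      else if p = \<infinity> then esssup A g
      else epowr (\<integral>\<^sup>+x. epowr (g x) (enn2real p) \<partial>A) (1 / enn2real p))"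

definition Lp_norm :: "ennreal \<Rightarrow> (real ^ 'd \<Rightarrow> complex) \<Rightarrow> ennreal" where
  "Lp_norm p f =
     (if f \<in> borel_measurable lebesgue
      then eLp_norm p lebesgue (\<lambda>x. ennreal (norm (f x))) else \<infinity>)"

definition Lp_space :: "ennreal \<Rightarrow> (real ^ 'd \<Rightarrow> complex) set" where
  "Lp_space p = {f. f \<in> borel_measurable lebesgue \<and> Lp_norm p f < \<infinity>}"

definition torus :: "(real ^ 'd) set" where
  "torus = cbox (\<chi> i. - 1 / 2) (\<chi> i. 1 / 2)"

definition calLp_norm :: "ennreal \<Rightarrow> (real ^ 'd \<Rightarrow> complex) \<Rightarrow> ennreal" where
  "calLp_norm p \<phi> =
     eLp_norm p (lebesgue_on torus) (\<lambda>x. \<Sum>\<^sub>\<infinity>k\<in>int_lattice. ennreal (norm (\<phi> (x + k))))"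

definition calLp_space :: "ennreal \<Rightarrow> (real ^ 'd \<Rightarrow> complex) set" where
  "calLp_space p = {\<phi> \<in> Lp_space p. calLp_norm p \<phi> < \<infinity>}"

section \<open>Partial derivatives\<close>

definition has_partial :: "'d \<Rightarrow> (real ^ 'd \<Rightarrow> complex) \<Rightarrow> real ^ 'd \<Rightarrow> bool" where
  "has_partial i F x \<longleftrightarrow> (\<lambda>t. F (x + t *\<^sub>R axis i 1)) differentiable (at (0::real))"

definition partial_deriv :: "'d \<Rightarrow> (real ^ 'd \<Rightarrow> complex) \<Rightarrow> real ^ 'd \<Rightarrow> complex" where
  "partial_deriv i F x = vector_derivative (\<lambda>t. F (x + t *\<^sub>R axis i 1)) (at (0::real))"

text \<open>
  The derivative \<open>D\<^sup>\<beta>\<close> is represented by any list in which each coordinate \<open>i\<close> occurs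
  \<open>\<beta> i\<close> times, so that the order \<open>[\<beta>]\<close> is the length of the list. Quantifying over all
  lists of a given length covers all partial derivatives of that order, without having to
  single out an order of differentiation.
\<close>

primrec partial_derivs :: "'d list \<Rightarrow> (real ^ 'd \<Rightarrow> complex) \<Rightarrow> real ^ 'd \<Rightarrow> complex" where
  "partial_derivs [] F = F"
| "partial_derivs (i # is) F = partial_deriv i (partial_derivs is F)"

definition boundedly_differentiable :: "nat \<Rightarrow> (real ^ 'd \<Rightarrow> complex) \<Rightarrow> (real ^ 'd) set \<Rightarrow> bool" where
  "boundedly_differentiable n F U \<longleftrightarrow>
     (\<forall>is. length is < n \<longrightarrow> (\<forall>i. \<forall>x\<in>U. has_partial i (partial_derivs is F) x)) \<and>
     (\<forall>is. length is \<le> n \<longrightarrow> bounded (partial_derivs is F ` U))"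

section \<open>Fourier transforms\<close>

definition fourier :: "(real ^ 'd \<Rightarrow> complex) \<Rightarrow> real ^ 'd \<Rightarrow> complex" where
  "fourier f \<xi> = (LINT x|lebesgue. f x * exp (- (2 * of_real pi * \<i> * of_real (x \<bullet> \<xi>))))"

definition schwartz_space :: "(real ^ 'd \<Rightarrow> complex) set" where
  "schwartz_space =
     {\<psi>. \<forall>is. (\<forall>i x. has_partial i (partial_derivs is \<psi>) x) \<and>
              (\<forall>r::nat. bounded (range (\<lambda>x. norm x ^ r *\<^sub>R partial_derivs is \<psi> x)))}"

text \<open>
  \<open>g\<close> is the Fourier transform of \<open>f\<close> in the sense of tempered distributions. This is
  the meaning of the transform for elements of Lebesgue spaces that are not integrable;
  for \<open>f\<close> and \<open>g\<close> in Lebesgue spaces both integrands below are integrable.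
\<close>

definition has_fourier_transform :: "(real ^ 'd \<Rightarrow> complex) \<Rightarrow> (real ^ 'd \<Rightarrow> complex) \<Rightarrow> bool" where
  "has_fourier_transform f g \<longleftrightarrow>
     (\<forall>\<psi>\<in>schwartz_space. (LINT x|lebesgue. f x * fourier \<psi> x) = (LINT \<xi>|lebesgue. g \<xi> * \<psi> \<xi>))"

text \<open>
  \<^const>\<open>partial_deriv\<close> is total, so the equation below does not by itself assert that the
  derivatives exist; that is part of \<^const>\<open>boundedly_differentiable\<close> near the lattice points.
\<close>

definition strang_fix :: "nat \<Rightarrow> (real ^ 'd \<Rightarrow> complex) \<Rightarrow> bool" where
  "strang_fix n \<phi> \<longleftrightarrow>
     (\<forall>k\<in>int_lattice - {0}. \<forall>is. length is < n \<longrightarrow> partial_derivs is (fourier \<phi>) k = 0)"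

section \<open>Averages and the associated differential operator\<close>

definition ball_vol :: "'d::finite itself \<Rightarrow> real \<Rightarrow> real" where
  "ball_vol _ r = measure lebesgue (cball (0 :: real ^ 'd) r)"

definition avg_sample ::
  "(real \<Rightarrow> real) \<Rightarrow> (real \<Rightarrow> real) \<Rightarrow> real ^ 'd ^ 'd \<Rightarrow> (real ^ 'd \<Rightarrow> complex) \<Rightarrow> nat \<Rightarrow> real ^ 'd \<Rightarrow> complex"
where
  "avg_sample w h M f j y =
     (LINT u:{0<..}|lebesgue.
        complex_of_real (w u * (\<bar>det M\<bar> ^ j / ball_vol TYPE('d) (h u))) *
        (LINT t:(\<lambda>s. mat_pow (matrix_inv M) j *v s) ` cball 0 (h u)|lebesgue. f (y + t)))"

definition mi_order :: "('d::finite \<Rightarrow> nat) \<Rightarrow> nat" where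
  "mi_order \<beta> = (\<Sum>i\<in>UNIV. \<beta> i)"

definition mi_fact :: "('d::finite \<Rightarrow> nat) \<Rightarrow> real" where
  "mi_fact \<beta> = (\<Prod>i\<in>UNIV. fact (\<beta> i))"

definition avg_coeff :: "(real \<Rightarrow> real) \<Rightarrow> (real \<Rightarrow> real) \<Rightarrow> ('d::finite \<Rightarrow> nat) \<Rightarrow> real" where
  "avg_coeff w h \<beta> =
     (LINT u:{0<..}|lebesgue.
        w u / (mi_fact \<beta> * ball_vol TYPE('d) (h u)) *
        (LINT t:cball (0 :: real ^ 'd) (h u)|lebesgue. (\<Prod>i\<in>UNIV. (t $ i) ^ \<beta> i)))"

lemma finite_mi_order: "finite {\<beta> :: 'd::finite \<Rightarrow> nat. mi_order \<beta> \<le> N}"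
proof (rule finite_subset)
  show "{\<beta> :: 'd \<Rightarrow> nat. mi_order \<beta> \<le> N} \<subseteq> (UNIV \<rightarrow>\<^sub>E {..N})"
  proof
    fix \<beta> :: "'d \<Rightarrow> nat"
    assume "\<beta> \<in> {\<beta>. mi_order \<beta> \<le> N}"
    then have "sum \<beta> UNIV \<le> N"
      by (simp add: mi_order_def)
    moreover have "\<beta> i \<le> sum \<beta> UNIV" for i
      by (rule member_le_sum) simp_all
    ultimately have "\<beta> i \<le> N" for i
      by (meson order_trans)
    then show "\<beta> \<in> UNIV \<rightarrow>\<^sub>E {..N}"
      by (auto simp: PiE_def)
  qed
  show "finite ((UNIV :: 'd set) \<rightarrow>\<^sub>E {..N})"
    by (rule finite_PiE) simp_all
qed

section \<open>The distribution associated with a differential operator\<close>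

text \<open>
  Distributions are functionals on smooth functions; only point-supported ones occur, so
  the Fourier transform of \<open>T\<close> is the function obtained by applying \<open>T\<close> to the exponentials
  \<open>x \<mapsto> exp (- 2 \<pi> \<i> (x, \<xi>))\<close>. In \<open>D\<^sup>\<beta>\<close> the choice of the order of
  differentiation is immaterial, as these functions are smooth.
\<close>

definition mi_list :: "('d::finite \<Rightarrow> nat) \<Rightarrow> 'd list" where
  "mi_list \<beta> = (SOME is. \<forall>i. count_list is i = \<beta> i)"

definition dirac :: "(real ^ 'd \<Rightarrow> complex) \<Rightarrow> complex" where
  "dirac \<psi> = \<psi> 0"

definition dist_deriv ::
  "('d::finite \<Rightarrow> nat) \<Rightarrow> ((real ^ 'd \<Rightarrow> complex) \<Rightarrow> complex) \<Rightarrow> (real ^ 'd \<Rightarrow> complex) \<Rightarrow> complex"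
where
  "dist_deriv \<beta> T \<psi> = (- 1) ^ mi_order \<beta> * T (partial_derivs (mi_list \<beta>) \<psi>)"

text \<open>The distribution associated with \<open>\<Sum> a \<beta> D\<^sup>\<beta>\<close>, \<open>[\<beta>] \<le> N\<close>:\<close>

definition assoc_dist ::
  "nat \<Rightarrow> (('d::finite \<Rightarrow> nat) \<Rightarrow> complex) \<Rightarrow> (real ^ 'd \<Rightarrow> complex) \<Rightarrow> complex"
where
  "assoc_dist N a \<psi> =
     (\<Sum>\<beta> | mi_order \<beta> \<le> N. cnj (a \<beta>) * (- 1) ^ mi_order \<beta> * dist_deriv \<beta> dirac \<psi>)"

definition dist_fourier ::
  "((real ^ 'd \<Rightarrow> complex) \<Rightarrow> complex) \<Rightarrow> real ^ 'd \<Rightarrow> complex"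
where
  "dist_fourier T \<xi> = T (\<lambda>x. exp (- (2 * of_real pi * \<i> * of_real (x \<bullet> \<xi>))))"

lemma count_list_mi_list:
  fixes \<beta> :: "'d::finite \<Rightarrow> nat"
  shows "count_list (mi_list \<beta>) i = \<beta> i"
proof -
  obtain xs :: "'d list" where "mset xs = Abs_multiset \<beta>"
    using ex_mset by blast
  then have "count_list xs i = \<beta> i" for i
    by (simp add: count_mset[symmetric] Abs_multiset_inverse)
  then have "\<exists>is. \<forall>i. count_list is i = \<beta> i"
    by blast
  then show ?thesis
    unfolding mi_list_def by (rule someI2_ex) blast
qed

lemma partial_derivs_exp:
  fixes \<xi> :: "real ^ 'd"
  shows "partial_derivs is (\<lambda>x. exp (- (2 * of_real pi * \<i> * of_real (x \<bullet> \<xi>)))) =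
    (\<lambda>x. (\<Prod>i\<leftarrow>is. - (2 * of_real pi * \<i> * of_real (\<xi> $ i))) *
          exp (- (2 * of_real pi * \<i> * of_real (x \<bullet> \<xi>))))"
proof (induction "is")
  case (Cons i "is")
  define c where "c = (\<Prod>i\<leftarrow>is. - (2 * complex_of_real pi * \<i> * of_real (\<xi> $ i)))"
  define e where "e = (\<lambda>x. exp (- (2 * complex_of_real pi * \<i> * of_real (x \<bullet> \<xi>))))"
  define b where "b = - (2 * complex_of_real pi * \<i> * of_real (\<xi> $ i))"
  have "partial_deriv i (\<lambda>x. c * e x) x = b * c * e x" for x
  proof -
    have eq: "(\<lambda>t. c * e (x + t *\<^sub>R axis i 1)) = (\<lambda>t. c * e x * exp (t *\<^sub>R b))"
      unfolding e_def b_def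
      by (rule ext) (simp add: inner_add_left inner_axis' exp_add[symmetric] algebra_simps scaleR_conv_of_real[where 'a = complex])
    have "((\<lambda>t. exp (t *\<^sub>R b)) has_vector_derivative exp (0 *\<^sub>R b) * b) (at 0)"
      by (rule exp_scaleR_has_vector_derivative_right)
    from has_vector_derivative_mult_right[OF this, of "c * e x"]
    show ?thesis
      unfolding partial_deriv_def eq by (simp add: vector_derivative_at mult_ac)
  qed
  then show ?case
    unfolding partial_derivs.simps Cons.IH
    unfolding c_def e_def b_def by (simp add: fun_eq_iff)
qed simp

lemma prod_list_mi_list:
  fixes g :: "'d::finite \<Rightarrow> complex"
  shows "(\<Prod>i\<leftarrow>mi_list \<beta>. g i) = (\<Prod>i\<in>UNIV. g i ^ \<beta> i)"
proof -
  have "(\<Prod>i\<leftarrow>xs. g i) = (\<Prod>i\<in>UNIV. g i ^ count_list xs i)" for xs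
  proof (induction xs)
    case (Cons a xs)
    have "(\<Prod>i\<in>UNIV. g i ^ count_list (a # xs) i) =
        (\<Prod>i\<in>UNIV. (if i = a then g i else 1) * g i ^ count_list xs i)"
      by (intro prod.cong) auto
    then show ?case
      using Cons by (simp add: prod.distrib)
  qed simp
  then show ?thesis
    by (simp add: count_list_mi_list)
qed

lemma dist_fourier_assoc_dist:
  "dist_fourier (assoc_dist N a) \<xi> =
     (\<Sum>\<beta> | mi_order \<beta> \<le> N.
        cnj (a \<beta>) * (\<Prod>i\<in>UNIV. (- (2 * of_real pi * \<i> * of_real (\<xi> $ i))) ^ \<beta> i))"
proof -
  have sign: "c * (- 1) ^ k * ((- 1) ^ k * z) = c * z" for c z :: complex and k :: nat
    by (cases "even k") auto
  show ?thesis
    by (simp add: sign dist_fourier_def assoc_dist_def dist_deriv_def dirac_def partial_derivs_exp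
        prod_list_mi_list)
qed

end

theory Submission
  imports Defs "HOL-Probability.Characteristic_Functions"
begin

text \<open>
  Let \<open>F\<close> and \<open>\<Phi>\<close> be the transforms of \<open>f\<close> and \<open>\<phi>\<close>, \<open>m = \<bar>det M\<bar>\<close> and \<open>A\<^sub>j(\<xi>) = m\<^sup>j F((M\<^sup>*)\<^sup>j \<xi>)\<close>.
  The decay of \<open>F\<close> makes it integrable, so that \<open>f\<close> is its inverse transform, and \<open>E(f, -M\<^sup>-\<^sup>jk)\<close> is the value at \<open>-k\<close> of the inverse transform of \<open>\<mu> A\<^sub>j\<close>, where \<open>\<mu>\<close> is the
  transform of the averaging kernel. By Poisson summation, tested against Gaussians, the error in the
  variable \<open>M\<^sup>jx\<close> is the inverse transform of \<open>H\<^sub>j = A\<^sub>j - \<Phi> \<cdot> (\<Sum>\<^sub>l \<mu>(\<cdot> + l) A\<^sub>j(\<cdot> + l))\<close>, and the Hausdorff--Young inequality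
  bounds its \<open>L\<^sub>p\<close> norm by the \<open>L\<^sub>q\<close> norm of \<open>H\<^sub>j\<close>.

  The Taylor polynomial of \<open>\<mu>\<close> of degree \<open>N\<close> is the transform of the distribution associated with \<open>L\<close>. Hence
  \<open>1 - \<Phi> \<mu>\<close> is \<open>O(|\<xi>|\<^sup>s)\<close> with \<open>s = min n (N + 1)\<close>; the Strang--Fix condition controls \<open>\<Phi>\<close> near the other
  lattice points in the same way, and the aliasing terms are summed by Hoelder's inequality with polynomial
  weights, which needs \<open>d < p\<close>. So the norm of \<open>H\<^sub>j\<close> is bounded by those of \<open>|\<xi>|\<^sup>s A\<^sub>j\<close> and \<open>|\<xi>|\<^sup>N\<^sup>+\<^sup>1 A\<^sub>j\<close>. For an isotropic
  \<open>M\<close> the matrix \<open>M\<^sup>-\<^sup>j\<close> contracts by \<open>|\<lambda>|\<^sup>-\<^sup>j\<close>, which gives the rate, and the powers of \<open>m\<close> cancel.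
\<close>

text \<open>The level j enters only through A_j: in the variable M^j x the kernel, \<mu> and \<Phi>
  stay fixed, so one frequency estimate serves all levels, and j survives only in the moments of A_j
  and in a determinant. The obstacle is that the error is not known beforehand to lie in L_p, nor,
  for finite p, H_j in L_1. Bounded samples and an integrable \<phi> put the series in L_1 only
  against a weight (1 + |x|)^(-b) with b > d. Hence identities are stated after convolution with the
  Gaussian \<open>gk t\<close>: the factor \<open>gh t\<close> makes H_j integrable and the
  interchanges absolutely convergent. Hausdorff--Young is applied to the damped H_j, and t tends to
  0 by almost everywhere convergence along a sequence and Fatou's lemma. Such weights also sum the
  aliasing terms: b > d gives summability over the lattice, b (q - 1) \<le> (N + 1) q lets the
  moment of order N + 1 absorb them, and d < p leaves room for such a b. Returning to x multiplies
  the L_p norm by m^(-j/p), which cancels the power m^(j (q - 1) / q) produced by the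
  moments.\<close>

abbreviation nn_lborel :: "('a :: euclidean_space \<Rightarrow> ennreal) \<Rightarrow> ennreal" (binder "NNINT " 10) where
  "nn_lborel \<equiv> integral\<^sup>N lborel"

section \<open>Sums over countable sets and integrals\<close>

text \<open>An enumeration of K, padded by 0 outside its range, turns the unordered sum into a
  series over the naturals, to which the convergence theorems for series apply. Finite K is covered
  as well.\<close>

lemma infsum_countable_eq:
  fixes f :: "'b \<Rightarrow> 'c :: {comm_monoid_add, t2_space}"
  assumes "countable K"
  shows "infsum f K = infsum (\<lambda>n. if n \<in> to_nat_on K ` K then f (from_nat_into K n) else 0) (UNIV :: nat set)"
    and "f summable_on K \<longleftrightarrow> (\<lambda>n. if n \<in> to_nat_on K ` K then f (from_nat_into K n) else 0) summable_on (UNIV :: nat set)"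
proof -
  have inj: "inj_on (to_nat_on K) K"
    using assms by (rule inj_on_to_nat_on)
  let ?g = "\<lambda>n. if n \<in> to_nat_on K ` K then f (from_nat_into K n) else 0"
  have "infsum ?g (to_nat_on K ` K) = infsum (?g \<circ> to_nat_on K) K"
    by (rule infsum_reindex[OF inj])
  also have "\<dots> = infsum f K"
    by (rule infsum_cong) (use assms in auto)
  finally have 1: "infsum ?g (to_nat_on K ` K) = infsum f K" .
  have "infsum ?g (to_nat_on K ` K) = infsum ?g UNIV"
    by (rule infsum_cong_neutral) auto
  with 1 show "infsum f K = infsum ?g (UNIV :: nat set)" by simp
  have "?g summable_on (to_nat_on K ` K) \<longleftrightarrow> (?g \<circ> to_nat_on K) summable_on K"
    by (rule summable_on_reindex[OF inj])
  also have "\<dots> \<longleftrightarrow> f summable_on K"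
    by (rule summable_on_cong) (use assms in auto)
  finally have 2: "?g summable_on (to_nat_on K ` K) \<longleftrightarrow> f summable_on K" .
  have "?g summable_on (to_nat_on K ` K) \<longleftrightarrow> ?g summable_on UNIV"
    by (rule summable_on_cong_neutral) auto
  with 2 show "f summable_on K \<longleftrightarrow> ?g summable_on (UNIV :: nat set)" by simp
qed

lemma ennreal_summable_on [simp]: "f summable_on K" for f :: "'b \<Rightarrow> ennreal"
  by (rule nonneg_summable_on_complete) simp

lemma infsum_ennreal_suminf: "infsum f (UNIV :: nat set) = (\<Sum>n. f n)" for f :: "nat \<Rightarrow> ennreal"
  using has_sum_imp_sums[OF has_sum_infsum, of f] by (auto simp: sums_iff)

lemma infsum_banach_suminf: "f summable_on UNIV \<Longrightarrow> infsum f (UNIV :: nat set) = (\<Sum>n. f n)"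
  for f :: "nat \<Rightarrow> 'a :: banach"
  using has_sum_imp_sums[OF has_sum_infsum[of f UNIV]] by (auto simp: sums_iff)

lemma borel_measurable_infsum_ennreal:
  fixes f :: "'b \<Rightarrow> 'a \<Rightarrow> ennreal"
  assumes "countable K" and f [measurable]: "\<And>k. k \<in> K \<Longrightarrow> f k \<in> borel_measurable M"
  shows "(\<lambda>x. \<Sum>\<^sub>\<infinity>k\<in>K. f k x) \<in> borel_measurable M"
proof -
  have [measurable]: "(\<lambda>x. if n \<in> to_nat_on K ` K then f (from_nat_into K n) x else 0) \<in> borel_measurable M" for n
  proof (cases "n \<in> to_nat_on K ` K")
    case True
    then have "from_nat_into K n \<in> K" using assms(1) by auto
    then show ?thesis using f True by simp
  qed auto
  show ?thesis
    unfolding infsum_countable_eq(1)[OF assms(1)] infsum_ennreal_suminf by measurable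
qed

lemma nn_integral_infsum:
  fixes f :: "'b \<Rightarrow> 'a \<Rightarrow> ennreal"
  assumes "countable K" and f: "\<And>k. k \<in> K \<Longrightarrow> f k \<in> borel_measurable M"
  shows "(\<integral>\<^sup>+x. (\<Sum>\<^sub>\<infinity>k\<in>K. f k x) \<partial>M) = (\<Sum>\<^sub>\<infinity>k\<in>K. \<integral>\<^sup>+x. f k x \<partial>M)"
proof -
  have [measurable]: "(\<lambda>x. if n \<in> to_nat_on K ` K then f (from_nat_into K n) x else 0) \<in> borel_measurable M" for n
  proof (cases "n \<in> to_nat_on K ` K")
    case True
    then have "from_nat_into K n \<in> K" using assms(1) by auto
    then show ?thesis using f True by simp
  qed auto
  show ?thesis
    unfolding infsum_countable_eq(1)[OF assms(1)] infsum_ennreal_suminf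
    by (subst nn_integral_suminf) (auto intro!: suminf_cong)
qed

lemma infsum_ennreal_eq:
  fixes g :: "'b \<Rightarrow> real"
  assumes "\<And>k. k \<in> K \<Longrightarrow> 0 \<le> g k" "g summable_on K"
  shows "(\<Sum>\<^sub>\<infinity>k\<in>K. ennreal (g k)) = ennreal (\<Sum>\<^sub>\<infinity>k\<in>K. g k)"
proof -
  have "(\<Sum>\<^sub>\<infinity>k\<in>K. ennreal (g k)) = (SUP F\<in>{F. finite F \<and> F \<subseteq> K}. sum (\<lambda>k. ennreal (g k)) F)"
    by (rule nonneg_infsum_complete) simp
  also have "\<dots> = (SUP F\<in>{F. finite F \<and> F \<subseteq> K}. ennreal (sum g F))"
    by (intro SUP_cong refl sum_ennreal) (use assms in auto)
  also have "\<dots> = ennreal (infsum g K)"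
    by (rule infsum_nonneg_is_SUPREMUM_ennreal[symmetric]) (use assms in auto)
  finally show ?thesis .
qed

lemma sum_le_infsum_ennreal:
  fixes f :: "'b \<Rightarrow> ennreal"
  assumes "finite F" "F \<subseteq> K"
  shows "sum f F \<le> infsum f K"
  by (subst nonneg_infsum_complete) (use assms in \<open>auto intro!: SUP_upper\<close>)

lemma infsum_ennreal_le:
  fixes f :: "'b \<Rightarrow> ennreal"
  assumes "\<And>F. finite F \<Longrightarrow> F \<subseteq> K \<Longrightarrow> sum f F \<le> c"
  shows "infsum f K \<le> c"
  by (subst nonneg_infsum_complete) (use assms in \<open>auto intro!: SUP_least\<close>)

lemma infsum_ennreal_mono:
  fixes f g :: "'b \<Rightarrow> ennreal"
  assumes "\<And>k. k \<in> K \<Longrightarrow> f k \<le> g k"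
  shows "infsum f K \<le> infsum g K"
  by (intro infsum_ennreal_le order_trans[OF sum_mono sum_le_infsum_ennreal]) (use assms in auto)

lemma infsum_ennreal_cmult: "(\<Sum>\<^sub>\<infinity>k\<in>K. c * f k) = c * (\<Sum>\<^sub>\<infinity>k\<in>K. f k)" for f :: "'b \<Rightarrow> ennreal"
proof -
  have "(\<Sum>\<^sub>\<infinity>k\<in>K. c * f k) = (SUP F\<in>{F. finite F \<and> F \<subseteq> K}. sum (\<lambda>k. c * f k) F)"
    by (rule nonneg_infsum_complete) simp
  also have "\<dots> = (SUP F\<in>{F. finite F \<and> F \<subseteq> K}. c * sum f F)"
    by (simp add: sum_distrib_left)
  also have "\<dots> = c * (SUP F\<in>{F. finite F \<and> F \<subseteq> K}. sum f F)"
    by (subst SUP_mult_left_ennreal) auto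
  also have "(SUP F\<in>{F. finite F \<and> F \<subseteq> K}. sum f F) = infsum f K"
    by (rule nonneg_infsum_complete[symmetric]) simp
  finally show ?thesis .
qed

lemma infsum_ennreal_add:
  "(\<Sum>\<^sub>\<infinity>k\<in>K. f k + g k) = (\<Sum>\<^sub>\<infinity>k\<in>K. f k) + (\<Sum>\<^sub>\<infinity>k\<in>K. g k)" for f :: "'b \<Rightarrow> ennreal"
  by (rule infsum_add) simp_all

lemma infsum_ennreal_subset:
  fixes f :: "'b \<Rightarrow> ennreal"
  assumes "A \<subseteq> B" shows "infsum f A \<le> infsum f B"
  by (intro infsum_ennreal_le sum_le_infsum_ennreal) (use assms in auto)

lemma infsum_ennreal_remove:
  fixes f :: "'b \<Rightarrow> ennreal"
  assumes "a \<in> K" shows "infsum f K = f a + infsum f (K - {a})"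
proof -
  have "infsum f (insert a (K - {a})) = f a + infsum f (K - {a})"
    by (rule infsum_insert) auto
  with assms show ?thesis by (simp add: insert_absorb)
qed

text \<open>Bridge between two kinds of sums: finiteness is established in \<open>ennreal\<close>,
  where every sum exists, and read back as absolute summability.\<close>

lemma abs_summable_ennreal_iff:
  fixes g :: "'b \<Rightarrow> 'c :: real_normed_vector"
  shows "(\<lambda>k. norm (g k)) summable_on K \<longleftrightarrow> (\<Sum>\<^sub>\<infinity>k\<in>K. ennreal (norm (g k))) < \<infinity>"
proof
  assume "(\<lambda>k. norm (g k)) summable_on K"
  then show "(\<Sum>\<^sub>\<infinity>k\<in>K. ennreal (norm (g k))) < \<infinity>"
    by (subst infsum_ennreal_eq) auto
next
  assume a: "(\<Sum>\<^sub>\<infinity>k\<in>K. ennreal (norm (g k))) < \<infinity>"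
  define c where "c = (\<Sum>\<^sub>\<infinity>k\<in>K. ennreal (norm (g k)))"
  have "sum (\<lambda>k. norm (g k)) F \<le> enn2real c" if "finite F" "F \<subseteq> K" for F
  proof -
    have "ennreal (sum (\<lambda>k. norm (g k)) F) \<le> c"
      unfolding c_def using sum_le_infsum_ennreal[OF that, of "\<lambda>k. ennreal (norm (g k))"]
      by (simp add: sum_ennreal)
    then show ?thesis
      using a unfolding c_def[symmetric] by (cases c) (auto simp: ennreal_le_iff2)
  qed
  then show "(\<lambda>k. norm (g k)) summable_on K"
    by (intro nonneg_bdd_above_summable_on bdd_aboveI2[where M = "enn2real c"]) auto
qed

lemma norm_infsum_le_ennreal:
  fixes g :: "'b \<Rightarrow> 'c :: banach"
  shows "ennreal (norm (\<Sum>\<^sub>\<infinity>k\<in>K. g k)) \<le> (\<Sum>\<^sub>\<infinity>k\<in>K. ennreal (norm (g k)))"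
proof (cases "(\<Sum>\<^sub>\<infinity>k\<in>K. ennreal (norm (g k))) < \<infinity>")
  case True
  then have s: "(\<lambda>k. norm (g k)) summable_on K"
    by (simp add: abs_summable_ennreal_iff)
  have "norm (\<Sum>\<^sub>\<infinity>k\<in>K. g k) \<le> (\<Sum>\<^sub>\<infinity>k\<in>K. norm (g k))"
    using s by (rule norm_infsum_bound)
  then show ?thesis
    using s by (subst infsum_ennreal_eq) (auto intro: ennreal_leI)
next
  case False
  then show ?thesis by (simp add: less_top[symmetric])
qed

lemma norm_integral_le_nn_integral:
  fixes f :: "'a \<Rightarrow> 'c :: {banach, second_countable_topology}"
  shows "ennreal (norm (\<integral>x. f x \<partial>M)) \<le> (\<integral>\<^sup>+x. ennreal (norm (f x)) \<partial>M)"
  by (cases "integrable M f") (auto simp: integral_norm_bound_ennreal not_integrable_integral_eq)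

text \<open>Fubini's theorem for a sum and an integral. Finiteness of the sum of the L_1 norms is
  Tonelli's condition; the interchange takes place on the enumerated series.\<close>

lemma integral_infsum:
  fixes f :: "'b \<Rightarrow> 'a \<Rightarrow> complex"
  assumes K: "countable K" and f [measurable]: "\<And>k. k \<in> K \<Longrightarrow> f k \<in> borel_measurable M"
    and fin: "(\<Sum>\<^sub>\<infinity>k\<in>K. \<integral>\<^sup>+x. ennreal (norm (f k x)) \<partial>M) < \<infinity>"
  shows AE_abs_summable_infsum: "AE x in M. (\<lambda>k. norm (f k x)) summable_on K"
    and integrable_infsum: "integrable M (\<lambda>x. \<Sum>\<^sub>\<infinity>k\<in>K. f k x)"
    and integral_infsum_eq: "(\<integral>x. (\<Sum>\<^sub>\<infinity>k\<in>K. f k x) \<partial>M) = (\<Sum>\<^sub>\<infinity>k\<in>K. \<integral>x. f k x \<partial>M)"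
    and abs_summable_integral: "(\<lambda>k. norm (\<integral>x. f k x \<partial>M)) summable_on K"
proof -
  let ?A = "to_nat_on K ` K"
  define g where "g n x = (if n \<in> ?A then f (from_nat_into K n) x else 0)" for n x
  have [measurable]: "g n \<in> borel_measurable M" for n
  proof (cases "n \<in> ?A")
    case True
    then have "from_nat_into K n \<in> K" using K by auto
    then show ?thesis using f True by (simp add: g_def[abs_def])
  qed (auto simp: g_def[abs_def])
  have norm_if: "ennreal (norm (g n x)) = (if n \<in> ?A then ennreal (norm (f (from_nat_into K n) x)) else 0)" for n x
    by (auto simp: g_def)
  have gfin: "(\<Sum>n. \<integral>\<^sup>+x. ennreal (norm (g n x)) \<partial>M) < \<infinity>"
  proof -
    have "(\<Sum>n. \<integral>\<^sup>+x. ennreal (norm (g n x)) \<partial>M)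
        = (\<Sum>\<^sub>\<infinity>n. if n \<in> ?A then \<integral>\<^sup>+x. ennreal (norm (f (from_nat_into K n) x)) \<partial>M else 0)"
      unfolding infsum_ennreal_suminf by (intro suminf_cong) (simp add: g_def)
    also have "\<dots> < \<infinity>"
      using fin by (subst (asm) infsum_countable_eq(1)[OF K])
    finally show ?thesis .
  qed
  have int: "integrable M (g n)" for n
  proof -
    have "(\<integral>\<^sup>+x. ennreal (norm (g n x)) \<partial>M) \<le> (\<Sum>n. \<integral>\<^sup>+x. ennreal (norm (g n x)) \<partial>M)"
      using sum_le_suminf[of "\<lambda>n. \<integral>\<^sup>+x. ennreal (norm (g n x)) \<partial>M" "{n}"] by simp
    with gfin show ?thesis by (auto simp: integrable_iff_bounded)
  qed
  have "AE x in M. (\<Sum>\<^sub>\<infinity>k\<in>K. ennreal (norm (f k x))) \<noteq> \<infinity>"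
    using fin by (intro nn_integral_PInf_AE)
      (auto simp: nn_integral_infsum[OF K] intro!: borel_measurable_infsum_ennreal K)
  then show ae: "AE x in M. (\<lambda>k. norm (f k x)) summable_on K"
    by eventually_elim (simp add: abs_summable_ennreal_iff less_top[symmetric])
  have gs: "summable (\<lambda>n. norm (g n x))" if "(\<lambda>k. norm (f k x)) summable_on K" for x
  proof -
    have "(\<lambda>n. if n \<in> ?A then norm (f (from_nat_into K n) x) else 0) summable_on UNIV"
      using that infsum_countable_eq(2)[OF K, of "\<lambda>k. norm (f k x)"] by simp
    also have "(\<lambda>n. if n \<in> ?A then norm (f (from_nat_into K n) x) else 0) = (\<lambda>n. norm (g n x))"
      by (auto simp: g_def)
    finally show ?thesis by (rule summable_on_imp_summable)
  qed
  have aeg: "AE x in M. summable (\<lambda>n. norm (g n x))"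
    using ae by eventually_elim (rule gs)
  have sg: "summable (\<lambda>n. \<integral>x. norm (g n x) \<partial>M)"
  proof (rule summable_suminf_not_top)
    show "(\<Sum>n. ennreal (\<integral>x. norm (g n x) \<partial>M)) \<noteq> top"
      using gfin int by (simp add: nn_integral_eq_integral[symmetric])
  qed simp
  have eq: "(\<Sum>\<^sub>\<infinity>k\<in>K. f k x) = (\<Sum>n. g n x)" if "(\<lambda>k. norm (f k x)) summable_on K" for x
    unfolding infsum_countable_eq(1)[OF K]
    using infsum_banach_suminf[OF norm_summable_imp_summable_on[OF gs[OF that]]]
    by (simp add: g_def)
  have int': "integrable M (\<lambda>x. \<Sum>n. g n x)"
    by (rule integrable_suminf[OF int aeg sg])
  \<comment> \<open>Where the series does not converge absolutely, \<open>infsum\<close> returns 0;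
    the set of such points is measurable, so the sum is measurable everywhere and not only up to a
    null set.\<close>
  have meas: "(\<lambda>x. \<Sum>\<^sub>\<infinity>k\<in>K. f k x) \<in> borel_measurable M"
  proof -
    have [measurable]: "(\<lambda>x. \<Sum>\<^sub>\<infinity>k\<in>K. ennreal (norm (f k x))) \<in> borel_measurable M"
      by (intro borel_measurable_infsum_ennreal K) simp
    have "(\<Sum>\<^sub>\<infinity>k\<in>K. f k x) = (if (\<Sum>\<^sub>\<infinity>k\<in>K. ennreal (norm (f k x))) < \<infinity> then (\<Sum>n. g n x) else 0)" for x
    proof (cases "(\<Sum>\<^sub>\<infinity>k\<in>K. ennreal (norm (f k x))) < \<infinity>")
      case True
      then show ?thesis
        using eq[of x] by (simp add: abs_summable_ennreal_iff)
    next
      case False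
      then have "\<not> (\<lambda>k. f k x) summable_on K"
        by (simp add: summable_on_iff_abs_summable_on_complex abs_summable_ennreal_iff)
      then show ?thesis
        using False by (simp add: infsum_not_exists)
    qed
    then show ?thesis by simp
  qed
  show "integrable M (\<lambda>x. \<Sum>\<^sub>\<infinity>k\<in>K. f k x)"
    using int' ae meas eq by (subst integrable_cong_AE) auto
  have ifi: "ennreal (norm (\<integral>x. f k x \<partial>M)) \<le> (\<integral>\<^sup>+x. ennreal (norm (f k x)) \<partial>M)" for k
    by (rule norm_integral_le_nn_integral)
  have "(\<Sum>\<^sub>\<infinity>k\<in>K. ennreal (norm (\<integral>x. f k x \<partial>M))) \<le> (\<Sum>\<^sub>\<infinity>k\<in>K. \<integral>\<^sup>+x. ennreal (norm (f k x)) \<partial>M)"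
    by (intro infsum_ennreal_mono ifi)
  with fin show s: "(\<lambda>k. norm (\<integral>x. f k x \<partial>M)) summable_on K"
    by (simp add: abs_summable_ennreal_iff)
  have "(\<integral>x. (\<Sum>\<^sub>\<infinity>k\<in>K. f k x) \<partial>M) = (\<integral>x. (\<Sum>n. g n x) \<partial>M)"
    using int' ae meas eq by (intro integral_cong_AE) auto
  also have "\<dots> = (\<Sum>n. \<integral>x. g n x \<partial>M)"
    by (rule integral_suminf[OF int aeg sg])
  also have "\<dots> = (\<Sum>\<^sub>\<infinity>n. \<integral>x. g n x \<partial>M)"
  proof (rule infsum_banach_suminf[symmetric, OF norm_summable_imp_summable_on])
    show "summable (\<lambda>n. norm (\<integral>x. g n x \<partial>M))"
      by (rule summable_comparison_test'[OF sg, of 0]) (simp add: integral_norm_bound)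
  qed
  also have "\<dots> = (\<Sum>\<^sub>\<infinity>n. if n \<in> ?A then \<integral>x. f (from_nat_into K n) x \<partial>M else 0)"
    by (intro infsum_cong) (simp add: g_def)
  also have "\<dots> = (\<Sum>\<^sub>\<infinity>k\<in>K. \<integral>x. f k x \<partial>M)"
    by (rule infsum_countable_eq(1)[OF K, symmetric])
  finally show "(\<integral>x. (\<Sum>\<^sub>\<infinity>k\<in>K. f k x) \<partial>M) = (\<Sum>\<^sub>\<infinity>k\<in>K. \<integral>x. f k x \<partial>M)" .
qed


section \<open>Polynomial weights\<close>

text \<open>Two roles: it measures the growth of functions outside L_1, and its lattice translates
  supply the weights in Hoelder's inequality for the aliasing terms.\<close>

definition wt :: "real \<Rightarrow> 'a :: real_normed_vector \<Rightarrow> real" where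
  "wt b x = (1 + norm x) powr (- b)"

lemma wt_pos: "0 < wt b x"
  unfolding wt_def by (simp add: add_pos_nonneg add_nonneg_eq_0_iff)

lemma wt_nonneg [simp]: "0 \<le> wt b x"
  using wt_pos[of b x] by simp

lemma wt_le_1: "0 \<le> b \<Longrightarrow> wt b x \<le> 1"
  unfolding wt_def by (simp add: powr_minus_divide divide_le_eq ge_one_powr_ge_zero)

lemma wt_uminus [simp]: "wt b (- x) = wt b x"
  by (simp add: wt_def)

lemma continuous_on_wt [continuous_intros]: "continuous_on S f \<Longrightarrow> continuous_on S (\<lambda>x. wt b (f x))"
  unfolding wt_def
  by (intro continuous_on_powr continuous_intros) (auto simp: add_nonneg_eq_0_iff)

lemma borel_measurable_wt [measurable]: "wt b \<in> borel_measurable borel"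
  for b :: real
  by (intro borel_measurable_continuous_onI continuous_intros)

text \<open>Peetre's inequality, from 1 + |x| \<le> (1 + |x + y|)(1 + |y|). A shift of the weight
  costs only a factor of polynomial growth, which a Gaussian absorbs.\<close>

lemma wt_add_le:
  assumes "0 \<le> b"
  shows "wt b (x + y) \<le> wt b x * (1 + norm y) powr b"
proof -
  have "norm x \<le> norm (x + y) + norm y"
    using norm_triangle_ineq4[of "x + y" y] by simp
  then have "1 + norm x \<le> (1 + norm (x + y)) * (1 + norm y)"
    using mult_nonneg_nonneg[OF norm_ge_zero[of "x + y"] norm_ge_zero[of y]]
    by (simp only: ring_distribs mult_1 mult_1_right)
  then have "(1 + norm x) powr b \<le> ((1 + norm (x + y)) * (1 + norm y)) powr b"
    by (intro powr_mono2 assms) auto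
  also have "\<dots> = (1 + norm (x + y)) powr b * (1 + norm y) powr b"
    by (rule powr_mult)
  finally have "(1 + norm x) powr b \<le> (1 + norm (x + y)) powr b * (1 + norm y) powr b" .
  moreover have "0 < (1 + norm x) powr b" "0 < (1 + norm (x + y)) powr b"
    by (simp_all add: add_pos_nonneg add_nonneg_eq_0_iff)
  moreover have "1 / z \<le> 1 / u * v" if "u \<le> z * v" "0 < u" "0 < z" for u v z :: real
    using that by (simp add: field_simps)
  ultimately show ?thesis
    unfolding wt_def powr_minus_divide by blast
qed

lemma le_suminf_ennreal: "f k \<le> (\<Sum>k. f k)" for f :: "nat \<Rightarrow> ennreal"
  using sum_le_suminf[of f "{k}"] by simp

text \<open>Dyadic majorant: if k is least with 1 + |x| \<le> 2^k, then x lies in the ball of radius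
  2^k and the weight is at most 2^(b - b k). The volumes turn this into a geometric series of ratio
  2^(d - b) < 1.\<close>

lemma nn_integral_wt_finite:
  assumes "real DIM('a) < b"
  shows "(\<integral>\<^sup>+x. ennreal (wt b x) \<partial>(lborel :: 'a :: euclidean_space measure)) < \<infinity>"
proof -
  define D where "D = DIM('a)"
  define V where "V = unit_ball_vol (real D)"
  define r where "r = 2 powr (real D - b)"
  have r: "0 < r" "r < 1"
    using assms by (auto simp: r_def D_def powr_less_one)
  have V: "V \<ge> 0" by (simp add: V_def)
  have b0: "b > 0" using assms by linarith
  have pt: "ennreal (wt b x) \<le> (\<Sum>k::nat. ennreal (2 powr (b - b * real k)) * indicator (cball 0 (2 ^ k)) x)" for x :: 'a
  proof -
    obtain k :: nat where k0: "1 + norm x \<le> 2 ^ k"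
      by (metis one_less_numeral_iff real_arch_pow less_imp_le semiring_norm(76))
    define k where "k = (LEAST k::nat. 1 + norm x \<le> 2 ^ k)"
    have k: "1 + norm x \<le> 2 ^ k"
      unfolding k_def by (rule LeastI[of "\<lambda>k. 1 + norm x \<le> 2 ^ k", OF k0])
    have "2 powr (real k - 1) \<le> 1 + norm x"
    proof (cases k)
      case 0
      then show ?thesis by (simp add: powr_minus_divide add_increasing2)
    next
      case (Suc l)
      then have "\<not> (1 + norm x \<le> 2 ^ l)"
        using not_less_Least[of l "\<lambda>k. 1 + norm x \<le> 2 ^ k"] by (simp add: k_def)
      then show ?thesis using Suc by (simp add: powr_realpow)
    qed
    then have "wt b x \<le> (2 powr (real k - 1)) powr (- b)"
      unfolding wt_def using b0 by (intro powr_mono2') auto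
    also have "\<dots> = 2 powr (b - b * real k)"
      by (simp add: powr_powr algebra_simps)
    finally have "ennreal (wt b x) \<le> ennreal (2 powr (b - b * real k)) * indicator (cball 0 (2 ^ k)) x"
      using k by (auto intro!: ennreal_leI)
    also have "\<dots> \<le> (\<Sum>k::nat. ennreal (2 powr (b - b * real k)) * indicator (cball 0 (2 ^ k)) x)"
      by (rule le_suminf_ennreal)
    finally show ?thesis .
  qed
  have "(\<integral>\<^sup>+x. ennreal (wt b x) \<partial>(lborel :: 'a measure))
     \<le> (\<integral>\<^sup>+x. (\<Sum>k::nat. ennreal (2 powr (b - b * real k)) * indicator (cball 0 (2 ^ k)) x) \<partial>(lborel :: 'a measure))"
    by (intro nn_integral_mono pt)
  also have "\<dots> = (\<Sum>k::nat. ennreal (2 powr (b - b * real k)) * emeasure lborel (cball (0::'a) (2 ^ k)))"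
  proof (subst nn_integral_suminf)
    show "(\<Sum>k::nat. \<integral>\<^sup>+x. ennreal (2 powr (b - b * real k)) * indicator (cball 0 (2 ^ k)) x \<partial>(lborel :: 'a measure))
      = (\<Sum>k::nat. ennreal (2 powr (b - b * real k)) * emeasure lborel (cball (0::'a) (2 ^ k)))"
      by (intro suminf_cong nn_integral_cmult_indicator) simp
    show "(\<lambda>x. ennreal (2 powr (b - b * real k)) * indicator (cball 0 (2 ^ k)) x) \<in> borel_measurable (lborel :: 'a measure)" for k
      by (intro borel_measurable_times_ennreal borel_measurable_const borel_measurable_indicator) simp
  qed
  also have "\<dots> = (\<Sum>k::nat. ennreal (2 powr b * V * r ^ k))"
  proof (intro suminf_cong)
    fix k :: nat
    have "ennreal (2 powr (b - b * real k)) * emeasure lborel (cball (0::'a) (2 ^ k))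
       = ennreal (2 powr (b - b * real k) * (V * (2 ^ k) ^ D))"
      by (subst emeasure_cball) (auto simp: V_def D_def ennreal_mult)
    also have "2 powr (b - b * real k) * (V * (2 ^ k) ^ D) = 2 powr b * V * r ^ k"
    proof -
      have "((2::real) ^ k) ^ D = 2 powr (real D * real k)"
        by (simp add: powr_realpow[symmetric] powr_powr power_mult[symmetric] mult.commute)
      moreover have "r ^ k = 2 powr (real D * real k - b * real k)"
        using r by (simp add: r_def powr_realpow[symmetric] powr_powr left_diff_distrib)
      ultimately show ?thesis
        by (simp add: powr_diff field_simps)
    qed
    finally show "ennreal (2 powr (b - b * real k)) * emeasure lborel (cball (0::'a) (2 ^ k)) = ennreal (2 powr b * V * r ^ k)" .
  qed
  also have "\<dots> < \<infinity>"
    using r V sums_mult[OF geometric_sums[of r], of "2 powr b * V"]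
    by (subst suminf_ennreal_eq[where x = "2 powr b * V * (1 / (1 - r))"]) auto
  finally show ?thesis .
qed

section \<open>The integer lattice\<close>

lemma int_lattice_0 [simp]: "0 \<in> int_lattice"
  by (simp add: int_lattice_def)

lemma int_lattice_add: "k \<in> int_lattice \<Longrightarrow> l \<in> int_lattice \<Longrightarrow> k + l \<in> int_lattice"
  by (simp add: int_lattice_def)

lemma int_lattice_diff: "k \<in> int_lattice \<Longrightarrow> l \<in> int_lattice \<Longrightarrow> k - l \<in> int_lattice"
  by (simp add: int_lattice_def)

lemma int_lattice_uminus_iff [simp]: "- k \<in> int_lattice \<longleftrightarrow> k \<in> int_lattice"
  by (simp add: int_lattice_def)

lemma int_lattice_inner: "k \<in> int_lattice \<Longrightarrow> l \<in> int_lattice \<Longrightarrow> k \<bullet> l \<in> \<int>"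
  by (auto simp: int_lattice_def inner_vec_def intro!: Ints_sum Ints_mult)

lemma int_lattice_axis: "axis i 1 \<in> int_lattice"
  by (auto simp: int_lattice_def axis_def)

lemma countable_int_lattice [simp]: "countable (int_lattice :: (real ^ 'd) set)"
proof -
  have "int_lattice \<subseteq> (\<lambda>g. (\<chi> i. of_int (g i)) :: real ^ 'd) ` (UNIV :: ('d \<Rightarrow> int) set)"
  proof
    fix k :: "real ^ 'd" assume "k \<in> int_lattice"
    then have "k = (\<chi> i. of_int \<lfloor>k $ i\<rfloor>)"
      by (auto simp: int_lattice_def vec_eq_iff Ints_def)
    then show "k \<in> (\<lambda>g. (\<chi> i. of_int (g i)) :: real ^ 'd) ` (UNIV :: ('d \<Rightarrow> int) set)"
      by (intro image_eqI[of _ _ "\<lambda>i. \<lfloor>k $ i\<rfloor>"]) auto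
  qed
  moreover have "countable (UNIV :: ('d \<Rightarrow> int) set)"
    by simp
  ultimately show ?thesis
    by (meson countable_image countable_subset)
qed

lemma infsum_lattice_shift:
  fixes f :: "real ^ 'd \<Rightarrow> 'c :: {comm_monoid_add, t2_space}"
  assumes "l \<in> int_lattice"
  shows "(\<Sum>\<^sub>\<infinity>k\<in>int_lattice. f (k + l)) = (\<Sum>\<^sub>\<infinity>k\<in>int_lattice. f k)"
proof (rule infsum_reindex_bij_betw)
  have "l + k \<in> (\<lambda>k. k + l) ` int_lattice" if "k + l \<in> int_lattice" for k
    using int_lattice_diff[OF that assms] by (auto simp: add.commute)
  moreover have "k \<in> (\<lambda>k. k + l) ` int_lattice" if "k \<in> int_lattice" for k
    using int_lattice_diff[OF that assms] by (intro image_eqI[of _ _ "k - l"]) auto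
  ultimately show "bij_betw (\<lambda>k. k + l) int_lattice int_lattice"
    using assms by (auto simp: bij_betw_def inj_on_def int_lattice_add)
qed

lemma infsum_lattice_uminus:
  fixes f :: "real ^ 'd \<Rightarrow> 'c :: {comm_monoid_add, t2_space}"
  shows "(\<Sum>\<^sub>\<infinity>k\<in>int_lattice. f (- k)) = (\<Sum>\<^sub>\<infinity>k\<in>int_lattice. f k)"
  by (rule infsum_reindex_bij_betw)
     (auto simp: bij_betw_def inj_on_def image_iff, metis add.inverse_inverse int_lattice_uminus_iff)

text \<open>Half-open, in contrast to \<open>torus\<close>, so that the lattice translates tile the
  space without overlap and identities over the cell hold exactly.\<close>

definition unit_cell :: "(real ^ 'd) set" where
  "unit_cell = {x. \<forall>i. - 1 / 2 \<le> x $ i \<and> x $ i < 1 / 2}"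

lemma unit_cell_measurable [measurable]: "unit_cell \<in> sets borel"
proof -
  have "(unit_cell :: (real ^ 'd) set) = (\<Inter>i. {x. - 1 / 2 \<le> x $ i} \<inter> {x. x $ i < 1 / 2})"
    by (auto simp: unit_cell_def)
  also have "\<dots> \<in> sets borel"
    by (intro sets.countable_INT' sets.Int borel_closed borel_open closed_Collect_le open_Collect_less
        continuous_intros) auto
  finally show ?thesis .
qed

lemma unit_cell_subset_torus: "unit_cell \<subseteq> torus"
  by (auto simp: unit_cell_def torus_def mem_box_cart less_imp_le)

lemma norm_le_of_torus: "x \<in> torus \<Longrightarrow> norm (x :: real ^ 'd) \<le> real CARD('d)"
proof -
  assume x: "x \<in> torus"
  have "norm x \<le> (\<Sum>i\<in>UNIV. \<bar>x $ i\<bar>)"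
    by (rule norm_le_l1_cart)
  also have "\<dots> \<le> (\<Sum>i\<in>(UNIV :: 'd set). 1)"
  proof (intro sum_mono)
    fix i
    have "- 1 / 2 \<le> x $ i" "x $ i \<le> 1 / 2"
      using x by (auto simp: torus_def mem_box_cart dest: spec[of _ i])
    then show "\<bar>x $ i\<bar> \<le> 1" by linarith
  qed
  finally show ?thesis by simp
qed

definition nearest_lattice :: "real ^ 'd \<Rightarrow> real ^ 'd" where
  "nearest_lattice x = (\<chi> i. of_int \<lfloor>x $ i + 1 / 2\<rfloor>)"

lemma nearest_lattice: "nearest_lattice x \<in> int_lattice" "x - nearest_lattice x \<in> unit_cell"
proof -
  show "nearest_lattice x \<in> int_lattice"
    by (simp add: nearest_lattice_def int_lattice_def)
  show "x - nearest_lattice x \<in> unit_cell"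
    unfolding unit_cell_def nearest_lattice_def mem_Collect_eq
  proof
    fix i
    show "- 1 / 2 \<le> (x - (\<chi> i. of_int \<lfloor>x $ i + 1 / 2\<rfloor>)) $ i \<and> (x - (\<chi> i. of_int \<lfloor>x $ i + 1 / 2\<rfloor>)) $ i < 1 / 2"
      using of_int_floor_le[of "x $ i + 1 / 2"] real_of_int_floor_add_one_gt[of "x $ i + 1 / 2"]
      by (simp, linarith)
  qed
qed

lemma unit_cell_lattice_unique:
  assumes "x \<in> unit_cell" "x + k \<in> unit_cell" "k \<in> int_lattice"
  shows "k = 0"
proof (rule vec_eq_iff[THEN iffD2], rule allI)
  fix i
  obtain z where z: "k $ i = of_int z"
    using assms(3) by (auto simp: int_lattice_def Ints_def)
  have "- 1 / 2 \<le> x $ i" "x $ i < 1 / 2" "- 1 / 2 \<le> x $ i + k $ i" "x $ i + k $ i < 1 / 2"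
    using assms(1,2) by (auto simp: unit_cell_def)
  then have "- 1 < real_of_int z" "real_of_int z < 1"
    using z by auto
  then have "z = 0" by linarith
  with z show "k $ i = 0 $ i" by simp
qed

lemma sum_indicator_unit_cell: "(\<Sum>\<^sub>\<infinity>k\<in>int_lattice. indicator unit_cell (x + k) :: ennreal) = 1"
proof -
  let ?k = "- nearest_lattice x"
  have k: "?k \<in> int_lattice" "x + ?k \<in> unit_cell"
    using nearest_lattice[of x] by auto
  have 0: "indicator unit_cell (x + l) = (0 :: ennreal)" if "l \<in> int_lattice - {?k}" for l
  proof (rule ccontr)
    assume "indicator unit_cell (x + l) \<noteq> (0 :: ennreal)"
    then have "x + l \<in> unit_cell" by (auto simp: indicator_def split: if_splits)
    moreover have "x + ?k = (x + l) + (?k - l)" by simp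
    ultimately have "?k - l = 0"
      using k that by (intro unit_cell_lattice_unique[of "x + l"]) (auto intro!: int_lattice_diff)
    with that show False by simp
  qed
  have "(\<Sum>\<^sub>\<infinity>l\<in>int_lattice. indicator unit_cell (x + l) :: ennreal)
     = indicator unit_cell (x + ?k) + (\<Sum>\<^sub>\<infinity>l\<in>int_lattice - {?k}. indicator unit_cell (x + l))"
    by (rule infsum_ennreal_remove[OF k(1)])
  also have "(\<Sum>\<^sub>\<infinity>l\<in>int_lattice - {?k}. indicator unit_cell (x + l) :: ennreal) = 0"
    by (subst infsum_cong[OF 0]) auto
  finally show ?thesis using k by simp
qed

section \<open>Unfolding integrals over the lattice translates of the cell\<close>

lemma nn_integral_lborel_shift:
  fixes f :: "'a :: euclidean_space \<Rightarrow> ennreal"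
  assumes [measurable]: "f \<in> borel_measurable borel"
  shows "(NNINT x. f (x + c)) = (NNINT x. f x)"
proof -
  have "(NNINT x. f x) = (\<integral>\<^sup>+x. f x \<partial>distr lborel borel ((+) c))"
    by (simp add: lborel_distr_plus)
  also have "\<dots> = (NNINT x. f (x + c))"
    by (subst nn_integral_distr) (auto simp: add.commute)
  finally show ?thesis by simp
qed

text \<open>The indicators of the translated cells form a partition of unity; inserting it,
  exchanging sum and integral and shifting each piece back to the cell gives the periodised
  integrand.\<close>

lemma nn_integral_lattice:
  fixes g :: "real ^ 'd \<Rightarrow> ennreal"
  assumes [measurable]: "g \<in> borel_measurable borel"
  shows "(NNINT x. g x) = (\<integral>\<^sup>+x\<in>unit_cell. (\<Sum>\<^sub>\<infinity>k\<in>int_lattice. g (x + k)) \<partial>lborel)"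
proof -
  have "(NNINT x. g x) = (NNINT x. (\<Sum>\<^sub>\<infinity>k\<in>int_lattice. g x * indicator unit_cell (x + k)))"
    by (simp add: infsum_ennreal_cmult sum_indicator_unit_cell)
  also have "\<dots> = (\<Sum>\<^sub>\<infinity>k\<in>int_lattice. NNINT x. g x * indicator unit_cell (x + k))"
    by (rule nn_integral_infsum) auto
  also have "\<dots> = (\<Sum>\<^sub>\<infinity>k\<in>int_lattice. NNINT x. g (x + - k) * indicator unit_cell x)"
  proof (rule infsum_cong)
    fix k :: "real ^ 'd"
    show "(NNINT x. g x * indicator unit_cell (x + k)) = (NNINT x. g (x + - k) * indicator unit_cell x)"
      by (subst nn_integral_lborel_shift[where c = "- k", symmetric]) simp_all
  qed
  also have "\<dots> = (\<Sum>\<^sub>\<infinity>k\<in>int_lattice. NNINT x. g (x + k) * indicator unit_cell x)"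
    by (rule infsum_lattice_uminus)
  also have "\<dots> = (NNINT x. (\<Sum>\<^sub>\<infinity>k\<in>int_lattice. g (x + k) * indicator unit_cell x))"
    by (rule nn_integral_infsum[symmetric]) auto
  also have "\<dots> = (\<integral>\<^sup>+x\<in>unit_cell. (\<Sum>\<^sub>\<infinity>k\<in>int_lattice. g (x + k)) \<partial>lborel)"
    by (subst (1 2) mult.commute) (simp add: infsum_ennreal_cmult)
  finally show ?thesis .
qed

lemma emeasure_unit_cell [simp]: "emeasure lborel (unit_cell :: (real ^ 'd) set) = 1"
proof -
  have "emeasure lborel (box ((\<chi> i. - (1 / 2)) :: real ^ 'd) (\<chi> i. 1 / 2)) = 1"
    by (subst emeasure_lborel_box)
       (auto simp: Basis_vec_def inner_axis prod_eq_1_iff inner_diff_left intro!: prod.neutral)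
  moreover have "emeasure lborel (cbox ((\<chi> i. - (1 / 2)) :: real ^ 'd) (\<chi> i. 1 / 2)) = 1"
    by (subst emeasure_lborel_cbox)
       (auto simp: Basis_vec_def inner_axis prod_eq_1_iff inner_diff_left intro!: prod.neutral)
  moreover have "box (\<chi> i. - (1 / 2)) (\<chi> i. 1 / 2) \<subseteq> (unit_cell :: (real ^ 'd) set)"
    by (auto simp: unit_cell_def mem_box_cart less_imp_le)
  moreover have "unit_cell \<subseteq> (cbox (\<chi> i. - (1 / 2)) (\<chi> i. 1 / 2) :: (real ^ 'd) set)"
    by (auto simp: unit_cell_def mem_box_cart less_imp_le)
  ultimately show ?thesis
    by (metis antisym emeasure_mono lborelD sets_lborel borel_closed closed_cbox unit_cell_measurable)
qed

text \<open>Comparison with the integral: by Peetre's inequality the weights at k and at x + k are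
  comparable uniformly for x in the cell, and averaging over x unfolds to the integral over the
  whole space.\<close>

lemma lattice_sum_wt_finite:
  assumes "real CARD('d) < b"
  shows "(\<Sum>\<^sub>\<infinity>k\<in>(int_lattice :: (real ^ 'd) set). ennreal (wt b k)) < \<infinity>"
proof -
  define c where "c = (1 + real CARD('d)) powr b"
  have b: "b > 0" using assms by linarith
  have pt: "ennreal (wt b k) \<le> ennreal c * ennreal (wt b (x + k))" if "x \<in> unit_cell" for x k :: "real ^ 'd"
  proof -
    have "wt b (k + x + - x) \<le> wt b (k + x) * (1 + norm (- x)) powr b"
      using b by (intro wt_add_le) auto
    also have "\<dots> \<le> wt b (k + x) * c"
      unfolding c_def using b norm_le_of_torus[of x] unit_cell_subset_torus that
      by (intro mult_left_mono powr_mono2) auto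
    finally show ?thesis
      by (simp add: ennreal_mult[symmetric] c_def mult.commute add.commute ennreal_leI)
  qed
  have "(\<Sum>\<^sub>\<infinity>k\<in>(int_lattice :: (real ^ 'd) set). ennreal (wt b k))
     = (\<integral>\<^sup>+x\<in>unit_cell. (\<Sum>\<^sub>\<infinity>k\<in>(int_lattice :: (real ^ 'd) set). ennreal (wt b k)) \<partial>(lborel :: (real ^ 'd) measure))"
    by (subst nn_integral_cmult_indicator) auto
  also have "\<dots> \<le> (\<integral>\<^sup>+x\<in>unit_cell. (\<Sum>\<^sub>\<infinity>k\<in>int_lattice. ennreal c * ennreal (wt b (x + k))) \<partial>(lborel :: (real ^ 'd) measure))"
    by (intro nn_integral_mono) (auto intro!: infsum_ennreal_mono pt split: split_indicator)
  also have "\<dots> = (NNINT x :: real ^ 'd. ennreal c * ennreal (wt b x))"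
    by (rule nn_integral_lattice[symmetric]) measurable
  also have "\<dots> = ennreal c * (NNINT x :: real ^ 'd. ennreal (wt b x))"
    by (rule nn_integral_cmult) measurable
  also have "\<dots> < \<infinity>"
    using nn_integral_wt_finite[of b, where 'a = "real ^ 'd"] assms by (simp add: ennreal_mult_less_top)
  finally show ?thesis .
qed

section \<open>Fourier integrals and Gaussians\<close>

lemma integrable_pairI:
  fixes f :: "'a :: euclidean_space \<Rightarrow> 'b :: euclidean_space \<Rightarrow> 'c :: {banach, second_countable_topology}"
  assumes [measurable]: "(\<lambda>(x, y). f x y) \<in> borel_measurable (borel \<Otimes>\<^sub>M borel)"
    and fin: "(NNINT x. NNINT y. ennreal (norm (f x y))) < \<infinity>"
  shows "integrable (lborel \<Otimes>\<^sub>M lborel) (\<lambda>(x, y). f x y)"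
proof -
  have m [measurable]: "(\<lambda>(x, y). f x y) \<in> borel_measurable (lborel \<Otimes>\<^sub>M lborel)"
    by (simp cong: measurable_cong_sets)
  have "(\<integral>\<^sup>+z. ennreal (norm (case z of (x, y) \<Rightarrow> f x y)) \<partial>(lborel \<Otimes>\<^sub>M lborel))
     = (NNINT x. NNINT y. ennreal (norm (f x y)))"
    by (subst lborel.nn_integral_fst[symmetric]) (auto simp: split_beta')
  with fin m show ?thesis
    by (simp add: integrable_iff_bounded)
qed

lemma integral_swap:
  fixes f :: "'a :: euclidean_space \<Rightarrow> 'b :: euclidean_space \<Rightarrow> 'c :: {banach, second_countable_topology}"
  assumes "(\<lambda>(x, y). f x y) \<in> borel_measurable (borel \<Otimes>\<^sub>M borel)"
    and "(NNINT x. NNINT y. ennreal (norm (f x y))) < \<infinity>"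
  shows "(LBINT x. LBINT y. f x y) = (LBINT y. LBINT x. f x y)"
  using lborel_pair.Fubini_integral[OF integrable_pairI[OF assms]] by simp

lemma nn_integral_swap:
  fixes f :: "'a :: euclidean_space \<Rightarrow> 'b :: euclidean_space \<Rightarrow> ennreal"
  assumes "(\<lambda>(x, y). f x y) \<in> borel_measurable (borel \<Otimes>\<^sub>M borel)"
  shows "(NNINT x. NNINT y. f x y) = (NNINT y. NNINT x. f x y)"
proof -
  have "(\<lambda>(x, y). f x y) \<in> borel_measurable (lborel \<Otimes>\<^sub>M lborel)"
    using assms by (simp cong: measurable_cong_sets)
  from lborel_pair.Fubini[OF this] show ?thesis by simp
qed

lemma integral_lborel_shift:
  fixes f :: "'a :: euclidean_space \<Rightarrow> 'c :: {banach, second_countable_topology}"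
  assumes [measurable]: "f \<in> borel_measurable borel"
  shows "(LBINT x. f (x + c)) = (LBINT x. f x)"
proof -
  have "(LBINT x. f x) = (\<integral>x. f x \<partial>distr lborel borel ((+) c))"
    by (simp add: lborel_distr_plus)
  also have "\<dots> = (LBINT x. f (x + c))"
    by (subst integral_distr) (auto simp: add.commute)
  finally show ?thesis by simp
qed

lemma lborel_distr_neg: "distr lborel borel uminus = (lborel :: 'a :: euclidean_space measure)"
proof -
  have "lborel = density (distr lborel borel (\<lambda>x::'a. 0 + (- 1) *\<^sub>R x)) (\<lambda>_. ennreal (\<bar>- 1\<bar> ^ DIM('a)))"
    by (rule lborel_affine) simp
  then show ?thesis by (simp add: density_1)
qed

lemma nn_integral_lborel_neg:
  fixes f :: "'a :: euclidean_space \<Rightarrow> ennreal"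
  assumes [measurable]: "f \<in> borel_measurable borel"
  shows "(NNINT x. f (- x)) = (NNINT x. f x)"
  using nn_integral_distr[of uminus lborel borel f] by (simp add: lborel_distr_neg)

lemma integral_lborel_neg:
  fixes f :: "'a :: euclidean_space \<Rightarrow> 'c :: {banach, second_countable_topology}"
  assumes [measurable]: "f \<in> borel_measurable borel"
  shows "(LBINT x. f (- x)) = (LBINT x. f x)"
  using integral_distr[of uminus lborel borel f] by (simp add: lborel_distr_neg)

lemma nn_integral_lborel_reflect:
  fixes f :: "'a :: euclidean_space \<Rightarrow> ennreal"
  assumes [measurable]: "f \<in> borel_measurable borel"
  shows "(NNINT x. f (c - x)) = (NNINT x. f x)"
  using nn_integral_lborel_neg[of "\<lambda>x. f (x + c)"] nn_integral_lborel_shift[of f c]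
  by (simp add: add.commute)

lemma integral_lborel_reflect:
  fixes f :: "'a :: euclidean_space \<Rightarrow> 'c :: {banach, second_countable_topology}"
  assumes [measurable]: "f \<in> borel_measurable borel"
  shows "(LBINT x. f (c - x)) = (LBINT x. f x)"
  using integral_lborel_neg[of "\<lambda>x. f (x + c)"] integral_lborel_shift[of f c]
  by (simp add: add.commute)

text \<open>Lebesgue measure is the image of a product measure under the coordinate map, so the
  Gaussian integral in any dimension reduces to dimension one.\<close>

lemma integral_lborel_prod:
  fixes f :: "'a :: euclidean_space \<Rightarrow> real \<Rightarrow> complex"
  assumes int: "\<And>b. b \<in> Basis \<Longrightarrow> integrable lborel (f b)"
  shows integrable_lborel_prod: "integrable lborel (\<lambda>x. \<Prod>b\<in>Basis. f b (x \<bullet> b))"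
    and integral_lborel_prod_eq: "(LBINT x. (\<Prod>b\<in>Basis. f b (x \<bullet> b))) = (\<Prod>b\<in>Basis. LBINT x. f b x)"
proof -
  interpret product_sigma_finite "\<lambda>_ :: 'a. lborel :: real measure" ..
  have [measurable]: "f b \<in> borel_measurable borel" if "b \<in> Basis" for b
    using borel_measurable_integrable[OF int[OF that]] by simp
  have T [measurable]: "(\<lambda>g. \<Sum>b\<in>Basis. g b *\<^sub>R b) \<in> measurable (\<Pi>\<^sub>M b\<in>Basis. lborel) (borel :: 'a measure)"
    by measurable
  have eq: "(\<Prod>b\<in>Basis. f b ((\<Sum>b\<in>Basis. g b *\<^sub>R b) \<bullet> b)) = (\<Prod>b\<in>Basis. f b (g b))" for g :: "'a \<Rightarrow> real"
    by (intro prod.cong refl) (simp add: inner_sum_left inner_Basis if_distrib cong: if_cong)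
  have m [measurable]: "(\<lambda>x. \<Prod>b\<in>Basis. f b (x \<bullet> b)) \<in> borel_measurable borel"
    by measurable
  show "integrable lborel (\<lambda>x. \<Prod>b\<in>Basis. f b (x \<bullet> b))"
    by (subst lborel_eq, subst integrable_distr_eq[OF T m], unfold eq, rule product_integrable_prod) (auto intro: int)
  show "(LBINT x. (\<Prod>b\<in>Basis. f b (x \<bullet> b))) = (\<Prod>b\<in>Basis. LBINT x. f b x)"
    by (subst lborel_eq, subst integral_distr[OF T m], unfold eq, rule product_integral_prod) (auto intro: int)
qed

text \<open>The inverse transform as an absolutely convergent integral. Forward transforms are
  written as values at a negated point, so that only one sign has to be developed.\<close>

definition ift :: "('a :: euclidean_space \<Rightarrow> complex) \<Rightarrow> 'a \<Rightarrow> complex" where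
  "ift G x = (LBINT \<xi>. G \<xi> * cis (2 * pi * (x \<bullet> \<xi>)))"

lemma borel_measurable_cis [measurable (raw)]:
  "f \<in> borel_measurable M \<Longrightarrow> (\<lambda>x. cis (f x)) \<in> borel_measurable M"
  using borel_measurable_continuous_onI[of cis] measurable_compose[of f M borel cis borel]
  by (simp add: continuous_on_cis continuous_on_id)

lemma borel_measurable_cnj [measurable (raw)]:
  "f \<in> borel_measurable M \<Longrightarrow> (\<lambda>x. cnj (f x)) \<in> borel_measurable M"
  using borel_measurable_continuous_onI[of cnj] measurable_compose[of f M borel cnj borel]
  by (simp add: continuous_on_cnj continuous_on_id)

lemma norm_ift_le: "ennreal (norm (ift G x)) \<le> (NNINT \<xi>. ennreal (norm (G \<xi>)))"
  unfolding ift_def using norm_integral_le_nn_integral[of lborel "\<lambda>\<xi>. G \<xi> * cis (2 * pi * (x \<bullet> \<xi>))"]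
  by (simp add: norm_mult)

lemma integrable_mult_cis:
  fixes G :: "'a :: euclidean_space \<Rightarrow> complex"
  assumes "integrable lborel G"
  shows "integrable lborel (\<lambda>\<xi>. G \<xi> * cis (2 * pi * (x \<bullet> \<xi>)))"
proof (rule Bochner_Integration.integrable_bound[OF assms])
  have [measurable]: "G \<in> borel_measurable borel"
    using borel_measurable_integrable[OF assms] by simp
  show "(\<lambda>\<xi>. G \<xi> * cis (2 * pi * (x \<bullet> \<xi>))) \<in> borel_measurable lborel"
    by measurable
qed (simp add: norm_mult)

lemma continuous_ift:
  fixes G :: "'a :: euclidean_space \<Rightarrow> complex"
  assumes G: "integrable lborel G"
  shows "continuous_on UNIV (ift G)"
proof -
  have [measurable]: "G \<in> borel_measurable borel"
    using borel_measurable_integrable[OF assms] by simp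
  have "(\<lambda>n. ift G (u n)) \<longlonglongrightarrow> ift G x" if u: "u \<longlonglongrightarrow> x" for u x
    unfolding ift_def
  proof (rule integral_dominated_convergence[where w = "\<lambda>\<xi>. norm (G \<xi>)"])
    show "AE \<xi> in lborel. (\<lambda>n. G \<xi> * cis (2 * pi * (u n \<bullet> \<xi>))) \<longlonglongrightarrow> G \<xi> * cis (2 * pi * (x \<bullet> \<xi>))"
      unfolding cis.ctr complex_eq_iff[symmetric]
      by (intro AE_I2 tendsto_intros tendsto_Complex u)
  qed (use G in \<open>auto simp: norm_mult\<close>)
  then show ?thesis
    by (auto simp: continuous_on_sequentially comp_def)
qed

lemma borel_measurable_ift:
  "integrable lborel G \<Longrightarrow> ift G \<in> borel_measurable borel"
  by (rule borel_measurable_continuous_onI[OF continuous_ift])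

text \<open>\<open>gk t\<close> is the Gaussian of mass one and width t, and \<open>gh t\<close> is
  its Fourier transform. As t decreases to 0 the first is an approximate identity and the second
  increases to 1.\<close>

definition gk :: "real \<Rightarrow> 'a :: euclidean_space \<Rightarrow> real" where
  "gk t x = exp (- (pi * (norm x)\<^sup>2 / t\<^sup>2)) / t ^ DIM('a)"

definition gh :: "real \<Rightarrow> 'a :: euclidean_space \<Rightarrow> real" where
  "gh t x = exp (- (pi * t\<^sup>2 * (norm x)\<^sup>2))"

lemma borel_measurable_gk [measurable]: "gk t \<in> borel_measurable borel"
  unfolding gk_def[abs_def] by measurable

lemma borel_measurable_gh [measurable]: "gh t \<in> borel_measurable borel"
  unfolding gh_def[abs_def] by measurable

lemma gk_nonneg [simp]: "0 < t \<Longrightarrow> 0 \<le> gk t x"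
  by (simp add: gk_def)

lemma gh_bounds [simp]: "0 \<le> gh t x" "gh t x \<le> 1"
  by (auto simp: gh_def)

lemma gk_uminus [simp]: "gk t (- x) = gk t x" and gh_uminus [simp]: "gh t (- x) = gh t x"
  by (simp_all add: gk_def gh_def)

lemma gh_eq_gk: "0 < t \<Longrightarrow> gh t (x :: 'a) = gk (1 / t) x / t ^ DIM('a :: euclidean_space)"
  by (simp add: gk_def gh_def power_divide field_simps)

text \<open>Read off from the characteristic function of the standard normal distribution by the
  substitution x = sqrt (2 \<pi>) y.\<close>

lemma gauss_real:
  fixes s :: real
  shows "integrable lborel (\<lambda>x. complex_of_real (exp (- (pi * x\<^sup>2))) * cis (2 * pi * (x * s)))"
    and "(LBINT x. complex_of_real (exp (- (pi * x\<^sup>2))) * cis (2 * pi * (x * s))) = complex_of_real (exp (- (pi * s\<^sup>2)))"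
proof -
  define c where "c = sqrt (2 * pi)"
  have c: "c > 0" "c\<^sup>2 = 2 * pi" by (auto simp: c_def)
  define F where "F x = complex_of_real (std_normal_density x) * cis (c * s * x)" for x
  have intN: "integrable lborel std_normal_density"
    by simp
  have intF: "integrable lborel F"
    unfolding F_def by (rule Bochner_Integration.integrable_bound[OF intN]) (auto simp: norm_mult)
  have "complex_of_real (exp (- ((c * s)\<^sup>2) / 2)) = char std_normal_distribution (c * s)"
    by (simp add: char_std_normal_distribution)
  also have "\<dots> = (LBINT x. std_normal_density x *\<^sub>R cis (c * s * x))"
    unfolding char_def
    by (subst integral_density) (auto simp: cis_conv_exp mult_ac)
  also have "\<dots> = (LBINT x. F x)"
    by (simp add: F_def scaleR_conv_of_real)
  also have "\<dots> = c *\<^sub>R (LBINT x. F (0 + c * x))"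
    using c by (subst lborel_integral_real_affine[of c _ 0]) auto
  also have "\<dots> = (LBINT x. c *\<^sub>R F (c * x))"
    by simp
  finally have 1: "(LBINT x. c *\<^sub>R F (c * x)) = complex_of_real (exp (- (pi * s\<^sup>2)))"
    using c by (simp add: power_mult_distrib)
  have 2: "c *\<^sub>R F (c * x) = complex_of_real (exp (- (pi * x\<^sup>2))) * cis (2 * pi * (x * s))" for x
  proof -
    have 1: "c * std_normal_density (c * x) = exp (- (pi * x\<^sup>2))"
      using c by (simp add: std_normal_density_def power_mult_distrib c_def[symmetric])
    have "c * s * (c * x) = c\<^sup>2 * (x * s)"
      by (simp add: power2_eq_square mult_ac)
    also have "\<dots> = 2 * pi * (x * s)"
      using c by simp
    finally have 2: "c * s * (c * x) = 2 * pi * (x * s)" .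
    show ?thesis
      unfolding F_def 2 unfolding scaleR_conv_of_real mult.assoc[symmetric] of_real_mult[symmetric] 1 ..
  qed
  have "integrable lborel (\<lambda>x. c *\<^sub>R F (0 + c * x))"
    by (intro integrable_scaleR_right lborel_integrable_real_affine intF) (use c in auto)
  then show "integrable lborel (\<lambda>x. complex_of_real (exp (- (pi * x\<^sup>2))) * cis (2 * pi * (x * s)))"
    by (simp add: 2)
  show "(LBINT x. complex_of_real (exp (- (pi * x\<^sup>2))) * cis (2 * pi * (x * s))) = complex_of_real (exp (- (pi * s\<^sup>2)))"
    using 1 by (simp add: 2)
qed

lemma gauss_real_scaled:
  fixes s t :: real
  assumes t: "0 < t"
  shows "integrable lborel (\<lambda>x. complex_of_real (exp (- (pi * x\<^sup>2 / t\<^sup>2)) / t) * cis (2 * pi * (x * s)))"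
    and "(LBINT x. complex_of_real (exp (- (pi * x\<^sup>2 / t\<^sup>2)) / t) * cis (2 * pi * (x * s)))
       = complex_of_real (exp (- (pi * t\<^sup>2 * s\<^sup>2)))"
proof -
  let ?f = "\<lambda>x. complex_of_real (exp (- (pi * x\<^sup>2))) * cis (2 * pi * (x * (t * s)))"
  have eq: "(1 / t) *\<^sub>R ?f (0 + (1 / t) * x) = complex_of_real (exp (- (pi * x\<^sup>2 / t\<^sup>2)) / t) * cis (2 * pi * (x * s))" for x
    using t by (simp add: power_divide scaleR_conv_of_real)
  have "integrable lborel (\<lambda>x. (1 / t) *\<^sub>R ?f (0 + (1 / t) * x))"
    by (intro integrable_scaleR_right lborel_integrable_real_affine gauss_real) (use t in auto)
  then show "integrable lborel (\<lambda>x. complex_of_real (exp (- (pi * x\<^sup>2 / t\<^sup>2)) / t) * cis (2 * pi * (x * s)))"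
    unfolding eq .
  have "complex_of_real (exp (- (pi * (t * s)\<^sup>2))) = (LBINT x. ?f x)"
    by (rule gauss_real(2)[symmetric])
  also have "\<dots> = \<bar>1 / t\<bar> *\<^sub>R (LBINT x. ?f (0 + (1 / t) * x))"
    by (rule lborel_integral_real_affine) (use t in auto)
  also have "\<dots> = (LBINT x. (1 / t) *\<^sub>R ?f (0 + (1 / t) * x))"
    using t by simp
  finally show "(LBINT x. complex_of_real (exp (- (pi * x\<^sup>2 / t\<^sup>2)) / t) * cis (2 * pi * (x * s)))
       = complex_of_real (exp (- (pi * t\<^sup>2 * s\<^sup>2)))"
    unfolding eq by (simp add: power_mult_distrib mult.assoc)
qed

lemma gauss_fourier:
  fixes \<xi> :: "'a :: euclidean_space"
  assumes t: "0 < t"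
  shows "integrable lborel (\<lambda>x. complex_of_real (gk t x) * cis (2 * pi * (x \<bullet> \<xi>)))"
    and "(LBINT x. complex_of_real (gk t x) * cis (2 * pi * (x \<bullet> \<xi>))) = complex_of_real (gh t \<xi>)"
proof -
  define f where "f b x = complex_of_real (exp (- (pi * x\<^sup>2 / t\<^sup>2)) / t) * cis (2 * pi * (x * (\<xi> \<bullet> b)))" for b and x :: real
  have cis_sum: "cis (\<Sum>b\<in>B. g b) = (\<Prod>b\<in>B. cis (g b))" for g :: "'a \<Rightarrow> real" and B
    by (induction B rule: infinite_finite_induct) (auto simp: cis_mult[symmetric])
  have nrm: "(norm y)\<^sup>2 = (\<Sum>b\<in>Basis. (y \<bullet> b)\<^sup>2)" for y :: 'a
    unfolding power2_norm_eq_inner by (subst euclidean_inner) (simp add: power2_eq_square)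
  have eq: "complex_of_real (gk t x) * cis (2 * pi * (x \<bullet> \<xi>)) = (\<Prod>b\<in>Basis. f b (x \<bullet> b))" for x
  proof -
    have "gk t x = (\<Prod>b\<in>Basis. exp (- (pi * (x \<bullet> b)\<^sup>2 / t\<^sup>2)) / t)"
      by (simp add: gk_def nrm prod_dividef exp_sum sum_distrib_left sum_divide_distrib flip: sum_negf)
    moreover have "cis (2 * pi * (x \<bullet> \<xi>)) = (\<Prod>b\<in>Basis. cis (2 * pi * ((x \<bullet> b) * (\<xi> \<bullet> b))))"
      unfolding cis_sum[symmetric] by (subst euclidean_inner) (simp add: sum_distrib_left)
    ultimately show ?thesis
      by (simp only: f_def prod.distrib of_real_prod)
  qed
  have int: "integrable lborel (f b)" for b
    unfolding f_def using gauss_real_scaled(1)[OF t] by blast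
  show "integrable lborel (\<lambda>x. complex_of_real (gk t x) * cis (2 * pi * (x \<bullet> \<xi>)))"
    unfolding eq by (rule integrable_lborel_prod) (rule int)
  have "(LBINT x. complex_of_real (gk t x) * cis (2 * pi * (x \<bullet> \<xi>))) = (\<Prod>b\<in>Basis. LBINT x. f b x)"
    unfolding eq by (rule integral_lborel_prod_eq) (rule int)
  also have "\<dots> = (\<Prod>b\<in>Basis. complex_of_real (exp (- (pi * t\<^sup>2 * (\<xi> \<bullet> b)\<^sup>2))))"
    unfolding f_def using gauss_real_scaled(2)[OF t] by simp
  also have "\<dots> = complex_of_real (gh t \<xi>)"
    by (simp add: gh_def nrm exp_sum sum_distrib_left flip: sum_negf)
  finally show "(LBINT x. complex_of_real (gk t x) * cis (2 * pi * (x \<bullet> \<xi>))) = complex_of_real (gh t \<xi>)" .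
qed

lemma integrable_gk: "0 < t \<Longrightarrow> integrable lborel (gk t :: 'a :: euclidean_space \<Rightarrow> real)"
  using gauss_fourier(1)[of t "0 :: 'a"] by (simp add: complex_of_real_integrable_eq)

lemma nn_integral_gk:
  assumes "0 < t" shows "(\<integral>\<^sup>+x. ennreal (gk t x) \<partial>(lborel :: 'a :: euclidean_space measure)) = 1"
proof -
  have "complex_of_real (LBINT x. gk t (x :: 'a)) = 1"
    using gauss_fourier(2)[OF assms, of "0 :: 'a"] by (simp add: gh_def)
  then have "(LBINT x. gk t (x :: 'a)) = 1" by (simp only: of_real_eq_1_iff)
  then show ?thesis
    using integrable_gk[OF assms, where 'a = 'a] assms by (subst nn_integral_eq_integral) auto
qed

text \<open>\<open>gh t\<close> is a multiple of \<open>gk (1 / t)\<close>, so this is the previous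
  formula at width 1 / t.\<close>

lemma gauss_fourier_inverse:
  fixes x :: "'a :: euclidean_space"
  assumes t: "0 < t"
  shows "integrable lborel (\<lambda>\<xi>. complex_of_real (gh t \<xi>) * cis (2 * pi * (x \<bullet> \<xi>)))"
    and "(LBINT \<xi>. complex_of_real (gh t \<xi>) * cis (2 * pi * (x \<bullet> \<xi>))) = complex_of_real (gk t x)"
proof -
  have eq: "complex_of_real (gh t \<xi>) * cis (2 * pi * (x \<bullet> \<xi>))
     = (complex_of_real (gk (1 / t) \<xi>) * cis (2 * pi * (\<xi> \<bullet> x))) / of_real (t ^ DIM('a))" for \<xi>
    using t by (simp add: gh_eq_gk inner_commute)
  show "integrable lborel (\<lambda>\<xi>. complex_of_real (gh t \<xi>) * cis (2 * pi * (x \<bullet> \<xi>)))"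
    unfolding eq by (intro integrable_divide gauss_fourier) (use t in auto)
  have "(LBINT \<xi>. complex_of_real (gh t \<xi>) * cis (2 * pi * (x \<bullet> \<xi>)))
     = (LBINT \<xi>. complex_of_real (gk (1 / t) \<xi>) * cis (2 * pi * (\<xi> \<bullet> x))) / of_real (t ^ DIM('a))"
    unfolding eq by simp
  also have "\<dots> = complex_of_real (gh (1 / t) x) / of_real (t ^ DIM('a))"
    by (subst gauss_fourier(2)) (use t in auto)
  also have "\<dots> = complex_of_real (gk t x)"
    using t by (simp add: gk_def gh_def power_divide)
  finally show "(LBINT \<xi>. complex_of_real (gh t \<xi>) * cis (2 * pi * (x \<bullet> \<xi>))) = complex_of_real (gk t x)" .
qed

lemma integrable_gh: "0 < t \<Longrightarrow> integrable lborel (gh t :: 'a :: euclidean_space \<Rightarrow> real)"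
  using gauss_fourier_inverse(1)[of t "0 :: 'a"] by (simp add: complex_of_real_integrable_eq)


section \<open>The Hausdorff--Young inequality\<close>

lemma ennreal_mult_le_half_sum: "ennreal a * ennreal b \<le> ennreal (a\<^sup>2 / 2) + ennreal (b\<^sup>2 / 2)"
  if "0 \<le> a" "0 \<le> b"
proof -
  have "a * b \<le> a\<^sup>2 / 2 + b\<^sup>2 / 2"
    using sum_squares_bound[of a b] by simp
  then show ?thesis
    using that by (simp flip: ennreal_mult ennreal_plus add: ennreal_leI)
qed

text \<open>With the damping factor in place Fubini's theorem applies and turns the energy into the
  quadratic form of G with kernel \<open>gk t (\<xi> - \<eta>)\<close>. As this kernel has mass one
  in each variable, Schur's test bounds the form by the squared L_2 norm, which may be
  infinite.\<close>

lemma gaussian_energy: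
  fixes G :: "'a :: euclidean_space \<Rightarrow> complex"
  assumes G: "integrable lborel G" and t: "0 < t"
  shows "(NNINT x. ennreal ((norm (ift G x))\<^sup>2 * gh t x)) \<le> (NNINT \<xi>. ennreal ((norm (G \<xi>))\<^sup>2))"
proof -
  have [measurable]: "G \<in> borel_measurable borel"
    using borel_measurable_integrable[OF G] by simp
  note [measurable] = borel_measurable_ift[OF G]
  define I where "I = (NNINT \<xi>. ennreal (norm (G \<xi>)))"
  have I: "I < \<infinity>"
    using G by (simp add: I_def integrable_iff_bounded)
  have gI: "(\<integral>\<^sup>+x. ennreal (gh t x) \<partial>(lborel :: 'a measure)) < \<infinity>"
    using integrable_gh[OF t, where 'a = 'a] by (simp add: integrable_iff_bounded)
  have normI: "ennreal (norm (ift G x)) \<le> I" for x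
    unfolding I_def by (rule norm_ift_le)
  define J where "J = (LBINT x. ift G x * of_real (gh t x) * cnj (ift G x))"
  \<comment> \<open>Damping \<open>ift G\<close> by \<open>gh t\<close> amounts to averaging G with
    \<open>gk t\<close> on the frequency side.\<close>
  have inner: "(LBINT x. ift G x * of_real (gh t x) * cis (2 * pi * (x \<bullet> - \<eta>)))
      = (LBINT \<xi>. G \<xi> * of_real (gk t (\<xi> - \<eta>)))" for \<eta>
  proof -
    have "(LBINT x. ift G x * of_real (gh t x) * cis (2 * pi * (x \<bullet> - \<eta>)))
       = (LBINT x. LBINT \<xi>. G \<xi> * of_real (gh t x) * cis (2 * pi * (x \<bullet> (\<xi> - \<eta>))))"
    proof (rule Bochner_Integration.integral_cong)
      fix x
      have "ift G x * of_real (gh t x) * cis (2 * pi * (x \<bullet> - \<eta>))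
        = (LBINT \<xi>. (G \<xi> * cis (2 * pi * (x \<bullet> \<xi>))) * (of_real (gh t x) * cis (2 * pi * (x \<bullet> - \<eta>))))"
        unfolding ift_def integral_mult_left_zero by (simp only: mult.assoc)
      also have "\<dots> = (LBINT \<xi>. G \<xi> * of_real (gh t x) * cis (2 * pi * (x \<bullet> (\<xi> - \<eta>))))"
      proof (intro Bochner_Integration.integral_cong refl)
        fix \<xi>
        have "cis (2 * pi * (x \<bullet> (\<xi> - \<eta>))) = cis (2 * pi * (x \<bullet> \<xi>)) * cis (2 * pi * (x \<bullet> - \<eta>))"
          by (simp add: cis_mult inner_diff_right right_diff_distrib)
        then show "G \<xi> * cis (2 * pi * (x \<bullet> \<xi>)) * (of_real (gh t x) * cis (2 * pi * (x \<bullet> - \<eta>)))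
          = G \<xi> * of_real (gh t x) * cis (2 * pi * (x \<bullet> (\<xi> - \<eta>)))"
          by (simp only: mult_ac)
      qed
      finally show "ift G x * of_real (gh t x) * cis (2 * pi * (x \<bullet> - \<eta>))
        = (LBINT \<xi>. G \<xi> * of_real (gh t x) * cis (2 * pi * (x \<bullet> (\<xi> - \<eta>))))" .
    qed simp
    also have "\<dots> = (LBINT \<xi>. LBINT x. G \<xi> * of_real (gh t x) * cis (2 * pi * (x \<bullet> (\<xi> - \<eta>))))"
    proof (rule integral_swap)
      have "(NNINT x. NNINT \<xi>. ennreal (norm (G \<xi> * complex_of_real (gh t x) * cis (2 * pi * (x \<bullet> (\<xi> - \<eta>))))))
        = (\<integral>\<^sup>+x. I * ennreal (gh t x) \<partial>(lborel :: 'a measure))"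
        by (simp add: norm_mult ennreal_mult nn_integral_multc I_def)
      also have "\<dots> = I * (\<integral>\<^sup>+x. ennreal (gh t x) \<partial>(lborel :: 'a measure))"
        by (rule nn_integral_cmult) simp
      also have "\<dots> < \<infinity>"
        using I gI by (simp add: ennreal_mult_less_top)
      finally show "(NNINT x. NNINT \<xi>. ennreal (norm (G \<xi> * complex_of_real (gh t x) * cis (2 * pi * (x \<bullet> (\<xi> - \<eta>)))))) < \<infinity>" .
    qed measurable
    also have "\<dots> = (LBINT \<xi>. G \<xi> * (LBINT x. of_real (gh t x) * cis (2 * pi * ((\<xi> - \<eta>) \<bullet> x))))"
      by (simp add: mult.assoc inner_commute)
    also have "\<dots> = (LBINT \<xi>. G \<xi> * of_real (gk t (\<xi> - \<eta>)))"
      by (simp add: gauss_fourier_inverse(2)[OF t])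
    finally show ?thesis .
  qed
  have "J = (LBINT x. LBINT \<eta>. ift G x * of_real (gh t x) * (cnj (G \<eta>) * cis (2 * pi * (x \<bullet> - \<eta>))))"
    unfolding J_def
  proof (rule Bochner_Integration.integral_cong)
    fix x
    have "cnj (ift G x) = (LBINT \<eta>. cnj (G \<eta>) * cis (2 * pi * (x \<bullet> - \<eta>)))"
      unfolding ift_def by (simp only: Bochner_Integration.integral_cnj[symmetric]) (simp add: cis_cnj)
    then show "ift G x * of_real (gh t x) * cnj (ift G x)
      = (LBINT \<eta>. ift G x * of_real (gh t x) * (cnj (G \<eta>) * cis (2 * pi * (x \<bullet> - \<eta>))))"
      by simp
  qed simp
  also have "\<dots> = (LBINT \<eta>. LBINT x. ift G x * of_real (gh t x) * (cnj (G \<eta>) * cis (2 * pi * (x \<bullet> - \<eta>))))"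
  proof (rule integral_swap)
    have "(NNINT x. NNINT \<eta>. ennreal (norm (ift G x * complex_of_real (gh t x) * (cnj (G \<eta>) * cis (2 * pi * (x \<bullet> - \<eta>))))))
       = (NNINT x. ennreal (norm (ift G x)) * ennreal (gh t x) * I)"
      by (simp add: norm_mult ennreal_mult nn_integral_cmult I_def)
    also have "\<dots> \<le> (\<integral>\<^sup>+x. I * ennreal (gh t x) * I \<partial>(lborel :: 'a measure))"
      by (intro nn_integral_mono mult_right_mono normI) auto
    also have "\<dots> = I * (\<integral>\<^sup>+x. ennreal (gh t x) \<partial>(lborel :: 'a measure)) * I"
      by (simp add: nn_integral_cmult nn_integral_multc)
    also have "\<dots> < \<infinity>"
      using I gI by (simp add: ennreal_mult_less_top)
    finally show "(NNINT x. NNINT \<eta>. ennreal (norm (ift G x * complex_of_real (gh t x) * (cnj (G \<eta>) * cis (2 * pi * (x \<bullet> - \<eta>)))))) < \<infinity>" .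
  qed measurable
  also have "\<dots> = (LBINT \<eta>. cnj (G \<eta>) * (LBINT x. ift G x * of_real (gh t x) * cis (2 * pi * (x \<bullet> - \<eta>))))"
    by (intro Bochner_Integration.integral_cong refl)
       (simp only: integral_mult_right_zero[symmetric] mult_ac)
  also have "\<dots> = (LBINT \<eta>. cnj (G \<eta>) * (LBINT \<xi>. G \<xi> * of_real (gk t (\<xi> - \<eta>))))"
    by (simp only: inner)
  finally have J: "J = (LBINT \<eta>. cnj (G \<eta>) * (LBINT \<xi>. G \<xi> * of_real (gk t (\<xi> - \<eta>))))" .
  have "ennreal (norm J) \<le> (NNINT \<eta>. ennreal (norm (G \<eta>)) * (NNINT \<xi>. ennreal (norm (G \<xi>)) * ennreal (gk t (\<xi> - \<eta>))))"
  proof -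
    have "ennreal (norm J) \<le> (NNINT \<eta>. ennreal (norm (cnj (G \<eta>) * (LBINT \<xi>. G \<xi> * of_real (gk t (\<xi> - \<eta>))))))"
      unfolding J by (rule norm_integral_le_nn_integral)
    also have "\<dots> \<le> (NNINT \<eta>. ennreal (norm (G \<eta>)) * (NNINT \<xi>. ennreal (norm (G \<xi> * complex_of_real (gk t (\<xi> - \<eta>))))))"
      unfolding norm_mult[of "cnj _"] ennreal_mult[OF norm_ge_zero norm_ge_zero] complex_mod_cnj
      by (intro nn_integral_mono mult_left_mono norm_integral_le_nn_integral) auto
    finally show ?thesis
      using t by (simp add: norm_mult ennreal_mult)
  qed
  also have "\<dots> = (NNINT \<eta>. NNINT \<xi>. ennreal (norm (G \<eta>)) * ennreal (norm (G \<xi>)) * ennreal (gk t (\<xi> - \<eta>)))"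
    by (simp add: nn_integral_cmult[symmetric] mult.assoc)
  \<comment> \<open>Schur's test: a b \<le> (a^2 + b^2) / 2 splits the form into two halves, in each
    of which one variable is integrated out against mass one.\<close>
  also have "\<dots> \<le> (NNINT \<eta>. NNINT \<xi>. (ennreal ((norm (G \<eta>))\<^sup>2 / 2) * ennreal (gk t (\<xi> - \<eta>))
        + ennreal ((norm (G \<xi>))\<^sup>2 / 2) * ennreal (gk t (\<xi> - \<eta>))))"
    unfolding distrib_right[symmetric]
    by (intro nn_integral_mono mult_right_mono ennreal_mult_le_half_sum) auto
  also have "\<dots> = (NNINT \<eta>. NNINT \<xi>. ennreal ((norm (G \<eta>))\<^sup>2 / 2) * ennreal (gk t (\<xi> - \<eta>)))
     + (NNINT \<eta>. NNINT \<xi>. ennreal ((norm (G \<xi>))\<^sup>2 / 2) * ennreal (gk t (\<xi> - \<eta>)))"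
    by (subst nn_integral_add[symmetric], measurable) (intro nn_integral_cong nn_integral_add; measurable)
  also have "(NNINT \<eta>. NNINT \<xi>. ennreal ((norm (G \<xi>))\<^sup>2 / 2) * ennreal (gk t (\<xi> - \<eta>)))
     = (NNINT \<xi>. NNINT \<eta>. ennreal ((norm (G \<xi>))\<^sup>2 / 2) * ennreal (gk t (\<xi> - \<eta>)))"
    by (rule nn_integral_swap) measurable
  also have "\<dots> = (NNINT \<xi>. ennreal ((norm (G \<xi>))\<^sup>2 / 2))"
    by (simp add: nn_integral_cmult nn_integral_lborel_reflect[of "\<lambda>x. ennreal (gk t x)"] nn_integral_gk[OF t])
  also have "(NNINT \<eta>. NNINT \<xi>. ennreal ((norm (G \<eta>))\<^sup>2 / 2) * ennreal (gk t (\<xi> - \<eta>)))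
     = (NNINT \<xi>. ennreal ((norm (G \<xi>))\<^sup>2 / 2))"
    using nn_integral_lborel_shift[of "\<lambda>x. ennreal (gk t (x :: 'a))"]
    by (simp add: nn_integral_cmult nn_integral_gk[OF t] flip: add_uminus_conv_diff)
  also have "(NNINT \<xi>. ennreal ((norm (G \<xi>))\<^sup>2 / 2)) + (NNINT \<xi>. ennreal ((norm (G \<xi>))\<^sup>2 / 2))
     = (NNINT \<xi>. ennreal ((norm (G \<xi>))\<^sup>2))"
    by (subst nn_integral_add[symmetric]) (auto simp flip: ennreal_plus)
  finally have bound: "ennreal (norm J) \<le> (NNINT \<xi>. ennreal ((norm (G \<xi>))\<^sup>2))" .
  have eqJ: "J = complex_of_real (LBINT x. (norm (ift G x))\<^sup>2 * gh t x)"
    unfolding J_def integral_complex_of_real[symmetric]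
  proof (intro Bochner_Integration.integral_cong refl)
    fix x
    have "ift G x * cnj (ift G x) = complex_of_real ((norm (ift G x))\<^sup>2)"
      by (metis complex_norm_square)
    moreover have "ift G x * of_real (gh t x) * cnj (ift G x) = (ift G x * cnj (ift G x)) * of_real (gh t x)"
      by (simp only: mult_ac)
    ultimately show "ift G x * of_real (gh t x) * cnj (ift G x) = of_real ((norm (ift G x))\<^sup>2 * gh t x)"
      by (simp only: of_real_mult)
  qed
  have int: "integrable lborel (\<lambda>x. (norm (ift G x))\<^sup>2 * gh t x)"
  proof (rule Bochner_Integration.integrable_bound)
    show "integrable lborel (\<lambda>x::'a. (enn2real I)\<^sup>2 * gh t x)"
      by (intro integrable_mult_right integrable_gh t)
    have "norm (ift G x) \<le> enn2real I" for x
      using normI[of x] I by (cases I) auto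
    then show "AE x in lborel. norm ((norm (ift G x))\<^sup>2 * gh t x) \<le> norm ((enn2real I)\<^sup>2 * gh t x)"
      by (auto simp: abs_mult intro!: mult_right_mono power_mono)
  qed measurable
  have "(NNINT x. ennreal ((norm (ift G x))\<^sup>2 * gh t x)) = ennreal (LBINT x. (norm (ift G x))\<^sup>2 * gh t x)"
    using int by (intro nn_integral_eq_integral) auto
  also have "\<dots> \<le> ennreal (norm J)"
    unfolding eqJ by (intro ennreal_leI) (simp add: abs_ge_self)
  finally show ?thesis using bound by simp
qed

text \<open>The damping is removed by Fatou's lemma along t = 1 / (n + 1), since
  \<open>gh t x\<close> tends to 1 at each point.\<close>

lemma plancherel_le:
  fixes G :: "'a :: euclidean_space \<Rightarrow> complex"
  assumes G: "integrable lborel G"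
  shows "(NNINT x. ennreal ((norm (ift G x))\<^sup>2)) \<le> (NNINT \<xi>. ennreal ((norm (G \<xi>))\<^sup>2))"
proof -
  note [measurable] = borel_measurable_ift[OF G]
  define t where "t n = 1 / real (Suc n)" for n
  have t: "t n > 0" for n by (simp add: t_def)
  have "(\<lambda>n. ennreal ((norm (ift G x))\<^sup>2 * gh (t n) x)) \<longlonglongrightarrow> ennreal ((norm (ift G x))\<^sup>2 * exp (- (pi * 0\<^sup>2 * (norm x)\<^sup>2)))" for x
    unfolding gh_def t_def by (intro tendsto_intros LIMSEQ_Suc[OF lim_1_over_n])
  then have "liminf (\<lambda>n. ennreal ((norm (ift G x))\<^sup>2 * gh (t n) x)) = ennreal ((norm (ift G x))\<^sup>2)" for x
    using lim_imp_Liminf[OF sequentially_bot] by fastforce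
  then have "(NNINT x. ennreal ((norm (ift G x))\<^sup>2))
     = (NNINT x. liminf (\<lambda>n. ennreal ((norm (ift G x))\<^sup>2 * gh (t n) x)))"
    by simp
  also have "\<dots> \<le> liminf (\<lambda>n. NNINT x. ennreal ((norm (ift G x))\<^sup>2 * gh (t n) x))"
    by (rule nn_integral_liminf) measurable
  also have "\<dots> \<le> liminf (\<lambda>n. NNINT \<xi>. ennreal ((norm (G \<xi>))\<^sup>2))"
    by (intro Liminf_mono always_eventually allI gaussian_energy[OF G t])
  finally show ?thesis by (simp add: Liminf_const)
qed


section \<open>Distribution functions and interpolation between exponents\<close>

lemma nn_integral_powr_interval:
  assumes "0 < a" "0 \<le> c"
  shows "(NNINT s. ennreal (s powr (a - 1)) * indicator {0<..c} s) = ennreal (c powr a / a)"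
proof -
  have "((\<lambda>x. x powr (a - 1)) has_integral c powr a / a) {0..c}"
    using has_integral_powr_from_0[of "a - 1" c] assms by simp
  from nn_integral_has_integral_lebesgue'[OF _ this]
  have "(NNINT s. ennreal (s powr (a - 1)) * indicator {0..c} s) = ennreal (c powr a / a)"
    by simp
  also have "(NNINT s. ennreal (s powr (a - 1)) * indicator {0..c} s)
     = (NNINT s. ennreal (s powr (a - 1)) * indicator {0<..c} s)"
    by (intro nn_integral_cong) (auto split: split_indicator)
  finally show ?thesis by simp
qed

text \<open>Write the p-th power of g x as the integral of p s^(p-1) over 0 < s \<le> g x and
  exchange the two integrations.\<close>

lemma layer_cake:
  fixes g :: "'a :: euclidean_space \<Rightarrow> real"
  assumes [measurable]: "g \<in> borel_measurable borel" and g: "\<And>x. 0 \<le> g x" and p: "0 < p"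
  shows "(NNINT x. ennreal (g x powr p))
    = (NNINT s. ennreal (p * s powr (p - 1)) * indicator {0<..} s * emeasure lborel {x. s \<le> g x})"
proof -
  have "(NNINT x. ennreal (g x powr p))
      = (NNINT x. NNINT s. ennreal (p * s powr (p - 1)) * indicator {0<..g x} s)"
  proof (rule nn_integral_cong)
    fix x
    have "(NNINT s. ennreal (p * s powr (p - 1)) * indicator {0<..g x} s)
      = ennreal p * (NNINT s. ennreal (s powr (p - 1)) * indicator {0<..g x} s)"
      using p by (subst nn_integral_cmult[symmetric]) (auto simp: ennreal_mult mult.assoc)
    also have "\<dots> = ennreal (g x powr p)"
      using p g by (simp add: nn_integral_powr_interval flip: ennreal_mult)
    finally show "ennreal (g x powr p) = (NNINT s. ennreal (p * s powr (p - 1)) * indicator {0<..g x} s)" ..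
  qed
  also have "\<dots> = (NNINT x. NNINT s. (ennreal (p * s powr (p - 1)) * indicator {0<..} s) * (if s \<le> g x then 1 else 0))"
    by (intro nn_integral_cong) (auto split: split_indicator)
  also have "\<dots> = (NNINT s. NNINT x. (ennreal (p * s powr (p - 1)) * indicator {0<..} s) * (if s \<le> g x then 1 else 0))"
    by (rule nn_integral_swap) measurable
  also have "\<dots> = (NNINT s. (ennreal (p * s powr (p - 1)) * indicator {0<..} s) * (NNINT x. indicator {x. s \<le> g x} x))"
    by (intro nn_integral_cong, subst nn_integral_cmult[symmetric]) (auto intro!: nn_integral_cong simp: indicator_def)
  also have "\<dots> = (NNINT s. ennreal (p * s powr (p - 1)) * indicator {0<..} s * emeasure lborel {x. s \<le> g x})"
    by (intro nn_integral_cong, subst nn_integral_indicator) auto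
  finally show ?thesis .
qed

text \<open>Marcinkiewicz interpolation between \<open>L\<^sub>1 \<rightarrow> L\<^sub>\<infinity>\<close> and \<open>L\<^sub>2 \<rightarrow> L\<^sub>2\<close>: the part of \<open>G\<close> above height
  \<open>(s / 2) powr (1 - p)\<close> contributes at most \<open>s / 2\<close> to the transform, and the rest is estimated in \<open>L\<^sub>2\<close>.\<close>

lemma hausdorff_young_normalized:
  fixes G :: "'a :: euclidean_space \<Rightarrow> complex"
  assumes p: "2 < p" and q: "q = p / (p - 1)" and G: "integrable lborel G"
    and norm1: "(NNINT \<xi>. ennreal (norm (G \<xi>) powr q)) \<le> 1"
  shows "(NNINT x. ennreal (norm (ift G x) powr p)) \<le> ennreal (4 * p * 2 powr (p - 2) / (p - 2))"
proof -
  have [measurable]: "G \<in> borel_measurable borel"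
    using borel_measurable_integrable[OF G] by simp
  note [measurable] = borel_measurable_ift[OF G]
  have q1: "1 < q" and pq: "(p - 1) * (q - 1) = 1"
    using p unfolding q by (auto simp: field_simps)
  \<comment> \<open>The exponent 1 - p is dictated by (p - 1)(q - 1) = 1: it gives T s powr (1 - q)
    = s / 2, the bound required for the part of G above the threshold.\<close>
  define T where "T s = (s / 2) powr (1 - p)" for s :: real
  have T [measurable]: "T \<in> borel_measurable borel"
    unfolding T_def[abs_def] by measurable
  define E where "E s = (NNINT \<xi>. ennreal ((norm (G \<xi>))\<^sup>2) * indicator {\<xi>. norm (G \<xi>) \<le> T s} \<xi>)" for s
  \<comment> \<open>Since |\<open>ift G1\<close>| never exceeds s / 2, the set where
    |\<open>ift G\<close>| \<ge> s lies in the set where |\<open>ift G2\<close>| \<ge> s / 2.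
    Markov's inequality for the square yields the factor 4 / s^2, and the L_2 bound passes to
    G2.\<close>
  have level: "emeasure lborel {x. s \<le> norm (ift G x)} \<le> ennreal (4 / s\<^sup>2) * E s" if s: "0 < s" for s
  proof -
    define G1 where "G1 \<xi> = (if norm (G \<xi>) \<le> T s then 0 else G \<xi>)" for \<xi>
    define G2 where "G2 \<xi> = (if norm (G \<xi>) \<le> T s then G \<xi> else 0)" for \<xi>
    have [measurable]: "G1 \<in> borel_measurable borel" "G2 \<in> borel_measurable borel"
      unfolding G1_def[abs_def] G2_def[abs_def] by measurable
    have G1: "integrable lborel G1"
      by (rule Bochner_Integration.integrable_bound[OF G]) (simp, simp add: G1_def)
    have G2: "integrable lborel G2"
      by (rule Bochner_Integration.integrable_bound[OF G]) (simp, simp add: G2_def)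
    note [measurable] = borel_measurable_ift[OF G1] borel_measurable_ift[OF G2]
    have T0: "T s > 0" using s by (simp add: T_def)
    have split: "ift G x = ift G1 x + ift G2 x" for x
      unfolding ift_def
        Bochner_Integration.integral_add[OF integrable_mult_cis[OF G1] integrable_mult_cis[OF G2], symmetric]
      by (intro Bochner_Integration.integral_cong refl) (simp add: G1_def G2_def)
    have small: "norm (ift G1 x) \<le> s / 2" for x
    proof -
      have "ennreal (norm (ift G1 x)) \<le> (NNINT \<xi>. ennreal (norm (G1 \<xi>)))"
        by (rule norm_ift_le)
      also have "\<dots> \<le> (NNINT \<xi>. ennreal (T s powr (1 - q)) * ennreal (norm (G \<xi>) powr q))"
      proof (rule nn_integral_mono)
        fix \<xi>
        show "ennreal (norm (G1 \<xi>)) \<le> ennreal (T s powr (1 - q)) * ennreal (norm (G \<xi>) powr q)"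
        proof (cases "norm (G \<xi>) \<le> T s")
          case False
          then have pos: "0 < norm (G \<xi>)" using T0 by linarith
          have "norm (G \<xi>) = norm (G \<xi>) powr (1 - q) * norm (G \<xi>) powr q"
            using pos by (simp flip: powr_add)
          also have "\<dots> \<le> T s powr (1 - q) * norm (G \<xi>) powr q"
            using False T0 q1 by (intro mult_right_mono powr_mono2') auto
          finally show ?thesis
            using False by (simp add: G1_def ennreal_leI flip: ennreal_mult)
        qed (simp add: G1_def)
      qed
      also have "\<dots> = ennreal (T s powr (1 - q)) * (NNINT \<xi>. ennreal (norm (G \<xi>) powr q))"
        by (rule nn_integral_cmult) measurable
      also have "\<dots> \<le> ennreal (T s powr (1 - q)) * 1"
        by (intro mult_left_mono norm1) auto
      also have "T s powr (1 - q) = s / 2"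
      proof -
        have "(1 - p) * (1 - q) = 1" using pq by (simp add: algebra_simps)
        then show ?thesis using s by (simp add: T_def powr_powr)
      qed
      finally show ?thesis using s by simp
    qed
    have sub: "{x. s \<le> norm (ift G x)} \<subseteq> {x \<in> UNIV. 1 \<le> ennreal (4 / s\<^sup>2) * ennreal ((norm (ift G2 x))\<^sup>2)}"
    proof clarify
      fix x assume "s \<le> norm (ift G x)"
      also have "\<dots> \<le> norm (ift G1 x) + norm (ift G2 x)"
        unfolding split by (rule norm_triangle_ineq)
      also have "\<dots> \<le> s / 2 + norm (ift G2 x)"
        using small by simp
      finally have "s / 2 \<le> norm (ift G2 x)" by simp
      then have "(s / 2)\<^sup>2 \<le> (norm (ift G2 x))\<^sup>2"
        using s by (intro power_mono) auto
      then have "1 \<le> 4 / s\<^sup>2 * (norm (ift G2 x))\<^sup>2"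
        using s by (simp add: power_divide field_simps)
      then show "x \<in> UNIV \<and> 1 \<le> ennreal (4 / s\<^sup>2) * ennreal ((norm (ift G2 x))\<^sup>2)"
        by (simp flip: ennreal_mult ennreal_1 add: ennreal_leI del: ennreal_1)
    qed
    have "emeasure lborel {x. s \<le> norm (ift G x)}
        \<le> emeasure lborel {x \<in> UNIV. 1 \<le> ennreal (4 / s\<^sup>2) * ennreal ((norm (ift G2 x))\<^sup>2)}"
      by (rule emeasure_mono[OF sub]) measurable
    also have "\<dots> \<le> ennreal (4 / s\<^sup>2) * (NNINT x. ennreal ((norm (ift G2 x))\<^sup>2) * indicator UNIV x)"
      by (rule nn_integral_Markov_inequality) auto
    also have "\<dots> \<le> ennreal (4 / s\<^sup>2) * (NNINT \<xi>. ennreal ((norm (G2 \<xi>))\<^sup>2))"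
      using plancherel_le[OF G2] by (intro mult_left_mono) auto
    also have "(NNINT \<xi>. ennreal ((norm (G2 \<xi>))\<^sup>2)) = E s"
      unfolding E_def by (intro nn_integral_cong) (auto simp: G2_def)
    finally show ?thesis .
  qed
  have "(NNINT x. ennreal (norm (ift G x) powr p))
     = (NNINT s. ennreal (p * s powr (p - 1)) * indicator {0<..} s * emeasure lborel {x. s \<le> norm (ift G x)})"
    using p by (intro layer_cake) auto
  also have "\<dots> \<le> (NNINT s. ennreal (4 * p * s powr (p - 3)) * indicator {0<..} s * E s)"
  proof (rule nn_integral_mono)
    fix s :: real
    show "ennreal (p * s powr (p - 1)) * indicator {0<..} s * emeasure lborel {x. s \<le> norm (ift G x)}
      \<le> ennreal (4 * p * s powr (p - 3)) * indicator {0<..} s * E s"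
    proof (cases "0 < s")
      case True
      have "s powr (p - 1) = s powr (p - 3) * s\<^sup>2"
        using True by (simp add: powr_diff powr_numeral power3_eq_cube power2_eq_square)
      then have "p * s powr (p - 1) * (4 / s\<^sup>2) = 4 * p * s powr (p - 3)"
        using True by simp
      then have "ennreal (p * s powr (p - 1)) * (ennreal (4 / s\<^sup>2) * E s) = ennreal (4 * p * s powr (p - 3)) * E s"
        using p by (simp add: mult.assoc[symmetric] ennreal_mult[symmetric])
      with mult_left_mono[OF level[OF True], of "ennreal (p * s powr (p - 1))"] True
      show ?thesis by simp
    qed simp
  qed
  also have "\<dots> = (NNINT s. NNINT \<xi>. ennreal (4 * p * s powr (p - 3)) * indicator {0<..} s *
      (ennreal ((norm (G \<xi>))\<^sup>2) * (if norm (G \<xi>) \<le> T s then 1 else 0)))"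
    unfolding E_def
    by (intro nn_integral_cong, subst nn_integral_cmult[symmetric]) (auto intro!: nn_integral_cong simp: indicator_def)
  also have "\<dots> = (NNINT \<xi>. NNINT s. ennreal (4 * p * s powr (p - 3)) * indicator {0<..} s *
      (ennreal ((norm (G \<xi>))\<^sup>2) * (if norm (G \<xi>) \<le> T s then 1 else 0)))"
    by (rule nn_integral_swap) measurable
  also have "\<dots> \<le> (NNINT \<xi>. ennreal (4 * p * 2 powr (p - 2) / (p - 2)) * ennreal (norm (G \<xi>) powr q))"
  proof (rule nn_integral_mono)
    fix \<xi>
    show "(NNINT s. ennreal (4 * p * s powr (p - 3)) * indicator {0<..} s *
        (ennreal ((norm (G \<xi>))\<^sup>2) * (if norm (G \<xi>) \<le> T s then 1 else 0)))
      \<le> ennreal (4 * p * 2 powr (p - 2) / (p - 2)) * ennreal (norm (G \<xi>) powr q)"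
    proof (cases "G \<xi> = 0")
      case False
      define g where "g = norm (G \<xi>)"
      have g: "g > 0" using False by (simp add: g_def)
      define c where "c = 2 * g powr (1 - q)"
      have c: "c > 0" using g by (simp add: c_def)
      \<comment> \<open>The threshold is inverted: g \<le> T s can hold only for s \<le> c = 2 g
        powr (1 - q). So the s-integral runs over a bounded interval, and p > 2 makes s powr (p - 3)
        integrable at 0.\<close>
      have le: "s \<le> c" if "0 < s" "g \<le> T s" for s
      proof -
        have "T s powr (1 - q) \<le> g powr (1 - q)"
          using that g q1 by (intro powr_mono2') auto
        moreover have "(1 - p) * (1 - q) = 1" using pq by (simp add: algebra_simps)
        then have "T s powr (1 - q) = s / 2"
          using that by (simp add: T_def powr_powr)
        ultimately show ?thesis by (simp add: c_def)
      qed
      have "(NNINT s. ennreal (4 * p * s powr (p - 3)) * indicator {0<..} s *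
          (ennreal (g\<^sup>2) * (if g \<le> T s then 1 else 0)))
        \<le> (NNINT s. ennreal (4 * p * g\<^sup>2) * (ennreal (s powr ((p - 2) - 1)) * indicator {0<..c} s))"
        by (intro nn_integral_mono)
           (use le p in \<open>auto split: split_indicator simp: ennreal_mult[symmetric] mult_ac\<close>)
      also have "\<dots> = ennreal (4 * p * g\<^sup>2) * (NNINT s. ennreal (s powr ((p - 2) - 1)) * indicator {0<..c} s)"
        by (rule nn_integral_cmult) measurable
      also have "\<dots> = ennreal (4 * p * g\<^sup>2) * ennreal (c powr (p - 2) / (p - 2))"
        using p c by (subst nn_integral_powr_interval) auto
      also have "\<dots> = ennreal (4 * p * g\<^sup>2 * (c powr (p - 2) / (p - 2)))"
        using p by (intro ennreal_mult[symmetric]) auto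
      also have "4 * p * g\<^sup>2 * (c powr (p - 2) / (p - 2)) = 4 * p * 2 powr (p - 2) / (p - 2) * g powr q"
      proof -
        have "(p - 2) * (q - 1) = 2 - q"
          using pq by (simp add: algebra_simps)
        then have "2 + (1 - q) * (p - 2) = q"
          by (simp add: algebra_simps)
        then have "g\<^sup>2 * (g powr (1 - q)) powr (p - 2) = g powr q"
          using g by (simp add: powr_powr powr_numeral[symmetric] powr_add[symmetric] del: powr_numeral)
        then show ?thesis
          unfolding c_def by (simp add: powr_mult)
      qed
      finally show ?thesis
        using p by (simp add: g_def ennreal_mult[symmetric])
    qed simp
  qed
  also have "\<dots> = ennreal (4 * p * 2 powr (p - 2) / (p - 2)) * (NNINT \<xi>. ennreal (norm (G \<xi>) powr q))"
    by (rule nn_integral_cmult) measurable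
  also have "\<dots> \<le> ennreal (4 * p * 2 powr (p - 2) / (p - 2)) * 1"
    by (intro mult_left_mono norm1) auto
  finally show ?thesis by simp
qed

text \<open>Homogeneity reduces the bound to R = 1. The exponent p = 2 is taken from Plancherel's
  inequality, as the constant of the interpolation argument blows up like 1 / (p - 2).\<close>

lemma hausdorff_young:
  fixes p q :: real
  assumes p: "2 \<le> p" and q: "q = p / (p - 1)"
  obtains C where "0 < C" and "\<And>(G :: 'a :: euclidean_space \<Rightarrow> complex) R.
     integrable lborel G \<Longrightarrow> 0 < R \<Longrightarrow>
     (NNINT \<xi>. ennreal (norm (G \<xi>) powr q)) \<le> ennreal (R powr q) \<Longrightarrow>
     (NNINT x. ennreal (norm (ift G x) powr p)) \<le> ennreal (C * R powr p)"
proof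
  define C where "C = (if p = 2 then 1 else 4 * p * 2 powr (p - 2) / (p - 2))"
  show "0 < C" using p by (auto simp: C_def)
  fix G :: "'a \<Rightarrow> complex" and R :: real
  assume G: "integrable lborel G" and R: "0 < R"
    and GR: "(NNINT \<xi>. ennreal (norm (G \<xi>) powr q)) \<le> ennreal (R powr q)"
  have [measurable]: "G \<in> borel_measurable borel"
    using borel_measurable_integrable[OF G] by simp
  note [measurable] = borel_measurable_ift[OF G]
  show "(NNINT x. ennreal (norm (ift G x) powr p)) \<le> ennreal (C * R powr p)"
  proof (cases "p = 2")
    case True
    then have "q = 2" using q by simp
    with True plancherel_le[OF G] GR R show ?thesis
      by (simp add: C_def powr_numeral)
  next
    case False
    with p have p2: "2 < p" by simp
    define G' where "G' \<xi> = G \<xi> / of_real R" for \<xi>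
    have G': "integrable lborel G'"
      unfolding G'_def using G by simp
    have ift': "ift G' x = ift G x / of_real R" for x
      unfolding ift_def G'_def by simp
    have "(NNINT \<xi>. ennreal (norm (G' \<xi>) powr q))
       = (NNINT \<xi>. ennreal (1 / R powr q) * ennreal (norm (G \<xi>) powr q))"
      using R by (intro nn_integral_cong) (simp add: G'_def norm_divide powr_divide flip: ennreal_mult)
    also have "\<dots> = ennreal (1 / R powr q) * (NNINT \<xi>. ennreal (norm (G \<xi>) powr q))"
      by (rule nn_integral_cmult) measurable
    also have "\<dots> \<le> ennreal (1 / R powr q) * ennreal (R powr q)"
      by (intro mult_left_mono GR) auto
    also have "\<dots> = 1"
      using R by (simp flip: ennreal_mult)
    finally have "(NNINT x. ennreal (norm (ift G' x) powr p)) \<le> ennreal C"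
      using hausdorff_young_normalized[OF p2 q G'] False by (simp add: C_def)
    then have le: "ennreal (R powr p) * (NNINT x. ennreal (norm (ift G' x) powr p)) \<le> ennreal (R powr p) * ennreal C"
      by (intro mult_left_mono) auto
    have "(NNINT x. ennreal (norm (ift G x) powr p))
       = (NNINT x. ennreal (R powr p) * ennreal (norm (ift G' x) powr p))"
      using R by (intro nn_integral_cong) (simp add: ift' norm_divide powr_divide flip: ennreal_mult)
    also have "\<dots> = ennreal (R powr p) * (NNINT x. ennreal (norm (ift G' x) powr p))"
      by (rule nn_integral_cmult) (simp add: ift')
    also note le
    finally show ?thesis
      using p2 False by (simp add: C_def mult.commute flip: ennreal_mult)
  qed
qed

section \<open>Approximation by Gaussian mollification\<close>

lemma ennreal_tendsto_0I:
  fixes f :: "'b \<Rightarrow> ennreal"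
  assumes "\<And>e. 0 < e \<Longrightarrow> eventually (\<lambda>n. f n \<le> ennreal e) F"
  shows "(f \<longlongrightarrow> 0) F"
proof (rule order_tendstoI)
  fix a :: ennreal assume "0 < a"
  then obtain b :: ennreal where b: "0 < b" "b < a" using dense by blast
  then obtain e where e: "b = ennreal e" "0 < e"
    by (cases b) auto
  show "eventually (\<lambda>n. f n < a) F"
    using assms[OF e(2)] by eventually_elim (use b e in auto)
qed simp

lemma ennreal_tendsto_0D:
  fixes f :: "'b \<Rightarrow> ennreal"
  assumes "(f \<longlongrightarrow> 0) F" "0 < e"
  shows "eventually (\<lambda>n. f n \<le> ennreal e) F"
  using order_tendstoD(2)[OF assms(1), of "ennreal e"] assms(2) by (auto elim: eventually_mono)

lemma nn_integral_norm_add_le: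
  fixes f g :: "'a \<Rightarrow> 'c :: {banach, second_countable_topology}"
  assumes [measurable]: "f \<in> borel_measurable M" "g \<in> borel_measurable M"
  shows "(\<integral>\<^sup>+x. ennreal (norm (f x + g x)) \<partial>M) \<le> (\<integral>\<^sup>+x. ennreal (norm (f x)) \<partial>M) + (\<integral>\<^sup>+x. ennreal (norm (g x)) \<partial>M)"
proof -
  have "(\<integral>\<^sup>+x. ennreal (norm (f x + g x)) \<partial>M) \<le> (\<integral>\<^sup>+x. ennreal (norm (f x)) + ennreal (norm (g x)) \<partial>M)"
    by (intro nn_integral_mono) (simp add: norm_triangle_ineq ennreal_leI flip: ennreal_plus)
  also have "\<dots> = (\<integral>\<^sup>+x. ennreal (norm (f x)) \<partial>M) + (\<integral>\<^sup>+x. ennreal (norm (g x)) \<partial>M)"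
    by (rule nn_integral_add) measurable
  finally show ?thesis .
qed

text \<open>Outer regularity: take an open U containing A with little excess measure. A point of A
  shifted out of A either lands in U - A, which is small, or leaves U, which for each point happens
  only finitely often because U is open.\<close>

lemma translation_indicator:
  fixes A :: "'a :: euclidean_space set"
  assumes A [measurable]: "A \<in> sets borel" and fin: "emeasure lborel A < \<infinity>" and z: "z \<longlonglongrightarrow> 0"
  shows "(\<lambda>n. NNINT x. indicator A x * indicator (- A) (x - z n)) \<longlonglongrightarrow> 0"
proof (rule ennreal_tendsto_0I)
  fix e :: real assume e: "0 < e"
  have "A \<in> sets lebesgue" using A by simp
  from sets_lebesgue_outer_open[OF this, of "e / 2"] e
  obtain U where U: "open U" "A \<subseteq> U" "emeasure lebesgue (U - A) < ennreal (e / 2)"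
    by (metis half_gt_zero)
  have [measurable]: "U \<in> sets borel" using U(1) by simp
  have UA: "emeasure lborel (U - A) \<le> ennreal (e / 2)"
    using U(3) by simp
  have "(\<lambda>n. NNINT x. indicator A x * indicator (- U) (x - z n)) \<longlonglongrightarrow> (\<integral>\<^sup>+x. 0 \<partial>(lborel :: 'a measure))"
  proof (rule nn_integral_dominated_convergence[where w = "indicator A"])
    show "AE x in lborel. (\<lambda>n. indicator A x * indicator (- U) (x - z n) :: ennreal) \<longlonglongrightarrow> 0"
    proof (rule AE_I2)
      fix x
      show "(\<lambda>n. indicator A x * indicator (- U) (x - z n) :: ennreal) \<longlonglongrightarrow> 0"
      proof (cases "x \<in> A")
        case True
        have "(\<lambda>n. x - z n) \<longlonglongrightarrow> x - 0" by (intro tendsto_intros z)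
        then have "eventually (\<lambda>n. x - z n \<in> U) sequentially"
          using U True by (intro topological_tendstoD) auto
        then have "eventually (\<lambda>n. indicator A x * indicator (- U) (x - z n) = (0 :: ennreal)) sequentially"
          by eventually_elim auto
        then show ?thesis by (rule tendsto_eventually)
      qed simp
    qed
    show "(NNINT x. indicator A x) < \<infinity>" using fin by simp
  qed (auto intro!: AE_I2 simp: indicator_def)
  then have "eventually (\<lambda>n. (NNINT x. indicator A x * indicator (- U) (x - z n)) \<le> ennreal (e / 2)) sequentially"
    using e by (intro ennreal_tendsto_0D) auto
  then show "eventually (\<lambda>n. (NNINT x. indicator A x * indicator (- A) (x - z n)) \<le> ennreal e) sequentially"
  proof eventually_elim
    case (elim n)
    have "(NNINT x. indicator A x * indicator (- A) (x - z n))
       \<le> (NNINT x. indicator A x * indicator (- U) (x - z n) + indicator (U - A) (x + - z n))"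
      by (intro nn_integral_mono) (auto simp: indicator_def)
    also have "\<dots> = (NNINT x. indicator A x * indicator (- U) (x - z n)) + (NNINT x. indicator (U - A) (x + - z n))"
      by (rule nn_integral_add) measurable
    also have "(NNINT x. indicator (U - A) (x + - z n)) = emeasure lborel (U - A)"
      by (subst nn_integral_lborel_shift) auto
    also have "(NNINT x. indicator A x * indicator (- U) (x - z n)) + emeasure lborel (U - A) \<le> ennreal (e / 2) + ennreal (e / 2)"
      by (intro add_mono elim UA)
    finally show ?case using e by (simp flip: ennreal_plus)
  qed
qed

text \<open>Continuity of translation in L_1, by induction over integrable functions. For an
  indicator the integrand is a symmetric difference, hence the two shifts by z and - z.\<close>

lemma translation_L1:
  fixes Y :: "'a :: euclidean_space \<Rightarrow> complex"
  assumes Y: "integrable lborel Y" and z: "z \<longlonglongrightarrow> 0"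
  shows "(\<lambda>n. NNINT x. ennreal (norm (Y (x - z n) - Y x))) \<longlonglongrightarrow> 0"
  using Y
proof (induction rule: integrable_induct)
  case (base A c)
  then have [measurable]: "A \<in> sets borel" by simp
  have z': "(\<lambda>n. - z n) \<longlonglongrightarrow> 0" using tendsto_minus[OF z] by simp
  let ?N = "\<lambda>z n. (NNINT x. indicator A x * indicator (- A) (x - z n))"
  have "(\<lambda>n. ennreal (norm c) * (?N z n + ?N (\<lambda>n. - z n) n)) \<longlonglongrightarrow> ennreal (norm c) * (0 + 0)"
    by (intro tendsto_intros ennreal_tendsto_cmult translation_indicator z z') (use base in auto)
  moreover have "(NNINT x. ennreal (norm (indicator A (x - z n) *\<^sub>R c - indicator A x *\<^sub>R c)))
      = ennreal (norm c) * (?N z n + ?N (\<lambda>n. - z n) n)" for n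
  proof -
    have "(NNINT x. ennreal (norm (indicator A (x - z n) *\<^sub>R c - indicator A x *\<^sub>R c)))
      = (NNINT x. ennreal (norm c) * (indicator A x * indicator (- A) (x - z n) + indicator A (x + - z n) * indicator (- A) (x + - z n + z n)))"
      by (intro nn_integral_cong) (auto simp: indicator_def)
    also have "\<dots> = ennreal (norm c) * (?N z n + (NNINT x. indicator A (x + - z n) * indicator (- A) (x + - z n + z n)))"
      by (subst nn_integral_cmult, measurable, subst nn_integral_add) auto
    also have "(NNINT x. indicator A (x + - z n) * indicator (- A) (x + - z n + z n)) = ?N (\<lambda>n. - z n) n"
      by (subst nn_integral_lborel_shift[of "\<lambda>x. indicator A x * indicator (- A) (x + z n)"]) auto
    finally show ?thesis .
  qed
  ultimately show ?case by simp
next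
  case (add f g)
  have [measurable]: "f \<in> borel_measurable borel" "g \<in> borel_measurable borel"
    using borel_measurable_integrable[OF add(1)] borel_measurable_integrable[OF add(2)] by simp_all
  have lim: "(\<lambda>n. (NNINT x. ennreal (norm (f (x - z n) - f x))) + (NNINT x. ennreal (norm (g (x - z n) - g x)))) \<longlonglongrightarrow> 0 + 0"
    by (intro tendsto_add add)
  have le: "(NNINT x. ennreal (norm (f (x - z n) + g (x - z n) - (f x + g x))))
    \<le> (NNINT x. ennreal (norm (f (x - z n) - f x))) + (NNINT x. ennreal (norm (g (x - z n) - g x)))" for n
    using nn_integral_norm_add_le[of "\<lambda>x. f (x - z n) - f x" lborel "\<lambda>x. g (x - z n) - g x"]
    by (simp add: algebra_simps)
  show ?case
    by (rule tendsto_sandwich[OF _ _ tendsto_const[of 0]]) (use lim le in auto)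
next
  case (lim f s)
  have [measurable]: "f \<in> borel_measurable borel" "\<And>i. s i \<in> borel_measurable borel"
    using borel_measurable_integrable[OF lim(1)] borel_measurable_integrable[OF lim(4)] by simp_all
  have "(\<lambda>i. NNINT x. ennreal (norm (s i x - f x))) \<longlonglongrightarrow> (\<integral>\<^sup>+x. 0 \<partial>(lborel :: 'a measure))"
  proof (rule nn_integral_dominated_convergence[where w = "\<lambda>x. ennreal (3 * norm (f x))"])
    show "AE x in lborel. ennreal (norm (s i x - f x)) \<le> ennreal (3 * norm (f x))" for i
    proof (rule AE_I2)
      fix x
      have "norm (s i x - f x) \<le> norm (s i x) + norm (f x)" by (rule norm_triangle_ineq4)
      also have "\<dots> \<le> 3 * norm (f x)" using lim(3)[of x i] by simp
      finally show "ennreal (norm (s i x - f x)) \<le> ennreal (3 * norm (f x))" by (rule ennreal_leI)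
    qed
    show "(NNINT x. ennreal (3 * norm (f x))) < \<infinity>"
      using lim(4) by (simp add: ennreal_mult nn_integral_cmult integrable_iff_bounded ennreal_mult_less_top)
    show "AE x in lborel. (\<lambda>i. ennreal (norm (s i x - f x))) \<longlonglongrightarrow> 0"
    proof (rule AE_I2)
      fix x
      have "(\<lambda>i. norm (s i x - f x)) \<longlonglongrightarrow> norm (f x - f x)"
        by (intro tendsto_intros lim(2)) simp
      then show "(\<lambda>i. ennreal (norm (s i x - f x))) \<longlonglongrightarrow> 0"
        using tendsto_ennrealI by fastforce
    qed
  qed measurable
  then have sf: "(\<lambda>i. NNINT x. ennreal (norm (s i x - f x))) \<longlonglongrightarrow> 0" by simp
  show ?case
  proof (rule ennreal_tendsto_0I)
    fix e :: real assume e: "0 < e"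
    obtain i where i: "(NNINT x. ennreal (norm (s i x - f x))) \<le> ennreal (e / 3)"
      using ennreal_tendsto_0D[OF sf, of "e / 3"] e unfolding eventually_sequentially by auto
    have "eventually (\<lambda>n. (NNINT x. ennreal (norm (s i (x - z n) - s i x))) \<le> ennreal (e / 3)) sequentially"
      using e by (intro ennreal_tendsto_0D lim(5)) auto
    then show "eventually (\<lambda>n. (NNINT x. ennreal (norm (f (x - z n) - f x))) \<le> ennreal e) sequentially"
    proof eventually_elim
      case (elim n)
      have "(NNINT x. ennreal (norm (f (x - z n) - f x)))
        = (NNINT x. ennreal (norm ((f (x - z n) - s i (x - z n)) + ((s i (x - z n) - s i x) + (s i x - f x)))))"
        by simp
      also have "\<dots> \<le> (NNINT x. ennreal (norm (f (x - z n) - s i (x - z n))))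
         + ((NNINT x. ennreal (norm (s i (x - z n) - s i x))) + (NNINT x. ennreal (norm (s i x - f x))))"
        by (intro order_trans[OF nn_integral_norm_add_le] add_left_mono nn_integral_norm_add_le) measurable
      also have "(NNINT x. ennreal (norm (f (x - z n) - s i (x - z n)))) = (NNINT x. ennreal (norm (s i x - f x)))"
        using nn_integral_lborel_shift[of "\<lambda>x. ennreal (norm (s i x - f x))" "- z n"]
        by (simp add: norm_minus_commute)
      also have "(NNINT x. ennreal (norm (s i x - f x))) +
          ((NNINT x. ennreal (norm (s i (x - z n) - s i x))) + (NNINT x. ennreal (norm (s i x - f x))))
        \<le> ennreal (e / 3) + (ennreal (e / 3) + ennreal (e / 3))"
        by (intro add_mono i elim)
      also have "\<dots> = ennreal e"
        using e by (simp flip: ennreal_plus)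
      finally show ?case .
    qed
  qed
qed

text \<open>With b \<le> 2 m, the b-th power of 1 + |z| is at most that of order m of 2 (1 + |z|^2),
  and this is controlled by a single term of the exponential series at a (1 + |z|^2), where a =
  \<pi> / t^2.\<close>

lemma gauss_le_wt:
  assumes t: "0 < t"
  obtains C where "0 < C" "\<And>z :: 'a :: euclidean_space. gk t z \<le> C * wt b z"
proof -
  obtain m :: nat where m: "b \<le> real (2 * m)"
    by (metis real_arch_simple mult.commute mult_2_right of_nat_add le_add1 of_nat_le_iff order_trans)
  define a where "a = pi / t\<^sup>2"
  have a: "a > 0" using t by (simp add: a_def)
  define C where "C = 2 ^ m * fact m / a ^ m * exp a / t ^ DIM('a)"
  have C: "C > 0" using a t by (simp add: C_def)
  have "gk t z \<le> C * wt b z" for z :: 'a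
  proof -
    define r where "r = norm z"
    have r: "r \<ge> 0" by (simp add: r_def)
    have "(1 + r) powr b \<le> (1 + r) powr real (2 * m)"
      using r m by (intro powr_mono) auto
    also have "\<dots> = ((1 + r)\<^sup>2) ^ m"
      using r by (subst powr_realpow) (auto simp: power_mult)
    also have "\<dots> \<le> (2 * (1 + r\<^sup>2)) ^ m"
    proof (intro power_mono)
      show "(1 + r)\<^sup>2 \<le> 2 * (1 + r\<^sup>2)"
        using sum_squares_bound[of 1 r] by (simp add: power2_sum)
    qed simp
    also have "\<dots> = 2 ^ m * fact m / a ^ m * ((a * (1 + r\<^sup>2)) ^ m / fact m)"
      unfolding power_mult_distrib using a by simp
    also have "\<dots> \<le> 2 ^ m * fact m / a ^ m * exp (a * (1 + r\<^sup>2))"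
    proof (intro mult_left_mono)
      have "(\<Sum>n\<in>{m}. inverse (fact n) * (a * (1 + r\<^sup>2)) ^ n) \<le> (\<Sum>n. inverse (fact n) * (a * (1 + r\<^sup>2)) ^ n)"
        using a by (intro sum_le_suminf summable_exp) auto
      then show "(a * (1 + r\<^sup>2)) ^ m / fact m \<le> exp (a * (1 + r\<^sup>2))"
        by (simp add: exp_def divide_inverse mult.commute)
    qed (use a in auto)
    finally have "(1 + r) powr b \<le> 2 ^ m * fact m / a ^ m * exp (a * (1 + r\<^sup>2))" .
    also have "\<dots> = C * t ^ DIM('a) * exp (a * r\<^sup>2)"
      using t by (simp add: C_def distrib_left exp_add)
    finally have 1: "(1 + r) powr b \<le> C * t ^ DIM('a) * exp (a * r\<^sup>2)" .
    have "gk t z = exp (- (a * r\<^sup>2)) / t ^ DIM('a)"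
      by (simp add: gk_def a_def r_def)
    also have "\<dots> \<le> C * wt b z"
    proof -
      have "0 < (1 + r) powr b" using r by (simp add: add_nonneg_eq_0_iff)
      moreover have "x / y \<le> c * (1 / w)" if "w \<le> c * y * (1 / x)" "0 < w" "0 < x" "0 < y" for x y c w :: real
        using that by (simp add: field_simps)
      ultimately show ?thesis
        unfolding wt_def powr_minus_divide r_def[symmetric]
        using 1 t by (auto simp: exp_minus field_simps)
    qed
    finally show ?thesis .
  qed
  with C that show ?thesis by blast
qed

definition conv_gk :: "('a :: euclidean_space \<Rightarrow> complex) \<Rightarrow> real \<Rightarrow> 'a \<Rightarrow> complex" where
  "conv_gk F t x = (LBINT y. F y * complex_of_real (gk t (x - y)))"

lemma nn_integral_gk_scale:
  fixes f :: "'a :: euclidean_space \<Rightarrow> ennreal"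
  assumes t: "0 < t" and [measurable]: "f \<in> borel_measurable borel"
  shows "(NNINT z. ennreal (gk t z) * f z) = (NNINT y. ennreal (gk 1 y) * f (t *\<^sub>R y))"
proof -
  have "(NNINT z. ennreal (gk t z) * f z)
     = (\<integral>\<^sup>+z. ennreal (gk t z) * f z \<partial>density (distr lborel borel (\<lambda>x::'a. 0 + t *\<^sub>R x)) (\<lambda>_. ennreal (\<bar>t\<bar> ^ DIM('a))))"
    using lborel_affine[of t "0 :: 'a"] t by simp
  also have "\<dots> = (NNINT y. ennreal (t ^ DIM('a)) * (ennreal (gk t (t *\<^sub>R y)) * f (t *\<^sub>R y)))"
    using t by (subst nn_integral_density, measurable, subst nn_integral_distr) (auto intro!: nn_integral_cong)
  also have "\<dots> = (NNINT y. ennreal (gk 1 y) * f (t *\<^sub>R y))"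
    using t by (intro nn_integral_cong)
      (simp add: gk_def power_mult_distrib mult.assoc[symmetric] flip: ennreal_mult)
  finally show ?thesis .
qed

section \<open>Gaussian means of functions integrable against a polynomial weight\<close>

context
  fixes F :: "'a :: euclidean_space \<Rightarrow> complex" and b :: real
  assumes F [measurable]: "F \<in> borel_measurable borel" and b: "0 \<le> b"
    and fin: "(NNINT x. ennreal (norm (F x) * wt b x)) < \<infinity>"
begin

lemma nn_integral_wt_shift_le:
  "(NNINT x. ennreal (norm (F (x - z)) * wt b x))
    \<le> ennreal ((1 + norm z) powr b) * (NNINT x. ennreal (norm (F x) * wt b x))"
proof -
  have "(NNINT x. ennreal (norm (F (x - z)) * wt b x)) = (NNINT x. ennreal (norm (F x) * wt b (x + z)))"
    using nn_integral_lborel_shift[of "\<lambda>x. ennreal (norm (F x) * wt b (x + z))" "- z"] by simp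
  also have "\<dots> \<le> (NNINT x. ennreal ((1 + norm z) powr b) * ennreal (norm (F x) * wt b x))"
  proof (rule nn_integral_mono)
    fix x
    have "norm (F x) * wt b (x + z) \<le> norm (F x) * (wt b x * (1 + norm z) powr b)"
      by (intro mult_left_mono wt_add_le b) auto
    then show "ennreal (norm (F x) * wt b (x + z)) \<le> ennreal ((1 + norm z) powr b) * ennreal (norm (F x) * wt b x)"
      by (simp add: ennreal_mult[symmetric] ennreal_leI mult_ac)
  qed
  also have "\<dots> = ennreal ((1 + norm z) powr b) * (NNINT x. ennreal (norm (F x) * wt b x))"
    by (rule nn_integral_cmult) measurable
  finally show ?thesis .
qed

lemma integrable_conv_gk:
  assumes t: "0 < t"
  shows "integrable lborel (\<lambda>y. F y * complex_of_real (gk t (x - y)))"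
proof -
  obtain C where C: "0 < C" "\<And>z :: 'a. gk t z \<le> C * wt b z"
    using gauss_le_wt[OF t] by blast
  have "ennreal (norm (F y * complex_of_real (gk t (x - y))))
      \<le> ennreal (C * (1 + norm x) powr b) * ennreal (norm (F y) * wt b y)" for y
  proof -
    have "gk t (x - y) \<le> C * wt b (y - x)"
      using C(2)[of "x - y"] wt_uminus[of b "x - y"] by simp
    also have "\<dots> \<le> C * (wt b y * (1 + norm x) powr b)"
      using wt_add_le[OF b, of y "- x"] C(1) by (intro mult_left_mono) auto
    finally have "norm (F y) * gk t (x - y) \<le> norm (F y) * (C * (wt b y * (1 + norm x) powr b))"
      by (intro mult_left_mono) auto
    then show ?thesis
      using t C(1) by (simp add: norm_mult ennreal_mult[symmetric] ennreal_leI mult_ac)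
  qed
  then have "(NNINT y. ennreal (norm (F y * complex_of_real (gk t (x - y)))))
    \<le> (NNINT y. ennreal (C * (1 + norm x) powr b) * ennreal (norm (F y) * wt b y))"
    by (intro nn_integral_mono)
  also have "\<dots> = ennreal (C * (1 + norm x) powr b) * (NNINT y. ennreal (norm (F y) * wt b y))"
    by (rule nn_integral_cmult) measurable
  also have "\<dots> < \<infinity>"
    using fin by (simp add: ennreal_mult_less_top)
  finally show ?thesis
    by (simp add: integrable_iff_bounded)
qed

text \<open>Reduced to L_1 continuity for Y = F times the weight. What remains is the variation of
  the weight itself, the term \<open>?Q\<close>; once |z n| < 1, Peetre's inequality dominates it by
  a multiple of the weight.\<close>

lemma translation_weighted:
  assumes z: "z \<longlonglongrightarrow> 0"
  shows "(\<lambda>n. NNINT x. ennreal (norm (F (x - z n) - F x) * wt b x)) \<longlonglongrightarrow> 0"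
proof -
  define Y where "Y x = F x * complex_of_real (wt b x)" for x
  have [measurable]: "Y \<in> borel_measurable borel"
    unfolding Y_def[abs_def] by measurable
  have Y: "integrable lborel Y"
    using fin by (simp add: integrable_iff_bounded Y_def norm_mult)
  let ?P = "\<lambda>n. (NNINT x. ennreal (norm (Y (x - z n) - Y x)))"
  let ?Q = "\<lambda>n. (NNINT x. ennreal (norm (F x) * \<bar>wt b x - wt b (x + z n)\<bar>))"
  have Q: "?Q \<longlonglongrightarrow> (\<integral>\<^sup>+x. 0 \<partial>(lborel :: 'a measure))"
  proof -
    obtain n0 where n0: "norm (z n) < 1" if "n \<ge> n0" for n
      using z[THEN tendstoD, of 1] by (auto simp: eventually_sequentially dist_norm)
    have "(\<lambda>n. ?Q (n + n0)) \<longlonglongrightarrow> (\<integral>\<^sup>+x. 0 \<partial>(lborel :: 'a measure))"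
    proof (rule nn_integral_dominated_convergence[where w = "\<lambda>x. ennreal (1 + 2 powr b) * ennreal (norm (F x) * wt b x)"])
      show "AE x in lborel. ennreal (norm (F x) * \<bar>wt b x - wt b (x + z (n + n0))\<bar>) \<le> ennreal (1 + 2 powr b) * ennreal (norm (F x) * wt b x)" for n
      proof (rule AE_I2)
        fix x
        have "wt b (x + z (n + n0)) \<le> wt b x * (1 + norm (z (n + n0))) powr b"
          by (rule wt_add_le[OF b])
        also have "\<dots> \<le> wt b x * 2 powr b"
          using n0[of "n + n0"] b by (intro mult_left_mono powr_mono2) auto
        finally have le: "wt b (x + z (n + n0)) \<le> wt b x * 2 powr b" .
        have "(1 + 2 powr b) * wt b x = wt b x + wt b x * 2 powr b" "0 \<le> wt b x * 2 powr b"
          by (simp_all add: algebra_simps)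
        then have "\<bar>wt b x - wt b (x + z (n + n0))\<bar> \<le> (1 + 2 powr b) * wt b x"
          using le wt_nonneg[of b x] wt_nonneg[of b "x + z (n + n0)"] by linarith
        then have "norm (F x) * \<bar>wt b x - wt b (x + z (n + n0))\<bar> \<le> norm (F x) * ((1 + 2 powr b) * wt b x)"
          by (intro mult_left_mono) auto
        then show "ennreal (norm (F x) * \<bar>wt b x - wt b (x + z (n + n0))\<bar>) \<le> ennreal (1 + 2 powr b) * ennreal (norm (F x) * wt b x)"
          by (subst ennreal_mult[symmetric]) (auto intro!: ennreal_leI simp: mult_ac)
      qed
      show "(NNINT x. ennreal (1 + 2 powr b) * ennreal (norm (F x) * wt b x)) < \<infinity>"
        using fin by (subst nn_integral_cmult) (auto simp: ennreal_mult_less_top)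
      show "AE x in lborel. (\<lambda>n. ennreal (norm (F x) * \<bar>wt b x - wt b (x + z (n + n0))\<bar>)) \<longlonglongrightarrow> 0"
      proof (rule AE_I2)
        fix x :: 'a
        have "isCont (wt b) (x + 0)"
          using continuous_on_wt[OF continuous_on_id, of "UNIV :: 'a set" b] by (simp add: continuous_on_eq_continuous_at)
        moreover have "(\<lambda>n. x + z (n + n0)) \<longlonglongrightarrow> x + 0"
          by (intro tendsto_intros LIMSEQ_ignore_initial_segment z)
        ultimately have "(\<lambda>n. wt b (x + z (n + n0))) \<longlonglongrightarrow> wt b (x + 0)"
          by (rule isCont_tendsto_compose)
        then have "(\<lambda>n. norm (F x) * \<bar>wt b x - wt b (x + z (n + n0))\<bar>) \<longlonglongrightarrow> norm (F x) * \<bar>wt b x - wt b (x + 0)\<bar>"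
          by (intro tendsto_intros)
        then show "(\<lambda>n. ennreal (norm (F x) * \<bar>wt b x - wt b (x + z (n + n0))\<bar>)) \<longlonglongrightarrow> 0"
          using tendsto_ennrealI by fastforce
      qed
    qed measurable
    then show ?thesis by (rule LIMSEQ_offset)
  qed
  have "(\<lambda>n. ?P n + ?Q n) \<longlonglongrightarrow> 0 + 0"
    using Q by (intro tendsto_add translation_L1 Y z) auto
  then have PQ0: "(\<lambda>n. ?P n + ?Q n) \<longlonglongrightarrow> 0" by simp
  have le: "(NNINT x. ennreal (norm (F (x - z n) - F x) * wt b x)) \<le> ?P n + ?Q n" for n
  proof -
    have "(NNINT x. ennreal (norm (F (x - z n) - F x) * wt b x))
       \<le> (NNINT x. ennreal (norm (Y (x - z n) - Y x)) + ennreal (norm (F (x - z n)) * \<bar>wt b (x - z n) - wt b x\<bar>))"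
    proof (rule nn_integral_mono)
      fix x
      have "norm (F (x - z n) - F x) * wt b x = norm ((F (x - z n) - F x) * complex_of_real (wt b x))"
        by (simp add: norm_mult)
      also have "(F (x - z n) - F x) * complex_of_real (wt b x)
          = (Y (x - z n) - Y x) + F (x - z n) * complex_of_real (wt b x - wt b (x - z n))"
        by (simp add: Y_def algebra_simps)
      also have "norm \<dots> \<le> norm (Y (x - z n) - Y x) + norm (F (x - z n)) * \<bar>wt b (x - z n) - wt b x\<bar>"
        by (intro order_trans[OF norm_triangle_ineq] add_left_mono) (simp only: norm_mult norm_of_real abs_minus_commute)
      finally show "ennreal (norm (F (x - z n) - F x) * wt b x)
        \<le> ennreal (norm (Y (x - z n) - Y x)) + ennreal (norm (F (x - z n)) * \<bar>wt b (x - z n) - wt b x\<bar>)"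
        by (simp flip: ennreal_plus add: ennreal_leI)
    qed
    also have "\<dots> = ?P n + (NNINT x. ennreal (norm (F (x - z n)) * \<bar>wt b (x - z n) - wt b x\<bar>))"
      by (rule nn_integral_add) measurable
    also have "(NNINT x. ennreal (norm (F (x - z n)) * \<bar>wt b (x - z n) - wt b x\<bar>)) = ?Q n"
      using nn_integral_lborel_shift[of "\<lambda>x. ennreal (norm (F x) * \<bar>wt b x - wt b (x + z n)\<bar>)" "- z n"] by simp
    finally show ?thesis .
  qed
  show ?thesis
    by (rule tendsto_sandwich[OF always_eventually always_eventually tendsto_const PQ0])
       (rule allI, rule zero_le, rule allI, rule le)
qed

lemma conv_gk_eq: "0 < t \<Longrightarrow> conv_gk F t x - F x = (LBINT z. (F (x - z) - F x) * complex_of_real (gk t z))"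
proof -
  assume t: "0 < t"
  have int: "integrable lborel (\<lambda>z. F (x - z) * complex_of_real (gk t z))"
  proof -
    have "(NNINT z. ennreal (norm (F (x - z) * complex_of_real (gk t z))))
      = (NNINT z. ennreal (norm (F z * complex_of_real (gk t (x - z)))))"
      using nn_integral_lborel_reflect[of "\<lambda>z. ennreal (norm (F z * complex_of_real (gk t (x - z))))" x] by simp
    then show ?thesis
      using integrable_conv_gk[OF t, of x] by (simp add: integrable_iff_bounded)
  qed
  have intg: "integrable lborel (\<lambda>z :: 'a. F x * complex_of_real (gk t z))"
    by (intro integrable_mult_right) (use integrable_gk[OF t, where 'a = 'a] in \<open>simp add: complex_of_real_integrable_eq\<close>)
  have "(LBINT z. complex_of_real (gk t (z :: 'a))) = 1"
    using gauss_fourier(2)[OF t, of "0 :: 'a"] by (simp add: gh_def)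
  then have "(LBINT z. F x * complex_of_real (gk t (z :: 'a))) = F x"
    by simp
  moreover have "conv_gk F t x = (LBINT z. F (x - z) * complex_of_real (gk t z))"
    unfolding conv_gk_def
    using integral_lborel_reflect[of "\<lambda>y. F y * complex_of_real (gk t (x - y))" x] by simp
  ultimately show "conv_gk F t x - F x = (LBINT z. (F (x - z) - F x) * complex_of_real (gk t z))"
    using Bochner_Integration.integral_diff[OF int intg] by (simp only: left_diff_distrib)
qed

lemma borel_measurable_conv_gk [measurable]: "conv_gk F t \<in> borel_measurable borel"
  unfolding conv_gk_def by measurable

text \<open>Minkowski's inequality bounds the distance by the Gaussian mean of the weighted modulus
  of continuity \<omega>. After rescaling the Gaussian no longer depends on t, \<omega> grows at
  most polynomially, and dominated convergence applies.\<close>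

lemma conv_gk_tendsto_L1:
  "(\<lambda>n. NNINT x. ennreal (norm (conv_gk F (1 / real (Suc n)) x - F x) * wt b x)) \<longlonglongrightarrow> 0"
proof -
  define \<omega> where "\<omega> z = (NNINT x. ennreal (norm (F (x - z) - F x) * wt b x))" for z
  have [measurable]: "\<omega> \<in> borel_measurable borel"
    unfolding \<omega>_def[abs_def] by measurable
  define I where "I = (NNINT x. ennreal (norm (F x) * wt b x))"
  have \<omega>_le: "\<omega> z \<le> 2 * I * ennreal ((1 + norm z) powr b)" for z
  proof -
    have one: "1 \<le> ennreal ((1 + norm z) powr b)"
      using b by (simp add: ge_one_powr_ge_zero flip: ennreal_1 del: ennreal_1)
    have "\<omega> z \<le> (NNINT x. ennreal (norm (F (x - z)) * wt b x) + ennreal (norm (F x) * wt b x))"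
      unfolding \<omega>_def
    proof (rule nn_integral_mono)
      fix x
      have "norm (F (x - z) - F x) * wt b x \<le> (norm (F (x - z)) + norm (F x)) * wt b x"
        by (intro mult_right_mono norm_triangle_ineq4) auto
      then show "ennreal (norm (F (x - z) - F x) * wt b x)
          \<le> ennreal (norm (F (x - z)) * wt b x) + ennreal (norm (F x) * wt b x)"
        by (simp flip: ennreal_plus add: ennreal_leI distrib_right)
    qed
    also have "\<dots> = (NNINT x. ennreal (norm (F (x - z)) * wt b x)) + I"
      unfolding I_def by (rule nn_integral_add) measurable
    also have "\<dots> \<le> ennreal ((1 + norm z) powr b) * I + ennreal ((1 + norm z) powr b) * I"
      using nn_integral_wt_shift_le[of z] mult_right_mono[OF one, of I] unfolding I_def by (intro add_mono) auto
    also have "\<dots> = 2 * I * ennreal ((1 + norm z) powr b)"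
      unfolding mult_2 distrib_right by (simp only: mult.commute)
    finally show ?thesis .
  qed
  have le: "(NNINT x. ennreal (norm (conv_gk F t x - F x) * wt b x))
     \<le> (NNINT y. ennreal (gk 1 y) * \<omega> (t *\<^sub>R y))" if t: "0 < t" for t
  proof -
    have "(NNINT x. ennreal (norm (conv_gk F t x - F x) * wt b x))
      \<le> (NNINT x. NNINT z. ennreal (gk t z) * ennreal (norm (F (x - z) - F x) * wt b x))"
    proof (rule nn_integral_mono)
      fix x
      have "ennreal (norm (conv_gk F t x - F x) * wt b x)
        \<le> (NNINT z. ennreal (norm ((F (x - z) - F x) * complex_of_real (gk t z)))) * ennreal (wt b x)"
        unfolding conv_gk_eq[OF t] by (subst ennreal_mult) (auto intro!: mult_right_mono norm_integral_le_nn_integral)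
      also have "\<dots> = (NNINT z. ennreal (norm ((F (x - z) - F x) * complex_of_real (gk t z))) * ennreal (wt b x))"
        by (rule nn_integral_multc[symmetric]) measurable
      also have "\<dots> = (NNINT z. ennreal (gk t z) * ennreal (norm (F (x - z) - F x) * wt b x))"
        using t by (intro nn_integral_cong) (simp add: norm_mult ennreal_mult[symmetric] mult_ac)
      finally show "ennreal (norm (conv_gk F t x - F x) * wt b x)
        \<le> (NNINT z. ennreal (gk t z) * ennreal (norm (F (x - z) - F x) * wt b x))" .
    qed
    also have "\<dots> = (NNINT z. NNINT x. ennreal (gk t z) * ennreal (norm (F (x - z) - F x) * wt b x))"
      by (rule nn_integral_swap) measurable
    also have "\<dots> = (NNINT z. ennreal (gk t z) * \<omega> z)"
      unfolding \<omega>_def by (intro nn_integral_cong nn_integral_cmult) measurable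
    also have "\<dots> = (NNINT y. ennreal (gk 1 y) * \<omega> (t *\<^sub>R y))"
      by (rule nn_integral_gk_scale[OF t]) measurable
    finally show ?thesis .
  qed
  define t where "t n = 1 / real (Suc n)" for n
  have t: "t n > 0" "t n \<le> 1" for n by (auto simp: t_def)
  have lim: "(\<lambda>n. NNINT y. ennreal (gk 1 y) * \<omega> (t n *\<^sub>R y)) \<longlonglongrightarrow> (\<integral>\<^sup>+y. 0 \<partial>(lborel :: 'a measure))"
  proof (rule nn_integral_dominated_convergence[where w = "\<lambda>y. 2 * I * (ennreal (gk 1 y) * ennreal ((1 + norm y) powr b))"])
    show "AE y in lborel. ennreal (gk 1 y) * \<omega> (t n *\<^sub>R y) \<le> 2 * I * (ennreal (gk 1 y) * ennreal ((1 + norm y) powr b))" for n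
    proof (rule AE_I2)
      fix y :: 'a
      have "norm (t n *\<^sub>R y) \<le> norm y"
        using t[of n] by (simp add: mult_left_le_one_le)
      then have "(1 + norm (t n *\<^sub>R y)) powr b \<le> (1 + norm y) powr b"
        using b by (intro powr_mono2) auto
      then have "\<omega> (t n *\<^sub>R y) \<le> 2 * I * ennreal ((1 + norm y) powr b)"
        using \<omega>_le[of "t n *\<^sub>R y"] by (meson ennreal_leI mult_left_mono order_trans zero_le)
      then have "ennreal (gk 1 y) * \<omega> (t n *\<^sub>R y) \<le> ennreal (gk 1 y) * (2 * I * ennreal ((1 + norm y) powr b))"
        by (rule mult_left_mono) simp
      then show "ennreal (gk 1 y) * \<omega> (t n *\<^sub>R y) \<le> 2 * I * (ennreal (gk 1 y) * ennreal ((1 + norm y) powr b))"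
        by (simp only: mult_ac)
    qed
    show "(\<integral>\<^sup>+y. 2 * I * (ennreal (gk 1 y) * ennreal ((1 + norm y) powr b)) \<partial>(lborel :: 'a measure)) < \<infinity>"
    proof -
      obtain C where C: "0 < C" "\<And>z :: 'a. gk 1 z \<le> C * wt (b + real DIM('a) + 1) z"
        using gauss_le_wt[of 1] by auto
      have "(\<integral>\<^sup>+y. ennreal (gk 1 y) * ennreal ((1 + norm y) powr b) \<partial>(lborel :: 'a measure))
        \<le> (\<integral>\<^sup>+y. ennreal C * ennreal (wt (real DIM('a) + 1) y) \<partial>(lborel :: 'a measure))"
      proof (rule nn_integral_mono)
        fix y :: 'a
        have "gk 1 y * (1 + norm y) powr b \<le> C * wt (b + real DIM('a) + 1) y * (1 + norm y) powr b"
          by (intro mult_right_mono C) auto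
        also have "\<dots> = C * wt (real DIM('a) + 1) y"
          by (simp add: wt_def mult.assoc flip: powr_add)
        finally show "ennreal (gk 1 y) * ennreal ((1 + norm y) powr b) \<le> ennreal C * ennreal (wt (real DIM('a) + 1) y)"
          using C(1) by (simp flip: ennreal_mult add: ennreal_leI)
      qed
      also have "\<dots> = ennreal C * (\<integral>\<^sup>+y. ennreal (wt (real DIM('a) + 1) y) \<partial>(lborel :: 'a measure))"
        by (rule nn_integral_cmult) measurable
      also have "\<dots> < \<infinity>"
        using nn_integral_wt_finite[where 'a = 'a, of "real DIM('a) + 1"] by (simp add: ennreal_mult_less_top)
      finally have "(\<integral>\<^sup>+y. ennreal (gk 1 y) * ennreal ((1 + norm y) powr b) \<partial>(lborel :: 'a measure)) < \<infinity>" .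
      moreover have "2 * I < \<infinity>"
        using fin by (simp add: I_def ennreal_mult_less_top)
      ultimately show ?thesis
        by (subst nn_integral_cmult) (auto simp: ennreal_mult_less_top)
    qed
    show "AE y in lborel. (\<lambda>n. ennreal (gk 1 y) * \<omega> (t n *\<^sub>R y)) \<longlonglongrightarrow> 0"
    proof (rule AE_I2)
      fix y :: 'a
      have "(\<lambda>n. t n *\<^sub>R y) \<longlonglongrightarrow> 0 *\<^sub>R y"
        unfolding t_def by (intro tendsto_intros LIMSEQ_Suc[OF lim_1_over_n])
      then have "(\<lambda>n. \<omega> (t n *\<^sub>R y)) \<longlonglongrightarrow> 0"
        unfolding \<omega>_def by (intro translation_weighted) simp
      then have "(\<lambda>n. ennreal (gk 1 y) * \<omega> (t n *\<^sub>R y)) \<longlonglongrightarrow> ennreal (gk 1 y) * 0"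
        by (intro ennreal_tendsto_cmult) auto
      then show "(\<lambda>n. ennreal (gk 1 y) * \<omega> (t n *\<^sub>R y)) \<longlonglongrightarrow> 0" by simp
    qed
  qed measurable
  then have lim0: "(\<lambda>n. NNINT y. ennreal (gk 1 y) * \<omega> (t n *\<^sub>R y)) \<longlonglongrightarrow> 0" by simp
  show ?thesis
    unfolding t_def[symmetric]
    by (rule tendsto_sandwich[OF always_eventually always_eventually tendsto_const lim0])
       (rule allI, rule zero_le, rule allI, rule le[OF t(1)])
qed

lemma conv_gk_tendsto_AE:
  obtains t :: "nat \<Rightarrow> real" where "\<And>n. 0 < t n" "t \<longlonglongrightarrow> 0" "AE x in lborel. (\<lambda>n. conv_gk F (t n) x) \<longlonglongrightarrow> F x"
proof -
  define u where "u n x = (conv_gk F (1 / real (Suc n)) x - F x) * complex_of_real (wt b x)" for n x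
  have norm_u: "norm (u n x) = norm (conv_gk F (1 / real (Suc n)) x - F x) * wt b x" for n x
    by (simp add: u_def norm_mult)
  have [measurable]: "u n \<in> borel_measurable borel" for n
    unfolding u_def[abs_def] by measurable
  have lim: "(\<lambda>n. NNINT x. ennreal (norm (u n x))) \<longlonglongrightarrow> 0"
    using conv_gk_tendsto_L1 by (simp only: norm_u)
  \<comment> \<open>Dropping the first n0 terms makes every member of the sequence integrable, so
    that convergence can be stated for Bochner integrals and an almost everywhere convergent
    subsequence extracted.\<close>
  obtain n0 where n0: "(NNINT x. ennreal (norm (u n x))) < \<infinity>" if "n \<ge> n0" for n
    using order_tendstoD(2)[OF lim, of \<infinity>] by (auto simp: eventually_sequentially)
  have int: "integrable lborel (u (n + n0))" for n
    using n0[of "n + n0"] by (simp add: integrable_iff_bounded)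
  have eq: "(NNINT x. ennreal (norm (u (n + n0) x))) = ennreal (LBINT x. norm (u (n + n0) x))" for n
    using int by (intro nn_integral_eq_integral) auto
  have "(\<lambda>n. ennreal (LBINT x. norm (u (n + n0) x))) \<longlonglongrightarrow> ennreal 0"
    using LIMSEQ_ignore_initial_segment[OF lim, of n0] unfolding eq by simp
  then have "(\<lambda>n. LBINT x. norm (u (n + n0) x)) \<longlonglongrightarrow> 0"
    by (subst (asm) tendsto_ennreal_iff) auto
  from tendsto_L1_AE_subseq[OF int this]
  obtain r where r: "strict_mono r" "AE x in lborel. (\<lambda>n. u (r n + n0) x) \<longlonglongrightarrow> 0" by auto
  define t where "t n = 1 / real (Suc (r n + n0))" for n
  have "t \<longlonglongrightarrow> 0"
    using LIMSEQ_subseq_LIMSEQ[OF LIMSEQ_ignore_initial_segment[OF LIMSEQ_Suc[OF lim_1_over_n], of n0] r(1)]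
    unfolding t_def comp_def by simp
  moreover have "AE x in lborel. (\<lambda>n. conv_gk F (t n) x) \<longlonglongrightarrow> F x"
    using r(2)
  proof eventually_elim
    case (elim x)
    have "(\<lambda>n. u (r n + n0) x / complex_of_real (wt b x) + F x) \<longlonglongrightarrow> 0 / complex_of_real (wt b x) + F x"
      using wt_pos[of b x] by (intro tendsto_intros elim) auto
    moreover have "u (r n + n0) x / complex_of_real (wt b x) + F x = conv_gk F (t n) x" for n
      using wt_pos[of b x] by (simp add: u_def t_def)
    ultimately show ?case by simp
  qed
  ultimately show ?thesis
    using that[of t] by (auto simp: t_def)
qed

section \<open>Transforms known through Gaussian means\<close>

context
  fixes H :: "'a \<Rightarrow> complex"
  assumes H [measurable]: "H \<in> borel_measurable borel"
    and conv: "\<And>t x. 0 < t \<Longrightarrow> conv_gk F t x = ift (\<lambda>\<xi>. H \<xi> * complex_of_real (gh t \<xi>)) x"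
begin

text \<open>The Gaussian means have two limits: F almost everywhere, and \<open>ift H\<close> at
  every point, by dominated convergence as \<open>gh t\<close> tends to 1.\<close>

lemma fourier_inversion_AE:
  assumes int: "integrable lborel H"
  shows "AE x in lborel. F x = ift H x"
proof -
  obtain t :: "nat \<Rightarrow> real" where t: "\<And>n. 0 < t n" "t \<longlonglongrightarrow> 0"
    and lim: "AE x in lborel. (\<lambda>n. conv_gk F (t n) x) \<longlonglongrightarrow> F x"
    by (rule conv_gk_tendsto_AE) blast
  have "(\<lambda>n. conv_gk F (t n) x) \<longlonglongrightarrow> ift H x" for x
    unfolding conv[OF t(1)] ift_def
  proof (rule integral_dominated_convergence[where w = "\<lambda>\<xi>. norm (H \<xi>)"])
    show "AE \<xi> in lborel. (\<lambda>n. H \<xi> * complex_of_real (gh (t n) \<xi>) * cis (2 * pi * (x \<bullet> \<xi>))) \<longlonglongrightarrow> H \<xi> * cis (2 * pi * (x \<bullet> \<xi>))"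
    proof (rule AE_I2)
      fix \<xi> :: 'a
      have "(\<lambda>n. gh (t n) \<xi>) \<longlonglongrightarrow> gh 0 \<xi>"
        unfolding gh_def by (intro tendsto_intros t)
      then have "(\<lambda>n. H \<xi> * complex_of_real (gh (t n) \<xi>) * cis (2 * pi * (x \<bullet> \<xi>))) \<longlonglongrightarrow> H \<xi> * complex_of_real (gh 0 \<xi>) * cis (2 * pi * (x \<bullet> \<xi>))"
        by (intro tendsto_intros)
      then show "(\<lambda>n. H \<xi> * complex_of_real (gh (t n) \<xi>) * cis (2 * pi * (x \<bullet> \<xi>))) \<longlonglongrightarrow> H \<xi> * cis (2 * pi * (x \<bullet> \<xi>))"
        by (simp add: gh_def)
    qed
    show "AE \<xi> in lborel. norm (H \<xi> * complex_of_real (gh (t n) \<xi>) * cis (2 * pi * (x \<bullet> \<xi>))) \<le> norm (H \<xi>)" for n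
      by (intro AE_I2) (simp add: norm_mult mult_left_le)
  qed (use int in auto)
  with lim show ?thesis
    by (auto elim!: eventually_mono intro: LIMSEQ_unique)
qed

text \<open>Where |H| \<le> 1 the Gaussian dominates; elsewhere |H| is at most its own q-th
  power.\<close>

lemma integrable_mult_gh:
  assumes q: "1 \<le> q" and fin: "(NNINT \<xi>. ennreal (norm (H \<xi>) powr q)) < \<infinity>" and t: "0 < t"
  shows "integrable lborel (\<lambda>\<xi>. H \<xi> * complex_of_real (gh t \<xi>))"
proof -
  have "(NNINT \<xi>. ennreal (norm (H \<xi> * complex_of_real (gh t \<xi>))))
    \<le> (NNINT \<xi>. ennreal (norm (H \<xi>) powr q) + ennreal (gh t \<xi>))"
  proof (rule nn_integral_mono)
    fix \<xi>
    have "norm (H \<xi>) * gh t \<xi> \<le> norm (H \<xi>) powr q + gh t \<xi>"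
    proof (cases "norm (H \<xi>) \<le> 1")
      case True
      then have "norm (H \<xi>) * gh t \<xi> \<le> 1 * gh t \<xi>"
        by (intro mult_right_mono) auto
      then show ?thesis by (simp add: add_increasing)
    next
      case False
      then have "norm (H \<xi>) \<le> norm (H \<xi>) powr q"
        using q powr_mono[of 1 q "norm (H \<xi>)"] by simp
      moreover have "norm (H \<xi>) * gh t \<xi> \<le> norm (H \<xi>)"
        by (simp add: mult_left_le)
      ultimately show ?thesis
        using gh_bounds(1)[of t \<xi>] by linarith
    qed
    then show "ennreal (norm (H \<xi> * complex_of_real (gh t \<xi>))) \<le> ennreal (norm (H \<xi>) powr q) + ennreal (gh t \<xi>)"
      by (simp add: norm_mult ennreal_leI flip: ennreal_plus)
  qed
  also have "\<dots> = (NNINT \<xi>. ennreal (norm (H \<xi>) powr q)) + (\<integral>\<^sup>+\<xi>. ennreal (gh t \<xi>) \<partial>(lborel :: 'a measure))"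
    by (rule nn_integral_add) measurable
  also have "\<dots> < \<infinity>"
    using fin integrable_gh[OF t, where 'a = 'a] by (simp add: integrable_iff_bounded)
  finally show ?thesis
    by (simp add: integrable_iff_bounded)
qed

text \<open>The damped transforms are integrable and no larger than H, so Hausdorff--Young applies
  to each of them, and Fatou's lemma carries the bound to F. That inequality enters as a hypothesis
  so that its constant can be fixed before F and H are given.\<close>

lemma Lp_bound_of_conv_gk:
  fixes p q C R :: real
  assumes pq: "2 \<le> p" "q = p / (p - 1)" and R: "0 < R"
    and le: "(NNINT \<xi>. ennreal (norm (H \<xi>) powr q)) \<le> ennreal (R powr q)"
    and HY: "\<And>(G :: 'a \<Rightarrow> complex) R.
     integrable lborel G \<Longrightarrow> 0 < R \<Longrightarrow>
     (NNINT \<xi>. ennreal (norm (G \<xi>) powr q)) \<le> ennreal (R powr q) \<Longrightarrow>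
     (NNINT x. ennreal (norm (ift G x) powr p)) \<le> ennreal (C * R powr p)"
  shows "(NNINT x. ennreal (norm (F x) powr p)) \<le> ennreal (C * R powr p)"
proof -
  have q: "1 \<le> q" unfolding pq(2) using pq(1) by (simp add: le_divide_eq)
  obtain t :: "nat \<Rightarrow> real" where t: "\<And>n. 0 < t n" "t \<longlonglongrightarrow> 0"
    and lim: "AE x in lborel. (\<lambda>n. conv_gk F (t n) x) \<longlonglongrightarrow> F x"
    by (rule conv_gk_tendsto_AE) blast
  have bound: "(NNINT x. ennreal (norm (conv_gk F (t n) x) powr p)) \<le> ennreal (C * R powr p)" for n
    unfolding conv[OF t(1)]
  proof (rule HY[OF integrable_mult_gh[OF q _ t(1)] R])
    show "(NNINT \<xi>. ennreal (norm (H \<xi>) powr q)) < \<infinity>"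
      using le by (rule le_less_trans) simp
    have "(NNINT \<xi>. ennreal (norm (H \<xi> * complex_of_real (gh (t n) \<xi>)) powr q))
      \<le> (NNINT \<xi>. ennreal (norm (H \<xi>) powr q))"
      using q by (intro nn_integral_mono ennreal_leI powr_mono2) (auto simp: norm_mult mult_left_le)
    with le show "(NNINT \<xi>. ennreal (norm (H \<xi> * complex_of_real (gh (t n) \<xi>)) powr q)) \<le> ennreal (R powr q)"
      by (rule order_trans[rotated])
  qed
  have "(NNINT x. ennreal (norm (F x) powr p)) = (NNINT x. liminf (\<lambda>n. ennreal (norm (conv_gk F (t n) x) powr p)))"
    using lim
  proof (intro nn_integral_cong_AE, eventually_elim)
    case (elim x)
    have "(\<lambda>n. norm (conv_gk F (t n) x) powr p) \<longlonglongrightarrow> norm (F x) powr p"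
      by (rule tendsto_powr'[OF tendsto_norm[OF elim(2)] tendsto_const]) (use pq in auto)
    then have "(\<lambda>n. ennreal (norm (conv_gk F (t n) x) powr p)) \<longlonglongrightarrow> ennreal (norm (F x) powr p)"
      by (rule tendsto_ennrealI)
    then show ?case
      using lim_imp_Liminf[OF sequentially_bot] by fastforce
  qed
  also have "\<dots> \<le> liminf (\<lambda>n. NNINT x. ennreal (norm (conv_gk F (t n) x) powr p))"
    by (rule nn_integral_liminf) measurable
  also have "\<dots> \<le> liminf (\<lambda>n. ennreal (C * R powr p))"
    by (intro Liminf_mono always_eventually allI bound)
  finally show ?thesis by (simp add: Liminf_const)
qed

end

end

section \<open>Modulated Gaussians as test functions\<close>

text \<open>Polynomials in the coordinates. Derivatives of a modulated Gaussian stay of the form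
  polynomial times the same function, which is all that the Schwartz conditions ask for.\<close>

inductive cpoly :: "(real ^ 'd \<Rightarrow> complex) \<Rightarrow> bool" where
  cpoly_const: "cpoly (\<lambda>_. c)"
| cpoly_coord: "cpoly (\<lambda>x. complex_of_real (x $ i))"
| cpoly_add: "cpoly P \<Longrightarrow> cpoly Q \<Longrightarrow> cpoly (\<lambda>x. P x + Q x)"
| cpoly_mult: "cpoly P \<Longrightarrow> cpoly Q \<Longrightarrow> cpoly (\<lambda>x. P x * Q x)"

lemma cpoly_partial:
  fixes P :: "real ^ 'd \<Rightarrow> complex" and i :: 'd
  assumes "cpoly P"
  shows "\<exists>P'. cpoly P' \<and> (\<forall>x. ((\<lambda>s. P (x + s *\<^sub>R axis i 1)) has_vector_derivative P' x) (at 0))"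
  using assms
proof induction
  case (cpoly_const c)
  show ?case by (intro exI[of _ "\<lambda>_. 0"] conjI cpoly.cpoly_const) auto
next
  case (cpoly_coord j)
  have "((\<lambda>s. complex_of_real ((x + s *\<^sub>R axis i 1) $ j)) has_vector_derivative of_real (axis i 1 $ j)) (at 0)" for x :: "real ^ 'd"
  proof -
    have "((\<lambda>s. x $ j + s * axis i 1 $ j) has_real_derivative axis i 1 $ j) (at 0)"
      by (auto intro!: derivative_eq_intros)
    from has_vector_derivative_of_real[OF this, where 'a = complex]
    show ?thesis by (simp add: comp_def)
  qed
  then show ?case
    by (intro exI[of _ "\<lambda>_. of_real (axis i 1 $ j)"] conjI cpoly.cpoly_const) auto
next
  case (cpoly_add P Q)
  then obtain P' Q' where "cpoly P'" "cpoly Q'"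
    "\<And>x. ((\<lambda>s. P (x + s *\<^sub>R axis i 1)) has_vector_derivative P' x) (at 0)"
    "\<And>x. ((\<lambda>s. Q (x + s *\<^sub>R axis i 1)) has_vector_derivative Q' x) (at 0)" by blast
  then show ?case
    by (intro exI[of _ "\<lambda>x. P' x + Q' x"]) (auto intro: cpoly.cpoly_add has_vector_derivative_add)
next
  case (cpoly_mult P Q)
  then obtain P' Q' where *: "cpoly P'" "cpoly Q'"
    "\<And>x. ((\<lambda>s. P (x + s *\<^sub>R axis i 1)) has_vector_derivative P' x) (at 0)"
    "\<And>x. ((\<lambda>s. Q (x + s *\<^sub>R axis i 1)) has_vector_derivative Q' x) (at 0)" by blast
  have "((\<lambda>s. P (x + s *\<^sub>R axis i 1) * Q (x + s *\<^sub>R axis i 1)) has_vector_derivative P x * Q' x + P' x * Q x) (at 0)" for x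
    using has_vector_derivative_mult[OF *(3,4)[of x]] by simp
  moreover have "cpoly (\<lambda>x. P x * Q' x + P' x * Q x)"
    by (intro cpoly.cpoly_add cpoly.cpoly_mult * cpoly_mult)
  ultimately show ?case by blast
qed

lemma cpoly_bound:
  fixes P :: "real ^ 'd \<Rightarrow> complex"
  assumes "cpoly P"
  shows "\<exists>C m. 0 \<le> C \<and> (\<forall>x. norm (P x) \<le> C * (1 + norm x) ^ m)"
  using assms
proof induction
  case (cpoly_const c)
  show ?case by (intro exI[of _ "norm c"] exI[of _ 0]) auto
next
  case (cpoly_coord i)
  have "norm (complex_of_real (x $ i)) \<le> 1 * (1 + norm x) ^ 1" for x :: "real ^ 'd"
    using component_le_norm_cart[of x i] by simp
  then show ?case by (intro exI[of _ 1]) auto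
next
  case (cpoly_add P Q)
  then obtain C m D n where *: "0 \<le> C" "\<And>x. norm (P x) \<le> C * (1 + norm x) ^ m"
     "0 \<le> D" "\<And>x. norm (Q x) \<le> D * (1 + norm x) ^ n" by blast
  have "norm (P x + Q x) \<le> (C + D) * (1 + norm x) ^ max m n" for x
  proof -
    have "norm (P x + Q x) \<le> C * (1 + norm x) ^ m + D * (1 + norm x) ^ n"
      using norm_triangle_ineq[of "P x" "Q x"] *(2,4)[of x] by linarith
    also have "\<dots> \<le> C * (1 + norm x) ^ max m n + D * (1 + norm x) ^ max m n"
      using * by (intro add_mono mult_left_mono power_increasing) auto
    finally show ?thesis by (simp add: distrib_right)
  qed
  then show ?case using * by (intro exI[of _ "C + D"] exI[of _ "max m n"]) auto
next
  case (cpoly_mult P Q)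
  then obtain C m D n where *: "0 \<le> C" "\<And>x. norm (P x) \<le> C * (1 + norm x) ^ m"
     "0 \<le> D" "\<And>x. norm (Q x) \<le> D * (1 + norm x) ^ n" by blast
  have "norm (P x * Q x) \<le> (C * D) * (1 + norm x) ^ (m + n)" for x
  proof -
    have "norm (P x * Q x) \<le> (C * (1 + norm x) ^ m) * (D * (1 + norm x) ^ n)"
      unfolding norm_mult using * by (intro mult_mono) auto
    then show ?thesis by (simp add: power_add mult_ac)
  qed
  then show ?case using * by (intro exI[of _ "C * D"] exI[of _ "m + n"]) auto
qed

text \<open>Chosen because its Fourier transform is the Gaussian \<open>gk t\<close> centred at a:
  testing against it produces a Gaussian mean at a.\<close>

definition mod_gauss :: "real \<Rightarrow> real ^ 'd \<Rightarrow> real ^ 'd \<Rightarrow> complex" where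
  "mod_gauss t a \<xi> = complex_of_real (gh t \<xi>) * cis (2 * pi * (a \<bullet> \<xi>))"

lemma norm_mod_gauss [simp]: "norm (mod_gauss t a \<xi>) = gh t \<xi>"
  by (simp add: mod_gauss_def norm_mult)

text \<open>On a line parallel to an axis the exponent is the quadratic c0 + s c1 + s^2 c2, so the
  derivative at s = 0 is c1 times the value there.\<close>

lemma mod_gauss_partial:
  fixes a \<xi> :: "real ^ 'd"
  shows "((\<lambda>s. mod_gauss t a (\<xi> + s *\<^sub>R axis i 1)) has_vector_derivative
    (of_real (- 2 * pi * t\<^sup>2) * of_real (\<xi> $ i) + \<i> * of_real (2 * pi * a $ i)) * mod_gauss t a \<xi>) (at 0)"
proof -
  define c0 where "c0 = complex_of_real (- (pi * t\<^sup>2 * (norm \<xi>)\<^sup>2)) + \<i> * of_real (2 * pi * (a \<bullet> \<xi>))"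
  define c1 where "c1 = complex_of_real (- 2 * pi * t\<^sup>2) * of_real (\<xi> $ i) + \<i> * of_real (2 * pi * a $ i)"
  define c2 where "c2 = complex_of_real (- (pi * t\<^sup>2))"
  have eq: "mod_gauss t a (\<xi> + s *\<^sub>R axis i 1) = exp (c0 + of_real s * c1 + (of_real s)\<^sup>2 * c2)" for s
  proof -
    have "(norm (\<xi> + s *\<^sub>R axis i 1))\<^sup>2 = (norm \<xi>)\<^sup>2 + 2 * s * \<xi> $ i + s\<^sup>2"
      unfolding power2_norm_eq_inner
      by (simp add: inner_add_left inner_add_right inner_axis inner_axis' power2_eq_square algebra_simps)
    moreover have "a \<bullet> (\<xi> + s *\<^sub>R axis i 1) = a \<bullet> \<xi> + s * a $ i"
      by (simp add: inner_add_right inner_axis)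
    ultimately show ?thesis
      unfolding mod_gauss_def gh_def cis_conv_exp exp_of_real[symmetric] exp_add[symmetric] c0_def c1_def c2_def
      by (intro arg_cong[of _ _ exp]) (simp add: algebra_simps)
  qed
  have "((\<lambda>z. exp (c0 + z * c1 + z\<^sup>2 * c2)) has_field_derivative c1 * exp c0) (at (of_real 0))"
    by (auto intro!: derivative_eq_intros)
  moreover have "(complex_of_real has_vector_derivative 1) (at 0)"
    using has_vector_derivative_of_real[OF DERIV_ident, where 'a = complex] by simp
  ultimately
  have "((\<lambda>z. exp (c0 + z * c1 + z\<^sup>2 * c2)) \<circ> of_real has_vector_derivative 1 * (c1 * exp c0)) (at 0)"
    by (intro field_vector_diff_chain_at) auto
  moreover have "mod_gauss t a \<xi> = exp c0"
    using eq[of 0] by simp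
  ultimately show ?thesis
    unfolding eq c1_def[symmetric] by (simp add: comp_def)
qed

lemma mod_gauss_partial_derivs:
  fixes a :: "real ^ 'd"
  shows "\<exists>P. cpoly P \<and> partial_derivs is (mod_gauss t a) = (\<lambda>x. P x * mod_gauss t a x)"
proof (induction "is")
  case Nil
  show ?case by (intro exI[of _ "\<lambda>_. 1"]) (auto intro: cpoly_const)
next
  case (Cons i "is")
  then obtain P where P: "cpoly P" "partial_derivs is (mod_gauss t a) = (\<lambda>x. P x * mod_gauss t a x)" by blast
  obtain P' where P': "cpoly P'" "\<And>x. ((\<lambda>s. P (x + s *\<^sub>R axis i 1)) has_vector_derivative P' x) (at 0)"
    using cpoly_partial[OF P(1)] by blast
  define Q where "Q x = P' x + P x * (of_real (- 2 * pi * t\<^sup>2) * of_real (x $ i) + \<i> * of_real (2 * pi * a $ i))" for x :: "real ^ 'd"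
  have Q: "cpoly Q"
    unfolding Q_def[abs_def] by (intro cpoly_add cpoly_mult P P' cpoly_const cpoly_coord)
  have "partial_deriv i (\<lambda>x. P x * mod_gauss t a x) x = Q x * mod_gauss t a x" for x
    unfolding partial_deriv_def
    using has_vector_derivative_mult[OF P'(2)[of x] mod_gauss_partial[of t a x i]]
    by (intro vector_derivative_at) (simp add: Q_def algebra_simps)
  then show ?case
    using Q P(2) by (intro exI[of _ Q]) auto
qed

lemma mod_gauss_schwartz:
  fixes a :: "real ^ 'd"
  assumes t: "0 < t"
  shows "mod_gauss t a \<in> schwartz_space"
  unfolding schwartz_space_def mem_Collect_eq
proof (intro allI conjI)
  fix "is" :: "'d list" and i :: 'd and x :: "real ^ 'd"
  obtain P where P: "cpoly P" "partial_derivs is (mod_gauss t a) = (\<lambda>x. P x * mod_gauss t a x)"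
    using mod_gauss_partial_derivs by blast
  obtain P' where P': "cpoly P'" "\<And>x. ((\<lambda>s. P (x + s *\<^sub>R axis i 1)) has_vector_derivative P' x) (at 0)"
    using cpoly_partial[OF P(1)] by blast
  show "has_partial i (partial_derivs is (mod_gauss t a)) x"
    unfolding has_partial_def P(2)
    using has_vector_derivative_mult[OF P'(2)[of x] mod_gauss_partial[of t a x i]]
    by (rule differentiableI_vector)
next
  fix "is" :: "'d list" and r :: nat
  obtain P where P: "cpoly P" "partial_derivs is (mod_gauss t a) = (\<lambda>x. P x * mod_gauss t a x)"
    using mod_gauss_partial_derivs by blast
  obtain C m where C: "0 \<le> C" "\<And>x. norm (P x) \<le> C * (1 + norm x) ^ m"
    using cpoly_bound[OF P(1)] by blast
  obtain D where D: "0 < D" "\<And>z :: real ^ 'd. gk (1 / t) z \<le> D * wt (real (r + m)) z"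
    using gauss_le_wt[of "1 / t"] t by (metis divide_pos_pos zero_less_one)
  have "norm (norm x ^ r *\<^sub>R partial_derivs is (mod_gauss t a) x) \<le> C * D / t ^ CARD('d)" for x
  proof -
    have "norm (norm x ^ r *\<^sub>R partial_derivs is (mod_gauss t a) x) = norm x ^ r * norm (P x) * gh t x"
      by (simp add: P(2) norm_mult)
    also have "\<dots> \<le> (1 + norm x) ^ r * (C * (1 + norm x) ^ m) * (D * wt (real (r + m)) x / t ^ CARD('d))"
    proof (intro mult_mono C power_mono)
      show "gh t x \<le> D * wt (real (r + m)) x / t ^ CARD('d)"
        using t D(2)[of x] by (simp add: gh_eq_gk divide_right_mono)
    qed (use C in auto)
    also have "\<dots> = C * D / t ^ CARD('d) * ((1 + norm x) ^ (r + m) * wt (real (r + m)) x)"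
      by (simp add: power_add)
    also have "(1 + norm x) ^ (r + m) * wt (real (r + m)) x = 1"
    proof -
      have "(1 + norm x) ^ (r + m) = (1 + norm x) powr real (r + m)"
        by (rule powr_realpow[symmetric]) (simp add: add_pos_nonneg)
      then show ?thesis
        by (simp add: wt_def add_nonneg_eq_0_iff flip: powr_add)
    qed
    finally show ?thesis by simp
  qed
  then show "bounded (range (\<lambda>x. norm x ^ r *\<^sub>R partial_derivs is (mod_gauss t a) x))"
    unfolding bounded_iff by blast
qed

lemma cis_eq_exp_fourier: "exp (- (2 * of_real pi * \<i> * of_real r)) = cis (- (2 * pi * r))"
  by (simp add: cis_conv_exp mult_ac)

lemma fourier_eq_ift:
  fixes f :: "real ^ 'd \<Rightarrow> complex"
  assumes [measurable]: "f \<in> borel_measurable borel"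
  shows "fourier f \<xi> = ift f (- \<xi>)"
proof -
  have "fourier f \<xi> = (LINT x|lebesgue. f x * cis (2 * pi * (- \<xi> \<bullet> x)))"
    unfolding fourier_def cis_eq_exp_fourier by (simp add: inner_commute)
  also have "\<dots> = (LBINT x. f x * cis (2 * pi * (- \<xi> \<bullet> x)))"
    by (rule integral_completion) measurable
  finally show ?thesis by (simp add: ift_def)
qed

lemma fourier_mod_gauss:
  assumes t: "0 < t"
  shows "fourier (mod_gauss t a) x = complex_of_real (gk t (a - x))"
proof -
  have "mod_gauss t a \<in> borel_measurable borel"
    unfolding mod_gauss_def by measurable
  then have "fourier (mod_gauss t a) x = (LBINT \<xi>. mod_gauss t a \<xi> * cis (2 * pi * (- x \<bullet> \<xi>)))"
    by (simp add: fourier_eq_ift ift_def)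
  also have "\<dots> = (LBINT \<xi>. complex_of_real (gh t \<xi>) * cis (2 * pi * ((a - x) \<bullet> \<xi>)))"
    by (intro Bochner_Integration.integral_cong refl)
       (simp add: mod_gauss_def cis_mult inner_diff_left right_diff_distrib)
  also have "\<dots> = complex_of_real (gk t (a - x))"
    by (rule gauss_fourier_inverse(2)[OF t])
  finally show ?thesis .
qed

section \<open>Borel representatives of Lebesgue measurable functions\<close>

lemma lebesgue_integral_cong_AE_lborel:
  fixes f g :: "'a :: euclidean_space \<Rightarrow> 'c :: {banach, second_countable_topology}"
  assumes f: "f \<in> borel_measurable lebesgue" and g: "g \<in> borel_measurable borel" and eq: "AE x in lborel. f x = g x"
  shows "(LINT x|lebesgue. f x) = (LBINT x. g x)"
proof -
  have "(LINT x|lebesgue. f x) = (LINT x|lebesgue. g x)"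
    using f g AE_completion[OF eq]
    by (intro integral_cong_AE) (auto intro: measurable_completion)
  also have "\<dots> = (LBINT x. g x)"
    using g by (intro integral_completion) auto
  finally show ?thesis .
qed

lemma complex_completion_ex_borel:
  fixes g :: "'a :: euclidean_space \<Rightarrow> complex"
  assumes g: "g \<in> borel_measurable lebesgue"
  obtains g' where "g' \<in> borel_measurable borel" "AE x in lborel. g x = g' x"
proof -
  have "(\<lambda>x. Re (g x)) \<in> borel_measurable lebesgue" "(\<lambda>x. Im (g x)) \<in> borel_measurable lebesgue"
    using g by measurable
  from completion_ex_borel_measurable_real[OF this(1)] completion_ex_borel_measurable_real[OF this(2)]
  obtain r i where ri: "r \<in> borel_measurable lborel" "i \<in> borel_measurable lborel"
    "AE x in lborel. Re (g x) = r x" "AE x in lborel. Im (g x) = i x" by blast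
  have [measurable]: "r \<in> borel_measurable borel" "i \<in> borel_measurable borel"
    using ri(1,2) by simp_all
  have "(\<lambda>x. complex_of_real (r x) + \<i> * complex_of_real (i x)) \<in> borel_measurable borel"
    by measurable
  moreover have "AE x in lborel. g x = complex_of_real (r x) + \<i> * complex_of_real (i x)"
    using ri(3,4) by eventually_elim (simp add: complex_eq_iff)
  ultimately show ?thesis by (rule that)
qed

text \<open>The single point where the distributional definition of the transform is evaluated.
  Tested on \<open>mod_gauss t a\<close> it says that the Gaussian mean of f at a is the inverse
  transform of the damped spectrum.\<close>

lemma has_fourier_transform_conv_gk:
  fixes f f0 fhat fhat0 :: "real ^ 'd \<Rightarrow> complex"
  assumes ft: "has_fourier_transform f fhat"
    and f: "f \<in> borel_measurable lebesgue" "f0 \<in> borel_measurable borel" "AE x in lborel. f x = f0 x"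
    and fhat: "fhat \<in> borel_measurable lebesgue" "fhat0 \<in> borel_measurable borel" "AE x in lborel. fhat x = fhat0 x"
    and t: "0 < t"
  shows "conv_gk f0 t a = ift (\<lambda>\<xi>. fhat0 \<xi> * complex_of_real (gh t \<xi>)) a"
proof -
  note [measurable] = f(2) fhat(2)
  have m: "mod_gauss t a \<in> borel_measurable borel"
    unfolding mod_gauss_def by measurable
  have "(LINT x|lebesgue. f x * fourier (mod_gauss t a) x) = (LINT \<xi>|lebesgue. fhat \<xi> * mod_gauss t a \<xi>)"
    using ft mod_gauss_schwartz[OF t] unfolding has_fourier_transform_def by blast
  moreover have "(LINT x|lebesgue. f x * fourier (mod_gauss t a) x) = (LBINT x. f0 x * complex_of_real (gk t (a - x)))"
    unfolding fourier_mod_gauss[OF t]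
  proof (rule lebesgue_integral_cong_AE_lborel)
    have "(\<lambda>x. complex_of_real (gk t (a - x))) \<in> borel_measurable lebesgue"
      by (rule measurable_completion) measurable
    with f(1) show "(\<lambda>x. f x * complex_of_real (gk t (a - x))) \<in> borel_measurable lebesgue"
      by (rule borel_measurable_times)
  qed (use f(3) in auto)
  moreover have "(LINT \<xi>|lebesgue. fhat \<xi> * mod_gauss t a \<xi>) = (LBINT \<xi>. fhat0 \<xi> * mod_gauss t a \<xi>)"
  proof (rule lebesgue_integral_cong_AE_lborel)
    have "mod_gauss t a \<in> borel_measurable lebesgue"
      using m by (auto intro: measurable_completion)
    with fhat(1) show "(\<lambda>\<xi>. fhat \<xi> * mod_gauss t a \<xi>) \<in> borel_measurable lebesgue"
      by (rule borel_measurable_times)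
    show "AE \<xi> in lborel. fhat \<xi> * mod_gauss t a \<xi> = fhat0 \<xi> * mod_gauss t a \<xi>"
      using fhat(3) by eventually_elim simp
  qed (use m in measurable)
  ultimately show ?thesis
    by (simp add: conv_gk_def ift_def mod_gauss_def mult.assoc)
qed

section \<open>Fourier series on the torus and Poisson summation\<close>

lemma cis_lattice_periodic: "k \<in> int_lattice \<Longrightarrow> l \<in> int_lattice \<Longrightarrow> cis (2 * pi * (k \<bullet> (x + l))) = cis (2 * pi * (k \<bullet> x))"
proof -
  assume "k \<in> int_lattice" "l \<in> int_lattice"
  then have "k \<bullet> l \<in> \<int>" by (rule int_lattice_inner)
  then have "cis (2 * pi * (k \<bullet> l)) = 1" by (rule cis_multiple_2pi)
  then show ?thesis by (simp add: inner_add_right distrib_left flip: cis_mult)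
qed

section \<open>Uniqueness of the Fourier coefficients of a continuous function\<close>

lemma integrable_unit_cell:
  fixes g :: "real ^ 'd \<Rightarrow> complex"
  assumes g: "continuous_on UNIV g"
  shows "integrable lborel (\<lambda>x. indicator unit_cell x *\<^sub>R g x)"
proof -
  have "compact (torus :: (real ^ 'd) set)" by (simp add: torus_def)
  then have "integrable lborel (\<lambda>x. indicator torus x *\<^sub>R g x)"
    by (intro borel_integrable_compact continuous_on_subset[OF g]) auto
  then have "integrable lborel (\<lambda>x. indicator unit_cell x *\<^sub>R (indicator torus x *\<^sub>R g x))"
    by (rule integrable_mult_indicator[rotated]) simp
  also have "(\<lambda>x. indicator unit_cell x *\<^sub>R (indicator torus x *\<^sub>R g x)) = (\<lambda>x. indicator unit_cell x *\<^sub>R g x)"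
    using unit_cell_subset_torus by (auto simp: fun_eq_iff indicator_def)
  finally show ?thesis .
qed

text \<open>A nonnegative trigonometric polynomial of degree one in the i-th coordinate with maximum
  1 at a. High powers of the product over i concentrate at a modulo the lattice.\<close>

definition bump :: "real ^ 'd \<Rightarrow> 'd \<Rightarrow> real ^ 'd \<Rightarrow> real" where
  "bump a i x = (1 + cos (2 * pi * (x $ i - a $ i))) / 2"

lemma half_one_plus: "0 \<le> (1 + c) / 2" "(1 + c) / 2 \<le> 1" if "- 1 \<le> c" "c \<le> 1" for c :: real
  using that by auto

lemma bump_bounds: "0 \<le> bump a i x" "bump a i x \<le> 1"
  using half_one_plus[OF cos_ge_minus_one cos_le_one] by (simp_all add: bump_def)

lemma continuous_on_bump [continuous_intros]: "continuous_on S (bump a i)"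
  unfolding bump_def[abs_def] by (intro continuous_intros) auto

lemma continuous_on_cis_inner [continuous_intros]: "continuous_on S (\<lambda>x. cis (2 * pi * (k \<bullet> x)))"
  by (intro continuous_intros)

text \<open>Continuity together with vanishing Fourier coefficients over the cell. Periodicity
  enters only in \<open>fourier_series_unique\<close>; the concentration argument at interior points
  stays inside one cell.\<close>

definition cell_orth :: "(real ^ 'd \<Rightarrow> complex) \<Rightarrow> bool" where
  "cell_orth g \<longleftrightarrow> continuous_on UNIV g \<and>
     (\<forall>k\<in>int_lattice. (LBINT x. indicator unit_cell x *\<^sub>R (g x * cis (2 * pi * (k \<bullet> x)))) = 0)"

text \<open>Expanding the cosine, the coefficient at k of the product combines those of g at k, k +
  e and k - e, where e is the i-th unit vector, and all three vanish.\<close>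

lemma cell_orth_bump:
  assumes g: "cell_orth g"
  shows "cell_orth (\<lambda>x. g x * complex_of_real (bump a i x))"
  unfolding cell_orth_def
proof (intro conjI ballI)
  have cont: "continuous_on UNIV g" using g by (simp add: cell_orth_def)
  then show "continuous_on UNIV (\<lambda>x. g x * complex_of_real (bump a i x))"
    by (intro continuous_intros)
  fix k :: "real ^ 'a" assume k: "k \<in> int_lattice"
  let ?e = "\<lambda>k x. indicator unit_cell x *\<^sub>R (g x * cis (2 * pi * (k \<bullet> x)))"
  have int: "integrable lborel (?e k)" for k
    by (intro integrable_unit_cell continuous_intros cont)
  let ?k1 = "k + axis i 1" and ?k2 = "k - axis i 1"
  have eq: "indicator unit_cell x *\<^sub>R (g x * complex_of_real (bump a i x) * cis (2 * pi * (k \<bullet> x)))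
     = (1 / 2) * ?e k x + cis (- (2 * pi * a $ i)) / 4 * ?e ?k1 x + cis (2 * pi * a $ i) / 4 * ?e ?k2 x" for x
  proof -
    define A B where "A = cis (2 * pi * (x $ i - a $ i))" and "B = cis (- (2 * pi * (x $ i - a $ i)))"
    have b: "complex_of_real (bump a i x) = 1 / 2 + A / 4 + B / 4"
      by (simp add: bump_def A_def B_def complex_eq_iff)
    have "cis (- (2 * pi * a $ i)) * cis (2 * pi * (?k1 \<bullet> x)) = A * cis (2 * pi * (k \<bullet> x))"
      "cis (2 * pi * a $ i) * cis (2 * pi * (?k2 \<bullet> x)) = B * cis (2 * pi * (k \<bullet> x))"
      unfolding A_def B_def cis_mult
      by (rule arg_cong[of _ _ cis], simp add: inner_add_left inner_diff_left inner_axis' algebra_simps)+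
    then have "g x * complex_of_real (bump a i x) * cis (2 * pi * (k \<bullet> x))
      = (1 / 2) * (g x * cis (2 * pi * (k \<bullet> x))) + cis (- (2 * pi * a $ i)) / 4 * (g x * cis (2 * pi * (?k1 \<bullet> x)))
        + cis (2 * pi * a $ i) / 4 * (g x * cis (2 * pi * (?k2 \<bullet> x)))"
      unfolding b by (simp add: distrib_right distrib_left mult_ac)
    then show ?thesis
      by (cases "x \<in> unit_cell") auto
  qed
  have k12: "?k1 \<in> int_lattice" "?k2 \<in> int_lattice"
    using k by (auto intro!: int_lattice_add int_lattice_diff int_lattice_axis)
  have zero: "(LBINT x. ?e k x) = 0" "(LBINT x. ?e ?k1 x) = 0" "(LBINT x. ?e ?k2 x) = 0"
    using g k k12 by (simp_all add: cell_orth_def)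
  show "(LBINT x. indicator unit_cell x *\<^sub>R (g x * complex_of_real (bump a i x) * cis (2 * pi * (k \<bullet> x)))) = 0"
    unfolding eq
    by (subst Bochner_Integration.integral_add, intro Bochner_Integration.integrable_add integrable_mult_right int,
        intro integrable_mult_right int,
        subst Bochner_Integration.integral_add, intro integrable_mult_right int, intro integrable_mult_right int)
       (simp only: integral_mult_right_zero zero, simp)
qed

lemma cell_orth_bump_prod:
  assumes g: "cell_orth g"
  shows "cell_orth (\<lambda>x. g x * complex_of_real ((\<Prod>i\<in>UNIV. bump a i x) ^ r))"
proof (induction r)
  case 0
  then show ?case using g by simp
next
  case (Suc r)
  have "cell_orth (\<lambda>x. (g x * complex_of_real ((\<Prod>i\<in>UNIV. bump a i x) ^ r)) * complex_of_real (\<Prod>i\<in>I. bump a i x))" for I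
  proof (induction I rule: infinite_finite_induct)
    case (insert i I)
    from cell_orth_bump[OF insert.IH, of a i] insert.hyps show ?case
      by (simp add: mult_ac)
  qed (use Suc in simp_all)
  from this[of UNIV] show ?case by (simp add: mult_ac)
qed

text \<open>The gap between \<rho> and \<rho>' is what makes powers of the product concentrate. The
  condition \<eta> \<le> |x i - a i| \<le> 1 - \<eta> expresses a distance of at least \<eta> modulo
  1; one factor at most \<rho> suffices there because the others are at most 1.\<close>

lemma prod_bump_concentration:
  fixes a :: "real ^ 'd"
  assumes \<eta>: "0 < \<eta>" "\<eta> \<le> 1 / 4"
  obtains \<rho> \<rho>' \<eta>' where "0 \<le> \<rho>" "\<rho> < \<rho>'" "0 < \<eta>'" "\<eta>' \<le> \<eta>"
    "\<And>x. (\<exists>i. \<eta> \<le> \<bar>x $ i - a $ i\<bar> \<and> \<bar>x $ i - a $ i\<bar> \<le> 1 - \<eta>) \<Longrightarrow> (\<Prod>i\<in>UNIV. bump a i x) \<le> \<rho>"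
    "\<And>x. (\<forall>i. \<bar>x $ i - a $ i\<bar> \<le> \<eta>') \<Longrightarrow> \<rho>' \<le> (\<Prod>i\<in>UNIV. bump a i x)"
proof -
  define c where "c s = (1 + cos (2 * pi * s)) / 2" for s :: real
  define \<rho> where "\<rho> = c \<eta>"
  have c_bounds: "0 \<le> c s" "c s \<le> 1" for s
    using half_one_plus[OF cos_ge_minus_one cos_le_one] by (simp_all add: c_def)
  have "cos (2 * pi * \<eta>) < cos 0"
    using \<eta> by (intro cos_monotone_0_pi) (auto simp: field_simps)
  then have \<rho>1: "\<rho> < 1" by (simp add: \<rho>_def c_def)
  define \<rho>' where "\<rho>' = (1 + \<rho>) / 2"
  have \<rho>': "\<rho> < \<rho>'" "\<rho>' < 1" using \<rho>1 by (auto simp: \<rho>'_def)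
  have "isCont (\<lambda>s. c s ^ CARD('d)) 0"
    unfolding c_def by (intro continuous_intros) auto
  then have "(\<lambda>s. c s ^ CARD('d)) \<midarrow>0\<rightarrow> 1"
    by (simp add: isCont_def c_def)
  from order_tendstoD(1)[OF this \<rho>'(2)]
  obtain e where e: "0 < e" "\<And>s. s \<noteq> 0 \<Longrightarrow> \<bar>s\<bar> < e \<Longrightarrow> \<rho>' < c s ^ CARD('d)"
    by (auto simp: eventually_at dist_real_def)
  define \<eta>' where "\<eta>' = min \<eta> (e / 2)"
  have \<eta>': "0 < \<eta>'" "\<eta>' \<le> \<eta>" "\<eta>' < e" using \<eta> e by (auto simp: \<eta>'_def)
  have b: "bump a i x = c \<bar>x $ i - a $ i\<bar>" for i x
    by (simp add: bump_def c_def abs_if cos_diff algebra_simps)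
  have mono: "c s \<le> c t" if "0 \<le> t" "t \<le> s" "s \<le> 1 / 2" for s t
    using that by (auto simp: c_def intro!: cos_monotone_0_pi_le)
  have sym: "c (1 - s) = c s" for s
    by (simp add: c_def right_diff_distrib cos_diff)
  show ?thesis
  proof (rule that[of \<rho> \<rho>' \<eta>'])
    fix x :: "real ^ 'd" assume "\<exists>i. \<eta> \<le> \<bar>x $ i - a $ i\<bar> \<and> \<bar>x $ i - a $ i\<bar> \<le> 1 - \<eta>"
    then obtain i where i: "\<eta> \<le> \<bar>x $ i - a $ i\<bar>" "\<bar>x $ i - a $ i\<bar> \<le> 1 - \<eta>" by blast
    have "bump a i x \<le> \<rho>"
    proof (cases "\<bar>x $ i - a $ i\<bar> \<le> 1 / 2")
      case True
      then show ?thesis unfolding b \<rho>_def using i \<eta> by (intro mono) auto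
    next
      case False
      then show ?thesis
        unfolding b \<rho>_def using i \<eta> by (subst sym[symmetric], intro mono) auto
    qed
    moreover have "(\<Prod>i\<in>UNIV - {i}. bump a i x) \<le> 1"
      by (intro prod_le_1) (auto simp: bump_bounds)
    moreover have "(\<Prod>i\<in>UNIV. bump a i x) = bump a i x * (\<Prod>i\<in>UNIV - {i}. bump a i x)"
      by (rule prod.remove) auto
    ultimately show "(\<Prod>i\<in>UNIV. bump a i x) \<le> \<rho>"
      using bump_bounds[of a i x] mult_left_le[of "\<Prod>i\<in>UNIV - {i}. bump a i x" "bump a i x"] by linarith
  next
    fix x :: "real ^ 'd" assume *: "\<forall>i. \<bar>x $ i - a $ i\<bar> \<le> \<eta>'"
    have "\<rho>' \<le> c \<eta>' ^ CARD('d)"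
      using e(2)[of \<eta>'] \<eta>' by auto
    also have "\<dots> = (\<Prod>i\<in>(UNIV :: 'd set). c \<eta>')" by simp
    also have "\<dots> \<le> (\<Prod>i\<in>UNIV. bump a i x)"
    proof (intro prod_mono conjI)
      fix i
      show "c \<eta>' \<le> bump a i x"
        unfolding b using * \<eta> \<eta>' by (intro mono) auto
    qed (use c_bounds in auto)
    finally show "\<rho>' \<le> (\<Prod>i\<in>UNIV. bump a i x)" .
  qed (use \<rho>' \<eta>' c_bounds \<rho>_def in auto)
qed

text \<open>If V a were nonzero, normalise U = V / V a and integrate U against the r-th power of the
  bump product K, a trigonometric polynomial, so that the integral is 0. A small cube around a
  contributes at least v / 2 times the r-th power of \<rho>', points farther than \<eta> cost at
  most B times that of \<rho> < \<rho>', and large r gives a contradiction.\<close>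

lemma fourier_series_unique_interior:
  fixes V :: "real ^ 'd \<Rightarrow> complex"
  assumes V: "cell_orth V" and a: "\<And>i. \<bar>a $ i\<bar> < 1 / 2"
  shows "V a = 0"
proof (rule ccontr)
  assume nz: "V a \<noteq> 0"
  have cont: "continuous_on UNIV V" using V by (simp add: cell_orth_def)
  define U where "U x = V x / V a" for x
  have contU: "continuous_on UNIV U"
    unfolding U_def[abs_def] by (intro continuous_intros cont) (use nz in auto)
  obtain e where e: "0 < e" "\<And>x. dist x a < e \<Longrightarrow> dist (U x) (U a) < 1 / 2"
    using contU[unfolded continuous_on_iff, rule_format, of a "1 / 2"] by auto
  define m where "m = (MIN i. 1 / 2 - \<bar>a $ i\<bar>)"
  have m: "m \<le> 1 / 2 - \<bar>a $ i\<bar>" for i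
    unfolding m_def by (intro Min_le) auto
  have m0: "m > 0"
    unfolding m_def using a by (subst Min_gr_iff) auto
  \<comment> \<open>The bound m keeps the cube of half-side \<eta> around a inside the cell and
    gives |x i - a i| \<le> 1 - \<eta> for all x in the cell. The last entry makes the cube small
    enough for continuity to yield Re U > 1 / 2.\<close>
  define \<eta> where "\<eta> = min (min m (1 / 4)) (e / (2 * real CARD('d)))"
  have \<eta>: "0 < \<eta>" "\<eta> \<le> 1 / 4" "\<eta> \<le> m" "\<eta> \<le> e / (2 * real CARD('d))"
    using m0 e by (auto simp: \<eta>_def)
  have near: "1 / 2 < Re (U x)" if "\<forall>i. \<bar>x $ i - a $ i\<bar> < \<eta>" for x
  proof -
    have "norm (x - a) \<le> (\<Sum>i\<in>UNIV. \<bar>(x - a) $ i\<bar>)" by (rule norm_le_l1_cart)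
    also have "\<dots> \<le> (\<Sum>i\<in>(UNIV :: 'd set). \<eta>)"
      using that by (intro sum_mono) (auto simp: less_imp_le)
    also have "\<dots> \<le> real CARD('d) * (e / (2 * real CARD('d)))"
      using mult_left_mono[OF \<eta>(4), of "real CARD('d)"] by simp
    also have "\<dots> < e" using e by simp
    finally have "dist (U x) (U a) < 1 / 2" by (intro e) (simp add: dist_norm)
    then have "\<bar>Re (U x - 1)\<bar> < 1 / 2"
      using nz abs_Re_le_cmod[of "U x - 1"] by (simp add: dist_norm U_def)
    then show ?thesis unfolding minus_complex.simps one_complex.simps by linarith
  qed
  obtain \<rho> \<rho>' \<eta>' where \<rho>: "0 \<le> \<rho>" "\<rho> < \<rho>'" and \<eta>': "0 < \<eta>'" "\<eta>' \<le> \<eta>" and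
    far: "\<And>x. (\<exists>i. \<eta> \<le> \<bar>x $ i - a $ i\<bar> \<and> \<bar>x $ i - a $ i\<bar> \<le> 1 - \<eta>) \<Longrightarrow> (\<Prod>i\<in>UNIV. bump a i x) \<le> \<rho>" and
    close: "\<And>x. (\<forall>i. \<bar>x $ i - a $ i\<bar> \<le> \<eta>') \<Longrightarrow> \<rho>' \<le> (\<Prod>i\<in>UNIV. bump a i x)"
    using prod_bump_concentration[OF \<eta>(1,2), of a] by metis
  define K where "K x = (\<Prod>i\<in>UNIV. bump a i x)" for x
  have K0: "0 \<le> K x" for x unfolding K_def by (intro prod_nonneg) (auto simp: bump_bounds)
  have contK: "continuous_on UNIV K" unfolding K_def by (intro continuous_intros)
  define Q where "Q = cbox (a - (\<chi> i. \<eta>' / 2)) (a + (\<chi> i. \<eta>' / 2))"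
  have Q: "\<bar>x $ i - a $ i\<bar> < \<eta>'" if "x \<in> Q" for x i
    using that \<eta>' unfolding Q_def mem_box_cart by (auto simp: abs_less_iff dest: spec[of _ i])
  have cell: "x \<in> unit_cell" if "\<And>i. \<bar>x $ i - a $ i\<bar> < \<eta>" for x
    unfolding unit_cell_def
  proof (intro CollectI allI)
    fix i
    have "\<bar>x $ i\<bar> < 1 / 2" using that[of i] m[of i] \<eta>(3) by linarith
    then show "- 1 / 2 \<le> x $ i \<and> x $ i < 1 / 2" by linarith
  qed
  have Qcell: "x \<in> unit_cell" if "x \<in> Q" for x
    using Q[OF that] \<eta>' by (intro cell) (meson less_le_trans)
  obtain B where B: "\<And>x. x \<in> torus \<Longrightarrow> norm (U x) \<le> B"
    using compact_imp_bounded[OF compact_continuous_image[OF continuous_on_subset[OF contU], of torus]]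
    by (auto simp: bounded_iff torus_def)
  have B0: "0 \<le> B"
    by (rule order_trans[OF norm_ge_zero B[of 0]]) (simp add: torus_def mem_box_cart)
  define v where "v = measure lborel Q"
  have v: "v > 0"
    unfolding v_def Q_def using \<eta>' by (subst content_pos_lt_eq) (auto simp: Basis_vec_def inner_axis inner_simps)
  have ineq: "v / 2 * \<rho>' ^ r \<le> B * \<rho> ^ r" for r
  proof -
    have int: "integrable lborel (\<lambda>x. indicator unit_cell x *\<^sub>R (U x * complex_of_real (K x ^ r)))"
      by (intro integrable_unit_cell continuous_intros contU contK)
    have "cell_orth (\<lambda>x. V x * complex_of_real (K x ^ r))"
      unfolding K_def by (rule cell_orth_bump_prod[OF V])
    then have "(LBINT x. indicator unit_cell x *\<^sub>R (V x * complex_of_real (K x ^ r) * cis (2 * pi * (0 \<bullet> x)))) = 0"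
      unfolding cell_orth_def using int_lattice_0 by blast
    then have "(LBINT x. (indicator unit_cell x *\<^sub>R (V x * complex_of_real (K x ^ r))) / V a) = 0"
      by simp
    also have "(\<lambda>x. (indicator unit_cell x *\<^sub>R (V x * complex_of_real (K x ^ r))) / V a)
       = (\<lambda>x. indicator unit_cell x *\<^sub>R (U x * complex_of_real (K x ^ r)))"
      by (auto simp: U_def fun_eq_iff scaleR_conv_of_real)
    finally have 0: "(LBINT x. indicator unit_cell x *\<^sub>R (U x * complex_of_real (K x ^ r))) = 0" .
    have "(LBINT x. Re (indicator unit_cell x *\<^sub>R (U x * complex_of_real (K x ^ r)))) = 0"
      using 0 int by (subst integral_Re) auto
    then have zero: "(LBINT x. indicator unit_cell x * (Re (U x) * K x ^ r)) = 0"
      by (simp del: of_real_power)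
    have intR: "integrable lborel (\<lambda>x. indicator unit_cell x * (Re (U x) * K x ^ r))"
      using integrable_Re[OF int] by (simp del: of_real_power)
    have fQ: "emeasure lborel Q < \<infinity>" using emeasure_compact_finite[of Q] by (simp add: Q_def)
    have Qs: "Q \<in> sets lborel" unfolding Q_def by simp
    have intL: "integrable lborel (\<lambda>x. indicator Q x * (\<rho>' ^ r / 2) - indicator unit_cell x * (B * \<rho> ^ r))"
      by (intro Bochner_Integration.integrable_diff integrable_mult_left integrable_real_indicator)
         (use fQ Qs in auto)
    have "(LBINT x. indicator Q x * (\<rho>' ^ r / 2) - indicator unit_cell x * (B * \<rho> ^ r))
       \<le> (LBINT x. indicator unit_cell x * (Re (U x) * K x ^ r))"
    proof (rule integral_mono[OF intL intR])
      fix x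
      show "indicator Q x * (\<rho>' ^ r / 2) - indicator unit_cell x * (B * \<rho> ^ r) \<le> indicator unit_cell x * (Re (U x) * K x ^ r)"
      proof (cases "x \<in> unit_cell")
        case False
        then show ?thesis using Qcell[of x] by (auto simp: indicator_def)
      next
        case True
        have Br: "0 \<le> B * \<rho> ^ r" using B0 \<rho> by simp
        show ?thesis
        proof (cases "\<forall>i. \<bar>x $ i - a $ i\<bar> < \<eta>")
          case near': True
          have U: "1 / 2 < Re (U x)" by (rule near[OF near'])
          have "indicator Q x * (\<rho>' ^ r / 2) \<le> Re (U x) * K x ^ r"
          proof (cases "x \<in> Q")
            case True
            then have "\<rho>' \<le> K x"
              unfolding K_def using Q[OF True] by (intro close) (auto simp: less_imp_le)
            then have "\<rho>' ^ r \<le> K x ^ r" using \<rho> by (intro power_mono) auto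
            then have "(1 / 2) * \<rho>' ^ r \<le> Re (U x) * K x ^ r"
              using U \<rho> by (intro mult_mono) auto
            then show ?thesis using True by simp
          next
            case False
            then show ?thesis using U K0[of x] by simp
          qed
          then show ?thesis using True Br by simp
        next
          case False
          then obtain i where i: "\<eta> \<le> \<bar>x $ i - a $ i\<bar>" by (auto simp: not_less)
          have "- 1 / 2 \<le> x $ i" "x $ i < 1 / 2" using True by (auto simp: unit_cell_def)
          then have "\<bar>x $ i - a $ i\<bar> \<le> 1 - \<eta>" using m[of i] \<eta>(3) by linarith
          then have "K x \<le> \<rho>" unfolding K_def using i by (intro far) blast
          then have "K x ^ r \<le> \<rho> ^ r" using K0 by (intro power_mono) auto
          moreover have "- B \<le> Re (U x)"
            using B[of x] True unit_cell_subset_torus abs_Re_le_cmod[of "U x"] by (auto simp: abs_le_iff)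
          ultimately have "- (B * \<rho> ^ r) \<le> Re (U x) * K x ^ r"
            using B0 K0[of x] \<rho>(1)
            by (smt (verit) mult_left_mono mult_minus_left mult_right_mono zero_le_power)
          moreover have "x \<notin> Q" using False Q[of x] \<eta>' by (meson less_le_trans)
          ultimately show ?thesis using True by simp
        qed
      qed
    qed
    also have "(LBINT x. indicator Q x * (\<rho>' ^ r / 2) - indicator unit_cell x * (B * \<rho> ^ r)) = v * (\<rho>' ^ r / 2) - 1 * (B * \<rho> ^ r)"
    proof -
      have "measure lborel (unit_cell :: (real ^ 'd) set) = 1" by (simp add: measure_def)
      then show ?thesis
        using fQ Qs
        by (subst Bochner_Integration.integral_diff) (auto intro!: integrable_mult_left integrable_real_indicator simp: v_def)
    qed
    finally show ?thesis using zero by simp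
  qed
  show False
  \<comment> \<open>For \<rho> = 0 the inequality at r = 1 already contradicts v \<rho>' > 0;
    otherwise the powers of \<rho>' / \<rho> > 1 are unbounded.\<close>
  proof (cases "\<rho> = 0")
    case True
    then have "v * \<rho>' \<le> 0" "0 < \<rho>'" using ineq[of 1] \<rho> by simp_all
    with v show ?thesis using mult_pos_pos[of v \<rho>'] by linarith
  next
    case False
    then have "\<rho> > 0" using \<rho> by simp
    have le: "v / 2 * (\<rho>' / \<rho>) ^ r \<le> B" for r
      using ineq[of r] \<open>\<rho> > 0\<close> by (simp add: power_divide divide_le_eq)
    have "z \<le> 2 * B / v" if "v / 2 * z \<le> B" for z
      using that v by (simp add: pos_le_divide_eq mult.commute)
    from this[OF le] have "(\<rho>' / \<rho>) ^ r \<le> 2 * B / v" for r .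
    moreover obtain r where "2 * B / v < (\<rho>' / \<rho>) ^ r"
      using real_arch_pow[of "\<rho>' / \<rho>"] \<rho> \<open>\<rho> > 0\<close> by auto
    ultimately show False by (meson not_le)
  qed
qed

text \<open>Every point of the half-open cell is a limit of the interior points (1 - 1 / (n + 1)) y,
  and periodicity covers the rest of the space.\<close>

lemma fourier_series_unique:
  fixes V :: "real ^ 'd \<Rightarrow> complex"
  assumes V: "cell_orth V" and per: "\<And>x k. k \<in> int_lattice \<Longrightarrow> V (x + k) = V x"
  shows "V x = 0"
proof -
  have cont: "continuous_on UNIV V" using V by (simp add: cell_orth_def)
  have cell: "V y = 0" if y: "y \<in> unit_cell" for y
  proof -
    define s where "s n = (1 - 1 / real (Suc n)) *\<^sub>R y" for n
    have "s \<longlonglongrightarrow> (1 - 0) *\<^sub>R y"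
      unfolding s_def by (intro tendsto_intros LIMSEQ_Suc[OF lim_1_over_n])
    then have "(\<lambda>n. V (s n)) \<longlonglongrightarrow> V y"
      using cont by (intro continuous_on_tendsto_compose[of UNIV V s y]) auto
    moreover have "V (s n) = 0" for n
    proof (rule fourier_series_unique_interior[OF V])
      fix i
      have yi: "\<bar>y $ i\<bar> \<le> 1 / 2"
        using y by (auto simp: unit_cell_def abs_le_iff less_imp_le dest: spec[of _ i])
      define c where "c = 1 - 1 / real (Suc n)"
      have c: "0 \<le> c" "c < 1" by (auto simp: c_def divide_le_eq)
      have "\<bar>s n $ i\<bar> = c * \<bar>y $ i\<bar>"
        unfolding s_def c_def[symmetric] using c by (simp add: abs_mult)
      also have "\<dots> \<le> c * (1 / 2)"
        using c yi by (intro mult_left_mono) auto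
      also have "\<dots> < 1 / 2" using c by simp
      finally show "\<bar>s n $ i\<bar> < 1 / 2" .
    qed
    ultimately show ?thesis by (simp add: LIMSEQ_const_iff)
  qed
  have "V x = V ((x - nearest_lattice x) + nearest_lattice x)" by simp
  also have "\<dots> = V (x - nearest_lattice x)"
    by (rule per) (rule nearest_lattice)
  also have "\<dots> = 0" by (rule cell) (rule nearest_lattice)
  finally show ?thesis .
qed

text \<open>Uniformity in \<xi>: the nearest lattice point is absorbed by shifting the sum, and the
  remaining displacement lies in the cell, where Peetre's inequality gives a fixed constant.\<close>

lemma lattice_wt_bound:
  assumes b: "real CARD('d) < b"
  obtains C where "0 < C" "\<And>\<xi> :: real ^ 'd. (\<Sum>\<^sub>\<infinity>l\<in>int_lattice. ennreal (wt b (\<xi> + l))) \<le> ennreal C"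
proof -
  define S where "S = (\<Sum>\<^sub>\<infinity>l\<in>(int_lattice :: (real ^ 'd) set). ennreal (wt b l))"
  have S: "S < \<infinity>" unfolding S_def by (rule lattice_sum_wt_finite[OF b])
  define c where "c = (1 + real CARD('d)) powr b"
  have c: "c > 0" by (simp add: c_def add_nonneg_eq_0_iff)
  have "(\<Sum>\<^sub>\<infinity>l\<in>int_lattice. ennreal (wt b (\<xi> + l))) \<le> ennreal (c * enn2real S + 1)" for \<xi> :: "real ^ 'd"
  proof -
    let ?k = "nearest_lattice \<xi>"
    have "(\<Sum>\<^sub>\<infinity>l\<in>int_lattice. ennreal (wt b (\<xi> + l))) \<le> (\<Sum>\<^sub>\<infinity>l\<in>int_lattice. ennreal c * ennreal (wt b (l + ?k)))"
    proof (rule infsum_ennreal_mono)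
      fix l
      have "wt b ((l + ?k) + (\<xi> - ?k)) \<le> wt b (l + ?k) * (1 + norm (\<xi> - ?k)) powr b"
        using b by (intro wt_add_le) auto
      also have "\<dots> \<le> wt b (l + ?k) * c"
        unfolding c_def using b nearest_lattice(2)[of \<xi>] unit_cell_subset_torus
        by (intro mult_left_mono powr_mono2 add_left_mono norm_le_of_torus) auto
      finally show "ennreal (wt b (\<xi> + l)) \<le> ennreal c * ennreal (wt b (l + ?k))"
        using c by (simp add: ennreal_mult[symmetric] ennreal_leI add.commute mult.commute)
    qed
    also have "\<dots> = ennreal c * (\<Sum>\<^sub>\<infinity>l\<in>int_lattice. ennreal (wt b (l + ?k)))"
      by (rule infsum_ennreal_cmult)
    also have "(\<Sum>\<^sub>\<infinity>l\<in>int_lattice. ennreal (wt b (l + ?k))) = S"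
      unfolding S_def by (rule infsum_lattice_shift) (rule nearest_lattice)
    also have "ennreal c * S = ennreal (c * enn2real S)"
      using S c by (cases S) (auto simp: ennreal_mult)
    also have "\<dots> \<le> ennreal (c * enn2real S + 1)" by (intro ennreal_leI) simp
    finally show ?thesis .
  qed
  moreover have "0 < c * enn2real S + 1" using c by (simp add: add_nonneg_pos)
  ultimately show ?thesis using that by blast
qed

section \<open>Unfolding, orthogonality of exponentials and Poisson summation\<close>

lemma infsum_indicator_unit_cell: "(\<Sum>\<^sub>\<infinity>k\<in>int_lattice. indicator unit_cell (x + k) *\<^sub>R z) = z"
  for x :: "real ^ 'd" and z :: complex
proof -
  let ?k = "- nearest_lattice x"
  have k: "?k \<in> int_lattice" "x + ?k \<in> unit_cell"
    using nearest_lattice[of x] by auto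
  have 0: "x + l \<notin> unit_cell" if "l \<in> int_lattice - {?k}" for l
  proof
    assume "x + l \<in> unit_cell"
    moreover have "x + ?k = (x + l) + (?k - l)" by simp
    ultimately have "?k - l = 0"
      using k that by (intro unit_cell_lattice_unique[of "x + l"]) (auto intro!: int_lattice_diff)
    with that show False by simp
  qed
  have "(\<Sum>\<^sub>\<infinity>k\<in>int_lattice. indicator unit_cell (x + k) *\<^sub>R z) = (\<Sum>\<^sub>\<infinity>k\<in>{?k}. indicator unit_cell (x + k) *\<^sub>R z)"
    by (rule infsum_cong_neutral) (use 0 k in auto)
  then show ?thesis using k by simp
qed

text \<open>Complex counterpart of \<open>nn_integral_lattice\<close>. The second claim is recorded
  because \<open>infsum\<close> has a default value: it guarantees that the periodisation is a
  genuine sum at almost every point of the cell.\<close>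

lemma integral_lattice:
  fixes g :: "real ^ 'd \<Rightarrow> complex"
  assumes g: "integrable lborel g"
  shows "(LBINT x. indicator unit_cell x *\<^sub>R (\<Sum>\<^sub>\<infinity>k\<in>int_lattice. g (x + k))) = (LBINT x. g x)"
    and "AE x in lborel. x \<in> unit_cell \<longrightarrow> (\<lambda>k. norm (g (x + k))) summable_on int_lattice"
proof -
  have [measurable]: "g \<in> borel_measurable borel"
    using borel_measurable_integrable[OF g] by simp
  have fin: "(NNINT x. ennreal (norm (g x))) < \<infinity>"
    using g by (simp add: integrable_iff_bounded)
  have fin1: "(\<Sum>\<^sub>\<infinity>k\<in>int_lattice. NNINT x. ennreal (norm (indicator unit_cell x *\<^sub>R g (x + k)))) < \<infinity>"
  proof -
    have "(\<Sum>\<^sub>\<infinity>k\<in>int_lattice. NNINT x. ennreal (norm (indicator unit_cell x *\<^sub>R g (x + k))))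
       = (NNINT x. (\<Sum>\<^sub>\<infinity>k\<in>int_lattice. ennreal (norm (indicator unit_cell x *\<^sub>R g (x + k)))))"
      by (rule nn_integral_infsum[symmetric]) auto
    also have "\<dots> = (\<integral>\<^sup>+x\<in>unit_cell. (\<Sum>\<^sub>\<infinity>k\<in>int_lattice. ennreal (norm (g (x + k)))) \<partial>lborel)"
      by (intro nn_integral_cong) (auto simp: indicator_def)
    also have "\<dots> = (NNINT x. ennreal (norm (g x)))"
      by (rule nn_integral_lattice[symmetric]) measurable
    finally show ?thesis using fin by simp
  qed
  have fin2: "(\<Sum>\<^sub>\<infinity>k\<in>int_lattice. NNINT x. ennreal (norm (indicator unit_cell (x + k) *\<^sub>R g x))) < \<infinity>"
  proof -
    have "(\<Sum>\<^sub>\<infinity>k\<in>int_lattice. NNINT x. ennreal (norm (indicator unit_cell (x + k) *\<^sub>R g x)))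
       = (NNINT x. (\<Sum>\<^sub>\<infinity>k\<in>int_lattice. ennreal (norm (g x)) * indicator unit_cell (x + k)))"
      by (subst nn_integral_infsum)
         (auto intro!: infsum_cong nn_integral_cong simp: indicator_def)
    then show ?thesis
      using fin by (simp add: infsum_ennreal_cmult sum_indicator_unit_cell)
  qed
  have "(LBINT x. indicator unit_cell x *\<^sub>R (\<Sum>\<^sub>\<infinity>k\<in>int_lattice. g (x + k)))
      = (LBINT x. (\<Sum>\<^sub>\<infinity>k\<in>int_lattice. indicator unit_cell x *\<^sub>R g (x + k)))"
    by (intro Bochner_Integration.integral_cong) (auto simp: indicator_def)
  also have "\<dots> = (\<Sum>\<^sub>\<infinity>k\<in>int_lattice. LBINT x. indicator unit_cell x *\<^sub>R g (x + k))"
    by (rule integral_infsum_eq[OF countable_int_lattice _ fin1]) measurable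
  also have "\<dots> = (\<Sum>\<^sub>\<infinity>k\<in>int_lattice. LBINT x. indicator unit_cell (x + - k) *\<^sub>R g x)"
  proof (rule infsum_cong)
    fix k :: "real ^ 'd"
    show "(LBINT x. indicator unit_cell x *\<^sub>R g (x + k)) = (LBINT x. indicator unit_cell (x + - k) *\<^sub>R g x)"
      using integral_lborel_shift[of "\<lambda>x. indicator unit_cell (x + - k) *\<^sub>R g x" k] by simp
  qed
  also have "\<dots> = (\<Sum>\<^sub>\<infinity>k\<in>int_lattice. LBINT x. indicator unit_cell (x + k) *\<^sub>R g x)"
    by (rule infsum_lattice_uminus)
  also have "\<dots> = (LBINT x. (\<Sum>\<^sub>\<infinity>k\<in>int_lattice. indicator unit_cell (x + k) *\<^sub>R g x))"
    by (rule integral_infsum_eq[OF countable_int_lattice _ fin2, symmetric]) measurable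
  also have "\<dots> = (LBINT x. g x)"
    by (simp only: infsum_indicator_unit_cell)
  finally show "(LBINT x. indicator unit_cell x *\<^sub>R (\<Sum>\<^sub>\<infinity>k\<in>int_lattice. g (x + k))) = (LBINT x. g x)" .
  have "AE x in lborel. (\<lambda>k. norm (indicator unit_cell x *\<^sub>R g (x + k))) summable_on int_lattice"
    by (rule AE_abs_summable_infsum[OF countable_int_lattice _ fin1]) measurable
  then show "AE x in lborel. x \<in> unit_cell \<longrightarrow> (\<lambda>k. norm (g (x + k))) summable_on int_lattice"
    by eventually_elim auto
qed

text \<open>For k \<noteq> 0 choose s with k \<bullet> s = 1 / 2. Shifting by s reverses the sign of
  the exponential but, by periodicity, preserves its integral over the cell, so the integral equals
  its own negative.\<close>

lemma integral_cell_cis: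
  fixes k :: "real ^ 'd"
  assumes k: "k \<in> int_lattice"
  shows "(LBINT x. indicator unit_cell x *\<^sub>R cis (2 * pi * (k \<bullet> x))) = (if k = 0 then 1 else 0)"
proof (cases "k = 0")
  case True
  then show ?thesis by (simp add: measure_def)
next
  case False
  then obtain i where i: "k $ i \<noteq> 0" by (auto simp: vec_eq_iff)
  define s :: "real ^ 'd" where "s = axis i (1 / (2 * k $ i))"
  have ks: "k \<bullet> s = 1 / 2" using i by (simp add: s_def inner_axis)
  define h where "h x = cis (2 * pi * (k \<bullet> x))" for x
  have hs: "h (x + s) = - h x" for x
    by (simp add: h_def inner_add_right ks distrib_left flip: cis_mult)
  have hp: "h (x + l) = h x" if "l \<in> int_lattice" for x l
    unfolding h_def by (rule cis_lattice_periodic[OF k that])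
  have [measurable]: "h \<in> borel_measurable borel" unfolding h_def by measurable
  have int: "integrable lborel (\<lambda>x. indicator unit_cell (x + - s) *\<^sub>R h x)"
  proof -
    have "(NNINT x. ennreal (norm (indicator unit_cell (x + - s) *\<^sub>R h x))) = (NNINT x. indicator unit_cell (x + - s))"
      by (intro nn_integral_cong) (auto simp: h_def indicator_def)
    also have "\<dots> = (NNINT x :: real ^ 'd. indicator unit_cell x)"
      by (rule nn_integral_lborel_shift) measurable
    also have "\<dots> < \<infinity>" by simp
    finally show ?thesis by (simp add: integrable_iff_bounded)
  qed
  have "(LBINT x. indicator unit_cell x *\<^sub>R h (x + s)) = (LBINT x. indicator unit_cell (x + - s) *\<^sub>R h x)"
    using integral_lborel_shift[of "\<lambda>x. indicator unit_cell (x + - s) *\<^sub>R h x" s] by simp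
  also have "\<dots> = (LBINT x. indicator unit_cell x *\<^sub>R (\<Sum>\<^sub>\<infinity>l\<in>int_lattice. indicator unit_cell ((x + l) + - s) *\<^sub>R h (x + l)))"
    by (rule integral_lattice(1)[OF int, symmetric])
  also have "\<dots> = (LBINT x. indicator unit_cell x *\<^sub>R h x)"
  proof (intro Bochner_Integration.integral_cong refl arg_cong2[of _ _ _ _ scaleR])
    fix x
    have "(\<Sum>\<^sub>\<infinity>l\<in>int_lattice. indicator unit_cell ((x + l) + - s) *\<^sub>R h (x + l))
      = (\<Sum>\<^sub>\<infinity>l\<in>int_lattice. indicator unit_cell ((x - s) + l) *\<^sub>R h x)"
      by (intro infsum_cong) (simp only: hp add_uminus_conv_diff diff_add_eq)
    also have "\<dots> = h x" by (rule infsum_indicator_unit_cell)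
    finally show "(\<Sum>\<^sub>\<infinity>l\<in>int_lattice. indicator unit_cell ((x + l) + - s) *\<^sub>R h (x + l)) = h x" .
  qed
  finally have "- (LBINT x. indicator unit_cell x *\<^sub>R h x) = (LBINT x. indicator unit_cell x *\<^sub>R h x)"
    by (simp add: hs)
  then show ?thesis using False by (simp add: h_def)
qed

text \<open>Weierstrass' test on balls. The majorants may depend on the radius, as they do for
  lattice translates of a decaying function.\<close>

lemma continuous_infsum:
  fixes f :: "'i \<Rightarrow> 'a :: euclidean_space \<Rightarrow> complex"
  assumes cont: "\<And>k. k \<in> K \<Longrightarrow> continuous_on UNIV (f k)"
    and bound: "\<And>k x R. k \<in> K \<Longrightarrow> norm x \<le> R \<Longrightarrow> norm (f k x) \<le> m R k"
    and summ: "\<And>R. m R summable_on K"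
  shows "continuous_on UNIV (\<lambda>x. \<Sum>\<^sub>\<infinity>k\<in>K. f k x)"
proof -
  have "continuous_on (cball 0 R) (\<lambda>x. \<Sum>\<^sub>\<infinity>k\<in>K. f k x)" for R
  proof (rule uniform_limit_theorem)
    show "uniform_limit (cball 0 R) (\<lambda>X x. \<Sum>k\<in>X. f k x) (\<lambda>x. \<Sum>\<^sub>\<infinity>k\<in>K. f k x) (finite_subsets_at_top K)"
      by (rule Weierstrass_m_test_general[OF _ summ[of R]]) (auto intro: bound)
    show "eventually (\<lambda>X. continuous_on (cball 0 R) (\<lambda>x. \<Sum>k\<in>X. f k x)) (finite_subsets_at_top K)"
      by (rule eventually_finite_subsets_at_top_weakI)
         (auto intro!: continuous_on_sum continuous_on_subset[OF cont])
  qed simp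
  then have "isCont (\<lambda>x. \<Sum>\<^sub>\<infinity>k\<in>K. f k x) x" for x
    by (rule continuous_on_interior[of "cball 0 (norm x + 1)"]) (auto simp: interior_cball)
  then show ?thesis by (simp add: continuous_on_eq_continuous_at)
qed

text \<open>Both sides are continuous and periodic with the same Fourier coefficients
  \<open>ift v m\<close>: for the periodisation V1 by unfolding, for the series V2 by orthogonality.
  Uniqueness of the coefficients then gives equality at every point.\<close>

lemma poisson_summation:
  fixes v :: "real ^ 'd \<Rightarrow> complex"
  assumes cont: "continuous_on UNIV v" and b: "real CARD('d) < b"
    and decay: "\<And>\<xi>. norm (v \<xi>) \<le> C * wt b \<xi>"
    and summ: "(\<lambda>k. norm (ift v k)) summable_on int_lattice"
  shows "(\<Sum>\<^sub>\<infinity>k\<in>int_lattice. ift v k * cis (- (2 * pi * (k \<bullet> \<xi>)))) = (\<Sum>\<^sub>\<infinity>l\<in>int_lattice. v (\<xi> + l))"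
proof -
  have C0: "0 \<le> C" using decay[of 0] norm_ge_zero[of "v 0"] wt_pos[of b "0 :: real ^ 'd"]
    by (meson order_trans zero_le_mult_iff not_le)
  have b0: "b \<ge> 0" using b by linarith
  have [measurable]: "v \<in> borel_measurable borel" using cont by (rule borel_measurable_continuous_onI)
  have int: "integrable lborel v"
  proof -
    have "(NNINT x. ennreal (norm (v x))) \<le> (NNINT x :: real ^ 'd. ennreal C * ennreal (wt b x))"
      using decay C0 by (intro nn_integral_mono) (simp add: ennreal_leI flip: ennreal_mult)
    also have "\<dots> = ennreal C * (NNINT x :: real ^ 'd. ennreal (wt b x))"
      by (rule nn_integral_cmult) measurable
    also have "\<dots> < \<infinity>"
      using nn_integral_wt_finite[where 'a = "real ^ 'd", of b] b by (simp add: ennreal_mult_less_top)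
    finally show ?thesis by (simp add: integrable_iff_bounded)
  qed
  define V1 where "V1 x = (\<Sum>\<^sub>\<infinity>l\<in>int_lattice. v (x + l))" for x
  define V2 where "V2 x = (\<Sum>\<^sub>\<infinity>k\<in>int_lattice. ift v k * cis (- (2 * pi * (k \<bullet> x))))" for x
  have c1: "continuous_on UNIV V1"
    unfolding V1_def
  proof (rule continuous_infsum[where m = "\<lambda>R l. C * (1 + R) powr b * wt b l"])
    fix l :: "real ^ 'd" assume "l \<in> int_lattice"
    show "continuous_on UNIV (\<lambda>x. v (x + l))"
      by (intro continuous_on_compose2[OF cont] continuous_intros) auto
    fix x :: "real ^ 'd" and R :: real assume R: "norm x \<le> R"
    have "norm (v (x + l)) \<le> C * wt b (x + l)" by (rule decay)
    also have "\<dots> \<le> C * (wt b l * (1 + norm x) powr b)"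
      using wt_add_le[OF b0, of l x] C0 by (intro mult_left_mono) (auto simp: add.commute)
    also have "\<dots> \<le> C * (wt b l * (1 + R) powr b)"
      using R C0 b0 by (intro mult_left_mono powr_mono2) auto
    finally show "norm (v (x + l)) \<le> C * (1 + R) powr b * wt b l" by (simp add: mult_ac)
  next
    fix R :: real
    have "(\<lambda>l :: real ^ 'd. norm (wt b l)) summable_on int_lattice"
      unfolding abs_summable_ennreal_iff using lattice_sum_wt_finite[OF b] by simp
    then show "(\<lambda>l :: real ^ 'd. C * (1 + R) powr b * wt b l) summable_on int_lattice"
      by (intro summable_on_cmult_right) simp
  qed
  have c2: "continuous_on UNIV V2"
    unfolding V2_def
  proof (rule continuous_infsum[where m = "\<lambda>_ k. norm (ift v k)"])
    fix k :: "real ^ 'd"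
    show "continuous_on UNIV (\<lambda>x. ift v k * cis (- (2 * pi * (k \<bullet> x))))"
      by (intro continuous_intros)
  qed (use summ in \<open>auto simp: norm_mult\<close>)
  have orth: "(LBINT x. indicator unit_cell x *\<^sub>R (V1 x * cis (2 * pi * (m \<bullet> x)))) = ift v m"
     "(LBINT x. indicator unit_cell x *\<^sub>R (V2 x * cis (2 * pi * (m \<bullet> x)))) = ift v m" if m: "m \<in> int_lattice" for m
  proof -
    have "(LBINT x. indicator unit_cell x *\<^sub>R (V1 x * cis (2 * pi * (m \<bullet> x))))
       = (LBINT x. indicator unit_cell x *\<^sub>R (\<Sum>\<^sub>\<infinity>l\<in>int_lattice. v (x + l) * cis (2 * pi * (m \<bullet> (x + l)))))"
    proof (intro Bochner_Integration.integral_cong refl arg_cong2[of _ _ _ _ scaleR])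
      fix x
      show "V1 x * cis (2 * pi * (m \<bullet> x)) = (\<Sum>\<^sub>\<infinity>l\<in>int_lattice. v (x + l) * cis (2 * pi * (m \<bullet> (x + l))))"
        unfolding V1_def infsum_cmult_left'[symmetric] by (intro infsum_cong) (simp add: cis_lattice_periodic[OF m])
    qed
    also have "\<dots> = (LBINT x. v x * cis (2 * pi * (m \<bullet> x)))"
      by (rule integral_lattice) (rule integrable_mult_cis[OF int])
    finally show "(LBINT x. indicator unit_cell x *\<^sub>R (V1 x * cis (2 * pi * (m \<bullet> x)))) = ift v m"
      by (simp add: ift_def)
    have nk: "(NNINT x. ennreal (norm (indicator unit_cell x *\<^sub>R (ift v k * cis (2 * pi * ((m - k) \<bullet> x)))))) = ennreal (norm (ift v k))" for k
    proof -
      have "(NNINT x. ennreal (norm (indicator unit_cell x *\<^sub>R (ift v k * cis (2 * pi * ((m - k) \<bullet> x))))))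
        = (NNINT x :: real ^ 'd. ennreal (norm (ift v k)) * indicator unit_cell x)"
        by (intro nn_integral_cong) (auto simp: norm_mult indicator_def)
      then show ?thesis by (simp add: nn_integral_cmult_indicator)
    qed
    have "(LBINT x. indicator unit_cell x *\<^sub>R (V2 x * cis (2 * pi * (m \<bullet> x))))
       = (LBINT x. (\<Sum>\<^sub>\<infinity>k\<in>int_lattice. indicator unit_cell x *\<^sub>R (ift v k * cis (2 * pi * ((m - k) \<bullet> x)))))"
    proof (intro Bochner_Integration.integral_cong refl)
      fix x
      have "V2 x * cis (2 * pi * (m \<bullet> x)) = (\<Sum>\<^sub>\<infinity>k\<in>int_lattice. ift v k * cis (2 * pi * ((m - k) \<bullet> x)))"
        unfolding V2_def infsum_cmult_left'[symmetric]
        by (intro infsum_cong) (simp add: mult.assoc cis_mult inner_diff_left algebra_simps)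
      then show "indicator unit_cell x *\<^sub>R (V2 x * cis (2 * pi * (m \<bullet> x)))
        = (\<Sum>\<^sub>\<infinity>k\<in>int_lattice. indicator unit_cell x *\<^sub>R (ift v k * cis (2 * pi * ((m - k) \<bullet> x))))"
        by (simp add: indicator_def)
    qed
    also have "\<dots> = (\<Sum>\<^sub>\<infinity>k\<in>int_lattice. LBINT x. indicator unit_cell x *\<^sub>R (ift v k * cis (2 * pi * ((m - k) \<bullet> x))))"
    proof (rule integral_infsum_eq[OF countable_int_lattice])
      show "(\<Sum>\<^sub>\<infinity>k\<in>int_lattice. NNINT x. ennreal (norm (indicator unit_cell x *\<^sub>R (ift v k * cis (2 * pi * ((m - k) \<bullet> x)))))) < \<infinity>"
        unfolding nk using summ by (simp add: abs_summable_ennreal_iff)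
    qed measurable
    also have "\<dots> = (\<Sum>\<^sub>\<infinity>k\<in>int_lattice. if k = m then ift v m else 0)"
    proof (rule infsum_cong)
      fix k :: "real ^ 'd" assume k: "k \<in> int_lattice"
      have "(LBINT x. indicator unit_cell x *\<^sub>R (ift v k * cis (2 * pi * ((m - k) \<bullet> x))))
        = ift v k * (LBINT x. indicator unit_cell x *\<^sub>R cis (2 * pi * ((m - k) \<bullet> x)))"
        by (subst integral_mult_right_zero[symmetric]) (simp add: scaleR_conv_of_real mult_ac)
      then show "(LBINT x. indicator unit_cell x *\<^sub>R (ift v k * cis (2 * pi * ((m - k) \<bullet> x)))) = (if k = m then ift v m else 0)"
        using integral_cell_cis[OF int_lattice_diff[OF m k]] by auto
    qed
    also have "\<dots> = (\<Sum>\<^sub>\<infinity>k\<in>{m}. if k = m then ift v m else 0)"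
      by (rule infsum_cong_neutral) (use m in auto)
    finally show "(LBINT x. indicator unit_cell x *\<^sub>R (V2 x * cis (2 * pi * (m \<bullet> x)))) = ift v m" by simp
  qed
  have "cell_orth (\<lambda>x. V1 x - V2 x)"
    unfolding cell_orth_def
  proof (intro conjI ballI)
    show "continuous_on UNIV (\<lambda>x. V1 x - V2 x)" by (intro continuous_intros c1 c2)
    fix m :: "real ^ 'd" assume m: "m \<in> int_lattice"
    have i: "integrable lborel (\<lambda>x. indicator unit_cell x *\<^sub>R (V1 x * cis (2 * pi * (m \<bullet> x))))"
      "integrable lborel (\<lambda>x. indicator unit_cell x *\<^sub>R (V2 x * cis (2 * pi * (m \<bullet> x))))"
      by (intro integrable_unit_cell continuous_intros c1 c2)+
    show "(LBINT x. indicator unit_cell x *\<^sub>R ((V1 x - V2 x) * cis (2 * pi * (m \<bullet> x)))) = 0"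
      using Bochner_Integration.integral_diff[OF i] by (simp add: orth[OF m] left_diff_distrib scaleR_diff_right)
  qed
  then have "V1 \<xi> - V2 \<xi> = 0"
  proof (rule fourier_series_unique)
    fix x l :: "real ^ 'd" assume l: "l \<in> int_lattice"
    have "V1 (x + l) = V1 x"
      unfolding V1_def using infsum_lattice_shift[OF l, of "\<lambda>k. v (x + k)"] by (simp add: add_ac)
    moreover have "V2 (x + l) = V2 x"
      unfolding V2_def
    proof (rule infsum_cong)
      fix k :: "real ^ 'd" assume "k \<in> int_lattice"
      from cis_lattice_periodic[OF this l, of x]
      show "ift v k * cis (- (2 * pi * (k \<bullet> (x + l)))) = ift v k * cis (- (2 * pi * (k \<bullet> x)))"
        by (simp flip: cis_inverse)
    qed
    ultimately show "V1 (x + l) - V2 (x + l) = V1 x - V2 x" by simp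
  qed
  then show ?thesis by (simp add: V1_def V2_def)
qed

section \<open>The Fourier transform of a sampling series\<close>

lemma borel_measurable_infsum_complex:
  fixes f :: "'b \<Rightarrow> 'a \<Rightarrow> complex"
  assumes K: "countable K" and f [measurable]: "\<And>k. k \<in> K \<Longrightarrow> f k \<in> borel_measurable M"
  shows "(\<lambda>x. \<Sum>\<^sub>\<infinity>k\<in>K. f k x) \<in> borel_measurable M"
proof -
  let ?A = "to_nat_on K ` K"
  define g where "g n x = (if n \<in> ?A then f (from_nat_into K n) x else 0)" for n x
  have [measurable]: "g n \<in> borel_measurable M" for n
  proof (cases "n \<in> ?A")
    case True
    then have "from_nat_into K n \<in> K" using K by auto
    then show ?thesis using f True by (simp add: g_def[abs_def])
  qed (auto simp: g_def[abs_def])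
  have [measurable]: "(\<lambda>x. \<Sum>\<^sub>\<infinity>k\<in>K. ennreal (norm (f k x))) \<in> borel_measurable M"
    by (intro borel_measurable_infsum_ennreal K) simp
  have "(\<Sum>\<^sub>\<infinity>k\<in>K. f k x) = (if (\<Sum>\<^sub>\<infinity>k\<in>K. ennreal (norm (f k x))) < \<infinity> then (\<Sum>n. g n x) else 0)" for x
  proof (cases "(\<Sum>\<^sub>\<infinity>k\<in>K. ennreal (norm (f k x))) < \<infinity>")
    case True
    then have "(\<lambda>k. f k x) summable_on K"
      by (simp add: summable_on_iff_abs_summable_on_complex abs_summable_ennreal_iff)
    then have "(\<lambda>n. g n x) summable_on UNIV"
      using \<open>(\<lambda>k. f k x) summable_on K\<close> infsum_countable_eq(2)[OF K, of "\<lambda>k. f k x"] by (simp add: g_def)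
    then show ?thesis
      using True infsum_countable_eq(1)[OF K, of "\<lambda>k. f k x"] infsum_banach_suminf[of "\<lambda>n. g n x"]
      by (simp add: g_def)
  next
    case False
    then have "\<not> (\<lambda>k. f k x) summable_on K"
      by (simp add: summable_on_iff_abs_summable_on_complex abs_summable_ennreal_iff)
    then show ?thesis
      using False by (simp add: infsum_not_exists)
  qed
  then show ?thesis by simp
qed

lemma lattice_gk_bound:
  assumes t: "0 < t"
  obtains C where "0 < C" "\<And>z :: real ^ 'd. (\<Sum>\<^sub>\<infinity>k\<in>int_lattice. ennreal (gk t (z + k))) \<le> ennreal C"
proof -
  obtain C where C: "0 < C" "\<And>z :: real ^ 'd. gk t z \<le> C * wt (real CARD('d) + 1) z"
    using gauss_le_wt[OF t] by metis
  obtain D where D: "0 < D" "\<And>\<xi> :: real ^ 'd. (\<Sum>\<^sub>\<infinity>l\<in>int_lattice. ennreal (wt (real CARD('d) + 1) (\<xi> + l))) \<le> ennreal D"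
    using lattice_wt_bound[where 'd = 'd, of "real CARD('d) + 1"] by auto
  have "(\<Sum>\<^sub>\<infinity>k\<in>int_lattice. ennreal (gk t (z + k))) \<le> ennreal (C * D)" for z :: "real ^ 'd"
  proof -
    have "(\<Sum>\<^sub>\<infinity>k\<in>int_lattice. ennreal (gk t (z + k))) \<le> (\<Sum>\<^sub>\<infinity>k\<in>int_lattice. ennreal C * ennreal (wt (real CARD('d) + 1) (z + k)))"
      using C by (intro infsum_ennreal_mono) (simp add: ennreal_leI flip: ennreal_mult)
    also have "\<dots> = ennreal C * (\<Sum>\<^sub>\<infinity>k\<in>int_lattice. ennreal (wt (real CARD('d) + 1) (z + k)))"
      by (rule infsum_ennreal_cmult)
    also have "\<dots> \<le> ennreal C * ennreal D"
      by (intro mult_left_mono D) auto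
    finally show ?thesis using C D by (simp add: ennreal_mult)
  qed
  with C D that[of "C * D"] show ?thesis by simp
qed

lemma conv_gk_ift:
  fixes A :: "'a :: euclidean_space \<Rightarrow> complex"
  assumes A: "integrable lborel A" and t: "0 < t"
  shows "conv_gk (ift A) t x = ift (\<lambda>\<xi>. A \<xi> * complex_of_real (gh t \<xi>)) x"
proof -
  have [measurable]: "A \<in> borel_measurable borel"
    using borel_measurable_integrable[OF A] by simp
  define I where "I = (NNINT \<xi>. ennreal (norm (A \<xi>)))"
  have I: "I < \<infinity>" using A by (simp add: I_def integrable_iff_bounded)
  have "conv_gk (ift A) t x = (LBINT y. LBINT \<xi>. A \<xi> * cis (2 * pi * (y \<bullet> \<xi>)) * complex_of_real (gk t (x - y)))"
    by (simp add: conv_gk_def ift_def)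
  also have "\<dots> = (LBINT \<xi>. LBINT y. A \<xi> * cis (2 * pi * (y \<bullet> \<xi>)) * complex_of_real (gk t (x - y)))"
  proof (rule integral_swap)
    have "(NNINT y. NNINT \<xi>. ennreal (norm (A \<xi> * cis (2 * pi * (y \<bullet> \<xi>)) * complex_of_real (gk t (x - y)))))
       = (NNINT y. I * ennreal (gk t (x - y)))"
      using t by (simp add: norm_mult ennreal_mult nn_integral_multc I_def)
    also have "\<dots> = I * (NNINT y. ennreal (gk t (x - y)))"
      by (rule nn_integral_cmult) measurable
    also have "(NNINT y. ennreal (gk t (x - y))) = 1"
      using nn_integral_lborel_reflect[of "\<lambda>y. ennreal (gk t y)" x] nn_integral_gk[OF t, where 'a = 'a] by simp
    finally show "(NNINT y. NNINT \<xi>. ennreal (norm (A \<xi> * cis (2 * pi * (y \<bullet> \<xi>)) * complex_of_real (gk t (x - y))))) < \<infinity>"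
      using I by simp
  qed measurable
  also have "\<dots> = (LBINT \<xi>. A \<xi> * complex_of_real (gh t \<xi>) * cis (2 * pi * (x \<bullet> \<xi>)))"
  proof (rule Bochner_Integration.integral_cong[OF refl])
    fix \<xi>
    have "(LBINT y. A \<xi> * cis (2 * pi * (y \<bullet> \<xi>)) * complex_of_real (gk t (x - y)))
       = (LBINT y. A \<xi> * cis (2 * pi * ((x - y) \<bullet> \<xi>)) * complex_of_real (gk t (x - (x - y))))"
      by (rule integral_lborel_reflect[symmetric]) measurable
    also have "\<dots> = (LBINT y. (A \<xi> * cis (2 * pi * (x \<bullet> \<xi>))) * (complex_of_real (gk t y) * cis (2 * pi * (y \<bullet> - \<xi>))))"
    proof (rule Bochner_Integration.integral_cong[OF refl])
      fix y
      have "cis (2 * pi * ((x - y) \<bullet> \<xi>)) = cis (2 * pi * (x \<bullet> \<xi>)) * cis (2 * pi * (y \<bullet> - \<xi>))"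
        by (simp add: cis_mult inner_diff_left right_diff_distrib)
      then show "A \<xi> * cis (2 * pi * ((x - y) \<bullet> \<xi>)) * complex_of_real (gk t (x - (x - y)))
        = (A \<xi> * cis (2 * pi * (x \<bullet> \<xi>))) * (complex_of_real (gk t y) * cis (2 * pi * (y \<bullet> - \<xi>)))"
        by simp
    qed
    also have "\<dots> = (A \<xi> * cis (2 * pi * (x \<bullet> \<xi>))) * complex_of_real (gh t (- \<xi>))"
      by (simp only: integral_mult_right_zero gauss_fourier(2)[OF t])
    finally show "(LBINT y. A \<xi> * cis (2 * pi * (y \<bullet> \<xi>)) * complex_of_real (gk t (x - y)))
       = A \<xi> * complex_of_real (gh t \<xi>) * cis (2 * pi * (x \<bullet> \<xi>))" by simp
  qed
  finally show ?thesis by (simp add: ift_def)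
qed

lemma conv_gk_fourier:
  fixes \<phi> :: "'a :: euclidean_space \<Rightarrow> complex"
  assumes \<phi>: "integrable lborel \<phi>" and t: "0 < t"
  shows "conv_gk \<phi> t z = ift (\<lambda>\<xi>. ift \<phi> (- \<xi>) * complex_of_real (gh t \<xi>)) z"
proof -
  have [measurable]: "\<phi> \<in> borel_measurable borel"
    using borel_measurable_integrable[OF \<phi>] by simp
  define I where "I = (NNINT \<xi>. ennreal (norm (\<phi> \<xi>)))"
  have I: "I < \<infinity>" using \<phi> by (simp add: I_def integrable_iff_bounded)
  have gI: "(\<integral>\<^sup>+\<xi>. ennreal (gh t \<xi>) \<partial>(lborel :: 'a measure)) < \<infinity>"
    using integrable_gh[OF t, where 'a = 'a] by (simp add: integrable_iff_bounded)
  have "ift (\<lambda>\<xi>. ift \<phi> (- \<xi>) * complex_of_real (gh t \<xi>)) z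
    = (LBINT \<xi>. LBINT y. \<phi> y * cis (2 * pi * (- \<xi> \<bullet> y)) * complex_of_real (gh t \<xi>) * cis (2 * pi * (z \<bullet> \<xi>)))"
    by (simp add: ift_def)
  also have "\<dots> = (LBINT y. LBINT \<xi>. \<phi> y * cis (2 * pi * (- \<xi> \<bullet> y)) * complex_of_real (gh t \<xi>) * cis (2 * pi * (z \<bullet> \<xi>)))"
  proof (rule integral_swap)
    have "(NNINT \<xi>. NNINT y. ennreal (norm (\<phi> y * cis (2 * pi * (- \<xi> \<bullet> y)) * complex_of_real (gh t \<xi>) * cis (2 * pi * (z \<bullet> \<xi>)))))
      = (\<integral>\<^sup>+\<xi>. I * ennreal (gh t \<xi>) \<partial>(lborel :: 'a measure))"
      by (simp add: norm_mult ennreal_mult nn_integral_multc I_def)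
    also have "\<dots> = I * (\<integral>\<^sup>+\<xi>. ennreal (gh t \<xi>) \<partial>(lborel :: 'a measure))"
      by (rule nn_integral_cmult) measurable
    finally show "(NNINT \<xi>. NNINT y. ennreal (norm (\<phi> y * cis (2 * pi * (- \<xi> \<bullet> y)) * complex_of_real (gh t \<xi>) * cis (2 * pi * (z \<bullet> \<xi>))))) < \<infinity>"
      using I gI by (simp add: ennreal_mult_less_top)
  qed measurable
  also have "\<dots> = (LBINT y. \<phi> y * complex_of_real (gk t (z - y)))"
  proof (rule Bochner_Integration.integral_cong[OF refl])
    fix y
    have "(LBINT \<xi>. \<phi> y * cis (2 * pi * (- \<xi> \<bullet> y)) * complex_of_real (gh t \<xi>) * cis (2 * pi * (z \<bullet> \<xi>)))
      = (LBINT \<xi>. \<phi> y * (complex_of_real (gh t \<xi>) * cis (2 * pi * ((z - y) \<bullet> \<xi>))))"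
    proof (rule Bochner_Integration.integral_cong[OF refl])
      fix \<xi>
      have "cis (2 * pi * ((z - y) \<bullet> \<xi>)) = cis (2 * pi * (- \<xi> \<bullet> y)) * cis (2 * pi * (z \<bullet> \<xi>))"
        by (simp add: cis_mult inner_diff_left right_diff_distrib inner_commute[of \<xi>])
      then show "\<phi> y * cis (2 * pi * (- \<xi> \<bullet> y)) * complex_of_real (gh t \<xi>) * cis (2 * pi * (z \<bullet> \<xi>))
         = \<phi> y * (complex_of_real (gh t \<xi>) * cis (2 * pi * ((z - y) \<bullet> \<xi>)))"
        by (simp only: mult_ac)
    qed
    also have "\<dots> = \<phi> y * complex_of_real (gk t (z - y))"
      by (simp only: integral_mult_right_zero gauss_fourier_inverse(2)[OF t])
    finally show "(LBINT \<xi>. \<phi> y * cis (2 * pi * (- \<xi> \<bullet> y)) * complex_of_real (gh t \<xi>) * cis (2 * pi * (z \<bullet> \<xi>)))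
      = \<phi> y * complex_of_real (gk t (z - y))" .
  qed
  finally show ?thesis by (simp add: conv_gk_def)
qed

section \<open>The sampling series and the periodised spectrum\<close>

context
  fixes \<phi> B :: "real ^ 'd \<Rightarrow> complex"
  assumes \<phi>: "integrable lborel \<phi>" and B: "integrable lborel B"
begin

text \<open>In the application B is \<open>mu\<close> times the dilated spectrum of f, so that
  \<open>ift B (- k)\<close> is the average sampled at the k-th node.\<close>

definition sample_series :: "real ^ 'd \<Rightarrow> complex" where
  "sample_series x = (\<Sum>\<^sub>\<infinity>k\<in>int_lattice. ift B (- k) * \<phi> (x + k))"

definition periodization :: "real ^ 'd \<Rightarrow> complex" where
  "periodization \<xi> = (\<Sum>\<^sub>\<infinity>l\<in>int_lattice. B (\<xi> + l))"

lemma borel_measurable_sampled [measurable]: "\<phi> \<in> borel_measurable borel" "B \<in> borel_measurable borel"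
  using borel_measurable_integrable[OF \<phi>] borel_measurable_integrable[OF B] by simp_all

lemma borel_measurable_sample_series [measurable]: "sample_series \<in> borel_measurable borel"
  unfolding sample_series_def[abs_def] by (rule borel_measurable_infsum_complex) auto

lemma borel_measurable_periodization [measurable]: "periodization \<in> borel_measurable borel"
  unfolding periodization_def[abs_def] by (rule borel_measurable_infsum_complex) auto

private lemma nn_B: "(NNINT \<xi>. ennreal (norm (B \<xi>))) < \<infinity>"
  using B by (simp add: integrable_iff_bounded)

private lemma nn_\<phi>: "(NNINT x. ennreal (norm (\<phi> x))) < \<infinity>"
  using \<phi> by (simp add: integrable_iff_bounded)

text \<open>A substitution moves the lattice shift from \<phi> to g, whose lattice sums are bounded
  uniformly; integrability of \<phi> does the rest. It serves both for g a weight and for g a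
  Gaussian.\<close>

lemma sum_sampled_weight_finite:
  assumes g [measurable]: "g \<in> borel_measurable borel"
    and C: "\<And>z. (\<Sum>\<^sub>\<infinity>k\<in>int_lattice. ennreal (g (z + k))) \<le> ennreal C"
  shows "(\<Sum>\<^sub>\<infinity>k\<in>int_lattice. NNINT y. ennreal (norm (\<phi> (y + k))) * ennreal (g (x - y))) < \<infinity>"
proof -
  have "(\<Sum>\<^sub>\<infinity>k\<in>int_lattice. NNINT y. ennreal (norm (\<phi> (y + k))) * ennreal (g (x - y)))
     = (\<Sum>\<^sub>\<infinity>k\<in>int_lattice. NNINT y. ennreal (norm (\<phi> y)) * ennreal (g ((x - y) + k)))"
  proof (rule infsum_cong)
    fix k :: "real ^ 'd"
    show "(NNINT y. ennreal (norm (\<phi> (y + k))) * ennreal (g (x - y)))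
       = (NNINT y. ennreal (norm (\<phi> y)) * ennreal (g ((x - y) + k)))"
      using nn_integral_lborel_shift[of "\<lambda>y. ennreal (norm (\<phi> y)) * ennreal (g ((x - y) + k))" k] by simp
  qed
  also have "\<dots> = (NNINT y. (\<Sum>\<^sub>\<infinity>k\<in>int_lattice. ennreal (norm (\<phi> y)) * ennreal (g ((x - y) + k))))"
    by (rule nn_integral_infsum[symmetric]) auto
  also have "\<dots> \<le> (NNINT y. ennreal (norm (\<phi> y)) * ennreal C)"
    unfolding infsum_ennreal_cmult by (intro nn_integral_mono mult_left_mono C) auto
  also have "\<dots> = (NNINT y. ennreal (norm (\<phi> y))) * ennreal C"
    by (rule nn_integral_multc) measurable
  also have "\<dots> < \<infinity>" using nn_\<phi> by (simp add: ennreal_mult_less_top)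
  finally show ?thesis .
qed

text \<open>Only boundedness of the samples is used, by the L_1 norm of B. The series therefore
  behaves like a periodised |\<phi>|, which is integrable against a weight but in general not over
  the whole space.\<close>

lemma sample_series_weighted:
  assumes b: "real CARD('d) < b"
  shows "(NNINT x. ennreal (norm (sample_series x) * wt b x)) < \<infinity>"
proof -
  define I where "I = (NNINT \<xi>. ennreal (norm (B \<xi>)))"
  obtain C where C: "0 < C" "\<And>\<xi> :: real ^ 'd. (\<Sum>\<^sub>\<infinity>l\<in>int_lattice. ennreal (wt b (\<xi> + l))) \<le> ennreal C"
    using lattice_wt_bound[OF b] by blast
  have "(NNINT x. ennreal (norm (sample_series x) * wt b x))
     \<le> (NNINT x. (\<Sum>\<^sub>\<infinity>k\<in>int_lattice. I * (ennreal (norm (\<phi> (x + k))) * ennreal (wt b (0 - x)))))"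
  proof (rule nn_integral_mono)
    fix x
    have "ennreal (norm (sample_series x)) \<le> (\<Sum>\<^sub>\<infinity>k\<in>int_lattice. ennreal (norm (ift B (- k) * \<phi> (x + k))))"
      unfolding sample_series_def by (rule norm_infsum_le_ennreal)
    also have "\<dots> \<le> (\<Sum>\<^sub>\<infinity>k\<in>int_lattice. I * ennreal (norm (\<phi> (x + k))))"
      unfolding norm_mult ennreal_mult[OF norm_ge_zero norm_ge_zero] I_def
      by (intro infsum_ennreal_mono mult_right_mono norm_ift_le) auto
    finally have "ennreal (norm (sample_series x)) * ennreal (wt b x) \<le> (\<Sum>\<^sub>\<infinity>k\<in>int_lattice. I * ennreal (norm (\<phi> (x + k)))) * ennreal (wt b x)"
      by (rule mult_right_mono) simp
    also have "\<dots> = (\<Sum>\<^sub>\<infinity>k\<in>int_lattice. I * (ennreal (norm (\<phi> (x + k))) * ennreal (wt b (0 - x))))"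
      by (subst mult.commute, subst infsum_ennreal_cmult[symmetric]) (simp add: mult_ac)
    finally show "ennreal (norm (sample_series x) * wt b x) \<le> (\<Sum>\<^sub>\<infinity>k\<in>int_lattice. I * (ennreal (norm (\<phi> (x + k))) * ennreal (wt b (0 - x))))"
      by (simp add: ennreal_mult)
  qed
  also have "\<dots> = (\<Sum>\<^sub>\<infinity>k\<in>int_lattice. NNINT x. I * (ennreal (norm (\<phi> (x + k))) * ennreal (wt b (0 - x))))"
    by (rule nn_integral_infsum) auto
  also have "\<dots> = I * (\<Sum>\<^sub>\<infinity>k\<in>int_lattice. NNINT x. ennreal (norm (\<phi> (x + k))) * ennreal (wt b (0 - x)))"
    unfolding infsum_ennreal_cmult[symmetric] by (intro infsum_cong nn_integral_cmult) measurable
  also have "\<dots> < \<infinity>"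
    using sum_sampled_weight_finite[of "wt b" C 0] C(2) nn_B by (simp add: ennreal_mult_less_top I_def)
  finally show ?thesis .
qed

text \<open>After Gaussian smoothing all sums and integrals converge absolutely. Writing each sample
  as an integral of B over \<xi> and exchanging, the sum over k for fixed \<xi> is evaluated by
  Poisson summation; the resulting lattice shifts are then moved onto B, which produces its
  periodisation.\<close>

lemma sample_series_conv:
  assumes t: "0 < t"
  shows "integrable lborel (\<lambda>\<xi>. ift \<phi> (- \<xi>) * periodization \<xi> * complex_of_real (gh t \<xi>))"
    and "conv_gk sample_series t x = ift (\<lambda>\<xi>. ift \<phi> (- \<xi>) * periodization \<xi> * complex_of_real (gh t \<xi>)) x"
proof -
  note [measurable] = borel_measurable_ift[OF \<phi>]
  define b where "b = real CARD('d) + 1"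
  have b: "real CARD('d) < b" by (simp add: b_def)
  define IB where "IB = (NNINT \<xi>. ennreal (norm (B \<xi>)))"
  define I\<phi> where "I\<phi> = (NNINT \<xi>. ennreal (norm (\<phi> \<xi>)))"
  have I: "IB < \<infinity>" "I\<phi> < \<infinity>" using nn_B nn_\<phi> by (simp_all add: IB_def I\<phi>_def)
  obtain C where C: "0 < C" "\<And>z :: real ^ 'd. (\<Sum>\<^sub>\<infinity>k\<in>int_lattice. ennreal (gk t (z + k))) \<le> ennreal C"
    using lattice_gk_bound[OF t] by blast
  have fin: "(\<Sum>\<^sub>\<infinity>k\<in>int_lattice. NNINT y. ennreal (norm (\<phi> (y + k))) * ennreal (gk t (x - y))) < \<infinity>" for x
    by (rule sum_sampled_weight_finite[OF _ C(2)]) measurable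
  \<comment> \<open>Frequency integrand of the smoothed \<phi>. It is continuous and decays like the
    Gaussian, as Poisson summation requires, and \<open>ift (v x) k\<close> is the Gaussian mean of
    \<phi> at x + k.\<close>
  define v where "v x \<xi> = ift \<phi> (- \<xi>) * complex_of_real (gh t \<xi>) * cis (2 * pi * (x \<bullet> \<xi>))" for x \<xi>
  have [measurable]: "v x \<in> borel_measurable borel" for x
    unfolding v_def[abs_def] by measurable
  have v_cont: "continuous_on UNIV (v x)" for x
    unfolding v_def[abs_def] gh_def
    by (intro continuous_intros continuous_on_compose2[OF continuous_ift[OF \<phi>]]) auto
  obtain E where E: "0 < E" "\<And>z :: real ^ 'd. gk (1 / t) z \<le> E * wt b z"
    using gauss_le_wt[of "1 / t"] t by (metis divide_pos_pos zero_less_one)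
  define D where "D = enn2real I\<phi> * (E / t ^ CARD('d))"
  have D0: "D \<ge> 0" using E t by (simp add: D_def)
  have v_decay: "norm (v x \<xi>) \<le> D * wt b \<xi>" for x \<xi>
  proof -
    have "ennreal (norm (ift \<phi> (- \<xi>))) \<le> I\<phi>" unfolding I\<phi>_def by (rule norm_ift_le)
    then have 1: "norm (ift \<phi> (- \<xi>)) \<le> enn2real I\<phi>"
      using I by (cases I\<phi>) auto
    have 2: "gh t \<xi> \<le> E / t ^ CARD('d) * wt b \<xi>"
      using t E(2)[of \<xi>] by (simp add: gh_eq_gk divide_right_mono)
    have "norm (v x \<xi>) = norm (ift \<phi> (- \<xi>)) * gh t \<xi>" by (simp add: v_def norm_mult)
    also have "\<dots> \<le> enn2real I\<phi> * (E / t ^ CARD('d) * wt b \<xi>)"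
      by (intro mult_mono 1 2) auto
    finally show ?thesis by (simp add: D_def)
  qed
  have ift_v: "ift (v x) k = conv_gk \<phi> t (x + k)" for x k
    unfolding conv_gk_fourier[OF \<phi> t] unfolding ift_def[of _ k] ift_def[of _ "x + k"]
    by (intro Bochner_Integration.integral_cong refl)
       (simp add: v_def mult.assoc cis_mult inner_add_left distrib_left)
  have conv_le: "ennreal (norm (conv_gk \<phi> t (x + k))) \<le> (NNINT y. ennreal (norm (\<phi> (y + k))) * ennreal (gk t (x - y)))" for x k
  proof -
    have "ennreal (norm (conv_gk \<phi> t (x + k))) \<le> (NNINT y. ennreal (norm (\<phi> y * complex_of_real (gk t (x + k - y)))))"
      unfolding conv_gk_def by (rule norm_integral_le_nn_integral)
    also have "\<dots> = (NNINT y. ennreal (norm (\<phi> (y + k))) * ennreal (gk t (x - y)))"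
      using nn_integral_lborel_shift[of "\<lambda>y. ennreal (norm (\<phi> y * complex_of_real (gk t (x + k - y))))" k] t
      by (simp add: norm_mult ennreal_mult add_diff_add)
    finally show ?thesis .
  qed
  have summ_U: "(\<lambda>k. norm (conv_gk \<phi> t (x + k))) summable_on int_lattice" for x
    unfolding abs_summable_ennreal_iff
    by (rule le_less_trans[OF infsum_ennreal_mono[OF conv_le] fin])
  obtain W where W: "0 < W" "\<And>\<xi> :: real ^ 'd. (\<Sum>\<^sub>\<infinity>l\<in>int_lattice. ennreal (wt b (\<xi> + l))) \<le> ennreal W"
    using lattice_wt_bound[OF b] by blast
  have sum_v: "(\<Sum>\<^sub>\<infinity>l\<in>int_lattice. ennreal (norm (v x (\<xi> + l)))) \<le> ennreal D * ennreal W" for x \<xi>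
  proof -
    have "(\<Sum>\<^sub>\<infinity>l\<in>int_lattice. ennreal (norm (v x (\<xi> + l)))) \<le> (\<Sum>\<^sub>\<infinity>l\<in>int_lattice. ennreal D * ennreal (wt b (\<xi> + l)))"
      using v_decay D0 by (intro infsum_ennreal_mono) (simp add: ennreal_leI flip: ennreal_mult)
    also have "\<dots> \<le> ennreal D * ennreal W"
      unfolding infsum_ennreal_cmult by (intro mult_left_mono W) auto
    finally show ?thesis .
  qed
  have finv1: "(\<Sum>\<^sub>\<infinity>l\<in>int_lattice. NNINT \<xi>. ennreal (norm (B \<xi> * v x (\<xi> + l)))) < \<infinity>" for x
  proof -
    have "(\<Sum>\<^sub>\<infinity>l\<in>int_lattice. NNINT \<xi>. ennreal (norm (B \<xi> * v x (\<xi> + l))))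
      = (NNINT \<xi>. (\<Sum>\<^sub>\<infinity>l\<in>int_lattice. ennreal (norm (B \<xi>)) * ennreal (norm (v x (\<xi> + l)))))"
      by (subst nn_integral_infsum) (auto simp: norm_mult ennreal_mult)
    also have "\<dots> \<le> (NNINT \<xi>. ennreal (norm (B \<xi>)) * (ennreal D * ennreal W))"
      unfolding infsum_ennreal_cmult by (intro nn_integral_mono mult_left_mono sum_v) auto
    also have "\<dots> = IB * (ennreal D * ennreal W)"
      unfolding IB_def by (rule nn_integral_multc) measurable
    also have "\<dots> < \<infinity>" using I by (simp add: ennreal_mult_less_top)
    finally show ?thesis .
  qed
  have finv2: "(\<Sum>\<^sub>\<infinity>l\<in>int_lattice. NNINT \<xi>. ennreal (norm (B (\<xi> + l) * v x \<xi>))) < \<infinity>" for x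
  proof -
    have "(\<Sum>\<^sub>\<infinity>l\<in>int_lattice. NNINT \<xi>. ennreal (norm (B (\<xi> + l) * v x \<xi>)))
       = (\<Sum>\<^sub>\<infinity>l\<in>int_lattice. NNINT \<xi>. ennreal (norm (B \<xi> * v x (\<xi> + - l))))"
    proof (rule infsum_cong)
      fix l :: "real ^ 'd"
      show "(NNINT \<xi>. ennreal (norm (B (\<xi> + l) * v x \<xi>))) = (NNINT \<xi>. ennreal (norm (B \<xi> * v x (\<xi> + - l))))"
        using nn_integral_lborel_shift[of "\<lambda>\<xi>. ennreal (norm (B \<xi> * v x (\<xi> + - l)))" l] by simp
    qed
    also have "\<dots> = (\<Sum>\<^sub>\<infinity>l\<in>int_lattice. NNINT \<xi>. ennreal (norm (B \<xi> * v x (\<xi> + l))))"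
      by (rule infsum_lattice_uminus)
    finally show ?thesis using finv1 by simp
  qed
  have "integrable lborel (\<lambda>\<xi>. \<Sum>\<^sub>\<infinity>l\<in>int_lattice. B (\<xi> + l) * v 0 \<xi>)"
    by (rule integrable_infsum[OF countable_int_lattice _ finv2]) measurable
  then show "integrable lborel (\<lambda>\<xi>. ift \<phi> (- \<xi>) * periodization \<xi> * complex_of_real (gh t \<xi>))"
    by (simp add: infsum_cmult_left' periodization_def v_def mult_ac)
  have "conv_gk sample_series t x = (LBINT y. (\<Sum>\<^sub>\<infinity>k\<in>int_lattice. ift B (- k) * \<phi> (y + k) * complex_of_real (gk t (x - y))))"
    by (simp add: conv_gk_def sample_series_def infsum_cmult_left')
  also have "\<dots> = (\<Sum>\<^sub>\<infinity>k\<in>int_lattice. LBINT y. ift B (- k) * \<phi> (y + k) * complex_of_real (gk t (x - y)))"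
  proof (rule integral_infsum_eq[OF countable_int_lattice])
    have "(\<Sum>\<^sub>\<infinity>k\<in>int_lattice. NNINT y. ennreal (norm (ift B (- k) * \<phi> (y + k) * complex_of_real (gk t (x - y)))))
      \<le> (\<Sum>\<^sub>\<infinity>k\<in>int_lattice. IB * (NNINT y. ennreal (norm (\<phi> (y + k))) * ennreal (gk t (x - y))))"
    proof (rule infsum_ennreal_mono)
      fix k :: "real ^ 'd"
      have "(NNINT y. ennreal (norm (ift B (- k) * \<phi> (y + k) * complex_of_real (gk t (x - y)))))
        = (NNINT y. ennreal (norm (ift B (- k))) * (ennreal (norm (\<phi> (y + k))) * ennreal (gk t (x - y))))"
        using t by (simp add: norm_mult ennreal_mult mult.assoc)
      also have "\<dots> = ennreal (norm (ift B (- k))) * (NNINT y. ennreal (norm (\<phi> (y + k))) * ennreal (gk t (x - y)))"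
        by (rule nn_integral_cmult) measurable
      also have "\<dots> \<le> IB * (NNINT y. ennreal (norm (\<phi> (y + k))) * ennreal (gk t (x - y)))"
        unfolding IB_def by (intro mult_right_mono norm_ift_le) auto
      finally show "(NNINT y. ennreal (norm (ift B (- k) * \<phi> (y + k) * complex_of_real (gk t (x - y)))))
        \<le> IB * (NNINT y. ennreal (norm (\<phi> (y + k))) * ennreal (gk t (x - y)))" .
    qed
    also have "\<dots> < \<infinity>"
      unfolding infsum_ennreal_cmult using fin[of x] I by (simp add: ennreal_mult_less_top)
    finally show "(\<Sum>\<^sub>\<infinity>k\<in>int_lattice. NNINT y. ennreal (norm (ift B (- k) * \<phi> (y + k) * complex_of_real (gk t (x - y))))) < \<infinity>" .
  qed measurable
  also have "\<dots> = (\<Sum>\<^sub>\<infinity>k\<in>int_lattice. LBINT \<xi>. B \<xi> * (conv_gk \<phi> t (x + k) * cis (- (2 * pi * (k \<bullet> \<xi>)))))"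
  proof (rule infsum_cong)
    fix k :: "real ^ 'd"
    have "(LBINT y. ift B (- k) * \<phi> (y + k) * complex_of_real (gk t (x - y))) = ift B (- k) * (LBINT y. \<phi> (y + k) * complex_of_real (gk t (x - y)))"
      by (simp only: mult.assoc integral_mult_right_zero)
    also have "(LBINT y. \<phi> (y + k) * complex_of_real (gk t (x - y))) = conv_gk \<phi> t (x + k)"
      unfolding conv_gk_def
      using integral_lborel_shift[of "\<lambda>y. \<phi> y * complex_of_real (gk t (x + k - y))" k] by (simp add: add_diff_add)
    also have "ift B (- k) * conv_gk \<phi> t (x + k) = (LBINT \<xi>. B \<xi> * (conv_gk \<phi> t (x + k) * cis (- (2 * pi * (k \<bullet> \<xi>)))))"
      unfolding ift_def by (subst integral_mult_left_zero[symmetric]) (simp add: mult_ac)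
    finally show "(LBINT y. ift B (- k) * \<phi> (y + k) * complex_of_real (gk t (x - y)))
      = (LBINT \<xi>. B \<xi> * (conv_gk \<phi> t (x + k) * cis (- (2 * pi * (k \<bullet> \<xi>)))))" .
  qed
  also have "\<dots> = (LBINT \<xi>. (\<Sum>\<^sub>\<infinity>k\<in>int_lattice. B \<xi> * (conv_gk \<phi> t (x + k) * cis (- (2 * pi * (k \<bullet> \<xi>))))))"
  proof (rule integral_infsum_eq[OF countable_int_lattice, symmetric])
    have "(\<Sum>\<^sub>\<infinity>k\<in>int_lattice. NNINT \<xi>. ennreal (norm (B \<xi> * (conv_gk \<phi> t (x + k) * cis (- (2 * pi * (k \<bullet> \<xi>)))))))
      = (\<Sum>\<^sub>\<infinity>k\<in>int_lattice. IB * ennreal (norm (conv_gk \<phi> t (x + k))))"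
      by (simp add: norm_mult ennreal_mult nn_integral_multc IB_def)
    also have "\<dots> < \<infinity>"
      unfolding infsum_ennreal_cmult using summ_U[of x] I by (simp add: ennreal_mult_less_top abs_summable_ennreal_iff)
    finally show "(\<Sum>\<^sub>\<infinity>k\<in>int_lattice. NNINT \<xi>. ennreal (norm (B \<xi> * (conv_gk \<phi> t (x + k) * cis (- (2 * pi * (k \<bullet> \<xi>))))))) < \<infinity>" .
  qed measurable
  \<comment> \<open>Poisson summation at each frequency \<xi> of B: the sum over the samples k
    becomes the sum of \<open>v x\<close> over the lattice translates of \<xi>.\<close>
  also have "\<dots> = (LBINT \<xi>. (\<Sum>\<^sub>\<infinity>l\<in>int_lattice. B \<xi> * v x (\<xi> + l)))"
    unfolding infsum_cmult_right'
    using poisson_summation[OF v_cont b v_decay, of x] summ_U[of x] by (simp add: ift_v)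
  also have "\<dots> = (\<Sum>\<^sub>\<infinity>l\<in>int_lattice. LBINT \<xi>. B \<xi> * v x (\<xi> + l))"
    by (rule integral_infsum_eq[OF countable_int_lattice _ finv1]) measurable
  also have "\<dots> = (\<Sum>\<^sub>\<infinity>l\<in>int_lattice. LBINT \<xi>. B (\<xi> + - l) * v x \<xi>)"
  proof (rule infsum_cong)
    fix l :: "real ^ 'd"
    show "(LBINT \<xi>. B \<xi> * v x (\<xi> + l)) = (LBINT \<xi>. B (\<xi> + - l) * v x \<xi>)"
      using integral_lborel_shift[of "\<lambda>\<xi>. B (\<xi> + - l) * v x \<xi>" l] by simp
  qed
  also have "\<dots> = (\<Sum>\<^sub>\<infinity>l\<in>int_lattice. LBINT \<xi>. B (\<xi> + l) * v x \<xi>)"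
    by (rule infsum_lattice_uminus)
  also have "\<dots> = (LBINT \<xi>. (\<Sum>\<^sub>\<infinity>l\<in>int_lattice. B (\<xi> + l) * v x \<xi>))"
    by (rule integral_infsum_eq[OF countable_int_lattice _ finv2, symmetric]) measurable
  also have "\<dots> = ift (\<lambda>\<xi>. ift \<phi> (- \<xi>) * periodization \<xi> * complex_of_real (gh t \<xi>)) x"
    unfolding ift_def[of _ x] infsum_cmult_left' periodization_def[symmetric] v_def
    by (intro Bochner_Integration.integral_cong refl) (simp only: mult_ac)
  finally show "conv_gk sample_series t x = ift (\<lambda>\<xi>. ift \<phi> (- \<xi>) * periodization \<xi> * complex_of_real (gh t \<xi>)) x" .
qed

lemma sampling_error_conv:
  assumes A: "integrable lborel A" and t: "0 < t"
  shows "conv_gk (\<lambda>x. ift A x - sample_series x) t x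
    = ift (\<lambda>\<xi>. (A \<xi> - ift \<phi> (- \<xi>) * periodization \<xi>) * complex_of_real (gh t \<xi>)) x"
proof -
  note [measurable] = borel_measurable_ift[OF A]
  have [measurable]: "A \<in> borel_measurable borel"
    using borel_measurable_integrable[OF A] by simp
  define b where "b = real CARD('d) + 1"
  have b: "real CARD('d) < b" "0 \<le> b" by (simp_all add: b_def)
  have 1: "(NNINT x. ennreal (norm (ift A x) * wt b x)) < \<infinity>"
  proof -
    have "(NNINT x. ennreal (norm (ift A x) * wt b x))
       \<le> (NNINT x :: real ^ 'd. (NNINT \<xi>. ennreal (norm (A \<xi>))) * ennreal (wt b x))"
      by (intro nn_integral_mono) (simp add: ennreal_mult mult_right_mono norm_ift_le)
    also have "\<dots> = (NNINT \<xi>. ennreal (norm (A \<xi>))) * (NNINT x :: real ^ 'd. ennreal (wt b x))"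
      by (rule nn_integral_cmult) measurable
    also have "\<dots> < \<infinity>"
      using A nn_integral_wt_finite[where 'a = "real ^ 'd", of b] b by (simp add: ennreal_mult_less_top integrable_iff_bounded)
    finally show ?thesis .
  qed
  have i1: "integrable lborel (\<lambda>y. ift A y * complex_of_real (gk t (x - y)))"
    by (rule integrable_conv_gk[OF _ b(2) 1 t]) measurable
  have i2: "integrable lborel (\<lambda>y. sample_series y * complex_of_real (gk t (x - y)))"
    by (rule integrable_conv_gk[OF _ b(2) sample_series_weighted[OF b(1)] t]) measurable
  have j1: "integrable lborel (\<lambda>\<xi>. A \<xi> * complex_of_real (gh t \<xi>))"
    by (rule Bochner_Integration.integrable_bound[OF A]) (auto simp: norm_mult mult_left_le)
  have "conv_gk (\<lambda>x. ift A x - sample_series x) t x = conv_gk (ift A) t x - conv_gk sample_series t x"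
    unfolding conv_gk_def using Bochner_Integration.integral_diff[OF i1 i2] by (simp only: left_diff_distrib)
  also have "\<dots> = ift (\<lambda>\<xi>. A \<xi> * complex_of_real (gh t \<xi>)) x - ift (\<lambda>\<xi>. ift \<phi> (- \<xi>) * periodization \<xi> * complex_of_real (gh t \<xi>)) x"
    by (simp only: conv_gk_ift[OF A t] sample_series_conv(2)[OF t])
  also have "\<dots> = ift (\<lambda>\<xi>. (A \<xi> - ift \<phi> (- \<xi>) * periodization \<xi>) * complex_of_real (gh t \<xi>)) x"
    unfolding ift_def[of _ x]
    using Bochner_Integration.integral_diff[OF integrable_mult_cis[OF j1, of x] integrable_mult_cis[OF sample_series_conv(1)[OF t], of x]]
    by (simp only: left_diff_distrib)
  finally show ?thesis .
qed

lemma sampling_error_weighted: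
  assumes A: "integrable lborel A" and b: "real CARD('d) < b"
  shows "(NNINT x. ennreal (norm (ift A x - sample_series x) * wt b x)) < \<infinity>"
proof -
  note [measurable] = borel_measurable_ift[OF A]
  have "(NNINT x. ennreal (norm (ift A x - sample_series x) * wt b x))
     \<le> (NNINT x. (NNINT \<xi>. ennreal (norm (A \<xi>))) * ennreal (wt b x) + ennreal (norm (sample_series x) * wt b x))"
  proof (rule nn_integral_mono)
    fix x
    have "norm (ift A x - sample_series x) * wt b x \<le> (norm (ift A x) + norm (sample_series x)) * wt b x"
      by (intro mult_right_mono norm_triangle_ineq4) auto
    then have "ennreal (norm (ift A x - sample_series x) * wt b x)
       \<le> ennreal (norm (ift A x)) * ennreal (wt b x) + ennreal (norm (sample_series x) * wt b x)"
      by (simp add: distrib_right ennreal_leI flip: ennreal_plus ennreal_mult)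
    also have "\<dots> \<le> (NNINT \<xi>. ennreal (norm (A \<xi>))) * ennreal (wt b x) + ennreal (norm (sample_series x) * wt b x)"
      by (intro add_right_mono mult_right_mono norm_ift_le) auto
    finally show "ennreal (norm (ift A x - sample_series x) * wt b x)
       \<le> (NNINT \<xi>. ennreal (norm (A \<xi>))) * ennreal (wt b x) + ennreal (norm (sample_series x) * wt b x)" .
  qed
  also have "\<dots> = (NNINT \<xi>. ennreal (norm (A \<xi>))) * (NNINT x :: real ^ 'd. ennreal (wt b x))
     + (NNINT x. ennreal (norm (sample_series x) * wt b x))"
    by (subst nn_integral_add) (auto simp: nn_integral_cmult)
  also have "\<dots> < \<infinity>"
    using sample_series_weighted[OF b] A nn_integral_wt_finite[where 'a = "real ^ 'd", of b] b
    by (simp add: ennreal_mult_less_top integrable_iff_bounded)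
  finally show ?thesis .
qed

end

section \<open>Consequences of the Strang--Fix conditions\<close>

lemma has_partial_vector_derivative:
  assumes "has_partial i G (x + s *\<^sub>R axis i 1)"
  shows "((\<lambda>t. G (x + t *\<^sub>R axis i 1)) has_vector_derivative partial_deriv i G (x + s *\<^sub>R axis i 1)) (at s)"
proof -
  have "((\<lambda>t. G ((x + s *\<^sub>R axis i 1) + t *\<^sub>R axis i 1)) has_vector_derivative partial_deriv i G (x + s *\<^sub>R axis i 1)) (at (s - s))"
    using assms unfolding has_partial_def partial_deriv_def by (simp add: vector_derivative_works)
  then have "(((\<lambda>t. G ((x + s *\<^sub>R axis i 1) + t *\<^sub>R axis i 1)) \<circ> (\<lambda>t. t - s)) has_vector_derivative 1 *\<^sub>R partial_deriv i G (x + s *\<^sub>R axis i 1)) (at s)"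
    by (intro vector_diff_chain_at) (auto intro!: derivative_eq_intros)
  then show ?thesis
    by (simp add: comp_def algebra_simps)
qed

lemma cnj_sgn_mult: "cnj (sgn w) * w = complex_of_real (norm w)"
proof (cases "w = 0")
  case False
  have "cnj w * w = complex_of_real ((norm w)\<^sup>2)"
    by (metis complex_norm_square mult.commute)
  moreover have "cnj (sgn w) * w = cnj w * w / complex_of_real (norm w)"
    by (simp add: sgn_div_norm scaleR_conv_of_real divide_inverse mult_ac)
  ultimately show ?thesis
    using False by (simp add: power2_eq_square)
qed simp

text \<open>The point \<open>0\<close> is joined to \<open>x\<close> along a path parallel to the axes, so that only
  partial derivatives enter; these need not be continuous.\<close>

lemma sum_norm_le_partial:
  fixes G :: "'k \<Rightarrow> real ^ 'd \<Rightarrow> complex"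
  assumes part: "\<And>k i y. k \<in> F \<Longrightarrow> norm y < \<delta> \<Longrightarrow> has_partial i (G k) y"
    and bound: "\<And>i y. norm y < \<delta> \<Longrightarrow> (\<Sum>k\<in>F. norm (partial_deriv i (G k) y)) \<le> c * norm y ^ r"
    and zero: "\<And>k. k \<in> F \<Longrightarrow> G k 0 = 0" and c: "0 \<le> c" and x: "norm x < \<delta>"
  shows "(\<Sum>k\<in>F. norm (G k x)) \<le> (real CARD('d) * c) * norm x ^ Suc r"
proof -
  define X where "X I = (\<chi> i. if i \<in> I then x $ i else 0)" for I
  have "(\<Sum>k\<in>F. norm (G k (X I))) \<le> (real (card I) * c) * norm x ^ Suc r" if "finite I" for I
    using that
  proof induction
    case empty
    have "X {} = 0" by (simp add: X_def vec_eq_iff)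
    then show ?case by (simp add: zero)
  next
    case (insert i I)
    define y where "y s = X I + s *\<^sub>R axis i 1" for s
    have y1: "X (insert i I) = y (x $ i)" "X I = y 0"
      using insert.hyps by (auto simp: X_def y_def vec_eq_iff axis_def)
    have ny: "norm (y s) \<le> norm x" if "s \<in> closed_segment 0 (x $ i)" for s
    proof (rule norm_le_componentwise_cart)
      fix j
      have "\<bar>s\<bar> \<le> \<bar>x $ i\<bar>"
        using that by (auto simp: closed_segment_eq_real_ivl split: if_splits)
      then show "norm (y s $ j) \<le> norm (x $ j)"
        using insert.hyps by (auto simp: y_def X_def axis_def)
    qed
    \<comment> \<open>Factors of modulus at most 1 that rotate each increment onto the nonnegative
      axis. The sum of the norms becomes the increment of one complex function g, so the mean value
      inequality is applied once and uses the bound on the whole sum of derivatives.\<close>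
    define z where "z k = cnj (sgn (G k (y (x $ i)) - G k (y 0)))" for k
    have z1: "norm (z k) \<le> 1" for k by (simp add: z_def norm_sgn)
    have z2: "z k * (G k (y (x $ i)) - G k (y 0)) = of_real (norm (G k (y (x $ i)) - G k (y 0)))" for k
      unfolding z_def by (rule cnj_sgn_mult)
    define g where "g s = (\<Sum>k\<in>F. z k * G k (y s))" for s
    define g' where "g' s = (\<Sum>k\<in>F. z k * partial_deriv i (G k) (y s))" for s
    have der: "(g has_vector_derivative g' s) (at s within closed_segment 0 (x $ i))" if "s \<in> closed_segment 0 (x $ i)" for s
    proof -
      have yd: "norm (X I + s *\<^sub>R axis i 1) < \<delta>" using ny[OF that] x by (simp add: y_def)
      have "((\<lambda>t. G k (y t)) has_vector_derivative partial_deriv i (G k) (y s)) (at s within closed_segment 0 (x $ i))" if "k \<in> F" for k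
        unfolding y_def
        by (rule has_vector_derivative_at_within, rule has_partial_vector_derivative, rule part[OF that yd])
      then show ?thesis
        unfolding g_def g'_def by (intro has_vector_derivative_sum has_vector_derivative_mult_right)
    qed
    have le: "norm (g' s) \<le> c * norm x ^ r" if "s \<in> closed_segment 0 (x $ i)" for s
    proof -
      have "norm (g' s) \<le> (\<Sum>k\<in>F. norm (z k * partial_deriv i (G k) (y s)))"
        unfolding g'_def by (rule norm_sum)
      also have "\<dots> \<le> (\<Sum>k\<in>F. norm (partial_deriv i (G k) (y s)))"
        by (intro sum_mono) (simp add: norm_mult mult_left_le_one_le z1)
      also have "\<dots> \<le> c * norm (y s) ^ r"
        using ny[OF that] x by (intro bound) simp
      also have "\<dots> \<le> c * norm x ^ r"
        using ny[OF that] c by (intro mult_left_mono power_mono) auto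
      finally show ?thesis .
    qed
    have "norm (g (x $ i) - g 0) \<le> (c * norm x ^ r) * norm (x $ i - 0)"
    proof (rule differentiable_bound)
      show "convex (closed_segment 0 (x $ i))" by simp
      fix s assume s: "s \<in> closed_segment 0 (x $ i)"
      show "(g has_derivative (\<lambda>h. h *\<^sub>R g' s)) (at s within closed_segment 0 (x $ i))"
        using der[OF s] by (simp add: has_vector_derivative_def)
      show "onorm (\<lambda>h. h *\<^sub>R g' s) \<le> c * norm x ^ r"
        by (rule onorm_le) (use le[OF s] in \<open>auto simp: mult.commute intro: mult_left_mono\<close>)
    qed auto
    also have "\<dots> \<le> (c * norm x ^ r) * norm x"
      using component_le_norm_cart[of x i] c by (intro mult_left_mono) auto
    finally have diff: "norm (g (x $ i) - g 0) \<le> c * norm x ^ Suc r" by (simp add: mult_ac)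
    have "g (x $ i) - g 0 = of_real (\<Sum>k\<in>F. norm (G k (y (x $ i)) - G k (y 0)))"
      by (simp add: g_def z2[symmetric] sum_subtractf[symmetric] right_diff_distrib[symmetric] del: of_real_sum) (simp add: z2)
    then have "norm (g (x $ i) - g 0) = (\<Sum>k\<in>F. norm (G k (y (x $ i)) - G k (y 0)))"
      by (simp only: norm_of_real) (simp add: sum_nonneg)
    with diff have 1: "(\<Sum>k\<in>F. norm (G k (y (x $ i)) - G k (y 0))) \<le> c * norm x ^ Suc r" by simp
    have "(\<Sum>k\<in>F. norm (G k (X (insert i I)))) \<le> (\<Sum>k\<in>F. norm (G k (y (x $ i)) - G k (y 0)) + norm (G k (X I)))"
      unfolding y1 by (intro sum_mono) (metis diff_add_cancel norm_triangle_ineq)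
    also have "\<dots> \<le> c * norm x ^ Suc r + (real (card I) * c) * norm x ^ Suc r"
      unfolding sum.distrib using 1 insert.IH by (intro add_mono) auto
    also have "\<dots> = (real (card (insert i I)) * c) * norm x ^ Suc r"
      using insert.hyps by (simp add: algebra_simps)
    finally show ?case .
  qed
  from this[of UNIV] show ?thesis by (simp add: X_def)
qed

text \<open>Derivatives of order n - m are O(|y|^m), by induction on m: as derivatives of order
  below n vanish at 0, each integration from 0 gains a power. The estimate is for sums over finite
  subfamilies with a common constant, since the Strang--Fix term is a sum over all lattice points
  rather than a single function.\<close>

lemma taylor_estimate_family:
  fixes \<Phi> :: "'k \<Rightarrow> real ^ 'd \<Rightarrow> complex"
  assumes part: "\<And>k is i y. k \<in> K \<Longrightarrow> length is < n \<Longrightarrow> norm y < \<delta> \<Longrightarrow> has_partial i (partial_derivs is (\<Phi> k)) y"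
    and bound: "\<And>is. length is = n \<Longrightarrow> \<exists>c. \<forall>y F. norm y < \<delta> \<longrightarrow> finite F \<longrightarrow> F \<subseteq> K \<longrightarrow>
      (\<Sum>k\<in>F. norm (partial_derivs is (\<Phi> k) y)) \<le> c"
    and zero: "\<And>k is. k \<in> K \<Longrightarrow> length is < n \<Longrightarrow> partial_derivs is (\<Phi> k) 0 = 0"
  obtains C where "0 \<le> C" "\<And>y F. norm y < \<delta> \<Longrightarrow> finite F \<Longrightarrow> F \<subseteq> K \<Longrightarrow> (\<Sum>k\<in>F. norm (\<Phi> k y)) \<le> C * norm y ^ n"
proof -
  have "\<forall>is. length is = n - m \<longrightarrow> (\<exists>C\<ge>0. \<forall>y F. norm y < \<delta> \<longrightarrow> finite F \<longrightarrow> F \<subseteq> K \<longrightarrow>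
      (\<Sum>k\<in>F. norm (partial_derivs is (\<Phi> k) y)) \<le> C * norm y ^ m)" if "m \<le> n" for m
    using that
  proof (induction m)
    case 0
    show ?case
    proof (intro allI impI)
      fix "is" :: "'d list" assume "length is = n - 0"
      then have "length is = n" by simp
      from bound[OF this] obtain c where "\<forall>y F. norm y < \<delta> \<longrightarrow> finite F \<longrightarrow> F \<subseteq> K \<longrightarrow> (\<Sum>k\<in>F. norm (partial_derivs is (\<Phi> k) y)) \<le> c"
        by blast
      then show "\<exists>C\<ge>0. \<forall>y F. norm y < \<delta> \<longrightarrow> finite F \<longrightarrow> F \<subseteq> K \<longrightarrow> (\<Sum>k\<in>F. norm (partial_derivs is (\<Phi> k) y)) \<le> C * norm y ^ 0"
        by (intro exI[of _ "max c 0"]) (auto simp: le_max_iff_disj)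
    qed
  next
    case (Suc m)
    show ?case
    proof (intro allI impI)
      fix "is" :: "'d list" assume len: "length is = n - Suc m"
      then have len': "length is < n" "\<And>i. length (i # is) = n - m" using Suc.prems by auto
      have "\<exists>C\<ge>0. \<forall>y F. norm y < \<delta> \<longrightarrow> finite F \<longrightarrow> F \<subseteq> K \<longrightarrow> (\<Sum>k\<in>F. norm (partial_derivs (i # is) (\<Phi> k) y)) \<le> C * norm y ^ m" for i
        using spec[OF Suc.IH[OF Suc_leD[OF Suc.prems]], of "i # is"] len'(2)[of i] by blast
      then obtain C where C: "\<And>i. 0 \<le> C i" "\<And>i y F. norm y < \<delta> \<Longrightarrow> finite F \<Longrightarrow> F \<subseteq> K \<Longrightarrow>
          (\<Sum>k\<in>F. norm (partial_derivs (i # is) (\<Phi> k) y)) \<le> C i * norm y ^ m"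
        by metis
      define c where "c = (\<Sum>i\<in>UNIV. C i)"
      have c: "0 \<le> c" "C i \<le> c" for i
        unfolding c_def using C by (auto intro: sum_nonneg member_le_sum)
      have "(\<Sum>k\<in>F. norm (partial_derivs is (\<Phi> k) y)) \<le> (real CARD('d) * c) * norm y ^ Suc m"
        if "norm y < \<delta>" "finite F" "F \<subseteq> K" for y F
      proof (rule sum_norm_le_partial[OF _ _ _ c(1) that(1)])
        fix i and z :: "real ^ 'd" assume z: "norm z < \<delta>"
        have "(\<Sum>k\<in>F. norm (partial_deriv i (partial_derivs is (\<Phi> k)) z)) \<le> C i * norm z ^ m"
          using C(2)[OF z that(2,3), of i] by simp
        also have "\<dots> \<le> c * norm z ^ m" by (intro mult_right_mono c) auto
        finally show "(\<Sum>k\<in>F. norm (partial_deriv i (partial_derivs is (\<Phi> k)) z)) \<le> c * norm z ^ m" .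
      qed (use that len' part zero in auto)
      then show "\<exists>C\<ge>0. \<forall>y F. norm y < \<delta> \<longrightarrow> finite F \<longrightarrow> F \<subseteq> K \<longrightarrow> (\<Sum>k\<in>F. norm (partial_derivs is (\<Phi> k) y)) \<le> C * norm y ^ Suc m"
        using c by (intro exI[of _ "real CARD('d) * c"]) auto
    qed
  qed
  from this[of n] have "\<exists>C\<ge>0. \<forall>y F. norm y < \<delta> \<longrightarrow> finite F \<longrightarrow> F \<subseteq> K \<longrightarrow> (\<Sum>k\<in>F. norm (partial_derivs [] (\<Phi> k) y)) \<le> C * norm y ^ n"
    by simp
  then show ?thesis using that by auto
qed

lemma partial_derivs_shift:
  "partial_derivs is (\<lambda>x. F (x + l)) = (\<lambda>x. partial_derivs is F (x + l))"
  by (induction "is") (auto simp: partial_deriv_def add_ac)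

lemma has_partial_shift: "has_partial i (\<lambda>x. F (x + l)) x \<longleftrightarrow> has_partial i F (x + l)"
  by (simp add: has_partial_def add_ac)

text \<open>As \<open>partial_deriv\<close> is total, linearity is available only where derivatives
  exist. They must exist near x and not only at x, because a derivative of higher order is taken of
  functions that agree on an open set of parameters.\<close>

lemma partial_derivs_one_minus:
  assumes F: "\<And>is i x. length is < n \<Longrightarrow> norm x < \<delta> \<Longrightarrow> has_partial i (partial_derivs is F) x"
    and len: "length is \<le> n" "is \<noteq> []" and x: "norm x < \<delta>"
  shows "partial_derivs is (\<lambda>x. 1 - F x) x = - partial_derivs is F x"
  using len x
proof (induction "is" arbitrary: x)
  case (Cons i js)
  have "has_partial i (partial_derivs js F) x"
    using Cons.prems by (intro F) auto
  then have d: "((\<lambda>t. partial_derivs js F (x + t *\<^sub>R axis i 1)) has_vector_derivative partial_derivs (i # js) F x) (at 0)"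
    using has_partial_vector_derivative[of i "partial_derivs js F" x 0] by simp
  have "((\<lambda>t. partial_derivs js (\<lambda>x. 1 - F x) (x + t *\<^sub>R axis i 1)) has_vector_derivative - partial_derivs (i # js) F x) (at 0)"
  proof (cases "js = []")
    case True
    then show ?thesis using has_vector_derivative_diff[OF has_vector_derivative_const d, of 1] by simp
  next
    case False
    define S where "S = {t. norm (x + t *\<^sub>R axis i 1) < \<delta>}"
    have "open S" unfolding S_def by (intro open_Collect_less continuous_intros)
    moreover have "0 \<in> S" using Cons.prems by (simp add: S_def)
    moreover have "- partial_derivs js F (x + t *\<^sub>R axis i 1) = partial_derivs js (\<lambda>x. 1 - F x) (x + t *\<^sub>R axis i 1)" if "t \<in> S" for t
      using Cons.IH[of "x + t *\<^sub>R axis i 1"] Cons.prems False that by (simp add: S_def)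
    ultimately show ?thesis
      by (rule has_vector_derivative_transform_within_open[OF has_vector_derivative_minus[OF d]])
  qed
  then show ?case
    unfolding partial_derivs.simps(2) partial_deriv_def[of i _ x] using vector_derivative_at by blast
qed simp

lemma has_partial_one_minus:
  assumes F: "\<And>is i x. length is < n \<Longrightarrow> norm x < \<delta> \<Longrightarrow> has_partial i (partial_derivs is F) x"
    and len: "length is < n" and x: "norm x < \<delta>"
  shows "has_partial i (partial_derivs is (\<lambda>x. 1 - F x)) x"
proof -
  have d: "((\<lambda>t. partial_derivs is F (x + t *\<^sub>R axis i 1)) has_vector_derivative partial_derivs (i # is) F x) (at 0)"
    using has_partial_vector_derivative[of i "partial_derivs is F" x 0] F[OF len x] by simp
  have "((\<lambda>t. partial_derivs is (\<lambda>x. 1 - F x) (x + t *\<^sub>R axis i 1)) has_vector_derivative - partial_derivs (i # is) F x) (at 0)"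
  proof (cases "is = []")
    case True
    then show ?thesis using has_vector_derivative_diff[OF has_vector_derivative_const d, of 1] by simp
  next
    case False
    define S where "S = {t. norm (x + t *\<^sub>R axis i 1) < \<delta>}"
    have "open S" unfolding S_def by (intro open_Collect_less continuous_intros)
    moreover have "0 \<in> S" using x by (simp add: S_def)
    moreover have "- partial_derivs is F (x + t *\<^sub>R axis i 1) = partial_derivs is (\<lambda>x. 1 - F x) (x + t *\<^sub>R axis i 1)" if "t \<in> S" for t
      using partial_derivs_one_minus[OF F, of n \<delta> "is" "x + t *\<^sub>R axis i 1"] len False that by (simp add: S_def)
    ultimately show ?thesis
      by (rule has_vector_derivative_transform_within_open[OF has_vector_derivative_minus[OF d]])
  qed
  then show ?thesis
    unfolding has_partial_def by (rule differentiableI_vector)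
qed

text \<open>All translates g (x + l) with l \<noteq> 0 form one family that vanishes at 0 to order
  n, so the Taylor estimate applies to their sum; the supremum over finite subfamilies is the
  infinite sum.\<close>

lemma strang_fix_sum_bound:
  fixes g :: "real ^ 'd \<Rightarrow> complex"
  assumes diff: "\<And>l. l \<in> int_lattice - {0} \<Longrightarrow> boundedly_differentiable n g {\<xi>. norm (\<xi> + l) < \<delta>}"
    and sums: "\<And>is. length is = n \<Longrightarrow> \<exists>K::real. \<forall>\<xi>. norm \<xi> < \<delta> \<longrightarrow>
                (\<Sum>\<^sub>\<infinity>l\<in>int_lattice - {0}. ennreal (norm (partial_derivs is g (\<xi> + l)))) \<le> ennreal K"
    and zero: "\<And>k is. k \<in> int_lattice - {0} \<Longrightarrow> length is < n \<Longrightarrow> partial_derivs is g k = 0"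
  obtains C where "0 \<le> C" "\<And>\<xi>. norm \<xi> < \<delta> \<Longrightarrow> (\<Sum>\<^sub>\<infinity>l\<in>int_lattice - {0}. ennreal (norm (g (\<xi> + l)))) \<le> ennreal (C * norm \<xi> ^ n)"
proof -
  define K where "K = (int_lattice - {0} :: (real ^ 'd) set)"
  define \<Phi> where "\<Phi> l x = g (x + l)" for l x
  have pd: "partial_derivs is (\<Phi> l) = (\<lambda>x. partial_derivs is g (x + l))" for "is" l
    unfolding \<Phi>_def by (rule partial_derivs_shift)
  obtain C where C: "0 \<le> C" "\<And>y F. norm y < \<delta> \<Longrightarrow> finite F \<Longrightarrow> F \<subseteq> K \<Longrightarrow> (\<Sum>k\<in>F. norm (\<Phi> k y)) \<le> C * norm y ^ n"
  proof (rule taylor_estimate_family[of K n \<delta> \<Phi>])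
    fix k and "is" :: "'d list" and i :: 'd and y :: "real ^ 'd" assume k: "k \<in> K" and len: "length is < n" and y: "norm y < \<delta>"
    \<comment> \<open>The neighbourhood attached to l in the hypothesis is centred at - l, hence the
      use at - k.\<close>
    have "- k \<in> int_lattice - {0}" using k by (auto simp: K_def int_lattice_def)
    from diff[OF this] len y have "has_partial i (partial_derivs is g) (y + k)"
      unfolding boundedly_differentiable_def by simp
    then show "has_partial i (partial_derivs is (\<Phi> k)) y"
      unfolding pd by (simp add: has_partial_shift)
  next
    fix "is" :: "'d list" assume len: "length is = n"
    from sums[OF len] obtain c where c: "\<And>\<xi>. norm \<xi> < \<delta> \<Longrightarrow> (\<Sum>\<^sub>\<infinity>l\<in>K. ennreal (norm (partial_derivs is g (\<xi> + l)))) \<le> ennreal c"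
      by (auto simp: K_def)
    have "(\<Sum>k\<in>F. norm (partial_derivs is (\<Phi> k) y)) \<le> max c 0" if "norm y < \<delta>" "finite F" "F \<subseteq> K" for y F
    proof -
      have "ennreal (\<Sum>k\<in>F. norm (partial_derivs is (\<Phi> k) y)) = (\<Sum>k\<in>F. ennreal (norm (partial_derivs is g (y + k))))"
        by (simp add: pd sum_ennreal)
      also have "\<dots> \<le> (SUP F\<in>{F. finite F \<and> F \<subseteq> K}. \<Sum>k\<in>F. ennreal (norm (partial_derivs is g (y + k))))"
        using that by (intro SUP_upper) auto
      also have "\<dots> = (\<Sum>\<^sub>\<infinity>l\<in>K. ennreal (norm (partial_derivs is g (y + l))))"
        by (rule nonneg_infsum_complete[symmetric]) simp
      also have "\<dots> \<le> ennreal c" by (rule c[OF that(1)])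
      also have "\<dots> \<le> ennreal (max c 0)" by (rule ennreal_leI) simp
      finally show ?thesis by (subst (asm) ennreal_le_iff) auto
    qed
    then show "\<exists>c. \<forall>y F. norm y < \<delta> \<longrightarrow> finite F \<longrightarrow> F \<subseteq> K \<longrightarrow> (\<Sum>k\<in>F. norm (partial_derivs is (\<Phi> k) y)) \<le> c"
      by blast
  next
    fix k and "is" :: "'d list" assume "k \<in> K" "length is < n"
    then show "partial_derivs is (\<Phi> k) 0 = 0" unfolding pd using zero by (simp add: K_def)
  qed blast
  have "(\<Sum>\<^sub>\<infinity>l\<in>K. ennreal (norm (g (\<xi> + l)))) \<le> ennreal (C * norm \<xi> ^ n)" if "norm \<xi> < \<delta>" for \<xi>
  proof (subst nonneg_infsum_complete)
    show "(SUP F\<in>{F. finite F \<and> F \<subseteq> K}. \<Sum>l\<in>F. ennreal (norm (g (\<xi> + l)))) \<le> ennreal (C * norm \<xi> ^ n)"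
      using C(2)[OF that] by (intro SUP_least) (auto simp: sum_ennreal \<Phi>_def intro: ennreal_leI)
  qed simp
  with C(1) show ?thesis using that by (simp add: K_def)
qed

lemma one_minus_bound:
  fixes F :: "real ^ 'd \<Rightarrow> complex"
  assumes n: "1 \<le> n" and diff: "boundedly_differentiable n F {\<xi>. norm \<xi> < \<delta>}"
    and zero: "\<And>is. length is < n \<Longrightarrow> partial_derivs is (\<lambda>\<xi>. 1 - F \<xi>) 0 = 0"
  obtains C where "0 \<le> C" "\<And>\<xi>. norm \<xi> < \<delta> \<Longrightarrow> norm (1 - F \<xi>) \<le> C * norm \<xi> ^ n"
proof -
  have part: "\<And>is i x. length is < n \<Longrightarrow> norm x < \<delta> \<Longrightarrow> has_partial i (partial_derivs is F) x"
    using diff by (simp add: boundedly_differentiable_def)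
  obtain C where C: "0 \<le> C" "\<And>y S. norm y < \<delta> \<Longrightarrow> finite S \<Longrightarrow> S \<subseteq> {()} \<Longrightarrow> (\<Sum>k\<in>S. norm (1 - F y)) \<le> C * norm y ^ n"
  \<comment> \<open>The unit type provides a family with one member.\<close>
  proof (rule taylor_estimate_family[of "{()}" n \<delta> "\<lambda>_ x. 1 - F x"])
    fix "is" :: "'d list" and i :: 'd and y :: "real ^ 'd" assume "length is < n" "norm y < \<delta>"
    then show "has_partial i (partial_derivs is (\<lambda>x. 1 - F x)) y"
      by (intro has_partial_one_minus[OF part]) auto
  next
    fix "is" :: "'d list" assume len: "length is = n"
    then have "bounded (partial_derivs is F ` {\<xi>. norm \<xi> < \<delta>})"
      using diff by (simp add: boundedly_differentiable_def)
    then obtain c where c: "\<And>y. norm y < \<delta> \<Longrightarrow> norm (partial_derivs is F y) \<le> c"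
      by (auto simp: bounded_iff)
    have "(\<Sum>k\<in>S. norm (partial_derivs is (\<lambda>x. 1 - F x) y)) \<le> max c 0" if "norm y < \<delta>" "S \<subseteq> {()}" for y and S :: "unit set"
    proof -
      have "partial_derivs is (\<lambda>x. 1 - F x) y = - partial_derivs is F y"
        using len n that(1) by (intro partial_derivs_one_minus[OF part]) auto
      moreover have "S = {} \<or> S = {()}" using that(2) by auto
      ultimately show ?thesis using c[OF that(1)] by auto
    qed
    then show "\<exists>c. \<forall>y S. norm y < \<delta> \<longrightarrow> finite S \<longrightarrow> S \<subseteq> {()} \<longrightarrow> (\<Sum>k\<in>S. norm (partial_derivs is (\<lambda>x. 1 - F x) y)) \<le> c"
      by blast
  qed (use zero in auto)
  show ?thesis
    using that[OF C(1)] C(2)[of _ "{()}"] by simp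
qed

section \<open>The averaging kernel\<close>

text \<open>Multi-indices with prescribed support, so that the multinomial theorem can be proved by
  induction over the set of coordinates.\<close>

definition mi_supp :: "'d::finite set \<Rightarrow> nat \<Rightarrow> ('d \<Rightarrow> nat) set" where
  "mi_supp S k = {\<beta>. (\<forall>i. i \<notin> S \<longrightarrow> \<beta> i = 0) \<and> mi_order \<beta> = k}"

lemma finite_mi_supp: "finite (mi_supp S k)"
  by (rule finite_subset[OF _ finite_mi_order[of k]]) (auto simp: mi_supp_def)

lemma mi_supp_insert:
  fixes a :: "'d::finite"
  assumes "a \<notin> S"
  shows "mi_supp (insert a S) k = (\<Union>j\<in>{..k}. (\<lambda>\<beta>. \<beta>(a := j)) ` mi_supp S (k - j))"
proof -
  have ord: "mi_order (\<beta>(a := j)) = j + (\<Sum>i\<in>UNIV - {a}. \<beta> i)" for \<beta> :: "'d \<Rightarrow> nat" and j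
    unfolding mi_order_def by (subst sum.remove[of _ a]) (auto intro!: sum.cong)
  have ord': "mi_order \<beta> = \<beta> a + (\<Sum>i\<in>UNIV - {a}. \<beta> i)" for \<beta> :: "'d \<Rightarrow> nat"
    unfolding mi_order_def by (subst sum.remove[of _ a]) auto
  show ?thesis
  proof (rule set_eqI, rule iffI)
    fix \<beta> :: "'d \<Rightarrow> nat" assume \<beta>: "\<beta> \<in> mi_supp (insert a S) k"
    have "\<beta>(a := 0) \<in> mi_supp S (k - \<beta> a)" "\<beta> a \<le> k"
      using \<beta> assms ord'[of \<beta>] ord[of \<beta> 0] by (auto simp: mi_supp_def)
    moreover have "\<beta> = (\<beta>(a := 0))(a := \<beta> a)" by simp
    ultimately show "\<beta> \<in> (\<Union>j\<in>{..k}. (\<lambda>\<beta>. \<beta>(a := j)) ` mi_supp S (k - j))"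
      by blast
  next
    fix \<beta> assume "\<beta> \<in> (\<Union>j\<in>{..k}. (\<lambda>\<beta>. \<beta>(a := j)) ` mi_supp S (k - j))"
    then obtain j \<gamma> where j: "j \<le> k" "\<gamma> \<in> mi_supp S (k - j)" "\<beta> = \<gamma>(a := j)" by auto
    then have "\<gamma> a = 0" using assms by (auto simp: mi_supp_def)
    then show "\<beta> \<in> mi_supp (insert a S) k"
      using j ord'[of \<gamma>] ord[of \<gamma> j] by (auto simp: mi_supp_def)
  qed
qed

text \<open>After division by factorials the binomial theorem becomes a convolution over the
  exponent j of the new coordinate, which matches the decomposition of
  \<open>mi_supp (insert a S) k\<close>.\<close>

lemma multinomial_supp:
  fixes x :: "'d::finite \<Rightarrow> complex"
  shows "(\<Sum>i\<in>S. x i) ^ k / fact k = (\<Sum>\<beta>\<in>mi_supp S k. \<Prod>i\<in>S. x i ^ \<beta> i / fact (\<beta> i))"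
  using finite[of S]
proof (induction S arbitrary: k)
  case empty
  have "mi_supp ({} :: 'd set) k = (if k = 0 then {\<lambda>_. 0} else {})"
    by (auto simp: mi_supp_def mi_order_def fun_eq_iff)
  then show ?case by simp
next
  case (insert a S)
  have inj: "inj_on (\<lambda>\<beta>. \<beta>(a := j)) (mi_supp S m)" for j m
  proof (rule inj_onI)
    fix \<beta> \<gamma> assume "\<beta> \<in> mi_supp S m" "\<gamma> \<in> mi_supp S m" and eq: "\<beta>(a := j) = \<gamma>(a := j)"
    then have "\<beta> a = 0" "\<gamma> a = 0" using insert.hyps by (auto simp: mi_supp_def)
    with eq show "\<beta> = \<gamma>" by (metis fun_upd_triv fun_upd_upd)
  qed
  have "(\<Sum>i\<in>insert a S. x i) ^ k / fact k = (\<Sum>j\<le>k. of_nat (k choose j) * x a ^ j * (\<Sum>i\<in>S. x i) ^ (k - j)) / fact k"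
    using insert.hyps by (simp add: binomial_ring)
  also have "\<dots> = (\<Sum>j\<le>k. (x a ^ j / fact j) * ((\<Sum>i\<in>S. x i) ^ (k - j) / fact (k - j)))"
    unfolding sum_divide_distrib by (intro sum.cong refl) (simp add: binomial_fact field_simps)
  also have "\<dots> = (\<Sum>j\<le>k. \<Sum>\<beta>\<in>mi_supp S (k - j). (x a ^ j / fact j) * (\<Prod>i\<in>S. x i ^ \<beta> i / fact (\<beta> i)))"
    unfolding insert.IH sum_distrib_left ..
  also have "\<dots> = (\<Sum>j\<le>k. \<Sum>\<beta>\<in>(\<lambda>\<beta>. \<beta>(a := j)) ` mi_supp S (k - j). \<Prod>i\<in>insert a S. x i ^ \<beta> i / fact (\<beta> i))"
  proof (rule sum.cong[OF refl])
    fix j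
    have "(\<Sum>\<beta>\<in>(\<lambda>\<beta>. \<beta>(a := j)) ` mi_supp S (k - j). \<Prod>i\<in>insert a S. x i ^ \<beta> i / fact (\<beta> i))
      = (\<Sum>\<beta>\<in>mi_supp S (k - j). \<Prod>i\<in>insert a S. x i ^ (\<beta>(a := j)) i / fact ((\<beta>(a := j)) i))"
      by (subst sum.reindex[OF inj]) simp
    also have "\<dots> = (\<Sum>\<beta>\<in>mi_supp S (k - j). (x a ^ j / fact j) * (\<Prod>i\<in>S. x i ^ \<beta> i / fact (\<beta> i)))"
    proof (intro sum.cong refl)
      fix \<beta> :: "'d \<Rightarrow> nat"
      have "(\<Prod>i\<in>S. x i ^ (\<beta>(a := j)) i / fact ((\<beta>(a := j)) i)) = (\<Prod>i\<in>S. x i ^ \<beta> i / fact (\<beta> i))"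
        using insert.hyps by (intro prod.cong) auto
      then show "(\<Prod>i\<in>insert a S. x i ^ (\<beta>(a := j)) i / fact ((\<beta>(a := j)) i)) = (x a ^ j / fact j) * (\<Prod>i\<in>S. x i ^ \<beta> i / fact (\<beta> i))"
        using insert.hyps by simp
    qed
    finally show "(\<Sum>\<beta>\<in>mi_supp S (k - j). (x a ^ j / fact j) * (\<Prod>i\<in>S. x i ^ \<beta> i / fact (\<beta> i)))
      = (\<Sum>\<beta>\<in>(\<lambda>\<beta>. \<beta>(a := j)) ` mi_supp S (k - j). \<Prod>i\<in>insert a S. x i ^ \<beta> i / fact (\<beta> i))" ..
  qed
  also have "\<dots> = (\<Sum>\<beta>\<in>mi_supp (insert a S) k. \<Prod>i\<in>insert a S. x i ^ \<beta> i / fact (\<beta> i))"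
    unfolding mi_supp_insert[OF insert.hyps(2)]
  proof (rule sum.UNION_disjoint[symmetric])
    show "\<forall>i\<in>{..k}. \<forall>j\<in>{..k}. i \<noteq> j \<longrightarrow> (\<lambda>\<beta>. \<beta>(a := i)) ` mi_supp S (k - i) \<inter> (\<lambda>\<beta>. \<beta>(a := j)) ` mi_supp S (k - j) = {}"
      by (auto dest: fun_upd_eqD)
  qed (auto intro: finite_mi_supp)
  finally show ?case .
qed

lemma multinomial_theorem:
  fixes x :: "'d::finite \<Rightarrow> complex"
  shows "(\<Sum>k\<le>N. (\<Sum>i\<in>UNIV. x i) ^ k / fact k) = (\<Sum>\<beta> | mi_order \<beta> \<le> N. (\<Prod>i\<in>UNIV. x i ^ \<beta> i) / of_real (mi_fact \<beta>))"
proof -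
  have "(\<Sum>k\<le>N. (\<Sum>i\<in>UNIV. x i) ^ k / fact k) = (\<Sum>k\<le>N. \<Sum>\<beta>\<in>mi_supp UNIV k. (\<Prod>i\<in>UNIV. x i ^ \<beta> i) / of_real (mi_fact \<beta>))"
    unfolding multinomial_supp by (simp add: prod_dividef mi_fact_def)
  also have "\<dots> = (\<Sum>\<beta>\<in>(\<Union>k\<in>{..N}. mi_supp UNIV k). (\<Prod>i\<in>UNIV. x i ^ \<beta> i) / of_real (mi_fact \<beta>))"
    by (rule sum.UNION_disjoint[symmetric]) (auto intro: finite_mi_supp, auto simp: mi_supp_def)
  also have "(\<Union>k\<in>{..N}. mi_supp UNIV k) = {\<beta> :: 'd \<Rightarrow> nat. mi_order \<beta> \<le> N}"
    by (auto simp: mi_supp_def)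
  finally show ?thesis .
qed

section \<open>The averaging density, its moments and its transform\<close>

lemma ball_vol_eq: "0 \<le> r \<Longrightarrow> ball_vol TYPE('d::finite) r = unit_ball_vol (real CARD('d)) * r ^ CARD('d)"
  unfolding ball_vol_def using content_cball[of r "0 :: real ^ 'd"] by simp

lemma ball_vol_pos: "0 < r \<Longrightarrow> 0 < ball_vol TYPE('d::finite) r"
  by (simp add: ball_vol_eq)

text \<open>The data in normalised form: Borel measurable on the whole line, with h positive
  everywhere. The type parameter carries the dimension, which occurs in none of the other
  parameters.\<close>

locale averaging =
  fixes w h :: "real \<Rightarrow> real" and N :: nat and dim_tag :: "'d::finite itself"
  assumes w_meas [measurable]: "w \<in> borel_measurable borel" and h_meas [measurable]: "h \<in> borel_measurable borel"
    and w_nonneg: "\<And>u. 0 \<le> w u" and h_pos: "\<And>u. 0 < h u"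
    and w_one: "(NNINT u. ennreal (w u)) = 1"
    and wh_fin: "(NNINT u. ennreal (w u * h u ^ Suc N)) < \<infinity>"
begin

definition W :: "real \<Rightarrow> real ^ 'd \<Rightarrow> real" where
  "W u s = w u / ball_vol TYPE('d) (h u) * indicator (cball 0 (h u)) s"

text \<open>Mixture of the uniform densities on the balls of radius h u with mixing density w. The
  average at level j becomes an integral against it after the substitution t = M^(-j) s.\<close>

definition dens :: "real ^ 'd \<Rightarrow> real" where
  "dens s = (LBINT u. W u s)"

lemma W_nonneg: "0 \<le> W u s"
  using w_nonneg[of u] ball_vol_pos[OF h_pos[of u], where 'd = 'd] by (simp add: W_def)

lemma dens_nonneg: "0 \<le> dens s"
  unfolding dens_def by (intro Bochner_Integration.integral_nonneg W_nonneg)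

lemma W_meas [measurable]: "(\<lambda>(u, s). W u s) \<in> borel_measurable (borel \<Otimes>\<^sub>M borel)"
proof -
  have "(\<lambda>(u, s). W u s) = (\<lambda>(u, s). w u / (unit_ball_vol (real CARD('d)) * h u ^ CARD('d)) * (if norm s \<le> h u then 1 else 0))"
    by (auto simp: W_def fun_eq_iff ball_vol_eq less_imp_le[OF h_pos] indicator_def)
  also have "\<dots> \<in> borel_measurable (borel \<Otimes>\<^sub>M borel)" by measurable
  finally show ?thesis .
qed

lemma dens_meas [measurable]: "dens \<in> borel_measurable borel"
proof -
  have "(\<lambda>(s, u). W u s) \<in> borel_measurable (borel \<Otimes>\<^sub>M borel)"
    using measurable_compose[OF measurable_pair_swap' W_meas] by (simp add: split_beta' comp_def)
  then have "(\<lambda>(s, u). W u s) \<in> borel_measurable (borel \<Otimes>\<^sub>M lborel)"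
    by (simp cong: measurable_cong_sets)
  then show ?thesis
    unfolding dens_def[abs_def] by (rule lborel.borel_measurable_lebesgue_integral)
qed

lemma nn_W: "(NNINT s. ennreal (W u s)) = ennreal (w u)"
proof -
  have v: "0 < ball_vol TYPE('d) (h u)" by (rule ball_vol_pos[OF h_pos])
  have "(NNINT s. ennreal (W u s)) = (NNINT s. ennreal (w u / ball_vol TYPE('d) (h u)) * indicator (cball (0 :: real ^ 'd) (h u)) s)"
    by (intro nn_integral_cong) (auto simp: W_def indicator_def)
  also have "\<dots> = ennreal (w u / ball_vol TYPE('d) (h u)) * emeasure lborel (cball (0 :: real ^ 'd) (h u))"
    by (rule nn_integral_cmult_indicator) simp
  also have "emeasure lborel (cball (0 :: real ^ 'd) (h u)) = ennreal (ball_vol TYPE('d) (h u))"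
    unfolding ball_vol_def using emeasure_compact_finite[of "cball (0 :: real ^ 'd) (h u)"]
    by (simp add: emeasure_eq_ennreal_measure measure_completion)
  finally show ?thesis
    using v w_nonneg[of u] by (simp flip: ennreal_mult)
qed

lemma nn_W_moment:
  "(NNINT u. NNINT s. ennreal (W u s) * ennreal (norm s ^ Suc N)) \<le> (NNINT u. ennreal (w u * h u ^ Suc N))"
proof (rule nn_integral_mono)
  fix u
  have "(NNINT s. ennreal (W u s) * ennreal (norm s ^ Suc N)) \<le> (NNINT s. ennreal (W u s) * ennreal (h u ^ Suc N))"
  proof (rule nn_integral_mono)
    fix s :: "real ^ 'd"
    show "ennreal (W u s) * ennreal (norm s ^ Suc N) \<le> ennreal (W u s) * ennreal (h u ^ Suc N)"
    proof (cases "norm s \<le> h u")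
      case True
      then have "norm s ^ Suc N \<le> h u ^ Suc N" by (intro power_mono) auto
      then show ?thesis by (intro mult_left_mono ennreal_leI) auto
    qed (simp add: W_def)
  qed
  also have "\<dots> = (NNINT s. ennreal (W u s)) * ennreal (h u ^ Suc N)"
    by (rule nn_integral_multc) measurable
  also have "\<dots> = ennreal (w u * h u ^ Suc N)"
    unfolding nn_W using w_nonneg[of u] less_imp_le[OF h_pos[of u]] by (intro ennreal_mult[symmetric]) auto
  finally show "(NNINT s. ennreal (W u s) * ennreal (norm s ^ Suc N)) \<le> ennreal (w u * h u ^ Suc N)" .
qed

text \<open>Fubini's theorem for the mixture. The admissible growth, of order N + 1, is the one
  controlled by the moment hypothesis; it covers the bounded function that is sampled as well as the
  monomials in the coefficients of L.\<close>

lemma dens_integral: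
  fixes g :: "real ^ 'd \<Rightarrow> complex"
  assumes g [measurable]: "g \<in> borel_measurable borel" and K: "0 \<le> K" "\<And>s. norm (g s) \<le> K * (1 + norm s ^ Suc N)"
  shows "integrable lborel (\<lambda>s. complex_of_real (dens s) * g s)"
    and "(LBINT s. complex_of_real (dens s) * g s)
       = (LBINT u. complex_of_real (w u / ball_vol TYPE('d) (h u)) * (LBINT s. indicator (cball 0 (h u)) s *\<^sub>R g s))"
proof -
  have m: "(\<lambda>(u, s). complex_of_real (W u s) * g s) \<in> borel_measurable (borel \<Otimes>\<^sub>M borel)"
    by measurable
  have fin: "(NNINT u. NNINT s. ennreal (norm (complex_of_real (W u s) * g s))) < \<infinity>"
  proof -
    have "(NNINT u. NNINT s. ennreal (norm (complex_of_real (W u s) * g s)))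
       \<le> (NNINT u. NNINT s. ennreal K * (ennreal (W u s) + ennreal (W u s) * ennreal (norm s ^ Suc N)))"
    proof (intro nn_integral_mono)
      fix u and s :: "real ^ 'd"
      have "norm (complex_of_real (W u s) * g s) \<le> W u s * (K * (1 + norm s ^ Suc N))"
        unfolding norm_mult norm_of_real using W_nonneg[of u s] K(2)[of s] by (intro mult_mono) auto
      also have "\<dots> = K * (W u s + W u s * norm s ^ Suc N)" by (simp add: algebra_simps)
      finally have "norm (complex_of_real (W u s) * g s) \<le> K * (W u s + W u s * norm s ^ Suc N)" .
      then show "ennreal (norm (complex_of_real (W u s) * g s)) \<le> ennreal K * (ennreal (W u s) + ennreal (W u s) * ennreal (norm s ^ Suc N))"
        using K(1) W_nonneg[of u s] by (simp add: ennreal_leI flip: ennreal_mult ennreal_plus del: power_Suc)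
    qed
    also have "\<dots> = ennreal K * ((NNINT u. ennreal (w u)) + (NNINT u. NNINT s. ennreal (W u s) * ennreal (norm s ^ Suc N)))"
    proof -
      have "(NNINT s. ennreal K * (ennreal (W u s) + ennreal (W u s) * ennreal (norm s ^ Suc N)))
         = ennreal K * (ennreal (w u) + (NNINT s. ennreal (W u s) * ennreal (norm s ^ Suc N)))" for u
        unfolding nn_W[symmetric] by (subst nn_integral_cmult, measurable, subst nn_integral_add) auto
      then show ?thesis
        by (simp del: power_Suc, subst nn_integral_cmult, measurable, subst nn_integral_add) auto
    qed
    also have "\<dots> < \<infinity>"
      using le_less_trans[OF nn_W_moment wh_fin] by (simp add: w_one ennreal_mult_less_top del: power_Suc)
    finally show ?thesis .
  qed
  have "integrable lborel (\<lambda>s. LBINT u. complex_of_real (W u s) * g s)"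
    using lborel_pair.integrable_snd[OF integrable_pairI[OF m fin]] by simp
  moreover have eq: "(LBINT u. complex_of_real (W u s) * g s) = complex_of_real (dens s) * g s" for s
    by (simp add: dens_def)
  ultimately show "integrable lborel (\<lambda>s. complex_of_real (dens s) * g s)" by (simp only: eq)
  have "(LBINT s. complex_of_real (dens s) * g s) = (LBINT u. LBINT s. complex_of_real (W u s) * g s)"
    unfolding eq[symmetric] by (rule integral_swap[OF m fin, symmetric])
  also have "\<dots> = (LBINT u. complex_of_real (w u / ball_vol TYPE('d) (h u)) * (LBINT s. indicator (cball 0 (h u)) s *\<^sub>R g s))"
    by (subst integral_mult_right_zero[symmetric])
       (simp add: W_def scaleR_conv_of_real mult.assoc)
  finally show "(LBINT s. complex_of_real (dens s) * g s)
       = (LBINT u. complex_of_real (w u / ball_vol TYPE('d) (h u)) * (LBINT s. indicator (cball 0 (h u)) s *\<^sub>R g s))" .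
qed

lemma nn_dens: "(NNINT s. ennreal (dens s)) \<le> 1"
proof -
  have "(NNINT s. ennreal (dens s)) \<le> (NNINT s. NNINT u. ennreal (W u s))"
    unfolding dens_def using norm_integral_le_nn_integral[of lborel "\<lambda>u. W u s" for s]
    by (intro nn_integral_mono) (auto simp: W_nonneg intro: order_trans[OF ennreal_leI[OF abs_ge_self]])
  also have "\<dots> = (NNINT u. NNINT s. ennreal (W u s))"
    by (rule nn_integral_swap[symmetric]) measurable
  finally show ?thesis by (simp add: nn_W w_one)
qed

lemma integrable_dens: "integrable lborel (\<lambda>s. complex_of_real (dens s))"
  using nn_dens by (auto simp: integrable_iff_bounded dens_nonneg intro: le_less_trans)

lemma dens_uminus: "dens (- s) = dens s"
  by (simp add: dens_def W_def indicator_def)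

text \<open>Balls are symmetric, hence \<open>dens\<close> is even and the inverse transform used
  here coincides with the forward one.\<close>

definition mu :: "real ^ 'd \<Rightarrow> complex" where
  "mu = ift (\<lambda>s. complex_of_real (dens s))"

lemma norm_mu_le: "norm (mu \<xi>) \<le> 1"
proof -
  have "ennreal (norm (mu \<xi>)) \<le> (NNINT s. ennreal (norm (complex_of_real (dens s))))"
    unfolding mu_def by (rule norm_ift_le)
  also have "\<dots> \<le> 1" using nn_dens by (simp add: dens_nonneg)
  finally show ?thesis by simp
qed

lemma mu_uminus: "mu (- \<xi>) = mu \<xi>"
  unfolding mu_def ift_def
  using integral_lborel_neg[of "\<lambda>s. complex_of_real (dens s) * cis (2 * pi * (\<xi> \<bullet> s))"]
  by (simp add: dens_uminus)

lemma mu_meas [measurable]: "mu \<in> borel_measurable borel"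
  unfolding mu_def by (rule borel_measurable_ift[OF integrable_dens])

text \<open>The coefficients of L as Borel integrals over normalised data;
  \<open>avg_coeff_eq\<close> identifies them with \<open>avg_coeff\<close>.\<close>

definition coeff :: "('d \<Rightarrow> nat) \<Rightarrow> real" where
  "coeff \<beta> = (LBINT u. w u / (mi_fact \<beta> * ball_vol TYPE('d) (h u)) *
     (LBINT t. indicator (cball 0 (h u)) t * (\<Prod>i\<in>UNIV. (t $ i) ^ \<beta> i)))"

lemma norm_monomial_le: "\<bar>\<Prod>i\<in>UNIV. (t $ i) ^ \<beta> i\<bar> \<le> norm t ^ mi_order \<beta>" for t :: "real ^ 'd"
proof -
  have "\<bar>\<Prod>i\<in>UNIV. (t $ i) ^ \<beta> i\<bar> = (\<Prod>i\<in>UNIV. \<bar>t $ i\<bar> ^ \<beta> i)" by (simp add: abs_prod power_abs)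
  also have "\<dots> \<le> (\<Prod>i\<in>UNIV. norm t ^ \<beta> i)"
    by (intro prod_mono) (auto intro!: power_mono component_le_norm_cart)
  also have "\<dots> = norm t ^ mi_order \<beta>" by (simp add: mi_order_def power_sum)
  finally show ?thesis .
qed

lemma power_le_one_plus: "x ^ m \<le> 1 + x ^ n" if "0 \<le> x" "m \<le> n" for x :: real
proof (cases "x \<le> 1")
  case True
  then have "x ^ m \<le> 1" using that by (intro power_le_one) auto
  then show ?thesis using that by (simp add: add_increasing2)
next
  case False
  then have "x ^ m \<le> x ^ n" using that by (intro power_increasing) auto
  then show ?thesis by simp
qed

lemma mi_fact_ge_1: "1 \<le> mi_fact \<beta>"
  unfolding mi_fact_def by (intro prod_ge_1) (auto simp: fact_ge_1)

lemma coeff_dens: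
  assumes "mi_order \<beta> \<le> N"
  shows "integrable lborel (\<lambda>s. complex_of_real (dens s) * complex_of_real ((\<Prod>i\<in>UNIV. (s $ i) ^ \<beta> i) / mi_fact \<beta>))"
    and "(LBINT s. complex_of_real (dens s) * complex_of_real ((\<Prod>i\<in>UNIV. (s $ i) ^ \<beta> i) / mi_fact \<beta>)) = complex_of_real (coeff \<beta>)"
proof -
  have m: "(\<lambda>s :: real ^ 'd. complex_of_real ((\<Prod>i\<in>UNIV. (s $ i) ^ \<beta> i) / mi_fact \<beta>)) \<in> borel_measurable borel"
    by measurable
  have b: "norm (complex_of_real ((\<Prod>i\<in>UNIV. (s $ i) ^ \<beta> i) / mi_fact \<beta>)) \<le> 1 * (1 + norm s ^ Suc N)" for s :: "real ^ 'd"
  proof -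
    have "norm (complex_of_real ((\<Prod>i\<in>UNIV. (s $ i) ^ \<beta> i) / mi_fact \<beta>)) = \<bar>\<Prod>i\<in>UNIV. (s $ i) ^ \<beta> i\<bar> / mi_fact \<beta>"
      using mi_fact_ge_1[of \<beta>] by (simp only: norm_of_real abs_divide)
    also have "\<dots> \<le> \<bar>\<Prod>i\<in>UNIV. (s $ i) ^ \<beta> i\<bar>"
      using mi_fact_ge_1[of \<beta>] by (simp add: divide_le_eq mult_le_cancel_left1)
    also have "\<dots> \<le> norm s ^ mi_order \<beta>" by (rule norm_monomial_le)
    also have "\<dots> \<le> 1 + norm s ^ Suc N" using assms by (intro power_le_one_plus) auto
    finally show ?thesis by simp
  qed
  show "integrable lborel (\<lambda>s. complex_of_real (dens s) * complex_of_real ((\<Prod>i\<in>UNIV. (s $ i) ^ \<beta> i) / mi_fact \<beta>))"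
    by (rule dens_integral(1)[OF m _ b]) simp
  have "(LBINT s. complex_of_real (dens s) * complex_of_real ((\<Prod>i\<in>UNIV. (s $ i) ^ \<beta> i) / mi_fact \<beta>))
    = (LBINT u. complex_of_real (w u / ball_vol TYPE('d) (h u)) * (LBINT s. indicator (cball 0 (h u)) s *\<^sub>R complex_of_real ((\<Prod>i\<in>UNIV. (s $ i) ^ \<beta> i) / mi_fact \<beta>)))"
    by (rule dens_integral(2)[OF m _ b]) simp
  also have "\<dots> = (LBINT u. complex_of_real (w u / (mi_fact \<beta> * ball_vol TYPE('d) (h u)) *
      (LBINT t. indicator (cball 0 (h u)) t * (\<Prod>i\<in>UNIV. (t $ i) ^ \<beta> i))))"
  proof (rule Bochner_Integration.integral_cong[OF refl])
    fix u
    have "(LBINT s. indicator (cball 0 (h u)) s *\<^sub>R complex_of_real ((\<Prod>i\<in>UNIV. (s $ i) ^ \<beta> i) / mi_fact \<beta>))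
      = (LBINT s. complex_of_real ((indicator (cball 0 (h u)) s * (\<Prod>i\<in>UNIV. (s $ i) ^ \<beta> i)) / mi_fact \<beta>))"
      by (intro Bochner_Integration.integral_cong refl) (simp add: scaleR_conv_of_real)
    also have "\<dots> = complex_of_real ((LBINT s. indicator (cball 0 (h u)) s * (\<Prod>i\<in>UNIV. (s $ i) ^ \<beta> i)) / mi_fact \<beta>)"
      by (simp only: integral_complex_of_real integral_divide_zero)
    finally show "complex_of_real (w u / ball_vol TYPE('d) (h u)) * (LBINT s. indicator (cball 0 (h u)) s *\<^sub>R complex_of_real ((\<Prod>i\<in>UNIV. (s $ i) ^ \<beta> i) / mi_fact \<beta>))
      = complex_of_real (w u / (mi_fact \<beta> * ball_vol TYPE('d) (h u)) * (LBINT t. indicator (cball 0 (h u)) t * (\<Prod>i\<in>UNIV. (t $ i) ^ \<beta> i)))"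
      by (simp del: of_real_prod)
  qed
  also have "\<dots> = complex_of_real (coeff \<beta>)"
    unfolding coeff_def by (rule integral_complex_of_real)
  finally show "(LBINT s. complex_of_real (dens s) * complex_of_real ((\<Prod>i\<in>UNIV. (s $ i) ^ \<beta> i) / mi_fact \<beta>)) = complex_of_real (coeff \<beta>)" .
qed

text \<open>The exponential under the integral is expanded to order N. The multinomial theorem turns
  the powers of \<xi> \<bullet> s into monomials, whose integrals are the coefficients of L, and the
  remainder is at most (2 \<pi> |\<xi>| |s|)^(N + 1), which the kernel integrates.\<close>

lemma mu_taylor:
  obtains C where "0 \<le> C" "\<And>\<xi>. norm (mu \<xi> -
     (\<Sum>\<beta> | mi_order \<beta> \<le> N. complex_of_real (coeff \<beta>) * (\<Prod>i\<in>UNIV. (- (2 * of_real pi * \<i> * of_real (\<xi> $ i))) ^ \<beta> i)))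
       \<le> C * norm \<xi> ^ Suc N"
proof -
  \<comment> \<open>Absolute moment of order N + 1 of the kernel, finite by
    \<open>dens_integral\<close>; up to powers of 2 \<pi> it is the constant sought.\<close>
  define MM where "MM = enn2real (NNINT s. ennreal (dens s * norm s ^ Suc N))"
  have intm: "integrable lborel (\<lambda>s. complex_of_real (dens s) * complex_of_real (norm s ^ Suc N))"
    by (rule dens_integral(1)[where K = 1]) (auto simp: norm_power simp del: power_Suc)
  have nn: "(NNINT s. ennreal (dens s * norm s ^ Suc N)) = ennreal MM"
    using intm unfolding MM_def
    by (simp add: integrable_iff_bounded norm_mult dens_nonneg norm_power del: power_Suc of_real_power)
  define c where "c \<xi> \<beta> = (\<Prod>i\<in>UNIV. (- (2 * complex_of_real pi * \<i> * of_real (\<xi> $ i))) ^ \<beta> i)" for \<xi> :: "real ^ 'd" and \<beta>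
  define P where "P \<xi> s = (\<Sum>\<beta> | mi_order \<beta> \<le> N. complex_of_real ((\<Prod>i\<in>UNIV. (s $ i) ^ \<beta> i) / mi_fact \<beta>) * c \<xi> \<beta>)" for \<xi> s :: "real ^ 'd"
  have P_eq: "P \<xi> s = (\<Sum>k\<le>N. (\<i> * of_real (- (2 * pi * (\<xi> \<bullet> s)))) ^ k / fact k)" for \<xi> s
  proof -
    define x where "x i = complex_of_real (s $ i) * (- (2 * complex_of_real pi * \<i> * of_real (\<xi> $ i)))" for i
    have "(\<Sum>i\<in>UNIV. x i) = \<i> * of_real (- (2 * pi * (\<xi> \<bullet> s)))"
      by (simp add: x_def inner_vec_def sum_distrib_left sum_negf mult_ac)
    moreover have "(\<Sum>\<beta> | mi_order \<beta> \<le> N. (\<Prod>i\<in>UNIV. x i ^ \<beta> i) / of_real (mi_fact \<beta>)) = P \<xi> s"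
      unfolding P_def c_def x_def
      by (intro sum.cong refl) (simp only: power_mult_distrib prod.distrib of_real_divide of_real_prod of_real_power, simp)
    ultimately show ?thesis using multinomial_theorem[of x N] by simp
  qed
  have rem: "norm (cis (- (2 * pi * (\<xi> \<bullet> s))) - P \<xi> s) \<le> (2 * pi) ^ Suc N * norm \<xi> ^ Suc N * norm s ^ Suc N" for \<xi> s
  proof -
    have "norm (cis (- (2 * pi * (\<xi> \<bullet> s))) - P \<xi> s) \<le> \<bar>- (2 * pi * (\<xi> \<bullet> s))\<bar> ^ Suc N / fact (Suc N)"
      unfolding P_eq cis_conv_exp by (rule iexp_approx1)
    also have "\<dots> \<le> \<bar>- (2 * pi * (\<xi> \<bullet> s))\<bar> ^ Suc N"
      by (simp add: divide_le_eq mult_le_cancel_left1 fact_ge_1 del: fact_Suc power_Suc)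
    also have "\<dots> \<le> (2 * pi * (norm \<xi> * norm s)) ^ Suc N"
      using Cauchy_Schwarz_ineq2[of \<xi> s] by (intro power_mono) (auto simp: abs_mult)
    finally show ?thesis by (simp only: power_mult_distrib mult.assoc)
  qed
  have intP: "integrable lborel (\<lambda>s. complex_of_real (dens s) * complex_of_real ((\<Prod>i\<in>UNIV. (s $ i) ^ \<beta> i) / mi_fact \<beta>) * c \<xi> \<beta>)"
    if "mi_order \<beta> \<le> N" for \<beta> \<xi>
    by (intro integrable_mult_left coeff_dens(1) that)
  have main: "norm (mu \<xi> - (\<Sum>\<beta> | mi_order \<beta> \<le> N. complex_of_real (coeff \<beta>) * c \<xi> \<beta>)) \<le> ((2 * pi) ^ Suc N * MM) * norm \<xi> ^ Suc N" for \<xi>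
  proof -
    have i1: "integrable lborel (\<lambda>s. complex_of_real (dens s) * cis (2 * pi * (- \<xi> \<bullet> s)))"
      by (rule integrable_mult_cis[OF integrable_dens])
    have i2: "integrable lborel (\<lambda>s. complex_of_real (dens s) * P \<xi> s)"
      unfolding P_def sum_distrib_left mult.assoc[symmetric]
      by (intro Bochner_Integration.integrable_sum intP) simp
    have "(\<Sum>\<beta> | mi_order \<beta> \<le> N. complex_of_real (coeff \<beta>) * c \<xi> \<beta>)
      = (\<Sum>\<beta> | mi_order \<beta> \<le> N. LBINT s. complex_of_real (dens s) * complex_of_real ((\<Prod>i\<in>UNIV. (s $ i) ^ \<beta> i) / mi_fact \<beta>) * c \<xi> \<beta>)"
      by (intro sum.cong refl) (simp only: integral_mult_left_zero coeff_dens(2) mem_Collect_eq)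
    also have "\<dots> = (LBINT s. (\<Sum>\<beta> | mi_order \<beta> \<le> N. complex_of_real (dens s) * complex_of_real ((\<Prod>i\<in>UNIV. (s $ i) ^ \<beta> i) / mi_fact \<beta>) * c \<xi> \<beta>))"
      by (rule Bochner_Integration.integral_sum[symmetric]) (simp add: intP del: of_real_divide)
    also have "\<dots> = (LBINT s. complex_of_real (dens s) * P \<xi> s)"
      unfolding P_def sum_distrib_left mult.assoc[symmetric] ..
    finally have 2: "(\<Sum>\<beta> | mi_order \<beta> \<le> N. complex_of_real (coeff \<beta>) * c \<xi> \<beta>) = (LBINT s. complex_of_real (dens s) * P \<xi> s)" .
    \<comment> \<open>Evenness of \<open>mu\<close> gives the negative sign of the exponent that
      occurs in the transform of the distribution.\<close>
    have "mu \<xi> = (LBINT s. complex_of_real (dens s) * cis (2 * pi * (- \<xi> \<bullet> s)))"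
      unfolding mu_uminus[of \<xi>, symmetric] by (simp add: mu_def ift_def)
    then have "mu \<xi> - (\<Sum>\<beta> | mi_order \<beta> \<le> N. complex_of_real (coeff \<beta>) * c \<xi> \<beta>)
      = (LBINT s. complex_of_real (dens s) * (cis (- (2 * pi * (\<xi> \<bullet> s))) - P \<xi> s))"
      unfolding 2 using Bochner_Integration.integral_diff[OF i1 i2] by (simp add: right_diff_distrib)
    then have "ennreal (norm (mu \<xi> - (\<Sum>\<beta> | mi_order \<beta> \<le> N. complex_of_real (coeff \<beta>) * c \<xi> \<beta>)))
      \<le> (NNINT s. ennreal (norm (complex_of_real (dens s) * (cis (- (2 * pi * (\<xi> \<bullet> s))) - P \<xi> s))))"
      by (simp only: norm_integral_le_nn_integral)
    also have "\<dots> \<le> (NNINT s. ennreal ((2 * pi) ^ Suc N * norm \<xi> ^ Suc N) * ennreal (dens s * norm s ^ Suc N))"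
    proof (rule nn_integral_mono)
      fix s
      have "norm (complex_of_real (dens s) * (cis (- (2 * pi * (\<xi> \<bullet> s))) - P \<xi> s)) \<le> dens s * ((2 * pi) ^ Suc N * norm \<xi> ^ Suc N * norm s ^ Suc N)"
        unfolding norm_mult norm_of_real using rem[of \<xi> s] dens_nonneg[of s] by (intro mult_mono) auto
      also have "\<dots> = (2 * pi) ^ Suc N * norm \<xi> ^ Suc N * (dens s * norm s ^ Suc N)" by (simp only: mult_ac)
      finally show "ennreal (norm (complex_of_real (dens s) * (cis (- (2 * pi * (\<xi> \<bullet> s))) - P \<xi> s)))
        \<le> ennreal ((2 * pi) ^ Suc N * norm \<xi> ^ Suc N) * ennreal (dens s * norm s ^ Suc N)"
        by (subst ennreal_mult[symmetric]) (auto simp: dens_nonneg intro!: ennreal_leI simp del: power_Suc)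
    qed
    also have "\<dots> = ennreal ((2 * pi) ^ Suc N * norm \<xi> ^ Suc N) * (NNINT s. ennreal (dens s * norm s ^ Suc N))"
      by (rule nn_integral_cmult) measurable
    also have "\<dots> = ennreal ((2 * pi) ^ Suc N * norm \<xi> ^ Suc N) * ennreal MM"
      unfolding nn ..
    also have "\<dots> = ennreal (((2 * pi) ^ Suc N * MM) * norm \<xi> ^ Suc N)"
      by (subst ennreal_mult[symmetric]) (auto simp: MM_def mult_ac simp del: power_Suc)
    finally show ?thesis
      by (subst (asm) ennreal_le_iff) (auto simp: MM_def simp del: power_Suc)
  qed
  show ?thesis
    by (rule that[of "(2 * pi) ^ Suc N * MM"]) (use main in \<open>auto simp: c_def MM_def simp del: power_Suc\<close>)
qed

end

section \<open>The weighted estimate in frequency space\<close>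

lemma powr_add_le: "(a + b) powr q \<le> 2 powr q * (a powr q + b powr q)" if "0 \<le> a" "0 \<le> b" "0 \<le> q" for a b q :: real
proof -
  have "(a + b) powr q \<le> (2 * max a b) powr q"
    using that by (intro powr_mono2) auto
  also have "\<dots> = 2 powr q * max a b powr q" by (rule powr_mult)
  also have "\<dots> \<le> 2 powr q * (a powr q + b powr q)"
    by (intro mult_left_mono) (auto simp: max_def)
  finally show ?thesis .
qed

lemma convex_powr_nonneg:
  assumes q: "1 \<le> q"
  shows "convex_on {0..} (\<lambda>x :: real. x powr q)"
proof (rule convex_onI)
  fix t x y :: real assume t: "0 < t" "t < 1" and xy: "x \<in> {0..}" "y \<in> {0..}"
  have le: "u powr q \<le> u" if "0 < u" "u < 1" for u :: real
    using powr_mono'[of 1 q u] that q by simp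
  consider "x = 0" | "y = 0" | "0 < x" "0 < y" using xy by force
  then show "((1 - t) *\<^sub>R x + t *\<^sub>R y) powr q \<le> (1 - t) * x powr q + t * y powr q"
  proof cases
    case 1
    then show ?thesis using le[of t] t by (simp add: powr_mult mult_right_mono)
  next
    case 2
    then show ?thesis using le[of "1 - t"] t by (simp add: powr_mult mult_right_mono)
  next
    case 3
    then show ?thesis using convex_onD[OF powr_convex[OF q], of t x y] t by simp
  qed
qed simp

text \<open>Hoelder's inequality in the form of Jensen's, with probability weights c l / s at the
  points x l / c l. This form includes q = 1, where the conjugate exponent is infinite.\<close>

lemma weighted_power_mean_finite:
  fixes c x :: "'b \<Rightarrow> real"
  assumes F: "finite F" and q: "1 \<le> q" and c: "\<And>l. l \<in> F \<Longrightarrow> 0 < c l" "sum c F \<le> S" and x: "\<And>l. l \<in> F \<Longrightarrow> 0 \<le> x l"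
  shows "(\<Sum>l\<in>F. x l) powr q \<le> S powr (q - 1) * (\<Sum>l\<in>F. c l powr (1 - q) * x l powr q)"
proof (cases "F = {}")
  case False
  define s where "s = sum c F"
  have s: "0 < s" unfolding s_def using F False c by (intro sum_pos) auto
  have "(\<Sum>l\<in>F. (c l / s) *\<^sub>R (x l / c l)) powr q \<le> (\<Sum>l\<in>F. (c l / s) * (x l / c l) powr q)"
  proof (rule convex_on_sum[OF F False, where C = "{0..}"])
    show "convex_on {0..} (\<lambda>x. x powr q)" by (rule convex_powr_nonneg[OF q])
    show "(\<Sum>l\<in>F. c l / s) = 1" using s by (simp add: sum_divide_distrib[symmetric] s_def[symmetric])
  qed (use c x s in \<open>auto simp: less_imp_le\<close>)
  moreover have "(\<Sum>l\<in>F. (c l / s) *\<^sub>R (x l / c l)) = (\<Sum>l\<in>F. x l) / s"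
    unfolding sum_divide_distrib using c(1) by (intro sum.cong refl) (force simp: field_simps)
  moreover have "(\<Sum>l\<in>F. (c l / s) * (x l / c l) powr q) = (\<Sum>l\<in>F. c l powr (1 - q) * x l powr q) / s"
    unfolding sum_divide_distrib
  proof (intro sum.cong refl)
    fix l assume l: "l \<in> F"
    have "c l powr (1 - q) = c l / c l powr q" using c(1)[OF l] by (simp add: powr_diff)
    then show "(c l / s) * (x l / c l) powr q = c l powr (1 - q) * x l powr q / s"
      by (simp add: powr_divide)
  qed
  ultimately have "((\<Sum>l\<in>F. x l) / s) powr q \<le> (\<Sum>l\<in>F. c l powr (1 - q) * x l powr q) / s" by simp
  then have "s powr q * ((\<Sum>l\<in>F. x l) powr q / s powr q) \<le> s powr q * ((\<Sum>l\<in>F. c l powr (1 - q) * x l powr q) / s)"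
    using s by (intro mult_left_mono) (auto simp: powr_divide)
  then have "(\<Sum>l\<in>F. x l) powr q \<le> s powr (q - 1) * (\<Sum>l\<in>F. c l powr (1 - q) * x l powr q)"
    using s by (simp add: powr_diff)
  also have "\<dots> \<le> S powr (q - 1) * (\<Sum>l\<in>F. c l powr (1 - q) * x l powr q)"
    using s c(2) q by (intro mult_right_mono powr_mono2 sum_nonneg) (auto simp: s_def)
  finally show ?thesis .
qed simp

text \<open>A divergent sum has the default value 0, for which the bound is trivial; a convergent
  one is the limit of its finite partial sums.\<close>

lemma weighted_power_mean:
  fixes z :: "'b \<Rightarrow> complex" and c :: "'b \<Rightarrow> real"
  assumes q: "1 \<le> q" and c: "\<And>l. l \<in> K \<Longrightarrow> 0 < c l" "(\<Sum>\<^sub>\<infinity>l\<in>K. ennreal (c l)) \<le> ennreal S" and S: "0 < S"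
  shows "ennreal (norm (\<Sum>\<^sub>\<infinity>l\<in>K. z l) powr q)
    \<le> ennreal (S powr (q - 1)) * (\<Sum>\<^sub>\<infinity>l\<in>K. ennreal (c l powr (1 - q) * norm (z l) powr q))"
proof (cases "z summable_on K")
  case False
  then show ?thesis using q by (simp add: infsum_not_exists)
next
  case True
  define R where "R = ennreal (S powr (q - 1)) * (\<Sum>\<^sub>\<infinity>l\<in>K. ennreal (c l powr (1 - q) * norm (z l) powr q))"
  have fin: "ennreal (norm (sum z F) powr q) \<le> R" if F: "finite F" "F \<subseteq> K" for F
  proof -
    have "ennreal (sum c F) \<le> (\<Sum>\<^sub>\<infinity>l\<in>K. ennreal (c l))"
      using sum_le_infsum_ennreal[OF F, of "\<lambda>l. ennreal (c l)"] c(1) F by (subst (asm) sum_ennreal) (auto simp: less_imp_le)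
    with c(2) have "ennreal (sum c F) \<le> ennreal S" by (rule order_trans[rotated])
    then have cF: "sum c F \<le> S" using S by (simp add: ennreal_le_iff)
    have "norm (sum z F) powr q \<le> (\<Sum>l\<in>F. norm (z l)) powr q"
      using q by (intro powr_mono2 norm_sum) auto
    also have "\<dots> \<le> S powr (q - 1) * (\<Sum>l\<in>F. c l powr (1 - q) * norm (z l) powr q)"
      using c(1) F by (intro weighted_power_mean_finite[OF F(1) q _ cF]) auto
    finally have "ennreal (norm (sum z F) powr q) \<le> ennreal (S powr (q - 1)) * ennreal (\<Sum>l\<in>F. c l powr (1 - q) * norm (z l) powr q)"
      by (subst ennreal_mult[symmetric]) (auto intro!: ennreal_leI sum_nonneg)
    also have "\<dots> \<le> R"
      unfolding R_def using sum_le_infsum_ennreal[OF F, of "\<lambda>l. ennreal (c l powr (1 - q) * norm (z l) powr q)"]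
      by (intro mult_left_mono) (auto simp: sum_ennreal)
    finally show ?thesis .
  qed
  have "(sum z \<longlongrightarrow> (\<Sum>\<^sub>\<infinity>l\<in>K. z l)) (finite_subsets_at_top K)"
    using has_sum_infsum[OF True] by (simp add: has_sum_def)
  then have "((\<lambda>F. norm (sum z F) powr q) \<longlongrightarrow> norm (\<Sum>\<^sub>\<infinity>l\<in>K. z l) powr q) (finite_subsets_at_top K)"
    using q by (intro tendsto_powr' tendsto_norm tendsto_const) auto
  then have "((\<lambda>F. ennreal (norm (sum z F) powr q)) \<longlongrightarrow> ennreal (norm (\<Sum>\<^sub>\<infinity>l\<in>K. z l) powr q)) (finite_subsets_at_top K)"
    by (rule tendsto_ennrealI)
  then show ?thesis
    unfolding R_def[symmetric]
    by (rule tendsto_upperbound) (auto intro!: eventually_finite_subsets_at_top_weakI fin)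
qed

lemma unit_cell_shift_norm_ge:
  fixes \<theta> l :: "real ^ 'd"
  assumes "\<theta> \<in> unit_cell" "l \<in> int_lattice" "l \<noteq> 0"
  shows "1 / 2 \<le> norm (\<theta> + l)"
proof -
  obtain i where i: "l $ i \<noteq> 0" using assms(3) by (auto simp: vec_eq_iff)
  obtain m where m: "l $ i = of_int m" using assms(2) by (auto simp: int_lattice_def Ints_def)
  have "1 \<le> \<bar>l $ i\<bar>" using i m by simp
  moreover have "- 1 / 2 \<le> \<theta> $ i" "\<theta> $ i < 1 / 2" using assms(1) by (auto simp: unit_cell_def)
  ultimately have "1 / 2 \<le> \<bar>(\<theta> + l) $ i\<bar>" unfolding vector_add_component by linarith
  also have "\<dots> \<le> norm (\<theta> + l)" by (rule component_le_norm_cart)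
  finally show ?thesis .
qed

lemma infsum_lattice_minus0_shift:
  fixes f :: "real ^ 'd \<Rightarrow> 'c :: {comm_monoid_add, t2_space}"
  assumes k: "k \<in> int_lattice"
  shows "(\<Sum>\<^sub>\<infinity>l\<in>int_lattice - {0}. f (k + l)) = (\<Sum>\<^sub>\<infinity>l\<in>int_lattice - {k}. f l)"
proof (rule infsum_reindex_bij_betw)
  have "l \<in> (+) k ` (int_lattice - {0})" if "l \<in> int_lattice - {k}" for l
    using that int_lattice_diff[of l k] k by (intro image_eqI[of _ _ "l - k"]) auto
  then show "bij_betw ((+) k) (int_lattice - {0}) (int_lattice - {k})"
    using k by (auto simp: bij_betw_def inj_on_def int_lattice_add)
qed

text \<open>An exponent b > d makes the weight summable over the lattice, and b (q - 1) \<le> m q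
  lets the m-th power of |\<xi>| in L_q pay for it in Hoelder's inequality. For conjugate exponents
  the gap between the two follows from d < p as soon as m \<ge> 1.\<close>

lemma weight_exponent:
  fixes d q m :: real
  assumes "1 \<le> q" "d * (q - 1) < m * q"
  obtains b where "d < b" "b * (q - 1) \<le> m * q"
proof (cases "q = 1")
  case True
  then show ?thesis using that[of "d + 1"] assms by simp
next
  case False
  with assms(1) have q1: "q - 1 > 0" by simp
  then show ?thesis
    using assms(2) that[of "m * q / (q - 1)"] by (simp add: less_divide_eq)
qed

text \<open>The error splits into A (1 - \<Phi> \<mu>), controlled near the origin, and \<Phi> T,
  where T collects the aliased terms. The second part is unfolded to the cell, \<xi> = \<theta> + k.
  For k \<noteq> 0 the sum T contains the low frequency term at \<theta>, and smallness must come
  from \<Phi> (\<theta> + k); the other terms lie at distance at least 1 / 2 from 0, where powers of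
  |\<xi>| dominate the weights.\<close>

lemma frequency_estimate:
  fixes \<phi>h \<mu> :: "real ^ 'd \<Rightarrow> complex" and q :: real and m s :: nat
  assumes q: "1 \<le> q" and dim: "real CARD('d) * (q - 1) < real m * q"
    and [measurable]: "\<phi>h \<in> borel_measurable borel" "\<mu> \<in> borel_measurable borel"
    and \<mu>: "\<And>\<xi>. norm (\<mu> \<xi>) \<le> 1"
    and B: "0 \<le> B" "\<And>\<xi>. (\<Sum>\<^sub>\<infinity>k\<in>int_lattice. ennreal (norm (\<phi>h (\<xi> + k)) powr q)) \<le> ennreal B"
    and near: "0 \<le> C1" "\<And>\<xi>. norm (1 - \<phi>h \<xi> * \<mu> \<xi>) \<le> C1 * norm \<xi> ^ s"
    and off: "0 \<le> C2" "\<And>\<xi>. \<xi> \<in> unit_cell \<Longrightarrow>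
       (\<Sum>\<^sub>\<infinity>k\<in>int_lattice - {0}. ennreal (norm (\<phi>h (\<xi> + k)) powr q)) \<le> ennreal (C2 * (norm \<xi> ^ s) powr q)"
  obtains C where "0 \<le> C" "\<And>A. integrable lborel A \<Longrightarrow>
     (NNINT \<xi>. ennreal (norm (A \<xi> - \<phi>h \<xi> * (\<Sum>\<^sub>\<infinity>l\<in>int_lattice. \<mu> (\<xi> + l) * A (\<xi> + l))) powr q))
     \<le> ennreal C * ((NNINT \<xi>. ennreal ((norm \<xi> ^ s * norm (A \<xi>)) powr q))
                    + (NNINT \<xi>. ennreal ((norm \<xi> ^ m * norm (A \<xi>)) powr q)))"
proof -
  obtain b where b: "real CARD('d) < b" "b * (q - 1) \<le> real m * q"
    using weight_exponent[OF q dim] by blast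
  have b0: "0 \<le> b" using b(1) by linarith
  obtain S where S: "0 < S" "\<And>\<xi> :: real ^ 'd. (\<Sum>\<^sub>\<infinity>l\<in>int_lattice. ennreal (wt b (\<xi> + l))) \<le> ennreal S"
    using lattice_wt_bound[OF b(1)] by blast
  define D where "D = S powr (q - 1)"
  have D: "D > 0" using S by (simp add: D_def)
  \<comment> \<open>\<open>E\<close> bounds the inverse weight on the cell, where the norm is at
    most d. \<open>Z\<close> comes from 1 + |y| \<le> 3 |y| for |y| \<ge> 1 / 2, which holds at all
    nonzero lattice translates of the cell.\<close>
  define E where "E = (1 + real CARD('d)) powr (b * (q - 1))"
  define Z where "Z = 3 powr (real m * q)"
  have EZ: "E \<ge> 0" "Z \<ge> 0" by (auto simp: E_def Z_def)
  have wt_q: "wt b y powr (1 - q) = (1 + norm y) powr (b * (q - 1))" for y :: "real ^ 'd"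
    by (simp add: wt_def powr_powr algebra_simps)
  define C where "C = 2 powr q * (C1 powr q + D * (E * C2 + Z * B))"
  have C: "0 \<le> C" unfolding C_def using D EZ B off by (intro mult_nonneg_nonneg add_nonneg_nonneg) auto
  have main: "(NNINT \<xi>. ennreal (norm (A \<xi> - \<phi>h \<xi> * (\<Sum>\<^sub>\<infinity>l\<in>int_lattice. \<mu> (\<xi> + l) * A (\<xi> + l))) powr q))
     \<le> ennreal C * ((NNINT \<xi>. ennreal ((norm \<xi> ^ s * norm (A \<xi>)) powr q))
                    + (NNINT \<xi>. ennreal ((norm \<xi> ^ m * norm (A \<xi>)) powr q)))"
    if A: "integrable lborel A" for A
  proof -
    have [measurable]: "A \<in> borel_measurable borel"
      using borel_measurable_integrable[OF A] by simp
    define BB where "BB \<xi> = \<mu> \<xi> * A \<xi>" for \<xi>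
    have [measurable]: "BB \<in> borel_measurable borel" unfolding BB_def[abs_def] by measurable
    have BB_le: "norm (BB \<xi>) \<le> norm (A \<xi>)" for \<xi>
      unfolding BB_def norm_mult using \<mu>[of \<xi>] by (simp add: mult_left_le_one_le)
    have BB: "integrable lborel BB"
      by (rule Bochner_Integration.integrable_bound[OF A]) (auto simp: BB_le)
    define T where "T \<xi> = (\<Sum>\<^sub>\<infinity>l\<in>int_lattice - {0}. BB (\<xi> + l))" for \<xi>
    have [measurable]: "T \<in> borel_measurable borel"
      unfolding T_def[abs_def] by (rule borel_measurable_infsum_complex) (auto intro: countable_subset[OF _ countable_int_lattice])
    define I1 where "I1 = (NNINT \<xi>. ennreal ((norm \<xi> ^ s * norm (A \<xi>)) powr q))"
    define I2 where "I2 = (NNINT \<xi>. ennreal ((norm \<xi> ^ m * norm (A \<xi>)) powr q))"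
    define G where "G \<xi> = ennreal ((norm \<xi> ^ m * norm (A \<xi>)) powr q)" for \<xi>
    define R where "R \<theta> = (\<Sum>\<^sub>\<infinity>l\<in>int_lattice. G (\<theta> + l))" for \<theta>
    have [measurable]: "G \<in> borel_measurable borel" unfolding G_def[abs_def] by measurable
    have [measurable]: "R \<in> borel_measurable borel"
      unfolding R_def[abs_def] by (rule borel_measurable_infsum_ennreal) auto
    \<comment> \<open>The sum T (\<theta> + k) omits the translate l = k, so the unweighted term A
      \<theta> occurs exactly when k \<noteq> 0; the remaining translates are collected in R
      \<theta> independently of k.\<close>
    have T_le: "ennreal (norm (T (\<theta> + k)) powr q)
        \<le> ennreal D * ((if k = 0 then 0 else ennreal (E * norm (A \<theta>) powr q)) + ennreal Z * R \<theta>)"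
      if \<theta>: "\<theta> \<in> unit_cell" and k: "k \<in> int_lattice" for \<theta> k
    proof -
      let ?t = "\<lambda>l. ennreal ((1 + norm (\<theta> + l)) powr (b * (q - 1)) * norm (A (\<theta> + l)) powr q)"
      have "T (\<theta> + k) = (\<Sum>\<^sub>\<infinity>l\<in>int_lattice - {k}. BB (\<theta> + l))"
        unfolding T_def add.assoc by (rule infsum_lattice_minus0_shift[OF k])
      then have "ennreal (norm (T (\<theta> + k)) powr q)
         \<le> ennreal D * (\<Sum>\<^sub>\<infinity>l\<in>int_lattice - {k}. ennreal (wt b (\<theta> + l) powr (1 - q) * norm (BB (\<theta> + l)) powr q))"
        unfolding D_def
        using weighted_power_mean[OF q, of "int_lattice - {k}" "\<lambda>l. wt b (\<theta> + l)" S "\<lambda>l. BB (\<theta> + l)"]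
          order_trans[OF infsum_ennreal_subset[of "int_lattice - {k}" int_lattice] S(2)[of \<theta>]] S(1)
        by (simp add: wt_pos)
      also have "\<dots> \<le> ennreal D * (\<Sum>\<^sub>\<infinity>l\<in>int_lattice - {k}. ?t l)"
        unfolding wt_q using BB_le q
        by (intro mult_left_mono infsum_ennreal_mono ennreal_leI powr_mono2) auto
      also have "\<dots> \<le> ennreal D * ((if k = 0 then 0 else ennreal (E * norm (A \<theta>) powr q)) + ennreal Z * R \<theta>)"
      proof (intro mult_left_mono)
        have t0: "?t 0 \<le> ennreal (E * norm (A \<theta>) powr q)"
          unfolding E_def using norm_le_of_torus[of \<theta>] unit_cell_subset_torus \<theta> b0 q
          by (intro ennreal_leI mult_mono powr_mono2) auto
        have tl: "?t l \<le> ennreal Z * G (\<theta> + l)" if "l \<in> int_lattice - {0}" for l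
        proof -
          have n: "1 / 2 \<le> norm (\<theta> + l)" using that \<theta> by (intro unit_cell_shift_norm_ge) auto
          have "(1 + norm (\<theta> + l)) powr (b * (q - 1)) \<le> (1 + norm (\<theta> + l)) powr (real m * q)"
            using b(2) by (intro powr_mono) auto
          also have "\<dots> \<le> (3 * norm (\<theta> + l)) powr (real m * q)"
            using n q by (intro powr_mono2) auto
          also have "\<dots> = Z * (norm (\<theta> + l) ^ m) powr q"
          proof -
            have "norm (\<theta> + l) powr real m = norm (\<theta> + l) ^ m"
              using n by (intro powr_realpow) linarith
            then show ?thesis by (simp add: Z_def powr_mult powr_powr[symmetric])
          qed
          finally have "(1 + norm (\<theta> + l)) powr (b * (q - 1)) * norm (A (\<theta> + l)) powr q
             \<le> Z * (norm (\<theta> + l) ^ m) powr q * norm (A (\<theta> + l)) powr q"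
            by (intro mult_right_mono) auto
          then show ?thesis
            unfolding G_def using EZ by (simp add: powr_mult ennreal_mult[symmetric] ennreal_leI mult.assoc)
        qed
        have sum_le: "(\<Sum>\<^sub>\<infinity>l\<in>K. ?t l) \<le> ennreal Z * R \<theta>" if "K \<subseteq> int_lattice - {0}" for K
        proof -
          have "(\<Sum>\<^sub>\<infinity>l\<in>K. ?t l) \<le> (\<Sum>\<^sub>\<infinity>l\<in>K. ennreal Z * G (\<theta> + l))"
            using that by (intro infsum_ennreal_mono tl) auto
          also have "\<dots> \<le> (\<Sum>\<^sub>\<infinity>l\<in>int_lattice. ennreal Z * G (\<theta> + l))"
            using that by (intro infsum_ennreal_subset) auto
          finally show ?thesis by (simp add: infsum_ennreal_cmult R_def)
        qed
        show "(\<Sum>\<^sub>\<infinity>l\<in>int_lattice - {k}. ?t l) \<le> (if k = 0 then 0 else ennreal (E * norm (A \<theta>) powr q)) + ennreal Z * R \<theta>"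
        proof (cases "k = 0")
          case True
          then show ?thesis using sum_le[of "int_lattice - {k}"] by simp
        next
          case False
          have "(\<Sum>\<^sub>\<infinity>l\<in>int_lattice - {k}. ?t l) = ?t 0 + (\<Sum>\<^sub>\<infinity>l\<in>int_lattice - {k} - {0}. ?t l)"
            by (rule infsum_ennreal_remove) (use False in auto)
          also have "\<dots> \<le> ennreal (E * norm (A \<theta>) powr q) + ennreal Z * R \<theta>"
            by (intro add_mono t0 sum_le) auto
          finally show ?thesis using False by simp
        qed
      qed simp
      finally show ?thesis .
    qed
    have off_part: "(NNINT \<xi>. ennreal (norm (\<phi>h \<xi> * T \<xi>) powr q)) \<le> ennreal D * (ennreal (E * C2) * I1 + ennreal (Z * B) * I2)"
    proof -
      have "(NNINT \<xi>. ennreal (norm (\<phi>h \<xi> * T \<xi>) powr q))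
         = (\<integral>\<^sup>+\<theta>\<in>unit_cell. (\<Sum>\<^sub>\<infinity>k\<in>int_lattice. ennreal (norm (\<phi>h (\<theta> + k) * T (\<theta> + k)) powr q)) \<partial>lborel)"
        by (rule nn_integral_lattice) measurable
      \<comment> \<open>The term A \<theta> meets only the sum of \<open>\<phi>h\<close> over k
        \<noteq> 0 and inherits its factor |\<theta>|^s, whereas R \<theta> meets the full sum, for
        which the bound B is enough.\<close>
      also have "\<dots> \<le> (\<integral>\<^sup>+\<theta>\<in>unit_cell. (ennreal D * (ennreal (E * C2) * ennreal ((norm \<theta> ^ s * norm (A \<theta>)) powr q) + ennreal (Z * B) * R \<theta>)) \<partial>lborel)"
      proof (rule nn_integral_mono)
        fix \<theta> :: "real ^ 'd"
        show "(\<Sum>\<^sub>\<infinity>k\<in>int_lattice. ennreal (norm (\<phi>h (\<theta> + k) * T (\<theta> + k)) powr q)) * indicator unit_cell \<theta>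
          \<le> (ennreal D * (ennreal (E * C2) * ennreal ((norm \<theta> ^ s * norm (A \<theta>)) powr q) + ennreal (Z * B) * R \<theta>)) * indicator unit_cell \<theta>"
        proof (cases "\<theta> \<in> unit_cell")
          case True
          let ?p = "\<lambda>k. ennreal (norm (\<phi>h (\<theta> + k)) powr q)"
          let ?a = "ennreal (E * norm (A \<theta>) powr q)"
          have "(\<Sum>\<^sub>\<infinity>k\<in>int_lattice. ennreal (norm (\<phi>h (\<theta> + k) * T (\<theta> + k)) powr q))
             \<le> (\<Sum>\<^sub>\<infinity>k\<in>int_lattice. ennreal D * (?a * (if k = 0 then 0 else ?p k) + ennreal Z * R \<theta> * ?p k))"
          proof (rule infsum_ennreal_mono)
            fix k :: "real ^ 'd" assume k: "k \<in> int_lattice"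
            have "ennreal (norm (\<phi>h (\<theta> + k) * T (\<theta> + k)) powr q) = ?p k * ennreal (norm (T (\<theta> + k)) powr q)"
              by (simp add: norm_mult powr_mult ennreal_mult)
            also have "\<dots> \<le> ?p k * (ennreal D * ((if k = 0 then 0 else ?a) + ennreal Z * R \<theta>))"
              by (intro mult_left_mono T_le True k) auto
            also have "\<dots> = ennreal D * (?a * (if k = 0 then 0 else ?p k) + ennreal Z * R \<theta> * ?p k)"
              by (cases "k = 0") (simp_all add: distrib_left distrib_right mult_ac)
            finally show "ennreal (norm (\<phi>h (\<theta> + k) * T (\<theta> + k)) powr q)
              \<le> ennreal D * (?a * (if k = 0 then 0 else ?p k) + ennreal Z * R \<theta> * ?p k)" .
          qed
          also have "\<dots> = ennreal D * (?a * (\<Sum>\<^sub>\<infinity>k\<in>int_lattice. if k = 0 then 0 else ?p k) + ennreal Z * R \<theta> * (\<Sum>\<^sub>\<infinity>k\<in>int_lattice. ?p k))"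
            by (simp only: infsum_ennreal_cmult infsum_ennreal_add)
          also have "(\<Sum>\<^sub>\<infinity>k\<in>int_lattice. if k = 0 then 0 else ?p k) = (\<Sum>\<^sub>\<infinity>k\<in>int_lattice - {0}. ?p k)"
            by (rule infsum_cong_neutral) auto
          also have "ennreal D * (?a * (\<Sum>\<^sub>\<infinity>k\<in>int_lattice - {0}. ?p k) + ennreal Z * R \<theta> * (\<Sum>\<^sub>\<infinity>k\<in>int_lattice. ?p k))
            \<le> ennreal D * (?a * ennreal (C2 * (norm \<theta> ^ s) powr q) + ennreal Z * R \<theta> * ennreal B)"
            by (intro mult_left_mono add_mono off B True) auto
          also have "\<dots> = ennreal D * (ennreal (E * C2) * ennreal ((norm \<theta> ^ s * norm (A \<theta>)) powr q) + ennreal (Z * B) * R \<theta>)"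
            using EZ off(1) B(1) by (simp add: powr_mult ennreal_mult mult_ac)
          finally show ?thesis using True by simp
        qed simp
      qed
      also have "\<dots> \<le> (NNINT \<theta>. ennreal D * (ennreal (E * C2) * ennreal ((norm \<theta> ^ s * norm (A \<theta>)) powr q) + ennreal (Z * B) * (R \<theta> * indicator unit_cell \<theta>)))"
        by (intro nn_integral_mono) (auto simp: indicator_def)
      also have "\<dots> = ennreal D * (ennreal (E * C2) * I1 + ennreal (Z * B) * (NNINT \<theta>. R \<theta> * indicator unit_cell \<theta>))"
        unfolding I1_def by (subst nn_integral_cmult, measurable, subst nn_integral_add) (auto simp: nn_integral_cmult)
      also have "(NNINT \<theta>. R \<theta> * indicator unit_cell \<theta>) = I2"
        unfolding R_def I2_def G_def[symmetric] by (rule nn_integral_lattice[symmetric]) measurable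
      finally show ?thesis .
    qed
    have near_part: "(NNINT \<xi>. ennreal (norm (A \<xi> * (1 - \<phi>h \<xi> * \<mu> \<xi>)) powr q)) \<le> ennreal (C1 powr q) * I1"
    proof -
      have "(NNINT \<xi>. ennreal (norm (A \<xi> * (1 - \<phi>h \<xi> * \<mu> \<xi>)) powr q))
        \<le> (NNINT \<xi>. ennreal (C1 powr q) * ennreal ((norm \<xi> ^ s * norm (A \<xi>)) powr q))"
      proof (rule nn_integral_mono)
        fix \<xi>
        have "norm (A \<xi> * (1 - \<phi>h \<xi> * \<mu> \<xi>)) \<le> norm (A \<xi>) * (C1 * norm \<xi> ^ s)"
          unfolding norm_mult[of "A \<xi>"] by (intro mult_left_mono near) auto
        then have "norm (A \<xi> * (1 - \<phi>h \<xi> * \<mu> \<xi>)) powr q \<le> (norm (A \<xi>) * (C1 * norm \<xi> ^ s)) powr q"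
          using q by (intro powr_mono2) auto
        also have "\<dots> = C1 powr q * (norm \<xi> ^ s * norm (A \<xi>)) powr q"
          by (simp add: powr_mult mult_ac)
        finally show "ennreal (norm (A \<xi> * (1 - \<phi>h \<xi> * \<mu> \<xi>)) powr q) \<le> ennreal (C1 powr q) * ennreal ((norm \<xi> ^ s * norm (A \<xi>)) powr q)"
          by (simp add: ennreal_leI flip: ennreal_mult)
      qed
      also have "\<dots> = ennreal (C1 powr q) * I1"
        unfolding I1_def by (rule nn_integral_cmult) measurable
      finally show ?thesis .
    qed
    \<comment> \<open>Convergence is known almost everywhere on the cell. Countably many lattice
      shifts carry it to almost every \<xi>, since the sum is invariant under them; it is needed to
      split off the term l = 0.\<close>
    have "AE \<xi> in lborel. (\<lambda>l. norm (BB (\<xi> + l))) summable_on int_lattice"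
    proof -
      have "AE \<xi> in lborel. \<forall>k\<in>int_lattice. \<xi> + k \<in> unit_cell \<longrightarrow> (\<lambda>l. norm (BB ((\<xi> + k) + l))) summable_on int_lattice"
      proof (subst AE_ball_countable[OF countable_int_lattice], intro ballI)
        fix k :: "real ^ 'd"
        have ae: "AE \<xi> in distr lborel borel ((+) k). \<xi> \<in> unit_cell \<longrightarrow> (\<lambda>l. norm (BB (\<xi> + l))) summable_on int_lattice"
          unfolding lborel_distr_plus by (rule integral_lattice(2)[OF BB])
        from AE_distrD[OF _ this]
        show "AE \<xi> in lborel. \<xi> + k \<in> unit_cell \<longrightarrow> (\<lambda>l. norm (BB ((\<xi> + k) + l))) summable_on int_lattice"
          by (simp add: add.commute)
      qed
      then show ?thesis
      proof eventually_elim
        case (elim \<xi>)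
        define k where "k = - nearest_lattice \<xi>"
        have k: "k \<in> int_lattice" "\<xi> + k \<in> unit_cell" using nearest_lattice[of \<xi>] by (auto simp: k_def)
        with elim have "(\<lambda>l. norm (BB ((\<xi> + k) + l))) summable_on int_lattice" by blast
        then have "(\<Sum>\<^sub>\<infinity>l\<in>int_lattice. ennreal (norm (BB (\<xi> + (l + k))))) < \<infinity>"
          by (simp add: abs_summable_ennreal_iff add_ac)
        then have "(\<Sum>\<^sub>\<infinity>l\<in>int_lattice. ennreal (norm (BB (\<xi> + l)))) < \<infinity>"
          using infsum_lattice_shift[OF k(1), of "\<lambda>l. ennreal (norm (BB (\<xi> + l)))"] by simp
        then show ?case by (simp add: abs_summable_ennreal_iff)
      qed
    qed
    then have "(NNINT \<xi>. ennreal (norm (A \<xi> - \<phi>h \<xi> * (\<Sum>\<^sub>\<infinity>l\<in>int_lattice. \<mu> (\<xi> + l) * A (\<xi> + l))) powr q))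
      \<le> (NNINT \<xi>. ennreal (2 powr q) * (ennreal (norm (A \<xi> * (1 - \<phi>h \<xi> * \<mu> \<xi>)) powr q) + ennreal (norm (\<phi>h \<xi> * T \<xi>) powr q)))"
    proof (intro nn_integral_mono_AE, eventually_elim)
      case (elim \<xi>)
      have summ: "(\<lambda>l. BB (\<xi> + l)) summable_on int_lattice"
        by (rule abs_summable_summable[OF elim(2)])
      have "(\<Sum>\<^sub>\<infinity>l\<in>insert 0 (int_lattice - {0}). BB (\<xi> + l)) = BB (\<xi> + 0) + (\<Sum>\<^sub>\<infinity>l\<in>int_lattice - {0}. BB (\<xi> + l))"
        by (rule infsum_insert[OF summable_on_subset_banach[OF summ]]) auto
      then have "(\<Sum>\<^sub>\<infinity>l\<in>int_lattice. BB (\<xi> + l)) = BB \<xi> + T \<xi>"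
        by (simp add: T_def insert_absorb)
      then have "A \<xi> - \<phi>h \<xi> * (\<Sum>\<^sub>\<infinity>l\<in>int_lattice. \<mu> (\<xi> + l) * A (\<xi> + l)) = A \<xi> * (1 - \<phi>h \<xi> * \<mu> \<xi>) - \<phi>h \<xi> * T \<xi>"
        by (simp add: BB_def algebra_simps)
      then have "norm (A \<xi> - \<phi>h \<xi> * (\<Sum>\<^sub>\<infinity>l\<in>int_lattice. \<mu> (\<xi> + l) * A (\<xi> + l))) \<le> norm (A \<xi> * (1 - \<phi>h \<xi> * \<mu> \<xi>)) + norm (\<phi>h \<xi> * T \<xi>)"
        by (simp only: norm_triangle_ineq4)
      then have "norm (A \<xi> - \<phi>h \<xi> * (\<Sum>\<^sub>\<infinity>l\<in>int_lattice. \<mu> (\<xi> + l) * A (\<xi> + l))) powr q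
          \<le> (norm (A \<xi> * (1 - \<phi>h \<xi> * \<mu> \<xi>)) + norm (\<phi>h \<xi> * T \<xi>)) powr q"
        using q by (intro powr_mono2) auto
      also have "\<dots> \<le> 2 powr q * (norm (A \<xi> * (1 - \<phi>h \<xi> * \<mu> \<xi>)) powr q + norm (\<phi>h \<xi> * T \<xi>) powr q)"
        using q by (intro powr_add_le) auto
      finally show ?case
        by (simp add: ennreal_leI flip: ennreal_plus ennreal_mult)
    qed
    also have "\<dots> = ennreal (2 powr q) * ((NNINT \<xi>. ennreal (norm (A \<xi> * (1 - \<phi>h \<xi> * \<mu> \<xi>)) powr q))
        + (NNINT \<xi>. ennreal (norm (\<phi>h \<xi> * T \<xi>) powr q)))"
      by (subst nn_integral_cmult, measurable, subst nn_integral_add) auto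
    also have "\<dots> \<le> ennreal (2 powr q) * (ennreal (C1 powr q) * I1 + ennreal D * (ennreal (E * C2) * I1 + ennreal (Z * B) * I2))"
      by (intro mult_left_mono add_mono near_part off_part) auto
    also have "\<dots> \<le> ennreal (2 powr q) * (ennreal (C1 powr q) * (I1 + I2) + ennreal D * (ennreal (E * C2) * (I1 + I2) + ennreal (Z * B) * (I1 + I2)))"
      by (intro mult_left_mono add_mono) auto
    also have "\<dots> = ennreal C * (I1 + I2)"
    proof -
      have "ennreal C = ennreal (2 powr q) * (ennreal (C1 powr q) + ennreal D * (ennreal (E * C2) + ennreal (Z * B)))"
        unfolding C_def using D EZ off(1) B(1) by (simp add: ennreal_mult ennreal_plus)
      then show ?thesis by (simp only: distrib_left distrib_right mult.assoc add_ac)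
    qed
    finally show ?thesis unfolding I1_def I2_def .
  qed
  from C main show ?thesis by (rule that)
qed

section \<open>Isotropic dilation matrices\<close>

definition diag_mat :: "('d::finite \<Rightarrow> complex) \<Rightarrow> complex ^ 'd ^ 'd" where
  "diag_mat \<Lambda> = (\<chi> i j. if i = j then \<Lambda> i else 0)"

lemma diag_mat_vec: "(diag_mat \<Lambda> *v y) $ i = \<Lambda> i * y $ i"
  by (simp add: diag_mat_def matrix_vector_mult_def if_distrib[of "\<lambda>x. x * _"] cong: if_cong)

lemma diag_mat_mult: "diag_mat \<Lambda> ** diag_mat \<Gamma> = diag_mat (\<lambda>i. \<Lambda> i * \<Gamma> i)"
  by (simp add: matrix_eq matrix_vector_mul_assoc[symmetric] vec_eq_iff diag_mat_vec mult_ac)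

lemma diag_mat_1: "diag_mat (\<lambda>_. 1) = mat 1"
  by (simp add: diag_mat_def mat_def)

lemma complex_mat_mult: "complex_mat (A ** B) = complex_mat A ** complex_mat B"
  by (simp add: complex_mat_def matrix_matrix_mult_def map_matrix_def vec_eq_iff)

lemma complex_mat_1: "complex_mat (mat 1) = mat 1"
  by (simp add: complex_mat_def mat_def map_matrix_def vec_eq_iff)

lemma complex_mat_nth [simp]: "complex_mat A $ i $ j = complex_of_real (A $ i $ j)"
  by (simp add: complex_mat_def map_matrix_def)

lemma matrix_inv_right_left:
  assumes "invertible A"
  shows "A ** matrix_inv A = mat 1" "matrix_inv A ** A = mat 1"
proof -
  have "A ** matrix_inv A = mat 1 \<and> matrix_inv A ** A = mat 1"
    unfolding matrix_inv_def using assms unfolding invertible_def by (rule someI_ex)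
  then show "A ** matrix_inv A = mat 1" "matrix_inv A ** A = mat 1" by simp_all
qed

lemma dilation_matrix_invertible:
  fixes M :: "real ^ 'd ^ 'd"
  assumes "dilation_matrix M"
  shows "invertible M"
proof -
  have "x = 0" if "M *v x = 0" for x
  proof (rule ccontr)
    assume "x \<noteq> 0"
    define v where "v = (\<chi> i. complex_of_real (x $ i))"
    have "v \<noteq> 0" using \<open>x \<noteq> 0\<close> by (auto simp: v_def vec_eq_iff)
    moreover have "complex_mat M *v v = 0 *s v"
    proof -
      have "(complex_mat M *v v) $ i = complex_of_real ((M *v x) $ i)" for i
        by (simp add: matrix_vector_mult_def v_def)
      then show ?thesis using that by (simp add: vec_eq_iff)
    qed
    ultimately have "eigenvalue M 0" unfolding eigenvalue_def by blast
    then show False using assms unfolding dilation_matrix_def by fastforce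
  qed
  then have "\<exists>B. B ** M = mat 1"
    using matrix_left_invertible_ker[of M] by blast
  then show ?thesis by (simp add: invertible_left_inverse)
qed

text \<open>In the diagonalisation of the j-th power of the inverse of M the outer factors do not
  depend on j, and the diagonal entries all have modulus |lam|^(-j). A bound on the matrix entries
  gives the same rate for the transpose, which acts on frequencies.\<close>

lemma isotropic_pow_inverse:
  fixes M :: "real ^ 'd ^ 'd"
  assumes M: "dilation_matrix M" "isotropic M" "eigenvalue M lam"
  obtains C where "0 < C"
    "\<And>j x. norm (transpose (mat_pow (matrix_inv M) j) *v x) \<le> C / norm lam ^ j * norm x"
proof -
  obtain P :: "complex ^ 'd ^ 'd" and \<Lambda> where P: "invertible P" and eq: "complex_mat M = P ** diag_mat \<Lambda> ** matrix_inv P"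
    and \<Lambda>: "\<And>i j. norm (\<Lambda> i) = norm (\<Lambda> j)"
    using M(2) unfolding isotropic_def diag_mat_def[symmetric]
    by blast
  define Q where "Q = matrix_inv P"
  have PQ: "P ** Q = mat 1" "Q ** P = mat 1"
    using P by (simp_all add: Q_def matrix_inv_right_left)
  obtain v where v: "v \<noteq> 0" "complex_mat M *v v = lam *s v"
    using M(3) unfolding eigenvalue_def by blast
  define y where "y = Q *v v"
  have Py: "P *v y = v"
    using PQ by (simp add: y_def matrix_vector_mul_assoc)
  have "y \<noteq> 0" using Py v by auto
  then obtain i where i: "y $ i \<noteq> 0" by (auto simp: vec_eq_iff)
  \<comment> \<open>The vector y is an eigenvector of the diagonal matrix with eigenvalue lam; a
    nonzero coordinate of y shows that lam is one of the diagonal entries, which fixes their common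
    modulus.\<close>
  have "diag_mat \<Lambda> *v y = Q *v (complex_mat M *v v)"
    unfolding eq Q_def[symmetric] Py[symmetric]
    using PQ by (metis matrix_mul_assoc matrix_mul_lid matrix_mul_rid matrix_vector_mul_assoc)
  also have "\<dots> = lam *s y"
    unfolding v(2) y_def by (simp add: vector_scalar_commute)
  finally have "(diag_mat \<Lambda> *v y) $ i = lam * y $ i" by simp
  then have "\<Lambda> i = lam" using i by (simp add: diag_mat_vec)
  then have norm\<Lambda>: "norm (\<Lambda> j) = norm lam" for j using \<Lambda>[of j i] by simp
  have lam: "1 < norm lam" using M(1,3) by (simp add: dilation_matrix_def)
  then have \<Lambda>0: "\<Lambda> j \<noteq> 0" for j using norm\<Lambda>[of j] by auto
  have Minv: "M ** matrix_inv M = mat 1"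
    using dilation_matrix_invertible[OF M(1)] by (simp add: matrix_inv_right_left)
  have inv1: "complex_mat (matrix_inv M) = P ** diag_mat (\<lambda>i. inverse (\<Lambda> i)) ** Q"
  proof -
    have 1: "(P ** diag_mat (\<lambda>i. inverse (\<Lambda> i)) ** Q) ** complex_mat M = mat 1"
    proof -
      have "(P ** diag_mat (\<lambda>i. inverse (\<Lambda> i)) ** Q) ** complex_mat M
        = P ** (diag_mat (\<lambda>i. inverse (\<Lambda> i)) ** ((Q ** P) ** diag_mat \<Lambda>)) ** Q"
        unfolding eq Q_def[symmetric] by (simp only: matrix_mul_assoc)
      also have "\<dots> = mat 1"
        using PQ \<Lambda>0 by (simp add: diag_mat_mult diag_mat_1)
      finally show ?thesis .
    qed
    have 2: "complex_mat M ** complex_mat (matrix_inv M) = mat 1"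
      using Minv by (simp add: complex_mat_mult[symmetric] complex_mat_1)
    have "complex_mat (matrix_inv M) = ((P ** diag_mat (\<lambda>i. inverse (\<Lambda> i)) ** Q) ** complex_mat M) ** complex_mat (matrix_inv M)"
      using 1 by simp
    also have "\<dots> = (P ** diag_mat (\<lambda>i. inverse (\<Lambda> i)) ** Q) ** (complex_mat M ** complex_mat (matrix_inv M))"
      by (simp only: matrix_mul_assoc)
    finally show ?thesis using 2 by simp
  qed
  have pow: "complex_mat (mat_pow (matrix_inv M) j) = P ** diag_mat (\<lambda>i. inverse (\<Lambda> i) ^ j) ** Q" for j
  proof (induction j)
    case 0
    then show ?case using PQ by (simp add: complex_mat_1 diag_mat_1)
  next
    case (Suc j)
    have "complex_mat (mat_pow (matrix_inv M) (Suc j))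
      = P ** (diag_mat (\<lambda>i. inverse (\<Lambda> i)) ** ((Q ** P) ** diag_mat (\<lambda>i. inverse (\<Lambda> i) ^ j))) ** Q"
      by (simp only: mat_pow.simps complex_mat_mult inv1 Suc matrix_mul_assoc)
    then show ?case using PQ by (simp add: diag_mat_mult)
  qed
  define c where "c = (\<Sum>l\<in>UNIV. \<Sum>i\<in>UNIV. \<Sum>k\<in>UNIV. norm (P $ i $ l) * norm (Q $ l $ k))"
  have c0: "0 \<le> c" unfolding c_def by (intro sum_nonneg) auto
  have entry: "\<bar>mat_pow (matrix_inv M) j $ i $ k\<bar> \<le> c / norm lam ^ j" for j i k
  proof -
    have "\<bar>mat_pow (matrix_inv M) j $ i $ k\<bar> = norm (complex_mat (mat_pow (matrix_inv M) j) $ i $ k)" by simp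
    also have "complex_mat (mat_pow (matrix_inv M) j) $ i $ k = (\<Sum>l\<in>UNIV. P $ i $ l * inverse (\<Lambda> l) ^ j * Q $ l $ k)"
      unfolding pow by (simp add: matrix_matrix_mult_def diag_mat_def if_distrib[of "\<lambda>x. _ * x"] cong: if_cong)
    also have "norm \<dots> \<le> (\<Sum>l\<in>UNIV. norm (P $ i $ l) * norm (Q $ l $ k) / norm lam ^ j)"
      by (intro order_trans[OF norm_sum] sum_mono)
         (simp add: norm_mult norm_power norm_inverse norm\<Lambda> divide_inverse power_inverse mult_ac)
    also have "\<dots> \<le> (\<Sum>l\<in>UNIV. (\<Sum>i\<in>UNIV. \<Sum>k\<in>UNIV. norm (P $ i $ l) * norm (Q $ l $ k)) / norm lam ^ j)"
    proof (intro sum_mono divide_right_mono)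
      fix l
      have "norm (P $ i $ l) * norm (Q $ l $ k) \<le> (\<Sum>k\<in>UNIV. norm (P $ i $ l) * norm (Q $ l $ k))"
        by (rule member_le_sum) auto
      also have "\<dots> \<le> (\<Sum>i\<in>UNIV. \<Sum>k\<in>UNIV. norm (P $ i $ l) * norm (Q $ l $ k))"
        by (rule member_le_sum) (auto intro: sum_nonneg)
      finally show "norm (P $ i $ l) * norm (Q $ l $ k) \<le> (\<Sum>i\<in>UNIV. \<Sum>k\<in>UNIV. norm (P $ i $ l) * norm (Q $ l $ k))" .
    qed auto
    also have "\<dots> = c / norm lam ^ j" by (simp add: c_def sum_divide_distrib)
    finally show ?thesis .
  qed
  define C where "C = real CARD('d) * real CARD('d) * c + 1"
  have "norm (transpose (mat_pow (matrix_inv M) j) *v x) \<le> C / norm lam ^ j * norm x" for j and x :: "real ^ 'd"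
  proof -
    have l0: "0 < norm lam ^ j" using lam by (intro zero_less_power) linarith
    have "norm (transpose (mat_pow (matrix_inv M) j) *v x) \<le> (\<Sum>i\<in>UNIV. \<bar>(transpose (mat_pow (matrix_inv M) j) *v x) $ i\<bar>)"
      by (rule norm_le_l1_cart)
    also have "\<dots> \<le> (\<Sum>i\<in>(UNIV :: 'd set). \<Sum>k\<in>(UNIV :: 'd set). c / norm lam ^ j * norm x)"
    proof (rule sum_mono)
      fix i
      have "\<bar>(transpose (mat_pow (matrix_inv M) j) *v x) $ i\<bar> \<le> (\<Sum>k\<in>UNIV. \<bar>mat_pow (matrix_inv M) j $ k $ i * x $ k\<bar>)"
        unfolding matrix_vector_mult_def transpose_def by (simp add: sum_abs)
      also have "\<dots> \<le> (\<Sum>k\<in>(UNIV :: 'd set). c / norm lam ^ j * norm x)"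
        unfolding abs_mult using entry c0 l0
        by (intro sum_mono mult_mono component_le_norm_cart) auto
      finally show "\<bar>(transpose (mat_pow (matrix_inv M) j) *v x) $ i\<bar> \<le> (\<Sum>k\<in>(UNIV :: 'd set). c / norm lam ^ j * norm x)" .
    qed
    also have "\<dots> = (real CARD('d) * real CARD('d) * c) / norm lam ^ j * norm x" by simp
    also have "\<dots> \<le> C / norm lam ^ j * norm x"
      using l0 by (intro mult_right_mono divide_right_mono) (auto simp: C_def)
    finally show ?thesis .
  qed
  moreover have "0 < C" using c0 by (simp add: C_def add_nonneg_pos)
  ultimately show ?thesis using that by blast
qed

lemma mat_pow_inverse:
  assumes "invertible M"
  shows "mat_pow M j ** mat_pow (matrix_inv M) j = mat 1" "mat_pow (matrix_inv M) j ** mat_pow M j = mat 1"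
proof -
  have comm: "A ** mat_pow A j = mat_pow A j ** A" for A :: "real ^ 'a ^ 'a" and j
    by (induction j) (simp_all add: matrix_mul_assoc)
  have gen: "mat_pow A j ** mat_pow B j = mat 1" if AB: "A ** B = mat 1" for A B :: "real ^ 'a ^ 'a"
  proof (induction j)
    case (Suc j)
    have "mat_pow A (Suc j) ** mat_pow B (Suc j) = mat_pow A j ** (A ** B) ** mat_pow B j"
      by (simp add: comm[of A] matrix_mul_assoc)
    then show ?case using Suc AB by simp
  qed simp
  show "mat_pow M j ** mat_pow (matrix_inv M) j = mat 1" "mat_pow (matrix_inv M) j ** mat_pow M j = mat 1"
    using assms by (auto intro!: gen simp: matrix_inv_right_left)
qed

lemma det_mat_pow: "det (mat_pow M j) = det M ^ j" for M :: "real ^ 'd ^ 'd"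
  by (induction j) (simp_all add: det_mul)

section \<open>Linear change of variables\<close>

lemma borel_measurable_matrix_vector [measurable (raw)]:
  fixes A :: "real ^ 'd ^ 'e"
  assumes "f \<in> borel_measurable M"
  shows "(\<lambda>x. A *v f x) \<in> borel_measurable M"
  using borel_measurable_continuous_onI[OF matrix_vector_mult_linear_continuous_on[of UNIV A]] assms
  by (rule measurable_compose[rotated])

text \<open>The library's change of variables for linear maps needs a well-ordered index type. For an arbitrary
  finite one, uniqueness of Haar measure gives the factor up to a constant; it is multiplicative, and the
  elementary matrices other than the diagonal ones are products of involutions.\<close>

lemma nn_integral_matrix_scale:
  fixes A :: "real ^ 'd ^ 'd"
  assumes A: "invertible A"
  obtains c :: ennreal where "\<And>f. f \<in> borel_measurable borel \<Longrightarrow> (NNINT x. f (A *v x)) = c * (NNINT x. f x)"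
proof -
  define g :: "real ^ 'd \<Rightarrow> ennreal" where "g = indicator unit_cell"
  have [measurable]: "g \<in> borel_measurable borel" by (simp add: g_def)
  have g1: "(NNINT x. g x) = 1" by (simp add: g_def emeasure_unit_cell)
  define B where "B = matrix_inv A"
  have AB: "A *v (B *v y) = y" for y
    using A by (simp add: B_def matrix_vector_mul_assoc matrix_inv_right_left)
  have "(NNINT x. f (A *v x)) = (NNINT x. g (A *v x)) * (NNINT x. f x)"
    if [measurable]: "f \<in> borel_measurable borel" for f :: "real ^ 'd \<Rightarrow> ennreal"
  proof -
    \<comment> \<open>For fixed x the integral of g (y + A x) over y is 1. Exchanging the
      integrations and shifting x by B y then separates f from g.\<close>
    have "(NNINT x. f (A *v x)) = (NNINT x. NNINT y. f (A *v x) * g (y + A *v x))"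
      by (simp add: nn_integral_cmult nn_integral_lborel_shift g1)
    also have "\<dots> = (NNINT y. NNINT x. f (A *v x) * g (y + A *v x))"
      by (rule nn_integral_swap) measurable
    also have "\<dots> = (NNINT y. NNINT x. f (A *v x - y) * g (A *v x))"
    proof (rule nn_integral_cong)
      fix y
      show "(NNINT x. f (A *v x) * g (y + A *v x)) = (NNINT x. f (A *v x - y) * g (A *v x))"
        using nn_integral_lborel_shift[of "\<lambda>x. f (A *v x - y) * g (A *v x)" "B *v y"]
        by (simp add: matrix_vector_right_distrib AB add.commute)
    qed
    also have "\<dots> = (NNINT x. NNINT y. f (A *v x - y) * g (A *v x))"
      by (rule nn_integral_swap) measurable
    also have "\<dots> = (NNINT x. g (A *v x)) * (NNINT x. f x)"
      by (simp add: nn_integral_multc nn_integral_cmult nn_integral_lborel_reflect)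
        (rule mult.commute)
    finally show ?thesis .
  qed
  then show ?thesis by (rule that)
qed

text \<open>Applying the scaling twice shows that the constant has square 1, hence is 1; the
  determinant satisfies the same equation up to sign.\<close>

lemma nn_integral_matrix_involution:
  fixes A :: "real ^ 'd ^ 'd"
  assumes A: "A ** A = mat 1"
  shows "\<bar>det A\<bar> = 1"
    and "f \<in> borel_measurable borel \<Longrightarrow> (NNINT x. f (A *v x)) = (NNINT x. f x)"
proof -
  have "\<bar>det A\<bar> * \<bar>det A\<bar> = 1" using A by (metis abs_mult abs_one det_I det_mul)
  then show "\<bar>det A\<bar> = 1" by (auto simp: square_eq_1_iff)
  have "invertible A" using A by (auto simp: invertible_def)
  then obtain c where c: "\<And>f. f \<in> borel_measurable borel \<Longrightarrow> (NNINT x. f (A *v x)) = c * (NNINT x. f x)"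
    using nn_integral_matrix_scale by blast
  define g :: "real ^ 'd \<Rightarrow> ennreal" where "g = indicator unit_cell"
  have [measurable]: "g \<in> borel_measurable borel" by (simp add: g_def)
  have g1: "(NNINT x. g x) = 1" by (simp add: g_def emeasure_unit_cell)
  have "(NNINT x. g (A *v (A *v x))) = c * (c * 1)"
    using c[of "\<lambda>x. g (A *v x)"] c[of g] by (simp add: g1)
  then have "c * c = 1" using A g1 by (simp add: matrix_vector_mul_assoc)
  then have "c = 1"
  proof (cases c)
    case (real r)
    then have "r * r = 1" using \<open>c * c = 1\<close> by (simp flip: ennreal_mult ennreal_1 add: ennreal_inj)
    then show ?thesis using real by (simp add: square_eq_1_iff)
  qed (simp add: ennreal_top_mult)
  then show "(NNINT x. f (A *v x)) = (NNINT x. f x)" if "f \<in> borel_measurable borel"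
    using c[OF that] by simp
qed

lemma nn_integral_matrix_diagonal:
  fixes A :: "real ^ 'd ^ 'd" and f :: "real ^ 'd \<Rightarrow> ennreal"
  assumes diag: "\<And>i j. i \<noteq> j \<Longrightarrow> A $ i $ j = 0" and det: "det A \<noteq> 0" and [measurable]: "f \<in> borel_measurable borel"
  shows "(NNINT x. f x) = ennreal \<bar>det A\<bar> * (NNINT x. f (A *v x))"
proof -
  define c where "c b = b \<bullet> (A *v b)" for b
  have c_axis: "c (axis i 1) = A $ i $ i" for i
    by (simp add: c_def inner_axis' matrix_vector_mult_basis column_def)
  have basis: "(Basis :: (real ^ 'd) set) = range (\<lambda>i. axis i 1)" by (auto simp: Basis_vec_def)
  have inj: "inj (\<lambda>i :: 'd. axis i (1 :: real))" by (auto simp: inj_def axis_eq_axis)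
  have detA: "det A = (\<Prod>i\<in>UNIV. A $ i $ i)" by (rule det_diagonal[OF diag])
  have T: "A *v x = 0 + (\<Sum>j\<in>Basis. (c j * (x \<bullet> j)) *\<^sub>R j)" for x
  proof -
    have "(\<Sum>j\<in>Basis. (c j * (x \<bullet> j)) *\<^sub>R j) = (\<Sum>i\<in>UNIV. (A $ i $ i * x $ i) *\<^sub>R axis i 1)"
      unfolding basis by (subst sum.reindex[OF inj]) (simp add: c_axis inner_axis)
    also have "\<dots> = A *v x"
    proof (simp add: vec_eq_iff, intro allI)
      fix k
      have "(A *v x) $ k = (\<Sum>j\<in>UNIV. if j = k then A $ k $ k * x $ k else 0)"
        unfolding matrix_vector_mult_def by (subst vec_lambda_beta, intro sum.cong) (auto simp: diag)
      moreover have "(\<Sum>i\<in>UNIV. A $ i $ i * x $ i * axis i 1 $ k) = (\<Sum>j\<in>UNIV. if j = k then A $ k $ k * x $ k else 0)"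
        by (intro sum.cong) (auto simp: axis_def)
      ultimately show "(\<Sum>i\<in>UNIV. A $ i $ i * x $ i * axis i 1 $ k) = (A *v x) $ k" by simp
    qed
    finally show ?thesis by simp
  qed
  have "c b \<noteq> 0" if "b \<in> Basis" for b :: "real ^ 'd"
    using that det unfolding basis detA by (auto simp: c_axis)
  note aff = lborel_affine_euclidean[of c 0, OF this]
  have prod: "(\<Prod>j\<in>Basis. \<bar>c j\<bar>) = \<bar>det A\<bar>"
    unfolding basis detA by (subst prod.reindex[OF inj]) (simp add: c_axis abs_prod)
  have aff': "density (distr lborel borel (\<lambda>x. A *v x)) (\<lambda>_. ennreal \<bar>det A\<bar>) = lborel"
    using aff[symmetric] by (simp only: T prod)
  have "(NNINT x. f x) = (\<integral>\<^sup>+x. f x \<partial>density (distr lborel borel (\<lambda>x. A *v x)) (\<lambda>_. ennreal \<bar>det A\<bar>))"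
    by (simp only: aff')
  also have "\<dots> = ennreal \<bar>det A\<bar> * (NNINT x. f (A *v x))"
    by (simp add: nn_integral_density nn_integral_distr nn_integral_cmult)
  finally show ?thesis .
qed

text \<open>Induction over elementary matrices. The guard det \<noteq> 0 in P makes the case of a
  zero row trivial and is inherited by the factors of a product.\<close>

lemma nn_integral_matrix:
  fixes A :: "real ^ 'd ^ 'd" and f :: "real ^ 'd \<Rightarrow> ennreal"
  assumes A: "invertible A" and f: "f \<in> borel_measurable borel"
  shows "(NNINT x. f x) = ennreal \<bar>det A\<bar> * (NNINT x. f (A *v x))"
proof -
  define P where "P A \<longleftrightarrow> (det A \<noteq> 0 \<longrightarrow> (\<forall>f\<in>borel_measurable borel.
      (NNINT x. f x) = ennreal \<bar>det A\<bar> * (NNINT x. f (A *v x))))" for A :: "real ^ 'd ^ 'd"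
  have mult: "P (A ** B)" if "P A" "P B" for A B
    unfolding P_def
  proof (intro impI ballI)
    fix f :: "real ^ 'd \<Rightarrow> ennreal" assume "det (A ** B) \<noteq> 0" and f [measurable]: "f \<in> borel_measurable borel"
    then have AB: "det A \<noteq> 0" "det B \<noteq> 0" by (auto simp: det_mul)
    have fA: "(\<lambda>x. f (A *v x)) \<in> borel_measurable borel" by measurable
    have "(NNINT x. f x) = ennreal \<bar>det A\<bar> * (NNINT x. f (A *v x))"
      using that(1) AB(1) f unfolding P_def by blast
    also have "(NNINT x. f (A *v x)) = ennreal \<bar>det B\<bar> * (NNINT x. f (A *v (B *v x)))"
      using that(2) AB(2) fA unfolding P_def by blast
    finally show "(NNINT x. f x) = ennreal \<bar>det (A ** B)\<bar> * (NNINT x. f ((A ** B) *v x))"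
      by (simp only: det_mul abs_mult ennreal_mult abs_ge_zero mult.assoc matrix_vector_mul_assoc)
  qed
  have diagonal: "P A" if "\<And>i j. i \<noteq> j \<Longrightarrow> A $ i $ j = 0" for A
    unfolding P_def using nn_integral_matrix_diagonal[OF that] by blast
  have involution: "P A" if "A ** A = mat 1" for A
    unfolding P_def using nn_integral_matrix_involution[OF that] by simp
  have "P A"
  proof (rule induct_matrix_elementary_alt)
    fix A B :: "real ^ 'd ^ 'd" assume "P A" "P B" then show "P (A ** B)" by (rule mult)
  next
    fix A :: "real ^ 'd ^ 'd" and i assume "row i A = 0"
    then show "P A" by (simp add: P_def det_zero_row)
  next
    fix A :: "real ^ 'd ^ 'd" assume "\<And>i j. i \<noteq> j \<Longrightarrow> A $ i $ j = 0" then show "P A" by (rule diagonal)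
  next
    fix m n :: 'd
    let ?S = "(\<chi> i j. mat 1 $ i $ Transposition.transpose m n j) :: real ^ 'd ^ 'd"
    have S: "(?S *v x) $ i = x $ Transposition.transpose m n i" for x i
    proof -
      have "(?S *v x) $ i = (\<Sum>j\<in>UNIV. if j = Transposition.transpose m n i then x $ j else 0)"
        unfolding matrix_vector_mult_def mat_def by (subst vec_lambda_beta, intro sum.cong) auto
      then show ?thesis by simp
    qed
    show "P ?S"
    proof (rule involution)
      show "?S ** ?S = mat 1"
        by (simp add: matrix_eq matrix_vector_mul_assoc[symmetric] vec_eq_iff S del: matrix_vector_mul_assoc)
    qed
  next
    fix m n :: 'd assume mn: "m \<noteq> n"
    \<comment> \<open>A shear is not an involution, but composed with the reflection D of the m-th
      coordinate it becomes one: E D sends x m to x n - x m. Since D is its own inverse, E = (E D)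
      D.\<close>
    define E :: "real ^ 'd ^ 'd" where "E = (\<chi> i j. of_bool (i = m \<and> j = n \<or> i = j))"
    define D :: "real ^ 'd ^ 'd" where "D = (\<chi> i j. if i = j then if i = m then - 1 else 1 else 0)"
    have D: "(D *v x) $ i = (if i = m then - x $ i else x $ i)" for x i
    proof -
      have "(D *v x) $ i = (\<Sum>j\<in>UNIV. if j = i then if i = m then - x $ i else x $ i else 0)"
        unfolding matrix_vector_mult_def D_def by (subst vec_lambda_beta, intro sum.cong) auto
      then show ?thesis by simp
    qed
    have E: "(E *v x) $ i = (if i = m then x $ m + x $ n else x $ i)" for x i
    proof -
      have "(E *v x) $ i = (\<Sum>j\<in>UNIV. (if j = i then x $ i else 0) + (if j = n then if i = m then x $ n else 0 else 0))"
        unfolding matrix_vector_mult_def E_def using mn by (subst vec_lambda_beta, intro sum.cong) auto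
      then show ?thesis by (simp add: sum.distrib)
    qed
    have "P D" by (rule diagonal) (simp add: D_def)
    moreover have "P (E ** D)"
      using mn by (intro involution)
        (simp add: matrix_eq matrix_vector_mul_assoc[symmetric] vec_eq_iff E D del: matrix_vector_mul_assoc)
    moreover have "E = (E ** D) ** D"
      by (simp only: matrix_eq matrix_vector_mul_assoc[symmetric] vec_eq_iff E D) simp
    ultimately have "P E" using mult[of "E ** D" D] by simp
    then show "P (\<chi> i j. of_bool (i = m \<and> j = n \<or> i = j))" by (simp only: E_def)
  qed
  then show ?thesis using A f unfolding P_def invertible_det_nz by blast
qed

lemma lborel_distr_matrix:
  fixes A :: "real ^ 'd ^ 'd"
  assumes A: "invertible A"
  shows "density (distr lborel borel (\<lambda>x. A *v x)) (\<lambda>_. ennreal \<bar>det A\<bar>) = lborel"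
proof (rule measure_eqI)
  fix X assume "X \<in> sets (density (distr lborel borel (\<lambda>x. A *v x)) (\<lambda>_. ennreal \<bar>det A\<bar>))"
  then have [measurable]: "X \<in> sets borel" by simp
  have "emeasure (density (distr lborel borel (\<lambda>x. A *v x)) (\<lambda>_. ennreal \<bar>det A\<bar>)) X
      = ennreal \<bar>det A\<bar> * (NNINT x. indicator X (A *v x))"
    by (simp add: emeasure_density nn_integral_cmult nn_integral_distr del: nn_integral_indicator)
  also have "\<dots> = emeasure lborel X"
    using nn_integral_matrix[OF A, of "indicator X"] by simp
  finally show "emeasure (density (distr lborel borel (\<lambda>x. A *v x)) (\<lambda>_. ennreal \<bar>det A\<bar>)) X = emeasure lborel X" .
qed simp

lemma integral_matrix:
  fixes A :: "real ^ 'd ^ 'd" and f :: "real ^ 'd \<Rightarrow> complex"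
  assumes A: "invertible A" and [measurable]: "f \<in> borel_measurable borel"
  shows "(LBINT x. f x) = \<bar>det A\<bar> *\<^sub>R (LBINT x. f (A *v x))"
proof -
  have "(LBINT x. f x) = (\<integral>x. f x \<partial>density (distr lborel borel (\<lambda>x. A *v x)) (\<lambda>_. ennreal \<bar>det A\<bar>))"
    by (simp only: lborel_distr_matrix[OF A])
  also have "\<dots> = \<bar>det A\<bar> *\<^sub>R (LBINT x. f (A *v x))"
    by (subst integral_density, simp, simp, simp, subst integral_distr) auto
  finally show ?thesis .
qed

lemma AE_matrix:
  fixes A :: "real ^ 'd ^ 'd"
  assumes A: "invertible A" and ae: "AE x in lborel. P x"
  shows "AE x in lborel. P (A *v x)"
proof -
  have det: "\<bar>det A\<bar> > 0" using A by (simp add: invertible_det_nz)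
  have "AE x in density (distr lborel borel (\<lambda>x. A *v x)) (\<lambda>_. ennreal \<bar>det A\<bar>). P x"
    using ae by (simp only: lborel_distr_matrix[OF A])
  then have "AE x in distr lborel borel (\<lambda>x. A *v x). P x"
    using det by (simp add: AE_density)
  from AE_distrD[OF _ this] show ?thesis by simp
qed

section \<open>Lebesgue norms and decay\<close>

text \<open>Separates the endpoint p = \<infinity>, q = 1 from real exponents. A nonpositive q is
  excluded because \<open>ennreal\<close> sends it to 0, whose inverse is infinite.\<close>

lemma conjugate_exponent:
  assumes q: "1 / p + 1 / ennreal q = 1" and p: "2 \<le> p"
  shows "(p = \<infinity> \<and> q = 1) \<or> (\<exists>r. p = ennreal r \<and> 2 \<le> r \<and> q = r / (r - 1))"
proof (cases p)
  case (real r)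
  then have r: "2 \<le> r" using p by (simp add: ennreal_numeral[symmetric] del: ennreal_numeral)
  have q0: "0 < q"
  proof (rule ccontr)
    assume "\<not> 0 < q"
    then have "1 / ennreal q = \<infinity>" by (simp add: ennreal_neg)
    then show False using q by simp
  qed
  have "1 / p = ennreal (1 / r)" using real r by (simp add: divide_ennreal[symmetric])
  moreover have "1 / ennreal q = ennreal (1 / q)" using q0 by (simp add: divide_ennreal[symmetric])
  ultimately have "ennreal (1 / r + 1 / q) = 1" using q r q0 by (simp add: ennreal_plus)
  then have "1 / r + 1 / q = 1" by (simp del: ennreal_plus)
  then have "q = r / (r - 1)" using r q0 by (simp add: field_simps)
  then show ?thesis using real r by auto
next
  case top
  then have *: "1 / ennreal q = 1" using q by simp
  have q0: "0 < q"
  proof (rule ccontr)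
    assume "\<not> 0 < q"
    then have "1 / ennreal q = \<infinity>" by (simp add: ennreal_neg)
    then show False using * by simp
  qed
  then have "ennreal (1 / q) = 1" using * by (simp add: divide_ennreal[symmetric])
  then have "q = 1" using q0 by (simp flip: ennreal_1 add: ennreal_inj)
  then show ?thesis using top by simp
qed

lemma epowr_ennreal [simp]: "0 \<le> x \<Longrightarrow> epowr (ennreal x) r = ennreal (x powr r)"
  by (simp add: epowr_def)

lemma epowr_finite_iff: "epowr x r < \<infinity> \<longleftrightarrow> x < \<infinity>"
  by (simp add: epowr_def less_top)

lemma Lp_norm_real:
  assumes "0 < r" "f \<in> borel_measurable lebesgue"
  shows "Lp_norm (ennreal r) f = epowr (NNINT x. ennreal (norm (f x) powr r)) (1 / r)"
proof -
  have "(\<lambda>x. ennreal (norm (f x))) \<in> borel_measurable lebesgue" using assms(2) by measurable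
  then show ?thesis
    using assms by (simp add: Lp_norm_def eLp_norm_def nn_integral_completion)
qed

lemma Lp_norm_le:
  assumes r: "0 < r" and f: "f \<in> borel_measurable lebesgue" and K: "0 \<le> K"
    and le: "(NNINT x. ennreal (norm (f x) powr r)) \<le> ennreal (K powr r)"
  shows "Lp_norm (ennreal r) f \<le> ennreal K"
proof -
  define I where "I = (NNINT x. ennreal (norm (f x) powr r))"
  have "I < \<infinity>" using le unfolding I_def by (rule le_less_trans) simp
  then obtain i where i: "0 \<le> i" "I = ennreal i" by (cases I) auto
  then have "i \<le> K powr r" using le by (simp add: I_def[symmetric])
  then have "i powr (1 / r) \<le> (K powr r) powr (1 / r)" using i r by (intro powr_mono2) auto
  also have "\<dots> = K" using r K by (simp add: powr_powr)
  finally show ?thesis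
    unfolding Lp_norm_real[OF r f] I_def[symmetric] using i by (simp add: ennreal_leI)
qed

lemma Lp_norm_infinity_le:
  assumes f: "f \<in> borel_measurable lebesgue" and le: "AE x in lborel. norm (f x) \<le> K"
  shows "Lp_norm \<infinity> f \<le> ennreal K"
proof -
  have m: "(\<lambda>x. ennreal (norm (f x))) \<in> borel_measurable lebesgue" using f by measurable
  have "AE x in lebesgue. ennreal (norm (f x)) \<le> ennreal K"
    using AE_completion[OF le] by eventually_elim (rule ennreal_leI)
  with m have "esssup lebesgue (\<lambda>x. ennreal (norm (f x))) \<le> ennreal K" by (intro esssup_I)
  then show ?thesis using f m by (simp add: Lp_norm_def eLp_norm_def)
qed

lemma powr_add_one_ge: "x \<le> 1 + x powr r" if "0 \<le> x" "1 \<le> r" for x r :: real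
proof (cases "x \<le> 1")
  case False
  then have "x \<le> x powr r" using powr_mono[of 1 r x] that by simp
  then show ?thesis by simp
qed (simp add: add_increasing2)

text \<open>For finite exponents |f| \<le> 1 + |f|^r, and the weight is both integrable and at most
  1; for p = \<infinity> the essential bound is a constant factor.\<close>

lemma Lp_weighted_finite:
  fixes f f0 :: "real ^ 'd \<Rightarrow> complex"
  assumes p: "p = \<infinity> \<or> (\<exists>r. p = ennreal r \<and> 1 \<le> r)" and f: "f \<in> Lp_space p"
    and f0 [measurable]: "f0 \<in> borel_measurable borel" and ae: "AE x in lborel. f x = f0 x" and b: "real CARD('d) < b"
  shows "(NNINT x. ennreal (norm (f0 x) * wt b x)) < \<infinity>"
proof -
  have wfin: "(NNINT x :: real ^ 'd. ennreal (wt b x)) < \<infinity>"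
    using nn_integral_wt_finite[where 'a = "real ^ 'd", of b] b by simp
  have fm: "f \<in> borel_measurable lebesgue" and ffin: "Lp_norm p f < \<infinity>" using f by (auto simp: Lp_space_def)
  from p show ?thesis
  proof
    assume p: "p = \<infinity>"
    have m: "(\<lambda>x. ennreal (norm (f x))) \<in> borel_measurable lebesgue" using fm by measurable
    define K where "K = esssup lebesgue (\<lambda>x. ennreal (norm (f x)))"
    have K: "K < \<infinity>" using ffin fm m p by (simp add: K_def Lp_norm_def eLp_norm_def)
    have "AE x in lebesgue. ennreal (norm (f x)) \<le> K" unfolding K_def by (rule esssup_AE)
    then have aeK: "AE x in lborel. ennreal (norm (f x)) \<le> K" by (simp add: AE_completion_iff)
    have "(NNINT x. ennreal (norm (f0 x) * wt b x)) \<le> (NNINT x :: real ^ 'd. K * ennreal (wt b x))"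
      using ae aeK by (intro nn_integral_mono_AE, eventually_elim) (simp add: ennreal_mult mult_right_mono)
    also have "\<dots> = K * (NNINT x :: real ^ 'd. ennreal (wt b x))"
      by (rule nn_integral_cmult) measurable
    also have "\<dots> < \<infinity>" using K wfin by (simp add: ennreal_mult_less_top)
    finally show ?thesis .
  next
    assume "\<exists>r. p = ennreal r \<and> 1 \<le> r"
    then obtain r where r: "p = ennreal r" "1 \<le> r" by blast
    have I: "(NNINT x. ennreal (norm (f x) powr r)) < \<infinity>"
      using ffin Lp_norm_real[of r f] fm r epowr_finite_iff by auto
    have "(NNINT x. ennreal (norm (f0 x) * wt b x)) \<le> (NNINT x. ennreal (norm (f0 x) powr r) + ennreal (wt b x))"
    proof (rule nn_integral_mono)
      fix x :: "real ^ 'd"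
      have "norm (f0 x) * wt b x \<le> (1 + norm (f0 x) powr r) * wt b x"
        using r(2) by (intro mult_right_mono powr_add_one_ge) auto
      also have "\<dots> \<le> norm (f0 x) powr r + wt b x"
        using wt_le_1[of b x] b by (simp add: distrib_right mult_left_le)
      finally show "ennreal (norm (f0 x) * wt b x) \<le> ennreal (norm (f0 x) powr r) + ennreal (wt b x)"
        by (simp add: ennreal_leI flip: ennreal_plus)
    qed
    also have "\<dots> = (NNINT x. ennreal (norm (f0 x) powr r)) + (NNINT x :: real ^ 'd. ennreal (wt b x))"
      by (rule nn_integral_add) measurable
    also have "(NNINT x. ennreal (norm (f0 x) powr r)) = (NNINT x. ennreal (norm (f x) powr r))"
      using ae by (intro nn_integral_cong_AE, eventually_elim) simp
    also have "\<dots> + (NNINT x :: real ^ 'd. ennreal (wt b x)) < \<infinity>"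
      using I wfin by simp
    finally show ?thesis .
  qed
qed

text \<open>The torus has finite measure, so the periodised |\<phi>| is integrable there, and
  unfolding makes \<phi> itself integrable. Its transform is thus a genuine integral whatever p
  is.\<close>

lemma calLp_integrable:
  fixes \<phi> \<phi>0 :: "real ^ 'd \<Rightarrow> complex"
  assumes p: "p = \<infinity> \<or> (\<exists>r. p = ennreal r \<and> 1 \<le> r)" and \<phi>: "\<phi> \<in> calLp_space p"
    and \<phi>0 [measurable]: "\<phi>0 \<in> borel_measurable borel" and ae: "AE x in lborel. \<phi> x = \<phi>0 x"
  shows "integrable lborel \<phi>0"
proof -
  define P where "P x = (\<Sum>\<^sub>\<infinity>k\<in>int_lattice. ennreal (norm (\<phi> (x + k))))" for x
  define P0 where "P0 x = (\<Sum>\<^sub>\<infinity>k\<in>int_lattice. ennreal (norm (\<phi>0 (x + k))))" for x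
  have fin: "eLp_norm p (lebesgue_on torus) P < \<infinity>"
    using \<phi> by (simp add: calLp_space_def calLp_norm_def P_def[abs_def])
  have tor: "torus \<in> sets (lebesgue :: (real ^ 'd) measure)" by (simp add: torus_def)
  \<comment> \<open>Finiteness of \<open>eLp_norm\<close> includes measurability, as the norm is
    infinite otherwise.\<close>
  have Pm: "P \<in> borel_measurable (lebesgue_on torus)"
    using fin by (auto simp: eLp_norm_def split: if_splits)
  have aeP: "AE x in lborel. P x = P0 x"
  proof -
    have "AE x in lborel. \<forall>k\<in>int_lattice. \<phi> (x + k) = \<phi>0 (x + k)"
    proof (subst AE_ball_countable[OF countable_int_lattice], intro ballI)
      fix k :: "real ^ 'd"
      have "AE x in distr lborel borel ((+) k). \<phi> x = \<phi>0 x"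
        unfolding lborel_distr_plus by (rule ae)
      from AE_distrD[OF _ this] show "AE x in lborel. \<phi> (x + k) = \<phi>0 (x + k)" by (simp add: add.commute)
    qed
    then show ?thesis
      by eventually_elim (auto simp: P_def P0_def intro!: infsum_cong)
  qed
  have tvol: "(NNINT x :: real ^ 'd. indicator torus x) < \<infinity>"
    using emeasure_compact_finite[of "torus :: (real ^ 'd) set"] by (simp add: torus_def)
  have le1: "(NNINT x. P x * indicator torus x) < \<infinity>"
    using p
  proof
    assume p: "p = \<infinity>"
    define K where "K = esssup (lebesgue_on torus) P"
    have K: "K < \<infinity>" using fin Pm p by (simp add: K_def eLp_norm_def)
    have "AE x in lebesgue_on torus. P x \<le> K" unfolding K_def by (rule esssup_AE)
    then have "AE x in lebesgue. x \<in> torus \<longrightarrow> P x \<le> K"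
      using tor by (subst (asm) AE_restrict_space_iff) auto
    then have "AE x in lborel. x \<in> torus \<longrightarrow> P x \<le> K" by (simp add: AE_completion_iff)
    then have "(NNINT x. P x * indicator torus x) \<le> (NNINT x :: real ^ 'd. K * indicator torus x)"
      by (intro nn_integral_mono_AE, eventually_elim) (auto simp: indicator_def)
    also have "\<dots> = K * (NNINT x :: real ^ 'd. indicator torus x)"
      by (rule nn_integral_cmult) (simp add: torus_def)
    also have "\<dots> < \<infinity>" using K tvol by (simp add: ennreal_mult_less_top)
    finally show ?thesis .
  next
    assume "\<exists>r. p = ennreal r \<and> 1 \<le> r"
    then obtain r where r: "p = ennreal r" "1 \<le> r" by blast
    have "(\<integral>\<^sup>+x. epowr (P x) r \<partial>(lebesgue_on torus)) < \<infinity>"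
      using fin Pm r epowr_finite_iff by (auto simp: eLp_norm_def)
    then have E: "(NNINT x. epowr (P x) r * indicator torus x) < \<infinity>"
      using tor by (simp add: nn_integral_restrict_space nn_integral_completion)
    have mE: "(\<lambda>x. epowr (P x) r * indicator torus x) \<in> borel_measurable lebesgue"
    proof -
      have e: "(\<lambda>y. epowr y r) \<in> borel_measurable borel" unfolding epowr_def by measurable
      have "(\<lambda>x. epowr (P x) r) \<in> borel_measurable (lebesgue_on torus)"
        by (rule measurable_compose[OF Pm e])
      then show ?thesis
        using tor by (subst (asm) borel_measurable_restrict_space_iff_ennreal) auto
    qed
    have "(\<integral>\<^sup>+x. P x * indicator torus x \<partial>lebesgue) \<le> (\<integral>\<^sup>+x. indicator torus x + epowr (P x) r * indicator torus x \<partial>lebesgue)"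
    proof (rule nn_integral_mono)
      fix x :: "real ^ 'd"
      have "y \<le> 1 + epowr y r" for y
      proof (cases y)
        case (real z)
        then have "ennreal z \<le> ennreal (1 + z powr r)" using r(2) by (intro ennreal_leI powr_add_one_ge) auto
        then show ?thesis using real by (simp add: ennreal_plus)
      qed (simp add: epowr_def)
      then show "P x * indicator torus x \<le> indicator torus x + epowr (P x) r * indicator torus x"
        by (auto simp: indicator_def)
    qed
    also have "\<dots> = (\<integral>\<^sup>+x. indicator torus x \<partial>(lebesgue :: (real ^ 'd) measure)) + (\<integral>\<^sup>+x. epowr (P x) r * indicator torus x \<partial>lebesgue)"
      by (rule nn_integral_add[OF borel_measurable_indicator[OF tor] mE])
    also have "\<dots> < \<infinity>" using E tvol by (simp add: nn_integral_completion)
    finally show ?thesis by (simp add: nn_integral_completion)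
  qed
  have "(NNINT x. ennreal (norm (\<phi>0 x))) = (NNINT x. P0 x * indicator unit_cell x)"
    unfolding P0_def by (rule nn_integral_lattice) measurable
  also have "\<dots> \<le> (NNINT x. P x * indicator torus x)"
    using aeP
    by (intro nn_integral_mono_AE, eventually_elim) (auto simp: indicator_def dest: subsetD[OF unit_cell_subset_torus])
  also note le1
  finally have "(NNINT x. ennreal (norm (\<phi>0 x))) < \<infinity>" .
  then show ?thesis by (intro integrableI_bounded) simp_all
qed

text \<open>On a ball the powers of |\<xi>| are bounded and membership in L_q suffices. Outside, the
  order N + 1 and the decay exponent leave |\<xi>| to the power - b / q with b = d + \<epsilon> q >
  d, whose q-th power is integrable at infinity.\<close>

lemma decay_weighted_finite:
  fixes fhat g :: "real ^ 'd \<Rightarrow> complex"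
  assumes q: "1 \<le> q" and fhat: "fhat \<in> Lp_space (ennreal q)" and eps: "0 < \<epsilon>"
    and g [measurable]: "g \<in> borel_measurable borel" and ae: "AE \<xi> in lborel. fhat \<xi> = g \<xi>"
    and decay: "(\<lambda>\<xi>. norm (fhat \<xi>)) \<in> O[at_infinity](\<lambda>\<xi>. norm \<xi> powr (- real N - 1 - real CARD('d) / q - \<epsilon>))"
    and m: "m \<le> N + 1"
  shows "(NNINT \<xi>. ennreal ((norm \<xi> ^ m * norm (g \<xi>)) powr q)) < \<infinity>"
proof -
  define e where "e = - real N - 1 - real CARD('d) / q - \<epsilon>"
  obtain c where c: "0 < c" "eventually (\<lambda>\<xi>. norm (norm (fhat \<xi>)) \<le> c * norm (norm \<xi> powr e)) at_infinity"
    using decay unfolding e_def by (elim landau_o.bigE) auto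
  then obtain R0 where R0: "\<And>\<xi>. R0 \<le> norm \<xi> \<Longrightarrow> norm (fhat \<xi>) \<le> c * norm \<xi> powr e"
    by (auto simp: eventually_at_infinity)
  define R where "R = max R0 1"
  have R: "1 \<le> R" "R0 \<le> R" by (auto simp: R_def)
  define b where "b = real CARD('d) + \<epsilon> * q"
  have b: "real CARD('d) < b" using eps q by (simp add: b_def)
  have b0: "0 \<le> b" using b by linarith
  have fm: "fhat \<in> borel_measurable lebesgue" and ffin: "Lp_norm (ennreal q) fhat < \<infinity>"
    using fhat by (auto simp: Lp_space_def)
  have I: "(NNINT \<xi>. ennreal (norm (fhat \<xi>) powr q)) < \<infinity>"
    using ffin Lp_norm_real[of q fhat] fm q epowr_finite_iff by auto
  have wfin: "(NNINT x :: real ^ 'd. ennreal (wt b x)) < \<infinity>"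
    using nn_integral_wt_finite[where 'a = "real ^ 'd", of b] b by simp
  define K1 where "K1 = (R ^ m) powr q"
  define K2 where "K2 = c powr q * 2 powr b"
  have pt: "(norm \<xi> ^ m * norm (fhat \<xi>)) powr q \<le> K1 * norm (fhat \<xi>) powr q + K2 * wt b \<xi>" for \<xi>
  proof (cases "norm \<xi> \<le> R")
    case True
    have "(norm \<xi> ^ m * norm (fhat \<xi>)) powr q \<le> (R ^ m * norm (fhat \<xi>)) powr q"
      using True q by (intro powr_mono2 mult_right_mono power_mono) auto
    also have "\<dots> = K1 * norm (fhat \<xi>) powr q" by (simp add: K1_def powr_mult)
    also have "\<dots> \<le> K1 * norm (fhat \<xi>) powr q + K2 * wt b \<xi>" by (simp add: K2_def)
    finally show ?thesis .
  next
    case False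
    then have n: "1 < norm \<xi>" "R0 \<le> norm \<xi>" using R by auto
    have "norm \<xi> ^ m * norm (fhat \<xi>) \<le> norm \<xi> powr real (N + 1) * (c * norm \<xi> powr e)"
    proof (intro mult_mono R0 n)
      have "norm \<xi> ^ m \<le> norm \<xi> ^ (N + 1)" using n m by (intro power_increasing) auto
      also have "\<dots> = norm \<xi> powr real (N + 1)" using n by (intro powr_realpow[symmetric]) auto
      finally show "norm \<xi> ^ m \<le> norm \<xi> powr real (N + 1)" .
    qed auto
    also have "\<dots> = c * norm \<xi> powr (real (N + 1) + e)" by (simp only: powr_add mult_ac)
    also have "real (N + 1) + e = - b / q"
      using q by (simp add: e_def b_def field_simps)
    finally have "(norm \<xi> ^ m * norm (fhat \<xi>)) powr q \<le> (c * norm \<xi> powr (- b / q)) powr q"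
      using q by (intro powr_mono2) auto
    also have "\<dots> = c powr q * norm \<xi> powr (- b)"
      using q by (simp add: powr_mult powr_powr)
    also have "norm \<xi> powr (- b) \<le> 2 powr b * wt b \<xi>"
    proof -
      have "1 + norm \<xi> \<le> 2 * norm \<xi>" using n by simp
      then have "(2 * norm \<xi>) powr (- b) \<le> (1 + norm \<xi>) powr (- b)"
        using n b0 by (intro powr_mono2') (auto simp: add_pos_nonneg)
      then have "2 powr b * (2 * norm \<xi>) powr (- b) \<le> 2 powr b * wt b \<xi>"
        unfolding wt_def by (intro mult_left_mono) auto
      moreover have "2 powr b * (2 * norm \<xi>) powr (- b) = norm \<xi> powr (- b)"
        by (simp only: powr_mult mult.assoc[symmetric] powr_add[symmetric]) simp
      ultimately show ?thesis by simp
    qed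
    finally have "(norm \<xi> ^ m * norm (fhat \<xi>)) powr q \<le> K2 * wt b \<xi>"
      by (simp add: K2_def mult_left_mono mult.assoc)
    then show ?thesis by (simp add: K1_def add_increasing)
  qed
  have "(NNINT \<xi>. ennreal ((norm \<xi> ^ m * norm (g \<xi>)) powr q))
    \<le> (NNINT \<xi>. ennreal K1 * ennreal (norm (g \<xi>) powr q) + ennreal K2 * ennreal (wt b \<xi>))"
    using ae
  proof (intro nn_integral_mono_AE, eventually_elim)
    case (elim \<xi>)
    then show ?case
      using pt[of \<xi>] by (simp add: K1_def K2_def ennreal_leI flip: ennreal_plus ennreal_mult)
  qed
  also have "\<dots> = ennreal K1 * (NNINT \<xi>. ennreal (norm (g \<xi>) powr q)) + ennreal K2 * (NNINT \<xi> :: real ^ 'd. ennreal (wt b \<xi>))"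
    by (subst nn_integral_add) (auto simp: nn_integral_cmult)
  also have "(NNINT \<xi>. ennreal (norm (g \<xi>) powr q)) = (NNINT \<xi>. ennreal (norm (fhat \<xi>) powr q))"
    using ae by (intro nn_integral_cong_AE, eventually_elim) simp
  also have "ennreal K1 * \<dots> + ennreal K2 * (NNINT \<xi> :: real ^ 'd. ennreal (wt b \<xi>)) < \<infinity>"
    using I wfin by (simp add: ennreal_mult_less_top)
  finally show ?thesis .
qed

text \<open>A pointwise form of Hoelder's inequality: where |g| exceeds the weight, the ratio x =
  |g| / \<open>wt b \<xi>\<close> is at least 1, so x \<le> x powr q, and the factor
  \<open>wt b \<xi>\<close> powr (1 - q) is absorbed by the moment of order m.\<close>

lemma weighted_integrable:
  fixes g :: "real ^ 'd \<Rightarrow> complex"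
  assumes q: "1 \<le> q" and dim: "real CARD('d) * (q - 1) < real m * q" and g [measurable]: "g \<in> borel_measurable borel"
    and fin0: "(NNINT \<xi>. ennreal (norm (g \<xi>) powr q)) < \<infinity>"
    and fin: "(NNINT \<xi>. ennreal ((norm \<xi> ^ m * norm (g \<xi>)) powr q)) < \<infinity>"
  shows "integrable lborel g"
proof -
  obtain b where b: "real CARD('d) < b" "b * (q - 1) \<le> real m * q"
    using weight_exponent[OF q dim] by blast
  have b0: "0 \<le> b" using b(1) by linarith
  define Z where "Z = 2 powr (real m * q)"
  have pt: "norm (g \<xi>) \<le> wt b \<xi> + Z * (norm (g \<xi>) powr q + (norm \<xi> ^ m * norm (g \<xi>)) powr q)" for \<xi>
  proof (cases "norm (g \<xi>) \<le> wt b \<xi>")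
    case True
    then show ?thesis by (simp add: Z_def add_increasing2)
  next
    case False
    define x where "x = norm (g \<xi>) / wt b \<xi>"
    have x: "1 \<le> x" using False wt_pos[of b \<xi>] by (simp add: x_def le_divide_eq)
    have "x \<le> x powr q" using powr_mono[of 1 q x] x q by simp
    then have "norm (g \<xi>) \<le> wt b \<xi> * x powr q"
      using wt_pos[of b \<xi>] by (simp add: x_def divide_le_eq mult.commute)
    also have "\<dots> = wt b \<xi> powr (1 - q) * norm (g \<xi>) powr q"
      using wt_pos[of b \<xi>] by (simp add: x_def powr_divide powr_diff)
    also have "wt b \<xi> powr (1 - q) = (1 + norm \<xi>) powr (b * (q - 1))"
      by (simp add: wt_def powr_powr algebra_simps)
    also have "\<dots> \<le> (1 + norm \<xi>) powr (real m * q)"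
      using b(2) by (intro powr_mono) auto
    also have "\<dots> \<le> Z * (1 powr (real m * q) + norm \<xi> powr (real m * q))"
      unfolding Z_def using q by (intro powr_add_le) auto
    finally have "norm (g \<xi>) \<le> Z * (1 + norm \<xi> powr (real m * q)) * norm (g \<xi>) powr q"
      by (simp add: mult_right_mono)
    also have "norm \<xi> powr (real m * q) * norm (g \<xi>) powr q \<le> (norm \<xi> ^ m * norm (g \<xi>)) powr q"
    proof (cases "\<xi> = 0")
      case False
      then have "norm \<xi> powr real m = norm \<xi> ^ m" by (intro powr_realpow) auto
      then show ?thesis by (simp add: powr_mult powr_powr[symmetric])
    qed simp
    then have "Z * (1 + norm \<xi> powr (real m * q)) * norm (g \<xi>) powr q \<le> Z * (norm (g \<xi>) powr q + (norm \<xi> ^ m * norm (g \<xi>)) powr q)"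
      unfolding mult.assoc by (intro mult_left_mono) (auto simp: distrib_right Z_def)
    finally show ?thesis using wt_nonneg[of b \<xi>] by linarith
  qed
  have "(NNINT \<xi>. ennreal (norm (g \<xi>)))
    \<le> (NNINT \<xi>. ennreal (wt b \<xi>) + ennreal Z * (ennreal (norm (g \<xi>) powr q) + ennreal ((norm \<xi> ^ m * norm (g \<xi>)) powr q)))"
    using pt by (intro nn_integral_mono) (simp add: Z_def ennreal_leI flip: ennreal_plus ennreal_mult)
  also have "\<dots> = (NNINT \<xi> :: real ^ 'd. ennreal (wt b \<xi>)) + ennreal Z * ((NNINT \<xi>. ennreal (norm (g \<xi>) powr q))
     + (NNINT \<xi>. ennreal ((norm \<xi> ^ m * norm (g \<xi>)) powr q)))"
    by (subst nn_integral_add, measurable, subst nn_integral_cmult, measurable, subst nn_integral_add) auto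
  also have "\<dots> < \<infinity>"
    using fin0 fin nn_integral_wt_finite[where 'a = "real ^ 'd", of b] b
    by (simp only: infinity_ennreal_def ennreal_add_less_top ennreal_mult_less_top ennreal_less_top DIM_cart DIM_real mult_1_right simp_thms)
  finally have "(NNINT \<xi>. ennreal (norm (g \<xi>))) < \<infinity>" .
  with g show ?thesis by (intro integrableI_bounded) simp_all
qed

text \<open>Each term is bounded by K, so q - 1 of its q factors can be replaced by K before
  summing.\<close>

lemma infsum_powr_le:
  assumes q: "1 \<le> q" and K: "0 \<le> K" and a: "\<And>l. 0 \<le> a l" and le: "(\<Sum>\<^sub>\<infinity>l\<in>L. ennreal (a l)) \<le> ennreal K"
  shows "(\<Sum>\<^sub>\<infinity>l\<in>L. ennreal (a l powr q)) \<le> ennreal (K powr q)"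
proof -
  have aK: "a l \<le> K" if "l \<in> L" for l
  proof -
    have "ennreal (a l) \<le> (\<Sum>\<^sub>\<infinity>l\<in>L. ennreal (a l))"
      using sum_le_infsum_ennreal[of "{l}" L "\<lambda>l. ennreal (a l)"] that by simp
    with le have "ennreal (a l) \<le> ennreal K" by simp
    then show ?thesis using K by (simp add: ennreal_le_iff)
  qed
  have pow: "y powr q = y powr (q - 1) * y" if "0 \<le> y" for y :: real
    using that by (cases "y = 0") (simp_all add: powr_diff)
  have "(\<Sum>\<^sub>\<infinity>l\<in>L. ennreal (a l powr q)) \<le> (\<Sum>\<^sub>\<infinity>l\<in>L. ennreal (K powr (q - 1)) * ennreal (a l))"
  proof (rule infsum_ennreal_mono)
    fix l assume l: "l \<in> L"
    have "a l powr q \<le> K powr (q - 1) * a l"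
      unfolding pow[OF a] using aK[OF l] a[of l] q by (intro mult_right_mono powr_mono2) auto
    then show "ennreal (a l powr q) \<le> ennreal (K powr (q - 1)) * ennreal (a l)"
      using a[of l] by (simp add: ennreal_leI flip: ennreal_mult)
  qed
  also have "\<dots> \<le> ennreal (K powr (q - 1)) * ennreal K"
    unfolding infsum_ennreal_cmult by (intro mult_left_mono le) auto
  also have "\<dots> = ennreal (K powr q)"
    using K by (simp add: pow[OF K] ennreal_mult)
  finally show ?thesis .
qed

lemma AE_lborel_measurable_lebesgue:
  fixes f g :: "'a :: euclidean_space \<Rightarrow> 'b :: topological_space"
  assumes g: "g \<in> borel_measurable borel" and ae: "AE x in lborel. f x = g x"
  shows "f \<in> borel_measurable lebesgue"
proof (rule measurableI)
  fix X :: "'b set" assume X: "X \<in> sets borel"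
  obtain Z where Z: "Z \<in> null_sets lborel" "{x. f x \<noteq> g x} \<subseteq> Z"
    using ae by (auto elim!: AE_E simp: null_sets_def)
  have gX: "g -` X \<in> sets lebesgue"
    using measurable_sets[OF g X] by simp
  have sub: "S \<in> sets lebesgue" if "S \<subseteq> Z" for S
    using Z(1) that null_sets_completion_subset[of S Z lborel] by (auto simp: null_sets_def intro: null_setsI)
  have "f -` X = (g -` X - Z) \<union> (f -` X \<inter> Z)"
    using Z(2) by auto
  also have "\<dots> \<in> sets lebesgue"
    by (intro sets.Un sets.Diff gX sub[of Z] sub[of "f -` X \<inter> Z"]) auto
  finally show "f -` X \<inter> space lebesgue \<in> sets lebesgue" by simp
qed auto

lemma lebesgue_integral_AE_borel:
  fixes f g :: "'a :: euclidean_space \<Rightarrow> 'c :: {banach, second_countable_topology}"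
  assumes g: "g \<in> borel_measurable borel" and ae: "AE x in lborel. f x = g x"
  shows "(LINT x|lebesgue. f x) = (LBINT x. g x)"
  by (rule lebesgue_integral_cong_AE_lborel[OF AE_lborel_measurable_lebesgue[OF g ae] g ae])

section \<open>The sampling error\<close>

text \<open>Near 0 write 1 - \<Phi> \<mu> = (1 - \<Phi> P) - \<Phi> (\<mu> - P), with errors of
  order n and N + 1. Away from 0 the left side is bounded and |\<xi>| is bounded below, which
  explains the division by the power of \<delta> in the constant.\<close>

lemma near_estimate:
  fixes \<phi>h \<mu> P :: "real ^ 'd \<Rightarrow> complex"
  assumes \<delta>: "0 < \<delta>" "\<delta> \<le> 1"
    and P: "0 \<le> C1" "\<And>\<xi>. norm \<xi> < \<delta> \<Longrightarrow> norm (1 - \<phi>h \<xi> * P \<xi>) \<le> C1 * norm \<xi> ^ n"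
    and \<mu>: "0 \<le> C2" "\<And>\<xi>. norm (\<mu> \<xi> - P \<xi>) \<le> C2 * norm \<xi> ^ Suc N" "\<And>\<xi>. norm (\<mu> \<xi>) \<le> 1"
    and b: "\<And>\<xi>. norm (\<phi>h \<xi>) \<le> b"
  obtains C where "0 \<le> C" "\<And>\<xi>. norm (1 - \<phi>h \<xi> * \<mu> \<xi>) \<le> C * norm \<xi> ^ min n (Suc N)"
proof -
  define s where "s = min n (Suc N)"
  have b0: "0 \<le> b" using b[of 0] norm_ge_zero order_trans by blast
  define C where "C = C1 + b * C2 + (1 + b) / \<delta> ^ s"
  have "norm (1 - \<phi>h \<xi> * \<mu> \<xi>) \<le> C * norm \<xi> ^ s" for \<xi>
  proof (cases "norm \<xi> < \<delta>")
    case True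
    have "norm (1 - \<phi>h \<xi> * \<mu> \<xi>) = norm ((1 - \<phi>h \<xi> * P \<xi>) - \<phi>h \<xi> * (\<mu> \<xi> - P \<xi>))"
      by (simp add: algebra_simps)
    also have "\<dots> \<le> norm (1 - \<phi>h \<xi> * P \<xi>) + norm (\<phi>h \<xi>) * norm (\<mu> \<xi> - P \<xi>)"
      by (metis norm_mult norm_triangle_ineq4)
    also have "\<dots> \<le> C1 * norm \<xi> ^ n + b * (C2 * norm \<xi> ^ Suc N)"
      using b0 by (intro add_mono mult_mono b P(2) True \<mu>(2)) auto
    also have "\<dots> \<le> C1 * norm \<xi> ^ s + b * (C2 * norm \<xi> ^ s)"
      using True \<delta> P(1) \<mu>(1) b0 by (intro add_mono mult_left_mono power_decreasing) (auto simp: s_def)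
    also have "\<dots> \<le> C * norm \<xi> ^ s"
      using b0 \<delta> by (simp add: C_def distrib_right)
    finally show ?thesis .
  next
    case False
    have "norm (1 - \<phi>h \<xi> * \<mu> \<xi>) \<le> norm (1 :: complex) + norm (\<phi>h \<xi>) * norm (\<mu> \<xi>)"
      by (metis norm_mult norm_triangle_ineq4)
    also have "\<dots> \<le> 1 + b * 1"
      using b0 by (intro add_mono mult_mono b \<mu>(3)) auto
    also have "\<dots> = (1 + b) / \<delta> ^ s * \<delta> ^ s" using \<delta> by simp
    also have "\<dots> \<le> C * norm \<xi> ^ s"
      using False \<delta> b0 P(1) \<mu>(1) by (intro mult_mono power_mono) (auto simp: C_def)
    finally show ?thesis .
  qed
  moreover have "0 \<le> C" using \<delta> b0 P(1) \<mu>(1) by (simp add: C_def)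
  ultimately show ?thesis using that unfolding s_def by blast
qed

text \<open>For small \<xi> the summed Strang--Fix estimate is raised to the power q; for |\<xi>|
  \<ge> \<delta> the uniform bound B is divided by the least value of the power of |\<xi>|.\<close>

lemma off_estimate:
  fixes \<phi>h :: "real ^ 'd \<Rightarrow> complex"
  assumes q: "1 \<le> q" and \<delta>: "0 < \<delta>" "\<delta> \<le> 1" and s: "s \<le> n"
    and C: "0 \<le> C" "\<And>\<xi>. norm \<xi> < \<delta> \<Longrightarrow> (\<Sum>\<^sub>\<infinity>l\<in>int_lattice - {0}. ennreal (norm (\<phi>h (\<xi> + l)))) \<le> ennreal (C * norm \<xi> ^ n)"
    and B: "0 \<le> B" "\<And>\<xi>. (\<Sum>\<^sub>\<infinity>k\<in>int_lattice. ennreal (norm (\<phi>h (\<xi> + k)) powr q)) \<le> ennreal B"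
  obtains C' where "0 \<le> C'"
    "\<And>\<xi>. (\<Sum>\<^sub>\<infinity>l\<in>int_lattice - {0}. ennreal (norm (\<phi>h (\<xi> + l)) powr q)) \<le> ennreal (C' * (norm \<xi> ^ s) powr q)"
proof -
  define C' where "C' = C powr q + B / (\<delta> ^ s) powr q"
  have "(\<Sum>\<^sub>\<infinity>l\<in>int_lattice - {0}. ennreal (norm (\<phi>h (\<xi> + l)) powr q)) \<le> ennreal (C' * (norm \<xi> ^ s) powr q)" for \<xi>
  proof (cases "norm \<xi> < \<delta>")
    case True
    have "(\<Sum>\<^sub>\<infinity>l\<in>int_lattice - {0}. ennreal (norm (\<phi>h (\<xi> + l)) powr q)) \<le> ennreal ((C * norm \<xi> ^ n) powr q)"
      using C(1) by (intro infsum_powr_le q C(2) True) auto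
    also have "\<dots> \<le> ennreal (C' * (norm \<xi> ^ s) powr q)"
    proof (rule ennreal_leI)
      have "(C * norm \<xi> ^ n) powr q \<le> (C * norm \<xi> ^ s) powr q"
        using True \<delta> C(1) q s by (intro powr_mono2 mult_left_mono power_decreasing) auto
      also have "\<dots> = C powr q * (norm \<xi> ^ s) powr q" by (simp add: powr_mult)
      also have "\<dots> \<le> C' * (norm \<xi> ^ s) powr q"
        using B(1) by (intro mult_right_mono) (auto simp: C'_def)
      finally show "(C * norm \<xi> ^ n) powr q \<le> C' * (norm \<xi> ^ s) powr q" .
    qed
    finally show ?thesis .
  next
    case False
    have "(\<Sum>\<^sub>\<infinity>l\<in>int_lattice - {0}. ennreal (norm (\<phi>h (\<xi> + l)) powr q)) \<le> (\<Sum>\<^sub>\<infinity>l\<in>int_lattice. ennreal (norm (\<phi>h (\<xi> + l)) powr q))"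
      by (rule infsum_ennreal_subset) auto
    also have "\<dots> \<le> ennreal B" by (rule B(2))
    also have "\<dots> \<le> ennreal (C' * (norm \<xi> ^ s) powr q)"
    proof (rule ennreal_leI)
      have "B = B / (\<delta> ^ s) powr q * (\<delta> ^ s) powr q" using \<delta> by simp
      also have "\<dots> \<le> C' * (norm \<xi> ^ s) powr q"
        using False \<delta> B(1) q by (intro mult_mono powr_mono2 power_mono) (auto simp: C'_def)
      finally show "B \<le> C' * (norm \<xi> ^ s) powr q" .
    qed
    finally show ?thesis .
  qed
  moreover have "0 \<le> C'" using B(1) by (simp add: C'_def)
  ultimately show ?thesis using that by blast
qed

text \<open>Measurability is assumed of \<open>w\<close> and \<open>w (1 + h\<^sup>N\<^sup>+\<^sup>1)\<close> but not of \<open>h\<close>; these determine \<open>h\<close> where \<open>w\<close> does not vanish.\<close>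

lemma averaging_representative:
  fixes w h :: "real \<Rightarrow> real"
  assumes h: "\<And>u. 0 < u \<Longrightarrow> 0 < h u"
    and w: "\<And>u. 0 < u \<Longrightarrow> 0 \<le> w u" "set_integrable lebesgue {0<..} w" "(LINT u:{0<..}|lebesgue. w u) = 1"
    and wh: "set_integrable lebesgue {0<..} (\<lambda>u. w u * (1 + h u ^ (N + 1)))"
  obtains w' h' where "averaging w' h' N"
    "AE u in lborel. (if 0 < u then w u else 0) = w' u \<and> (w' u \<noteq> 0 \<longrightarrow> h' u = h u)"
proof -
  define W0 where "W0 u = indicator {0<..} u *\<^sub>R w u" for u
  define G0 where "G0 u = indicator {0<..} u *\<^sub>R (w u * (1 + h u ^ (N + 1)))" for u
  have W0: "integrable lebesgue W0" and G0: "integrable lebesgue G0"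
    using w(2) wh by (simp_all add: set_integrable_def W0_def[abs_def] G0_def[abs_def])
  have W0_nn: "0 \<le> W0 u" for u using w(1)[of u] by (simp add: W0_def indicator_def)
  obtain w1 where w1 [measurable]: "w1 \<in> borel_measurable lborel" and aew: "AE u in lborel. W0 u = w1 u"
    using completion_ex_borel_measurable_real[of W0 lborel] W0 by auto
  obtain g1 where g1 [measurable]: "g1 \<in> borel_measurable lborel" and aeg: "AE u in lborel. G0 u = g1 u"
    using completion_ex_borel_measurable_real[of G0 lborel] G0 by auto
  define w' where "w' u = max 0 (w1 u)" for u
  \<comment> \<open>Where w is positive, h is recovered as the root of order N + 1 of g / w - 1,
    with g = w (1 + h^(N + 1)). The default 1 keeps \<open>h'\<close> positive elsewhere.\<close>
  define h' where "h' u = (if 0 < w' u \<and> w' u < g1 u then root (N + 1) (g1 u / w' u - 1) else 1)" for u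
  have ae: "AE u in lborel. W0 u = w' u \<and> (w' u \<noteq> 0 \<longrightarrow> h' u = h u) \<and> w' u * h' u ^ Suc N \<le> \<bar>g1 u\<bar>"
    using aew aeg
  proof eventually_elim
    case (elim u)
    then have eq: "w' u = W0 u" using W0_nn[of u] by (simp add: w'_def)
    show ?case
    proof (cases "W0 u = 0")
      case False
      then have u: "0 < u" and wu: "0 < w u" "W0 u = w u"
        using w(1)[of u] by (auto simp: W0_def indicator_def split: if_splits)
      have g: "g1 u = w u * (1 + h u ^ (N + 1))" using elim(2) u by (simp add: G0_def)
      have hp: "0 < h u ^ (N + 1)" using h[OF u] by (rule zero_less_power)
      have "w u < g1 u" unfolding g using wu hp by simp
      moreover have "g1 u / w u - 1 = h u ^ (N + 1)" unfolding g using wu by simp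
      ultimately have "h' u = h u"
        using wu eq h[OF u] by (simp add: h'_def real_root_pos2 del: power_Suc)
      moreover have "w u * h u ^ Suc N \<le> \<bar>g1 u\<bar>" using wu hp unfolding g by (simp add: distrib_left)
      ultimately show ?thesis using eq wu by simp
    qed (simp add: eq)
  qed
  have "averaging w' h' N"
  proof
    show "w' \<in> borel_measurable borel" unfolding w'_def using w1 by measurable
    then show "h' \<in> borel_measurable borel" unfolding h'_def using g1 by measurable
    show "0 \<le> w' u" for u by (simp add: w'_def)
    show "0 < h' u" for u
    proof (cases "0 < w' u \<and> w' u < g1 u")
      case True
      then have "0 < g1 u / w' u - 1" by (simp add: less_divide_eq)
      then show ?thesis using True unfolding h'_def by (simp only: simp_thms if_True real_root_gt_zero)
    qed (simp add: h'_def)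
    have "(NNINT u. ennreal (w' u)) = (NNINT u. ennreal (W0 u))"
      using ae by (intro nn_integral_cong_AE, eventually_elim) simp
    also have "\<dots> = (\<integral>\<^sup>+u. ennreal (W0 u) \<partial>lebesgue)" by (simp add: nn_integral_completion)
    also have "\<dots> = ennreal (LINT u|lebesgue. W0 u)"
      using W0 W0_nn by (intro nn_integral_eq_integral) auto
    also have "\<dots> = 1" using w(3) by (simp add: W0_def set_lebesgue_integral_def)
    finally show "(NNINT u. ennreal (w' u)) = 1" .
    have "(NNINT u. ennreal (w' u * h' u ^ Suc N)) \<le> (NNINT u. ennreal \<bar>g1 u\<bar>)"
      using ae by (intro nn_integral_mono_AE, eventually_elim) (auto intro: ennreal_leI)
    also have "\<dots> = (NNINT u. ennreal (norm (G0 u)))"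
      using aeg by (intro nn_integral_cong_AE, eventually_elim) simp
    also have "\<dots> = (\<integral>\<^sup>+u. ennreal (norm (G0 u)) \<partial>lebesgue)" by (simp add: nn_integral_completion)
    also have "\<dots> < \<infinity>" using G0 by (simp add: integrable_iff_bounded)
    finally show "(NNINT u. ennreal (w' u * h' u ^ Suc N)) < \<infinity>" .
  qed
  moreover have "AE u in lborel. (if 0 < u then w u else 0) = w' u \<and> (w' u \<noteq> 0 \<longrightarrow> h' u = h u)"
    using ae by eventually_elim (auto simp: W0_def indicator_def split: if_splits)
  ultimately show ?thesis by (rule that)
qed

text \<open>The representative of h agrees with h only where the density does not vanish, hence the
  condition \<Psi> 0 r = 0 on the integrand.\<close>

lemma averaging_integral_cong:
  fixes \<Psi> :: "real \<Rightarrow> real \<Rightarrow> 'c :: {banach, second_countable_topology}"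
  assumes ae: "AE u in lborel. (if 0 < u then w u else 0) = w' u \<and> (w' u \<noteq> 0 \<longrightarrow> h' u = h u)"
    and meas: "(\<lambda>u. \<Psi> (w' u) (h' u)) \<in> borel_measurable borel" and zero: "\<And>r. \<Psi> 0 r = 0"
  shows "(LINT u:{0<..}|lebesgue. \<Psi> (w u) (h u)) = (LBINT u. \<Psi> (w' u) (h' u))"
  unfolding set_lebesgue_integral_def
proof (rule lebesgue_integral_AE_borel[OF meas])
  show "AE u in lborel. indicator {0<..} u *\<^sub>R \<Psi> (w u) (h u) = \<Psi> (w' u) (h' u)"
    using ae
  proof eventually_elim
    case (elim u)
    then show ?case by (cases "w' u = 0") (auto simp: zero split: if_splits)
  qed
qed

section \<open>Sampled averages as integrals against the kernel\<close>

context averaging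
begin

lemma borel_measurable_ball_vol [measurable]: "(\<lambda>u. ball_vol TYPE('d) (h u)) \<in> borel_measurable borel"
proof -
  have "(\<lambda>u. ball_vol TYPE('d) (h u)) = (\<lambda>u. unit_ball_vol (real CARD('d)) * h u ^ CARD('d))"
    by (intro ext ball_vol_eq less_imp_le h_pos)
  then show ?thesis by simp
qed

lemma borel_measurable_ball_average [measurable]:
  fixes g :: "real ^ 'd \<Rightarrow> 'c :: {banach, second_countable_topology}"
  assumes [measurable]: "g \<in> borel_measurable borel"
  shows "(\<lambda>u. LBINT s. indicator (cball 0 (h u)) s *\<^sub>R g s) \<in> borel_measurable borel"
proof -
  have "(\<lambda>(u, s). indicator (cball 0 (h u)) s *\<^sub>R g s) = (\<lambda>(u, s). (if norm s \<le> h u then 1 else 0 :: real) *\<^sub>R g s)"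
    by (auto simp: fun_eq_iff indicator_def)
  moreover have "\<dots> \<in> borel_measurable (borel \<Otimes>\<^sub>M lborel)" by measurable
  ultimately show ?thesis
    using lborel.borel_measurable_lebesgue_integral[of "\<lambda>u s. indicator (cball 0 (h u)) s *\<^sub>R g s" borel] by simp
qed

lemma avg_coeff_eq:
  fixes \<beta> :: "'d \<Rightarrow> nat"
  assumes ae: "AE u in lborel. (if 0 < u then v u else 0) = w u \<and> (w u \<noteq> 0 \<longrightarrow> h u = r u)"
  shows "avg_coeff v r \<beta> = coeff \<beta>"
proof -
  have mono: "(\<lambda>t :: real ^ 'd. \<Prod>i\<in>UNIV. (t $ i) ^ \<beta> i) \<in> borel_measurable borel" by measurable
  note [measurable] = mono
  have ball: "(\<lambda>t :: real ^ 'd. indicator (cball 0 \<rho>) t *\<^sub>R (\<Prod>i\<in>UNIV. (t $ i) ^ \<beta> i)) \<in> borel_measurable lborel" for \<rho>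
    using borel_measurable_scaleR[OF borel_measurable_indicator mono, of "cball 0 \<rho>"] by simp
  have inner: "(LINT t:cball (0 :: real ^ 'd) \<rho>|lebesgue. (\<Prod>i\<in>UNIV. (t $ i) ^ \<beta> i))
      = (LBINT t. indicator (cball 0 \<rho>) t *\<^sub>R (\<Prod>i\<in>UNIV. (t $ i) ^ \<beta> i))" for \<rho>
    unfolding set_lebesgue_integral_def by (rule integral_completion[OF ball])
  have "avg_coeff v r \<beta> = (LBINT u. w u / (mi_fact \<beta> * ball_vol TYPE('d) (h u)) *
      (LBINT t. indicator (cball 0 (h u)) t *\<^sub>R (\<Prod>i\<in>UNIV. (t $ i) ^ \<beta> i)))"
    unfolding avg_coeff_def inner
    by (rule averaging_integral_cong[OF ae, where \<Psi> = "\<lambda>a \<rho>. a / (mi_fact \<beta> * ball_vol TYPE('d) \<rho>) *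
      (LBINT t. indicator (cball 0 \<rho>) t *\<^sub>R (\<Prod>i\<in>UNIV. (t $ i) ^ \<beta> i))"])
      (intro borel_measurable_times borel_measurable_divide borel_measurable_ball_average mono
        borel_measurable_ball_vol w_meas borel_measurable_const, simp)
  then show ?thesis by (simp add: coeff_def)
qed

text \<open>The substitution t = M^(-j) s carries the dilated ball to the ball itself, and its
  Jacobian cancels the factor |det M|^j. Boundedness of \<open>F0\<close> supplies the growth
  condition of \<open>dens_integral\<close>.\<close>

lemma avg_sample_eq:
  fixes f F0 :: "real ^ 'd \<Rightarrow> complex"
  assumes M: "invertible M"
    and ae: "AE u in lborel. (if 0 < u then v u else 0) = w u \<and> (w u \<noteq> 0 \<longrightarrow> h u = r u)"
    and F0 [measurable]: "F0 \<in> borel_measurable borel" and aef: "AE x in lborel. f x = F0 x" and K: "\<And>x. norm (F0 x) \<le> K"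
  shows "avg_sample v r M f j y = (LBINT s. complex_of_real (dens s) * F0 (y + mat_pow (matrix_inv M) j *v s))"
proof -
  define J where "J = mat_pow (matrix_inv M) j"
  define Kj where "Kj = mat_pow M j"
  have JK: "Kj ** J = mat 1" "J ** Kj = mat 1" using mat_pow_inverse[OF M, of j] by (simp_all add: J_def Kj_def)
  then have J: "invertible J" by (auto simp: invertible_def)
  have det: "\<bar>det M\<bar> ^ j * \<bar>det J\<bar> = 1"
  proof -
    have "det Kj * det J = 1" using JK(1) by (metis det_I det_mul)
    then show ?thesis unfolding Kj_def det_mat_pow by (metis abs_mult abs_one power_abs)
  qed
  have img: "indicator ((\<lambda>s. J *v s) ` C) t = (indicator C (Kj *v t) :: real)" for C t
  proof -
    have "t \<in> (\<lambda>s. J *v s) ` C \<longleftrightarrow> Kj *v t \<in> C"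
    proof
      assume "t \<in> (\<lambda>s. J *v s) ` C"
      then show "Kj *v t \<in> C" using JK by (auto simp: matrix_vector_mul_assoc)
    next
      assume "Kj *v t \<in> C"
      then show "t \<in> (\<lambda>s. J *v s) ` C" using JK by (intro image_eqI[of _ _ "Kj *v t"]) (auto simp: matrix_vector_mul_assoc)
    qed
    then show ?thesis by (simp add: indicator_def)
  qed
  have aey: "AE t in lborel. f (y + t) = F0 (y + t)"
  proof -
    have "AE x in distr lborel borel ((+) y). f x = F0 x" unfolding lborel_distr_plus by (rule aef)
    from AE_distrD[OF _ this] show ?thesis by simp
  qed
  have inner: "(LINT t:(\<lambda>s. J *v s) ` cball 0 \<rho>|lebesgue. f (y + t))
      = \<bar>det J\<bar> *\<^sub>R (LBINT s. indicator (cball 0 \<rho>) s *\<^sub>R F0 (y + J *v s))" for \<rho>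
  proof -
    have [measurable]: "cball (0 :: real ^ 'd) \<rho> \<in> sets borel" by simp
    have m: "(\<lambda>t. indicator (cball 0 \<rho>) (Kj *v t) *\<^sub>R F0 (y + t)) \<in> borel_measurable borel" by measurable
    have "(LINT t:(\<lambda>s. J *v s) ` cball 0 \<rho>|lebesgue. f (y + t)) = (LBINT t. indicator (cball 0 \<rho>) (Kj *v t) *\<^sub>R F0 (y + t))"
      unfolding set_lebesgue_integral_def img
      by (rule lebesgue_integral_AE_borel[OF m]) (use aey in \<open>eventually_elim, simp\<close>)
    also have "\<dots> = \<bar>det J\<bar> *\<^sub>R (LBINT s. indicator (cball 0 \<rho>) (Kj *v (J *v s)) *\<^sub>R F0 (y + J *v s))"
      by (rule integral_matrix[OF J m])
    finally show ?thesis using JK by (simp add: matrix_vector_mul_assoc)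
  qed
  have cancel: "complex_of_real (a * (\<bar>det M\<bar> ^ j / b)) * (\<bar>det J\<bar> *\<^sub>R z) = complex_of_real (a / b) * z" for a b z
  proof -
    have "complex_of_real (a * (\<bar>det M\<bar> ^ j / b)) * (\<bar>det J\<bar> *\<^sub>R z) = complex_of_real (a / b) * (complex_of_real (\<bar>det M\<bar> ^ j * \<bar>det J\<bar>) * z)"
      by (simp add: scaleR_conv_of_real)
    then show ?thesis by (simp only: det of_real_1 mult_1_left)
  qed
  have "avg_sample v r M f j y = (LBINT u. complex_of_real (w u / ball_vol TYPE('d) (h u)) *
      (LBINT s. indicator (cball 0 (h u)) s *\<^sub>R F0 (y + J *v s)))"
    unfolding avg_sample_def J_def[symmetric] inner cancel
    by (rule averaging_integral_cong[OF ae, where \<Psi> = "\<lambda>a \<rho>. complex_of_real (a / ball_vol TYPE('d) \<rho>) *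
      (LBINT s. indicator (cball 0 \<rho>) s *\<^sub>R F0 (y + J *v s))"]) simp_all
  also have "\<dots> = (LBINT s. complex_of_real (dens s) * F0 (y + J *v s))"
  proof (rule dens_integral(2)[symmetric])
    have "0 \<le> K" using K[of 0] norm_ge_zero order_trans by blast
    then show "0 \<le> K" "\<And>s :: real ^ 'd. norm (F0 (y + J *v s)) \<le> K * (1 + norm s ^ Suc N)"
      using K by (auto intro!: order_trans[OF K] simp: mult_le_cancel_left1 simp del: power_Suc)
  qed measurable
  finally show ?thesis unfolding J_def .
qed

lemma integrable_mu_mult:
  assumes "integrable lborel A"
  shows "integrable lborel (\<lambda>\<xi>. mu \<xi> * A \<xi>)"
  using assms mult_right_mono[OF norm_mu_le norm_ge_zero]
  by (intro Bochner_Integration.integrable_bound[OF assms]) (auto simp: norm_mult)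

text \<open>Averaging against the kernel is a Fourier multiplier; as a translation by y is built in,
  the value at a node comes out directly.\<close>

lemma integral_dens_ift:
  fixes A :: "real ^ 'd \<Rightarrow> complex"
  assumes A: "integrable lborel A"
  shows "(LBINT s. complex_of_real (dens s) * ift A (s + y)) = ift (\<lambda>\<xi>. mu \<xi> * A \<xi>) y"
proof -
  have [measurable]: "A \<in> borel_measurable borel" using A by auto
  have "(LBINT s. complex_of_real (dens s) * ift A (s + y))
     = (LBINT s. LBINT \<xi>. complex_of_real (dens s) * (A \<xi> * cis (2 * pi * ((s + y) \<bullet> \<xi>))))"
    by (simp only: ift_def integral_mult_right_zero)
  also have "\<dots> = (LBINT \<xi>. LBINT s. complex_of_real (dens s) * (A \<xi> * cis (2 * pi * ((s + y) \<bullet> \<xi>))))"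
  proof (rule integral_swap)
    show "(\<lambda>(s, \<xi>). complex_of_real (dens s) * (A \<xi> * cis (2 * pi * ((s + y) \<bullet> \<xi>)))) \<in> borel_measurable (borel \<Otimes>\<^sub>M borel)"
      unfolding cis_conv_exp by measurable
    have "(NNINT s. NNINT \<xi>. ennreal (norm (complex_of_real (dens s) * (A \<xi> * cis (2 * pi * ((s + y) \<bullet> \<xi>))))))
       = (NNINT s. ennreal (dens (s :: real ^ 'd))) * (NNINT \<xi>. ennreal (norm (A \<xi>)))"
      by (simp add: norm_mult dens_nonneg ennreal_mult nn_integral_cmult nn_integral_multc)
    also have "\<dots> \<le> 1 * (NNINT \<xi>. ennreal (norm (A \<xi>)))"
      by (intro mult_right_mono nn_dens) auto
    also have "\<dots> < \<infinity>" using A unfolding integrable_iff_bounded by simp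
    finally show "(NNINT s. NNINT \<xi>. ennreal (norm (complex_of_real (dens s) * (A \<xi> * cis (2 * pi * ((s + y) \<bullet> \<xi>)))))) < \<infinity>" .
  qed
  also have "\<dots> = (LBINT \<xi>. LBINT s. (A \<xi> * cis (2 * pi * (y \<bullet> \<xi>))) * (complex_of_real (dens s) * cis (2 * pi * (\<xi> \<bullet> s))))"
  proof -
    have "cis (2 * pi * ((s + y) \<bullet> \<xi>)) = cis (2 * pi * (y \<bullet> \<xi>)) * cis (2 * pi * (\<xi> \<bullet> s))" for s \<xi> :: "real ^ 'd"
      by (simp add: cis_mult inner_add_left inner_commute[of s] algebra_simps)
    then show ?thesis by (simp only: mult_ac)
  qed
  also have "\<dots> = ift (\<lambda>\<xi>. mu \<xi> * A \<xi>) y"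
  proof -
    have mu: "mu \<xi> = (LBINT s. complex_of_real (dens s) * cis (2 * pi * (\<xi> \<bullet> s)))" for \<xi> :: "real ^ 'd"
      by (simp only: mu_def ift_def)
    show ?thesis
      unfolding integral_mult_right_zero mu[symmetric] ift_def[of "\<lambda>\<xi>. mu \<xi> * A \<xi>"] by (simp only: mult_ac)
  qed
  finally show ?thesis .
qed

end

section \<open>Dilation of the spectrum and return to the original variable\<close>

lemma ift_dilate:
  fixes g :: "real ^ 'd \<Rightarrow> complex" and K J :: "real ^ 'd ^ 'd"
  assumes KJ: "K ** J = mat 1" and [measurable]: "g \<in> borel_measurable borel"
  shows "ift (\<lambda>\<xi>. complex_of_real \<bar>det K\<bar> * g (transpose K *v \<xi>)) x = ift g (J *v x)"
proof -
  have inv: "invertible (transpose K)"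
    using KJ by (metis invertible_def matrix_left_right_inverse matrix_transpose_mul transpose_mat)
  have dot: "(J *v x) \<bullet> (transpose K *v \<xi>) = x \<bullet> \<xi>" for \<xi>
  proof -
    have "(J *v x) \<bullet> (transpose K *v \<xi>) = (K *v (J *v x)) \<bullet> \<xi>"
      by (metis dot_lmul_matrix inner_commute transpose_matrix_vector)
    then show ?thesis using KJ by (simp add: matrix_vector_mul_assoc)
  qed
  have "ift g (J *v x) = \<bar>det (transpose K)\<bar> *\<^sub>R (LBINT \<xi>. g (transpose K *v \<xi>) * cis (2 * pi * ((J *v x) \<bullet> (transpose K *v \<xi>))))"
    unfolding ift_def by (rule integral_matrix[OF inv]) (unfold cis_conv_exp, measurable)
  then show ?thesis
    unfolding dot ift_def by (simp add: det_transpose scaleR_conv_of_real mult.assoc)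
qed

text \<open>Substituting the transpose of J for \<xi>, the prefactor contributes |det K| to the
  power q and the Jacobian divides by |det K|; each of the e powers of |\<xi>| contributes the
  contraction constant c.\<close>

lemma dilate_moment_le:
  fixes g :: "real ^ 'd \<Rightarrow> complex" and K J :: "real ^ 'd ^ 'd"
  assumes KJ: "K ** J = mat 1" and g [measurable]: "g \<in> borel_measurable borel" and q: "1 \<le> q"
    and c: "0 \<le> c" "\<And>x. norm (transpose J *v x) \<le> c * norm x"
  shows "(NNINT \<xi>. ennreal ((norm \<xi> ^ e * norm (complex_of_real \<bar>det K\<bar> * g (transpose K *v \<xi>))) powr q))
    \<le> ennreal (\<bar>det K\<bar> powr (q - 1) * (c ^ e) powr q) * (NNINT \<xi>. ennreal ((norm \<xi> ^ e * norm (g \<xi>)) powr q))"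
proof -
  define D where "D = \<bar>det K\<bar>"
  have detKJ: "det K * det J = 1" using KJ by (metis det_I det_mul)
  then have DJ: "D * \<bar>det J\<bar> = 1" unfolding D_def by (metis abs_mult abs_one)
  have "0 < D" using detKJ by (auto simp: D_def)
  with DJ have D: "0 < D" "\<bar>det J\<bar> = 1 / D" by (simp_all add: field_simps)
  have tr: "transpose K ** transpose J = mat 1"
    using KJ by (metis matrix_left_right_inverse matrix_transpose_mul transpose_mat)
  then have inv: "invertible (transpose J)" by (metis invertible_def matrix_left_right_inverse)
  have pow: "D powr q = D * D powr (q - 1)" using D(1) by (simp add: powr_diff)
  have m: "(\<lambda>\<xi>. ennreal ((norm \<xi> ^ e * norm (complex_of_real D * g (transpose K *v \<xi>))) powr q)) \<in> borel_measurable borel"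
    by measurable
  have "(NNINT \<xi>. ennreal ((norm \<xi> ^ e * norm (complex_of_real D * g (transpose K *v \<xi>))) powr q))
     = ennreal (1 / D) * (NNINT \<xi>. ennreal ((norm (transpose J *v \<xi>) ^ e * norm (complex_of_real D * g (transpose K *v (transpose J *v \<xi>)))) powr q))"
    using nn_integral_matrix[OF inv m] unfolding det_transpose D(2) .
  also have "\<dots> \<le> ennreal (1 / D) * (NNINT \<xi>. ennreal (D powr q * (c ^ e) powr q) * ennreal ((norm \<xi> ^ e * norm (g \<xi>)) powr q))"
  proof (intro mult_left_mono nn_integral_mono)
    fix \<xi> :: "real ^ 'd"
    have "(norm (transpose J *v \<xi>) ^ e * norm (complex_of_real D * g (transpose K *v (transpose J *v \<xi>)))) powr q
      = (norm (transpose J *v \<xi>) ^ e * (D * norm (g \<xi>))) powr q"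
      using D(1) tr by (simp only: matrix_vector_mul_assoc matrix_vector_mul_lid norm_mult norm_of_real abs_of_pos)
    also have "\<dots> \<le> ((c * norm \<xi>) ^ e * (D * norm (g \<xi>))) powr q"
      using D(1) q c by (intro powr_mono2 mult_right_mono power_mono) auto
    also have "\<dots> = (D * (c ^ e * (norm \<xi> ^ e * norm (g \<xi>)))) powr q" by (simp add: power_mult_distrib mult_ac)
    also have "\<dots> = D powr q * (c ^ e) powr q * (norm \<xi> ^ e * norm (g \<xi>)) powr q"
      using D(1) c(1) by (simp only: powr_mult mult.assoc)
    finally show "ennreal ((norm (transpose J *v \<xi>) ^ e * norm (complex_of_real D * g (transpose K *v (transpose J *v \<xi>)))) powr q)
      \<le> ennreal (D powr q * (c ^ e) powr q) * ennreal ((norm \<xi> ^ e * norm (g \<xi>)) powr q)"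
      by (simp add: ennreal_leI flip: ennreal_mult)
  qed simp
  also have "\<dots> = ennreal (1 / D) * (ennreal (D powr q * (c ^ e) powr q) * (NNINT \<xi>. ennreal ((norm \<xi> ^ e * norm (g \<xi>)) powr q)))"
    by (subst nn_integral_cmult) auto
  also have "\<dots> = ennreal (1 / D * (D powr q * (c ^ e) powr q)) * (NNINT \<xi>. ennreal ((norm \<xi> ^ e * norm (g \<xi>)) powr q))"
    using D(1) by (subst ennreal_mult) (auto simp: mult.assoc)
  also have "1 / D * (D powr q * (c ^ e) powr q) = D powr (q - 1) * (c ^ e) powr q"
    using D(1) by (simp add: pow)
  finally show ?thesis unfolding D_def .
qed

lemma error_norm_bound:
  assumes pq: "(p = \<infinity> \<and> q = 1) \<or> (\<exists>r. p = ennreal r \<and> 2 \<le> r \<and> q = r / (r - 1))"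
  obtains C where "0 \<le> C"
    "\<And>(E :: real ^ 'd \<Rightarrow> complex) H D K b R. \<lbrakk>E \<in> borel_measurable borel; 0 \<le> b;
       (NNINT x. ennreal (norm (E x) * wt b x)) < \<infinity>; H \<in> borel_measurable borel;
       \<And>t x. 0 < t \<Longrightarrow> conv_gk E t x = ift (\<lambda>\<xi>. H \<xi> * of_real (gh t \<xi>)) x;
       invertible K; AE x in lborel. D x = E (K *v x); 0 < R;
       (NNINT \<xi>. ennreal (norm (H \<xi>) powr q)) \<le> ennreal ((\<bar>det K\<bar> powr ((q - 1) / q) * R) powr q)\<rbrakk>
     \<Longrightarrow> Lp_norm p D \<le> ennreal (C * R)"
  using pq
proof (elim disjE exE conjE)
  assume p: "p = \<infinity>" and q: "q = 1"
  show thesis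
  proof (rule that[of 1])
    fix E H D :: "real ^ 'd \<Rightarrow> complex" and K :: "real ^ 'd ^ 'd" and b R :: real
    assume E [measurable]: "E \<in> borel_measurable borel" and b: "0 \<le> b" "(NNINT x. ennreal (norm (E x) * wt b x)) < \<infinity>"
      and H [measurable]: "H \<in> borel_measurable borel"
      and conv: "\<And>t x. 0 < t \<Longrightarrow> conv_gk E t x = ift (\<lambda>\<xi>. H \<xi> * of_real (gh t \<xi>)) x"
      and K: "invertible K" and ae: "AE x in lborel. D x = E (K *v x)" and R: "0 < R"
      and le: "(NNINT \<xi>. ennreal (norm (H \<xi>) powr q)) \<le> ennreal ((\<bar>det K\<bar> powr ((q - 1) / q) * R) powr q)"
    have "det K \<noteq> 0" using K by (simp add: invertible_det_nz)
    then have le': "(NNINT \<xi>. ennreal (norm (H \<xi>))) \<le> ennreal R" using le R q by simp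
    then have "(NNINT \<xi>. ennreal (norm (H \<xi>))) < \<infinity>" by (rule le_less_trans) simp
    then have "integrable lborel H" by (intro integrableI_bounded) auto
    then have "AE x in lborel. E x = ift H x" by (intro fourier_inversion_AE[OF E b H] conv)
    then have "AE x in lborel. norm (E x) \<le> R"
    proof eventually_elim
      case (elim x)
      have "ennreal (norm (ift H x)) \<le> ennreal R" using norm_ift_le le' by (rule order_trans)
      then show ?case using elim R by simp
    qed
    from AE_matrix[OF K this] ae have bd: "AE x in lborel. norm (D x) \<le> R" by eventually_elim simp
    have "D \<in> borel_measurable lebesgue" by (rule AE_lborel_measurable_lebesgue[OF _ ae]) measurable
    from Lp_norm_infinity_le[OF this bd] show "Lp_norm p D \<le> ennreal (1 * R)" using p by simp
  qed simp
next
  fix r assume p: "p = ennreal r" and r: "2 \<le> r" and q: "q = r / (r - 1)"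
  obtain C where C: "0 < C" and HY: "\<And>(G :: real ^ 'd \<Rightarrow> complex) R. \<lbrakk>integrable lborel G; 0 < R;
      (NNINT \<xi>. ennreal (norm (G \<xi>) powr q)) \<le> ennreal (R powr q)\<rbrakk>
      \<Longrightarrow> (NNINT x. ennreal (norm (ift G x) powr r)) \<le> ennreal (C * R powr r)"
    using hausdorff_young[OF r q, where 'a = "real ^ 'd"] by blast
  show thesis
  proof (rule that[of "C powr (1 / r)"])
    fix E H D :: "real ^ 'd \<Rightarrow> complex" and K :: "real ^ 'd ^ 'd" and b R :: real
    assume E [measurable]: "E \<in> borel_measurable borel" and b: "0 \<le> b" "(NNINT x. ennreal (norm (E x) * wt b x)) < \<infinity>"
      and H [measurable]: "H \<in> borel_measurable borel"
      and conv: "\<And>t x. 0 < t \<Longrightarrow> conv_gk E t x = ift (\<lambda>\<xi>. H \<xi> * of_real (gh t \<xi>)) x"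
      and K: "invertible K" and ae: "AE x in lborel. D x = E (K *v x)" and R: "0 < R"
      and le: "(NNINT \<xi>. ennreal (norm (H \<xi>) powr q)) \<le> ennreal ((\<bar>det K\<bar> powr ((q - 1) / q) * R) powr q)"
    define m where "m = \<bar>det K\<bar>"
    have m: "0 < m" using K by (simp add: m_def invertible_det_nz)
    have "(NNINT x. ennreal (norm (E x) powr r)) \<le> ennreal (C * (m powr ((q - 1) / q) * R) powr r)"
    proof (rule Lp_bound_of_conv_gk[OF E b H _ r q _ le[folded m_def]])
      show "0 < m powr ((q - 1) / q) * R" using m R by simp
    qed (rule conv HY; assumption)+
    also have "(m powr ((q - 1) / q) * R) powr r = m * R powr r"
    proof -
      have "(q - 1) / q * r = 1" unfolding q using r by (simp add: field_simps)
      then show ?thesis using m by (simp add: powr_mult powr_powr)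
    qed
    finally have "ennreal m * (NNINT x. ennreal (norm (E (K *v x)) powr r)) \<le> ennreal (C * (m * R powr r))"
      using nn_integral_matrix[OF K, of "\<lambda>x. ennreal (norm (E x) powr r)"] by (simp add: m_def)
    then have "ennreal (1 / m) * (ennreal m * (NNINT x. ennreal (norm (E (K *v x)) powr r))) \<le> ennreal (1 / m) * ennreal (C * (m * R powr r))"
      by (rule mult_left_mono) simp
    moreover have "ennreal (1 / m) * (ennreal m * I) = I" for I
      using m by (simp add: mult.assoc[symmetric] flip: ennreal_mult)
    moreover have "ennreal (1 / m) * ennreal (C * (m * R powr r)) = ennreal (C * R powr r)"
      using m C by (simp flip: ennreal_mult)
    ultimately have "(NNINT x. ennreal (norm (E (K *v x)) powr r)) \<le> ennreal (C * R powr r)" by simp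
    also have "C * R powr r = (C powr (1 / r) * R) powr r"
      using C R r by (simp add: powr_mult powr_powr)
    also have "(NNINT x. ennreal (norm (E (K *v x)) powr r)) = (NNINT x. ennreal (norm (D x) powr r))"
      using ae by (intro nn_integral_cong_AE, eventually_elim) simp
    finally have "(NNINT x. ennreal (norm (D x) powr r)) \<le> ennreal ((C powr (1 / r) * R) powr r)" .
    moreover have "D \<in> borel_measurable lebesgue" by (rule AE_lborel_measurable_lebesgue[OF _ ae]) measurable
    ultimately show "Lp_norm p D \<le> ennreal (C powr (1 / r) * R)"
      unfolding p using r R by (intro Lp_norm_le) auto
  qed simp
qed

text \<open>In the \<open>L\<^sub>q\<close> bound of the error at level \<open>j\<close>, \<open>m\<close> is the determinant and \<open>L\<close> the growth of the eigenvalues of \<open>M\<^sup>j\<close>.\<close>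

lemma moment_constant:
  fixes q m L Ci C5 Is IN :: real and s k :: nat
  assumes q: "1 \<le> q" and m: "0 < m" and L: "1 \<le> L" and s: "s \<le> k" and Ci: "0 < Ci" and nn: "0 \<le> C5" "0 \<le> Is" "0 \<le> IN"
  shows "C5 * (m powr (q - 1) * ((Ci / L) ^ s) powr q * Is + m powr (q - 1) * ((Ci / L) ^ k) powr q * IN)
     \<le> (m powr ((q - 1) / q) * ((C5 * ((Ci ^ s) powr q * Is + (Ci ^ k) powr q * IN) + 1) powr (1 / q) / L ^ s)) powr q"
proof -
  define X where "X = C5 * ((Ci ^ s) powr q * Is + (Ci ^ k) powr q * IN)"
  have X: "0 \<le> X" using nn Ci by (simp add: X_def)
  have split: "((Ci / L) ^ e) powr q = (Ci ^ e) powr q / (L ^ e) powr q" for e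
    using Ci L by (simp add: power_divide powr_divide)
  have Lp: "0 < (L ^ e) powr q" for e using L by simp
  \<comment> \<open>Since L \<ge> 1 and s \<le> k, the faster rate of the moment of order k may be
    weakened to the rate of order s.\<close>
  have "(L ^ s) powr q \<le> (L ^ k) powr q" using L s q by (intro powr_mono2 power_increasing) auto
  then have "(Ci ^ k) powr q / (L ^ k) powr q \<le> (Ci ^ k) powr q / (L ^ s) powr q"
    using Lp by (intro divide_left_mono mult_pos_pos) auto
  then have "C5 * (m powr (q - 1) * ((Ci / L) ^ s) powr q * Is + m powr (q - 1) * ((Ci / L) ^ k) powr q * IN)
    \<le> C5 * (m powr (q - 1) * ((Ci ^ s) powr q / (L ^ s) powr q) * Is + m powr (q - 1) * ((Ci ^ k) powr q / (L ^ s) powr q) * IN)"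
    unfolding split using nn by (intro mult_left_mono add_left_mono mult_right_mono) auto
  also have "\<dots> = m powr (q - 1) * (X / (L ^ s) powr q)"
    by (simp add: X_def algebra_simps add_divide_distrib)
  also have "\<dots> \<le> m powr (q - 1) * ((X + 1) / (L ^ s) powr q)"
    by (intro mult_left_mono divide_right_mono) auto
  also have "\<dots> = (m powr ((q - 1) / q) * ((X + 1) powr (1 / q) / L ^ s)) powr q"
    using q X L m by (simp add: powr_mult powr_divide powr_powr)
  finally show ?thesis unfolding X_def .
qed

theorem theorem22:
  fixes p :: ennreal and q :: real and N n :: nat
    and M :: "real ^ 'd ^ 'd" and lam :: complex
    and h w :: "real \<Rightarrow> real"
    and \<phi> f fhat :: "real ^ 'd \<Rightarrow> complex"
    and phit :: "(real ^ 'd \<Rightarrow> complex) \<Rightarrow> complex"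
    and \<delta> \<epsilon> :: real
  assumes p: "of_nat CARD('d) < p" "2 \<le> p"
    and q: "1 / p + 1 / ennreal q = 1"
    and M: "dilation_matrix M" "isotropic M" "eigenvalue M lam"
    and h: "\<And>u. 0 < u \<Longrightarrow> 0 < h u"
    and w: "\<And>u. 0 < u \<Longrightarrow> 0 \<le> w u" "set_integrable lebesgue {0<..} w"
           "(LINT u:{0<..}|lebesgue. w u) = 1"
    and wh: "set_integrable lebesgue {0<..} (\<lambda>u. w u * (1 + h u ^ (N + 1)))"
    and phit: "phit = assoc_dist N (\<lambda>\<beta>. complex_of_real (avg_coeff w h \<beta>))"
    and b: "\<phi> \<in> calLp_space p"
           "\<exists>B>0. \<forall>\<xi>. (\<Sum>\<^sub>\<infinity>k\<in>int_lattice. ennreal (norm (fourier \<phi> (\<xi> + k)) powr q)) < ennreal B"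
    and c: "1 \<le> n" "0 < \<delta>" "\<delta> < 1 / 2"
           "boundedly_differentiable n (\<lambda>\<xi>. fourier \<phi> \<xi> * dist_fourier phit \<xi>) {\<xi>. norm \<xi> < \<delta>}"
           "\<And>l. l \<in> int_lattice - {0} \<Longrightarrow>
              boundedly_differentiable n (fourier \<phi>) {\<xi>. norm (\<xi> + l) < \<delta>}"
           "\<And>is. length is = n \<Longrightarrow>
              \<exists>K::real. \<forall>\<xi>. norm \<xi> < \<delta> \<longrightarrow>
                (\<Sum>\<^sub>\<infinity>l\<in>int_lattice - {0}. ennreal (norm (partial_derivs is (fourier \<phi>) (\<xi> + l)))) \<le> ennreal K"
           "\<And>is. length is < n \<Longrightarrow>
              partial_derivs is (\<lambda>\<xi>. 1 - fourier \<phi> \<xi> * dist_fourier phit \<xi>) 0 = 0"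
           "strang_fix n \<phi>"
    and d: "f \<in> Lp_space p" "has_fourier_transform f fhat" "fhat \<in> Lp_space (ennreal q)"
           "0 < \<epsilon>"
           "(\<lambda>\<xi>. norm (fhat \<xi>)) \<in>
              O[at_infinity](\<lambda>\<xi>. norm \<xi> powr (- real N - 1 - real CARD('d) / q - \<epsilon>))"
  shows "\<exists>C::real. \<forall>j::nat.
      Lp_norm p (\<lambda>x. f x - complex_of_real (\<bar>det M\<bar> powr (- real j / 2)) *
        (\<Sum>\<^sub>\<infinity>k\<in>int_lattice.
           avg_sample w h M f j (- (mat_pow (matrix_inv M) j *v k)) * dilate M \<phi> j k x))
      \<le> ennreal (if n > N + 1 then C * norm lam powi (- int (j * (N + 1)))
                 else C * norm lam powi (- int (j * n)))"
proof -
  have inv: "invertible M" by (rule dilation_matrix_invertible[OF M(1)])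
  have lam: "1 < norm lam" using M(1,3) by (simp add: dilation_matrix_def)
  have pq: "(p = \<infinity> \<and> q = 1) \<or> (\<exists>r. p = ennreal r \<and> 2 \<le> r \<and> q = r / (r - 1))"
    by (rule conjugate_exponent[OF q p(2)])
  have q1: "1 \<le> q" using pq by (auto simp: le_divide_eq)
  have pr: "p = \<infinity> \<or> (\<exists>r. p = ennreal r \<and> 1 \<le> r)" using pq by fastforce
  \<comment> \<open>For finite p, multiplying d < p \<le> (N + 1) p by q - 1 = 1 / (p - 1) gives the
    gap required by \<open>weight_exponent\<close>; for p = \<infinity> the left side is 0.\<close>
  have dim: "real CARD('d) * (q - 1) < real (Suc N) * q"
    using pq
  proof (elim disjE exE conjE)
    fix r assume r: "p = ennreal r" "2 \<le> r" "q = r / (r - 1)"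
    have "real CARD('d) < r" using p(1) r by (simp add: ennreal_of_nat_eq_real_of_nat ennreal_less_iff)
    also have "r \<le> real (Suc N) * r" using r by simp
    finally have lt: "real CARD('d) < real (Suc N) * r" .
    have "q - 1 = 1 / (r - 1)" using r by (simp add: field_simps)
    then have "real CARD('d) * (q - 1) = real CARD('d) / (r - 1)" by simp
    also have "\<dots> < real (Suc N) * r / (r - 1)" using lt r(2) by (intro divide_strict_right_mono) auto
    finally show ?thesis using r(3) by simp
  qed simp
  \<comment> \<open>From here on w and h are replaced by Borel representatives; averages and
    coefficients see h only where w does not vanish.\<close>
  obtain w' h' where avg: "averaging w' h' N"
    and aew: "AE u in lborel. (if 0 < u then w u else 0) = w' u \<and> (w' u \<noteq> 0 \<longrightarrow> h' u = h u)"
    using averaging_representative[OF h w wh] by blast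
  interpret averaging w' h' N "TYPE('d)" by (rule avg)
  have fm: "f \<in> borel_measurable lebesgue" and fhm: "fhat \<in> borel_measurable lebesgue" and \<phi>m: "\<phi> \<in> borel_measurable lebesgue"
    using d(1,3) b(1) by (simp_all add: Lp_space_def calLp_space_def)
  obtain f0 where f0 [measurable]: "f0 \<in> borel_measurable borel" and aef: "AE x in lborel. f x = f0 x"
    using complex_completion_ex_borel[OF fm] by blast
  obtain g where g [measurable]: "g \<in> borel_measurable borel" and aeg: "AE x in lborel. fhat x = g x"
    using complex_completion_ex_borel[OF fhm] by blast
  obtain \<phi>0 where \<phi>0 [measurable]: "\<phi>0 \<in> borel_measurable borel" and ae\<phi>: "AE x in lborel. \<phi> x = \<phi>0 x"
    using complex_completion_ex_borel[OF \<phi>m] by blast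
  have int\<phi>: "integrable lborel \<phi>0" by (rule calLp_integrable[OF pr b(1) \<phi>0 ae\<phi>])

  \<comment> \<open>Equality holds at every \<xi>, since an integral does not see null sets; the
    pointwise smoothness conditions on the transform are therefore untouched by the change of
    representative.\<close>
  have \<phi>h: "fourier \<phi> \<xi> = ift \<phi>0 (- \<xi>)" for \<xi>
  proof -
    have m: "(\<lambda>x. \<phi>0 x * exp (- (2 * of_real pi * \<i> * of_real (x \<bullet> \<xi>)))) \<in> borel_measurable borel" by measurable
    have "fourier \<phi> \<xi> = (LBINT x. \<phi>0 x * exp (- (2 * of_real pi * \<i> * of_real (x \<bullet> \<xi>))))"
      unfolding fourier_def by (rule lebesgue_integral_AE_borel[OF m]) (use ae\<phi> in \<open>eventually_elim, simp\<close>)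
    also have "\<dots> = fourier \<phi>0 \<xi>"
      unfolding fourier_def by (rule lebesgue_integral_AE_borel[OF m, symmetric]) simp
    finally show ?thesis by (simp add: fourier_eq_ift[OF \<phi>0])
  qed
  have \<phi>h_meas: "fourier \<phi> \<in> borel_measurable borel"
  proof -
    note [measurable] = borel_measurable_ift[OF int\<phi>]
    have "(\<lambda>\<xi>. ift \<phi>0 (- \<xi>)) \<in> borel_measurable borel" by measurable
    then show ?thesis by (simp add: \<phi>h[abs_def])
  qed
  obtain B where B: "0 < B" "\<And>\<xi>. (\<Sum>\<^sub>\<infinity>k\<in>int_lattice. ennreal (norm (fourier \<phi> (\<xi> + k)) powr q)) \<le> ennreal B"
    using b(2) less_imp_le by metis
  \<comment> \<open>The summand k = 0 of the bounded lattice sum, with x \<le> 1 + x powr q.\<close>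
  have \<phi>h_le: "norm (fourier \<phi> \<xi>) \<le> 1 + B" for \<xi>
  proof -
    have "ennreal (norm (fourier \<phi> \<xi>) powr q) \<le> (\<Sum>\<^sub>\<infinity>k\<in>int_lattice. ennreal (norm (fourier \<phi> (\<xi> + k)) powr q))"
      using sum_le_infsum_ennreal[of "{0}" int_lattice "\<lambda>k. ennreal (norm (fourier \<phi> (\<xi> + k)) powr q)"] by simp
    then have "norm (fourier \<phi> \<xi>) powr q \<le> B" using B order_trans by fastforce
    then show ?thesis using powr_add_one_ge[of "norm (fourier \<phi> \<xi>)" q] q1 by simp
  qed

  have "\<exists>C\<ge>0. \<forall>\<xi>. norm \<xi> < \<delta> \<longrightarrow> norm (1 - fourier \<phi> \<xi> * dist_fourier phit \<xi>) \<le> C * norm \<xi> ^ n"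
    by (rule one_minus_bound[OF c(1) c(4)], erule c(7), blast)
  then obtain C1 where C1: "0 \<le> C1" "\<And>\<xi>. norm \<xi> < \<delta> \<Longrightarrow> norm (1 - fourier \<phi> \<xi> * dist_fourier phit \<xi>) \<le> C1 * norm \<xi> ^ n"
    by blast
  have sf: "partial_derivs is (fourier \<phi>) k = 0" if "k \<in> int_lattice - {0}" "length is < n" for k "is"
    using c(8) that by (simp add: strang_fix_def)
  have "\<exists>C\<ge>0. \<forall>\<xi>. norm \<xi> < \<delta> \<longrightarrow> (\<Sum>\<^sub>\<infinity>l\<in>int_lattice - {0}. ennreal (norm (fourier \<phi> (\<xi> + l)))) \<le> ennreal (C * norm \<xi> ^ n)"
    by (rule strang_fix_sum_bound[where g = "fourier \<phi>" and n = n and \<delta> = \<delta>], erule c(5), erule c(6),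
        rule sf, assumption, assumption, blast)
  then obtain C2 where C2: "0 \<le> C2"
    "\<And>\<xi>. norm \<xi> < \<delta> \<Longrightarrow> (\<Sum>\<^sub>\<infinity>l\<in>int_lattice - {0}. ennreal (norm (fourier \<phi> (\<xi> + l)))) \<le> ennreal (C2 * norm \<xi> ^ n)"
    by blast
  have Pt: "dist_fourier phit \<xi> = (\<Sum>\<beta> | mi_order \<beta> \<le> N. complex_of_real (coeff \<beta>) *
      (\<Prod>i\<in>UNIV. (- (2 * of_real pi * \<i> * of_real (\<xi> $ i))) ^ \<beta> i))" for \<xi>
    unfolding phit dist_fourier_assoc_dist avg_coeff_eq[OF aew] complex_cnj_complex_of_real ..
  have "\<exists>C\<ge>0. \<forall>\<xi>. norm (mu \<xi> - dist_fourier phit \<xi>) \<le> C * norm \<xi> ^ Suc N"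
    unfolding Pt by (rule mu_taylor) blast
  then obtain C3 where C3: "0 \<le> C3" "\<And>\<xi>. norm (mu \<xi> - dist_fourier phit \<xi>) \<le> C3 * norm \<xi> ^ Suc N"
    by blast
  \<comment> \<open>The order n limits the approximation through \<phi>, and N + 1 through the
    Taylor remainder of the averaging multiplier.\<close>
  define s where "s = min n (Suc N)"
  have \<delta>1: "\<delta> \<le> 1" using c(3) by simp
  obtain C4 where C4: "0 \<le> C4" "\<And>\<xi>. norm (1 - fourier \<phi> \<xi> * mu \<xi>) \<le> C4 * norm \<xi> ^ s"
    unfolding s_def using near_estimate[OF c(2) \<delta>1 C1 C3 norm_mu_le \<phi>h_le] by blast
  obtain C4' where C4': "0 \<le> C4'"
    "\<And>\<xi>. (\<Sum>\<^sub>\<infinity>l\<in>int_lattice - {0}. ennreal (norm (fourier \<phi> (\<xi> + l)) powr q)) \<le> ennreal (C4' * (norm \<xi> ^ s) powr q)"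
    using off_estimate[OF q1 c(2) \<delta>1 _ C2 less_imp_le[OF B(1)] B(2), of s] by (auto simp: s_def)
  obtain C5 where C5: "0 \<le> C5" "\<And>A. integrable lborel A \<Longrightarrow>
     (NNINT \<xi>. ennreal (norm (A \<xi> - fourier \<phi> \<xi> * (\<Sum>\<^sub>\<infinity>l\<in>int_lattice. mu (\<xi> + l) * A (\<xi> + l))) powr q))
     \<le> ennreal C5 * ((NNINT \<xi>. ennreal ((norm \<xi> ^ s * norm (A \<xi>)) powr q))
                    + (NNINT \<xi>. ennreal ((norm \<xi> ^ Suc N * norm (A \<xi>)) powr q)))"
    using frequency_estimate[OF q1 dim \<phi>h_meas mu_meas norm_mu_le less_imp_le[OF B(1)] B(2) C4 C4'] by blast

  define I where "I e = (NNINT \<xi>. ennreal ((norm \<xi> ^ e * norm (g \<xi>)) powr q))" for e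
  have Ifin: "I e < \<infinity>" if "e \<le> Suc N" for e
    unfolding I_def by (rule decay_weighted_finite[OF q1 d(3,4) g aeg d(5)]) (use that in simp)
  have fin0: "(NNINT \<xi>. ennreal (norm (g \<xi>) powr q)) < \<infinity>" using Ifin[of 0] by (simp add: I_def)
  have intg: "integrable lborel g"
    by (rule weighted_integrable[OF q1 dim g fin0]) (use Ifin[of "Suc N"] in \<open>simp add: I_def\<close>)
  have b1: "real CARD('d) < real CARD('d) + 1" "0 \<le> real CARD('d) + 1" by simp_all
  \<comment> \<open>The distributional transform becomes an ordinary one: f is integrable against a
    weight, g is integrable, and their Gaussian means correspond.\<close>
  have "AE x in lborel. f0 x = ift g x"
    by (rule fourier_inversion_AE[OF f0 b1(2) Lp_weighted_finite[OF pr d(1) f0 aef b1(1)] g _ intg])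
       (rule has_fourier_transform_conv_gk[OF d(2) fm f0 aef fhm g aeg])
  with aef have aeF: "AE x in lborel. f x = ift g x" by eventually_elim simp
  have Fm: "ift g \<in> borel_measurable borel" by (rule borel_measurable_ift[OF intg])
  obtain Kg where Kg: "\<And>x. norm (ift g x) \<le> Kg"
  proof -
    have "(NNINT \<xi>. ennreal (norm (g \<xi>))) < \<infinity>" using intg unfolding integrable_iff_bounded by simp
    then obtain r where r: "0 \<le> r" "(NNINT \<xi>. ennreal (norm (g \<xi>))) = ennreal r"
      by (cases "(NNINT \<xi>. ennreal (norm (g \<xi>)))") auto
    have "norm (ift g x) \<le> r" for x using norm_ift_le[of g x] r by simp
    then show ?thesis by (rule that)
  qed
  obtain Ci where Ci: "0 < Ci" "\<And>j x. norm (transpose (mat_pow (matrix_inv M) j) *v x) \<le> Ci / norm lam ^ j * norm x"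
    using isotropic_pow_inverse[OF M] by blast
  obtain CE where CE: "0 \<le> CE"
    "\<And>(E :: real ^ 'd \<Rightarrow> complex) H D K b R. \<lbrakk>E \<in> borel_measurable borel; 0 \<le> b;
       (NNINT x. ennreal (norm (E x) * wt b x)) < \<infinity>; H \<in> borel_measurable borel;
       \<And>t x. 0 < t \<Longrightarrow> conv_gk E t x = ift (\<lambda>\<xi>. H \<xi> * of_real (gh t \<xi>)) x;
       invertible K; AE x in lborel. D x = E (K *v x); 0 < R;
       (NNINT \<xi>. ennreal (norm (H \<xi>) powr q)) \<le> ennreal ((\<bar>det K\<bar> powr ((q - 1) / q) * R) powr q)\<rbrakk>
     \<Longrightarrow> Lp_norm p D \<le> ennreal (CE * R)"
    by (fact error_norm_bound[OF pq])
  \<comment> \<open>The summand 1 keeps \<open>C6\<close> positive, as the error bound is stated for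
    R > 0.\<close>
  define C6 where "C6 = C5 * ((Ci ^ s) powr q * enn2real (I s) + (Ci ^ Suc N) powr q * enn2real (I (Suc N))) + 1"
  have C6: "0 < C6" using C5(1) by (simp add: C6_def add_nonneg_pos)
  have aelat: "AE y in lborel. \<forall>k\<in>int_lattice. \<phi> (y + k) = \<phi>0 (y + k)"
  proof (subst AE_ball_countable[OF countable_int_lattice], intro ballI)
    fix k :: "real ^ 'd"
    have "AE x in distr lborel borel ((+) k). \<phi> x = \<phi>0 x" unfolding lborel_distr_plus by (rule ae\<phi>)
    from AE_distrD[OF _ this] show "AE x in lborel. \<phi> (x + k) = \<phi>0 (x + k)" by (simp add: add.commute)
  qed

  have main: "Lp_norm p (\<lambda>x. f x - complex_of_real (\<bar>det M\<bar> powr (- real j / 2)) *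
        (\<Sum>\<^sub>\<infinity>k\<in>int_lattice. avg_sample w h M f j (- (mat_pow (matrix_inv M) j *v k)) * dilate M \<phi> j k x))
      \<le> ennreal (CE * (C6 powr (1 / q) / (norm lam ^ j) ^ s))" for j
  proof -
    define K where "K = mat_pow M j"
    define J where "J = mat_pow (matrix_inv M) j"
    have KJ: "K ** J = mat 1" and JK: "J ** K = mat 1" using mat_pow_inverse[OF inv, of j] by (simp_all add: K_def J_def)
    then have invK: "invertible K" by (auto simp: invertible_def)
    have m: "0 < \<bar>det K\<bar>" using invK by (simp add: invertible_det_nz)
    have L: "1 \<le> norm lam ^ j" using lam by (intro one_le_power) simp
    have cJ: "0 \<le> Ci / norm lam ^ j" "\<And>x. norm (transpose J *v x) \<le> Ci / norm lam ^ j * norm x"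
      using Ci L by (simp_all add: J_def)
    \<comment> \<open>Spectrum of x \<mapsto> f (M^(-j) x), that is, of f in the variable in which
      the nodes form the integer lattice.\<close>
    define A where "A \<xi> = complex_of_real \<bar>det K\<bar> * g (transpose K *v \<xi>)" for \<xi>
    have Am [measurable]: "A \<in> borel_measurable borel" unfolding A_def by measurable
    have moment: "(NNINT \<xi>. ennreal ((norm \<xi> ^ e * norm (A \<xi>)) powr q))
        \<le> ennreal (\<bar>det K\<bar> powr (q - 1) * ((Ci / norm lam ^ j) ^ e) powr q) * I e" for e
      unfolding A_def I_def by (rule dilate_moment_le[OF KJ g q1 cJ])
    have intA: "integrable lborel A"
    proof (rule integrableI_bounded)
      \<comment> \<open>The moment estimate with exponent 1 and order 0; no power of the determinant
        remains.\<close>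
      have "(NNINT \<xi>. ennreal (norm (A \<xi>))) = (NNINT \<xi>. ennreal ((norm \<xi> ^ 0 * norm (A \<xi>)) powr 1))" by simp
      also have "\<dots> \<le> ennreal (\<bar>det K\<bar> powr (1 - 1) * ((Ci / norm lam ^ j) ^ 0) powr 1) * (NNINT \<xi>. ennreal ((norm \<xi> ^ 0 * norm (g \<xi>)) powr 1))"
        unfolding A_def by (rule dilate_moment_le[OF KJ g order_refl cJ])
      also have "\<dots> = (NNINT \<xi>. ennreal (norm (g \<xi>)))" using m by simp
      also have "\<dots> < \<infinity>" using intg unfolding integrable_iff_bounded by simp
      finally show "(NNINT \<xi>. ennreal (norm (A \<xi>))) < \<infinity>" .
    qed simp
    have iftA: "ift A x = ift g (J *v x)" for x
      unfolding A_def[abs_def] by (rule ift_dilate[OF KJ g])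
    define Bj where "Bj = (\<lambda>\<xi>. mu \<xi> * A \<xi>)"
    have intB: "integrable lborel Bj" unfolding Bj_def by (rule integrable_mu_mult[OF intA])
    \<comment> \<open>The error in the dilated variable; at K x it is almost everywhere the error in
      the original one.\<close>
    define E where "E = (\<lambda>x. ift A x - sample_series \<phi>0 Bj x)"
    define H where "H = (\<lambda>\<xi>. A \<xi> - ift \<phi>0 (- \<xi>) * periodization Bj \<xi>)"
    define R where "R = C6 powr (1 / q) / (norm lam ^ j) ^ s"
    have Em: "E \<in> borel_measurable borel"
      unfolding E_def by (intro borel_measurable_diff borel_measurable_ift intA borel_measurable_sample_series int\<phi> intB)
    have Hm: "H \<in> borel_measurable borel"
      unfolding H_def \<phi>h[symmetric]
      by (intro borel_measurable_diff borel_measurable_times Am \<phi>h_meas borel_measurable_periodization[OF int\<phi> intB])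
    have R: "0 < R" using C6 L by (simp add: R_def)
    have Hle: "(NNINT \<xi>. ennreal (norm (H \<xi>) powr q)) \<le> ennreal ((\<bar>det K\<bar> powr ((q - 1) / q) * R) powr q)"
    proof -
      have I: "I e = ennreal (enn2real (I e))" if "e \<le> Suc N" for e using Ifin[OF that] by simp
      have s: "s \<le> Suc N" by (simp add: s_def)
      have "(NNINT \<xi>. ennreal (norm (H \<xi>) powr q))
         \<le> ennreal C5 * ((NNINT \<xi>. ennreal ((norm \<xi> ^ s * norm (A \<xi>)) powr q))
                    + (NNINT \<xi>. ennreal ((norm \<xi> ^ Suc N * norm (A \<xi>)) powr q)))"
        unfolding H_def \<phi>h[symmetric] periodization_def[OF int\<phi> intB] unfolding Bj_def by (rule C5(2)[OF intA])
      also have "\<dots> \<le> ennreal C5 * (ennreal (\<bar>det K\<bar> powr (q - 1) * ((Ci / norm lam ^ j) ^ s) powr q) * ennreal (enn2real (I s))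
          + ennreal (\<bar>det K\<bar> powr (q - 1) * ((Ci / norm lam ^ j) ^ Suc N) powr q) * ennreal (enn2real (I (Suc N))))"
        unfolding I[OF s, symmetric] I[OF order_refl, symmetric] by (intro mult_left_mono add_mono moment) simp
      also have "\<dots> = ennreal (C5 * (\<bar>det K\<bar> powr (q - 1) * ((Ci / norm lam ^ j) ^ s) powr q * enn2real (I s)
          + \<bar>det K\<bar> powr (q - 1) * ((Ci / norm lam ^ j) ^ Suc N) powr q * enn2real (I (Suc N))))"
        using C5(1) by (simp only: ennreal_mult[symmetric] ennreal_plus[symmetric] mult_nonneg_nonneg powr_ge_zero enn2real_nonneg add_nonneg_nonneg)
      also have "\<dots> \<le> ennreal ((\<bar>det K\<bar> powr ((q - 1) / q) * R) powr q)"
        unfolding R_def C6_def using s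
        by (intro ennreal_leI moment_constant q1 m L Ci(1) C5(1) enn2real_nonneg) auto
      finally show ?thesis .
    qed
    have sample: "avg_sample w h M f j (- (J *v k)) = ift Bj (- k)" for k
    proof -
      have "avg_sample w h M f j (- (J *v k)) = (LBINT s. complex_of_real (dens s) * ift g (- (J *v k) + J *v s))"
        unfolding J_def by (rule avg_sample_eq[OF inv aew Fm aeF Kg])
      also have "\<dots> = (LBINT s. complex_of_real (dens s) * ift A (s + - k))"
        by (simp add: iftA matrix_vector_mult_diff_distrib)
      finally show ?thesis unfolding Bj_def integral_dens_ift[OF intA] .
    qed
    have ae: "AE x in lborel. f x - complex_of_real (\<bar>det M\<bar> powr (- real j / 2)) *
        (\<Sum>\<^sub>\<infinity>k\<in>int_lattice. avg_sample w h M f j (- (J *v k)) * dilate M \<phi> j k x) = E (K *v x)"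
      using aeF AE_matrix[OF invK aelat]
    proof eventually_elim
      case (elim x)
      \<comment> \<open>The normalisation of the dilates of \<phi> is undone by the factor in front
        of the sum.\<close>
      have one: "complex_of_real (\<bar>det M\<bar> powr (- real j / 2)) * complex_of_real (\<bar>det M\<bar> powr (real j / 2)) = 1"
        using inv by (simp add: invertible_det_nz flip: of_real_mult powr_add)
      have "complex_of_real (\<bar>det M\<bar> powr (- real j / 2)) *
        (\<Sum>\<^sub>\<infinity>k\<in>int_lattice. avg_sample w h M f j (- (J *v k)) * dilate M \<phi> j k x)
        = (\<Sum>\<^sub>\<infinity>k\<in>int_lattice. complex_of_real (\<bar>det M\<bar> powr (- real j / 2)) * (avg_sample w h M f j (- (J *v k)) * dilate M \<phi> j k x))"
        by (rule infsum_cmult_right'[symmetric])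
      also have "\<dots> = (\<Sum>\<^sub>\<infinity>k\<in>int_lattice. ift Bj (- k) * \<phi>0 (K *v x + k))"
      proof (rule infsum_cong)
        fix k :: "real ^ 'd" assume "k \<in> int_lattice"
        then have "\<phi> (K *v x + k) = \<phi>0 (K *v x + k)" using elim(2) by blast
        then have "complex_of_real (\<bar>det M\<bar> powr (- real j / 2)) * (avg_sample w h M f j (- (J *v k)) * dilate M \<phi> j k x)
          = (complex_of_real (\<bar>det M\<bar> powr (- real j / 2)) * complex_of_real (\<bar>det M\<bar> powr (real j / 2))) * (ift Bj (- k) * \<phi>0 (K *v x + k))"
          unfolding sample dilate_def K_def[symmetric] by (simp only: mult_ac)
        then show "complex_of_real (\<bar>det M\<bar> powr (- real j / 2)) * (avg_sample w h M f j (- (J *v k)) * dilate M \<phi> j k x)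
          = ift Bj (- k) * \<phi>0 (K *v x + k)" unfolding one by simp
      qed
      also have "\<dots> = sample_series \<phi>0 Bj (K *v x)"
        by (simp only: sample_series_def[OF int\<phi> intB])
      finally show ?case
        using elim(1) JK by (simp add: E_def iftA matrix_vector_mul_assoc)
    qed
    show ?thesis
      unfolding J_def[symmetric] R_def[symmetric]
    proof (rule CE(2)[OF Em b1(2) _ Hm _ invK ae R Hle])
      show "(NNINT x. ennreal (norm (E x) * wt (real CARD('d) + 1) x)) < \<infinity>"
        unfolding E_def by (rule sampling_error_weighted[OF int\<phi> intB intA b1(1)])
      show "conv_gk E t x = ift (\<lambda>\<xi>. H \<xi> * of_real (gh t \<xi>)) x" if "0 < t" for t x
        unfolding E_def H_def by (rule sampling_error_conv[OF int\<phi> intB intA that])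
    qed
  qed
  \<comment> \<open>With e = s this is the claimed rate: s is N + 1 if n > N + 1 and n
    otherwise.\<close>
  have rate: "CE * (C6 powr (1 / q) / (norm lam ^ j) ^ e) = (CE * C6 powr (1 / q)) * norm lam powi (- int (j * e))" for j e
  proof -
    have "norm lam powi (- int (j * e)) = inverse (norm lam ^ (j * e))" by (simp only: power_int_minus power_int_of_nat)
    then show ?thesis by (simp add: power_mult divide_inverse)
  qed
  show ?thesis
  proof (intro exI allI)
    fix j
    show "Lp_norm p (\<lambda>x. f x - complex_of_real (\<bar>det M\<bar> powr (- real j / 2)) *
        (\<Sum>\<^sub>\<infinity>k\<in>int_lattice. avg_sample w h M f j (- (mat_pow (matrix_inv M) j *v k)) * dilate M \<phi> j k x))
      \<le> ennreal (if n > N + 1 then (CE * C6 powr (1 / q)) * norm lam powi (- int (j * (N + 1)))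
                 else (CE * C6 powr (1 / q)) * norm lam powi (- int (j * n)))"
      using main[of j] unfolding s_def rate[symmetric] by (simp split: if_splits add: min_def)
  qed
qed

end
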